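(* Let $K$ be a field, let $\mathcal{C}$ be a small $K$-category, let $\mathcal{I}$ be a two-sided ideal of $\mathcal{C}$ and suppose that the canonical projection $\pi_1:\mathcal{C}\to\mathcal{C}/\mathcal{I}$ is a homological epimorphism. Let $\pi_2:\mathcal{C}^{op}\to\mathcal{C}^{op}/\mathcal{I}^{op}\simeq(\mathcal{C}/\mathcal{I})^{op}$ be the canonical projection. Then $\pi^{e}:=\pi_2\otimes\pi_1:\mathcal{C}^{op}\otimes_K\mathcal{C}\to(\mathcal{C}/\mathcal{I})^{op}\otimes_K(\mathcal{C}/\mathcal{I})$ is a homological epimorphism.
   Context: A $K$-category is a category whose Hom-sets are $K$-vector spaces with $K$-bilinear composition. $\mathrm{Mod}(\mathcal{C})$ is the abelian category of covariant $K$-linear functors $\mathcal{C}\to\mathrm{Mod}(K)$ ($K$-vector spaces). The tensor product $\mathcal{C}\otimes_K\mathcal{D}$ has objects the pairs $(C,D)$ and morphism spaces $\mathcal{C}(C,C')\otimes_K\mathcal{D}(D,D')$. A two-sided ideal $\mathcal{I}$ of $\mathcal{C}$ is a $K$-subfunctor of $\mathcal{C}(-,-)$ (closed under composition with arbitrary morphisms on both sides). The quotient $\mathcal{C}/\mathcal{I}$ has the same objects and morphisms $\mathcal{C}(X,Y)/\mathcal{I}(X,Y)$. $\mathcal{I}$ is strongly idempotent if, with $\pi:\mathcal{C}\to\mathcal{C}/\mathcal{I}$ the canonical projection, the canonical maps $\mathrm{Ext}^{i}_{\mathrm{Mod}(\mathcal{C}/\mathcal{I})}(F,F')\to\mathrm{Ext}^{i}_{\mathrm{Mod}(\mathcal{C})}(F\circ\pi,F'\circ\pi)$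 induced by the exact functor $F\mapsto F\circ\pi$ are isomorphisms for all $F,F'\in\mathrm{Mod}(\mathcal{C}/\mathcal{I})$ and all $i\ge0$; then $\pi$ is called a homological epimorphism. The functor $\pi^e$ is full and the identity on objects, so it is identified with the canonical projection $\mathcal{C}^{op}\otimes_K\mathcal{C}\to(\mathcal{C}^{op}\otimes_K\mathcal{C})/\mathcal{J}$, where $\mathcal{J}=\mathrm{Ker}(\pi^e)$ is the ideal of morphisms sent to zero; $\pi^e$ being a homological epimorphism means that $\mathcal{J}$ is strongly idempotent. *)

theory Defs
  imports "HOL-Algebra.QuotRing" "HOL-Algebra.Module" "HOL-Library.Equipollence"
begin

section \<open>Linear algebra\<close>

text \<open>
  Vector spaces over the field \<open>K\<close> are \<open>module K V\<close>. The fields \<open>mult\<close> and \<open>one\<close> of the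
  record type \<open>module\<close> play no role and are left undefined.
\<close>

definition linear_map ::
  "('k, 'r) ring_scheme \<Rightarrow> ('k, 'v) module \<Rightarrow> ('k, 'w) module \<Rightarrow> ('v \<Rightarrow> 'w) \<Rightarrow> bool" where
  "linear_map K V W f \<longleftrightarrow>
     f \<in> carrier V \<rightarrow> carrier W \<and>
     (\<forall>u\<in>carrier V. \<forall>v\<in>carrier V. f (u \<oplus>\<^bsub>V\<^esub> v) = f u \<oplus>\<^bsub>W\<^esub> f v) \<and>
     (\<forall>a\<in>carrier K. \<forall>v\<in>carrier V. f (a \<odot>\<^bsub>V\<^esub> v) = a \<odot>\<^bsub>W\<^esub> f v)"

definition linear_iso ::
  "('k, 'r) ring_scheme \<Rightarrow> ('k, 'v) module \<Rightarrow> ('k, 'w) module \<Rightarrow> ('v \<Rightarrow> 'w) \<Rightarrow> bool" where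
  "linear_iso K V W f \<longleftrightarrow> linear_map K V W f \<and> bij_betw f (carrier V) (carrier W)"

definition bilinear_map ::
  "('k, 'r) ring_scheme \<Rightarrow> ('k, 'u) module \<Rightarrow> ('k, 'v) module \<Rightarrow> ('k, 'w) module
     \<Rightarrow> ('u \<Rightarrow> 'v \<Rightarrow> 'w) \<Rightarrow> bool" where
  "bilinear_map K U V W b \<longleftrightarrow>
     (\<forall>u\<in>carrier U. linear_map K V W (b u)) \<and>
     (\<forall>v\<in>carrier V. linear_map K U W (\<lambda>u. b u v))"

text \<open>The quotient by a submodule \<open>N\<close>; operations on cosets are in the style of \<^const>\<open>FactRing\<close>.\<close>

definition quot_module :: "('k, 'v) module \<Rightarrow> 'v set \<Rightarrow> ('k, 'v set) module" where
  "quot_module M N =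
     \<lparr>carrier = a_rcosets\<^bsub>M\<^esub> N, mult = undefined, one = undefined, zero = N, add = set_add M,
      smult = (\<lambda>a X. \<Union>x\<in>X. N +>\<^bsub>M\<^esub> (a \<odot>\<^bsub>M\<^esub> x))\<rparr>"

definition module_span ::
  "('k, 'r) ring_scheme \<Rightarrow> ('k, 'v) module \<Rightarrow> 'v set \<Rightarrow> 'v set" where
  "module_span K M X = \<Inter>{N. submodule N K M \<and> X \<subseteq> N}"

definition free_module :: "('k, 'r) ring_scheme \<Rightarrow> 's set \<Rightarrow> ('k, 's \<Rightarrow> 'k) module" where
  "free_module K S =
     \<lparr>carrier = {f. finite {s. f s \<noteq> \<zero>\<^bsub>K\<^esub>} \<and> (\<forall>s\<in>S. f s \<in> carrier K) \<and> (\<forall>s. s \<notin> S \<longrightarrow> f s = \<zero>\<^bsub>K\<^esub>)},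
      mult = undefined, one = undefined,
      zero = (\<lambda>s. \<zero>\<^bsub>K\<^esub>), add = (\<lambda>f g s. f s \<oplus>\<^bsub>K\<^esub> g s),
      smult = (\<lambda>a f s. a \<otimes>\<^bsub>K\<^esub> f s)\<rparr>"

definition free_gen :: "('k, 'r) ring_scheme \<Rightarrow> 's \<Rightarrow> ('s \<Rightarrow> 'k)" where
  "free_gen K s = (\<lambda>t. if t = s then \<one>\<^bsub>K\<^esub> else \<zero>\<^bsub>K\<^esub>)"

definition free_lift ::
  "('k, 'r) ring_scheme \<Rightarrow> ('k, 'v) module \<Rightarrow> ('s \<Rightarrow> 'v) \<Rightarrow> ('s \<Rightarrow> 'k) \<Rightarrow> 'v" where
  "free_lift K M g f = (\<Oplus>\<^bsub>M\<^esub>s\<in>{s. f s \<noteq> \<zero>\<^bsub>K\<^esub>}. f s \<odot>\<^bsub>M\<^esub> g s)"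

text \<open>
  The tensor product \<open>V \<otimes>\<^sub>K W\<close> is the free module on \<open>carrier V \<times> carrier W\<close> modulo the
  bilinearity relations.
\<close>

definition tensor_relations ::
  "('k, 'r) ring_scheme \<Rightarrow> ('k, 'v) module \<Rightarrow> ('k, 'w) module \<Rightarrow> ('v \<times> 'w \<Rightarrow> 'k) set" where
  "tensor_relations K V W =
     (let L = free_module K (carrier V \<times> carrier W); g = (\<lambda>v w. free_gen K (v, w)) in
      module_span K L
       ({g (v \<oplus>\<^bsub>V\<^esub> v') w \<ominus>\<^bsub>L\<^esub> (g v w \<oplus>\<^bsub>L\<^esub> g v' w) | v v' w.
            v \<in> carrier V \<and> v' \<in> carrier V \<and> w \<in> carrier W} \<union>
        {g v (w \<oplus>\<^bsub>W\<^esub> w') \<ominus>\<^bsub>L\<^esub> (g v w \<oplus>\<^bsub>L\<^esub> g v w') | v w w'.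
            v \<in> carrier V \<and> w \<in> carrier W \<and> w' \<in> carrier W} \<union>
        {g (a \<odot>\<^bsub>V\<^esub> v) w \<ominus>\<^bsub>L\<^esub> (a \<odot>\<^bsub>L\<^esub> g v w) | a v w.
            a \<in> carrier K \<and> v \<in> carrier V \<and> w \<in> carrier W} \<union>
        {g v (a \<odot>\<^bsub>W\<^esub> w) \<ominus>\<^bsub>L\<^esub> (a \<odot>\<^bsub>L\<^esub> g v w) | a v w.
            a \<in> carrier K \<and> v \<in> carrier V \<and> w \<in> carrier W}))"

definition tensor_module ::
  "('k, 'r) ring_scheme \<Rightarrow> ('k, 'v) module \<Rightarrow> ('k, 'w) module
     \<Rightarrow> ('k, ('v \<times> 'w \<Rightarrow> 'k) set) module" where
  "tensor_module K V W =
     quot_module (free_module K (carrier V \<times> carrier W)) (tensor_relations K V W)"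

definition tensor_elt ::
  "('k, 'r) ring_scheme \<Rightarrow> ('k, 'v) module \<Rightarrow> ('k, 'w) module \<Rightarrow> 'v \<Rightarrow> 'w
     \<Rightarrow> ('v \<times> 'w \<Rightarrow> 'k) set" where
  "tensor_elt K V W v w =
     tensor_relations K V W +>\<^bsub>free_module K (carrier V \<times> carrier W)\<^esub> free_gen K (v, w)"

text \<open>
  For \<open>b\<close> bilinear with values in \<open>M\<close>, \<open>tensor_lift K M b\<close> is the linear map out of the tensor
  product sending \<open>v \<otimes> w\<close> to \<open>b v w\<close>; bilinearity makes it independent of the representative
  chosen in the coset.
\<close>

definition tensor_lift ::
  "('k, 'r) ring_scheme \<Rightarrow> ('k, 'x) module \<Rightarrow> ('v \<Rightarrow> 'w \<Rightarrow> 'x) \<Rightarrow> ('v \<times> 'w \<Rightarrow> 'k) set \<Rightarrow> 'x" where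
  "tensor_lift K M b X = free_lift K M (\<lambda>(v, w). b v w) (SOME t. t \<in> X)"


section \<open>\<open>K\<close>-categories\<close>

text \<open>
  \<open>Comp C x y z g f\<close> is \<open>g \<circ> f\<close> for \<open>f : x \<rightarrow> y\<close> and \<open>g : y \<rightarrow> z\<close>. Morphism spaces for different
  pairs of objects need not be disjoint, so all operations carry their objects.
\<close>

record ('o, 'k, 'm) kcat =
  Ob :: "'o set"
  Hom :: "'o \<Rightarrow> 'o \<Rightarrow> ('k, 'm) module"
  Id :: "'o \<Rightarrow> 'm"
  Comp :: "'o \<Rightarrow> 'o \<Rightarrow> 'o \<Rightarrow> 'm \<Rightarrow> 'm \<Rightarrow> 'm"

definition k_category :: "('k, 'r) ring_scheme \<Rightarrow> ('o, 'k, 'm) kcat \<Rightarrow> bool" where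
  "k_category K C \<longleftrightarrow>
     (\<forall>x\<in>Ob C. \<forall>y\<in>Ob C. module K (Hom C x y)) \<and>
     (\<forall>x\<in>Ob C. Id C x \<in> carrier (Hom C x x)) \<and>
     (\<forall>x\<in>Ob C. \<forall>y\<in>Ob C. \<forall>z\<in>Ob C.
        bilinear_map K (Hom C y z) (Hom C x y) (Hom C x z) (Comp C x y z)) \<and>
     (\<forall>x\<in>Ob C. \<forall>y\<in>Ob C. \<forall>f\<in>carrier (Hom C x y).
        Comp C x y y (Id C y) f = f \<and> Comp C x x y f (Id C x) = f) \<and>
     (\<forall>w\<in>Ob C. \<forall>x\<in>Ob C. \<forall>y\<in>Ob C. \<forall>z\<in>Ob C.
        \<forall>f\<in>carrier (Hom C w x). \<forall>g\<in>carrier (Hom C x y). \<forall>h\<in>carrier (Hom C y z).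
        Comp C w x z (Comp C x y z h g) f = Comp C w y z h (Comp C w x y g f))"

definition op_cat :: "('o, 'k, 'm) kcat \<Rightarrow> ('o, 'k, 'm) kcat" where
  "op_cat C =
     \<lparr>Ob = Ob C, Hom = (\<lambda>x y. Hom C y x), Id = Id C, Comp = (\<lambda>x y z g f. Comp C z y x f g)\<rparr>"

definition tensor_cat ::
  "('k, 'r) ring_scheme \<Rightarrow> ('o, 'k, 'm) kcat \<Rightarrow> ('p, 'k, 'n) kcat
     \<Rightarrow> ('o \<times> 'p, 'k, ('m \<times> 'n \<Rightarrow> 'k) set) kcat" where
  "tensor_cat K C D =
     \<lparr>Ob = Ob C \<times> Ob D,
      Hom = (\<lambda>(c, d) (c', d'). tensor_module K (Hom C c c') (Hom D d d')),
      Id = (\<lambda>(c, d). tensor_elt K (Hom C c c) (Hom D d d) (Id C c) (Id D d)),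
      Comp = (\<lambda>(c, d) (c', d') (c'', d'') X Y.
        let T = tensor_module K (Hom C c c'') (Hom D d d'') in
        tensor_lift K T (\<lambda>f' g'.
          tensor_lift K T (\<lambda>f g.
            tensor_elt K (Hom C c c'') (Hom D d d'') (Comp C c c' c'' f' f) (Comp D d d' d'' g' g)) Y) X)\<rparr>"

definition two_sided_ideal ::
  "('k, 'r) ring_scheme \<Rightarrow> ('o, 'k, 'm) kcat \<Rightarrow> ('o \<Rightarrow> 'o \<Rightarrow> 'm set) \<Rightarrow> bool" where
  "two_sided_ideal K C I \<longleftrightarrow>
     (\<forall>x\<in>Ob C. \<forall>y\<in>Ob C. submodule (I x y) K (Hom C x y)) \<and>
     (\<forall>x\<in>Ob C. \<forall>y\<in>Ob C. \<forall>z\<in>Ob C. \<forall>f\<in>I x y. \<forall>g\<in>carrier (Hom C y z). Comp C x y z g f \<in> I x z) \<and>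
     (\<forall>x\<in>Ob C. \<forall>y\<in>Ob C. \<forall>z\<in>Ob C. \<forall>f\<in>carrier (Hom C x y). \<forall>g\<in>I y z. Comp C x y z g f \<in> I x z)"

definition op_ideal :: "('o \<Rightarrow> 'o \<Rightarrow> 'm set) \<Rightarrow> 'o \<Rightarrow> 'o \<Rightarrow> 'm set" where
  "op_ideal I = (\<lambda>x y. I y x)"

definition quot_cat ::
  "('o, 'k, 'm) kcat \<Rightarrow> ('o \<Rightarrow> 'o \<Rightarrow> 'm set) \<Rightarrow> ('o, 'k, 'm set) kcat" where
  "quot_cat C I =
     \<lparr>Ob = Ob C,
      Hom = (\<lambda>x y. quot_module (Hom C x y) (I x y)),
      Id = (\<lambda>x. I x x +>\<^bsub>Hom C x x\<^esub> Id C x),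
      Comp = (\<lambda>x y z X Y. \<Union>g\<in>X. \<Union>f\<in>Y. I x z +>\<^bsub>Hom C x z\<^esub> Comp C x y z g f)\<rparr>"

text \<open>The canonical identification \<open>C\<^sup>o\<^sup>p/I\<^sup>o\<^sup>p \<simeq> (C/I)\<^sup>o\<^sup>p\<close> is an equality in this encoding.\<close>

lemma quot_cat_op: "quot_cat (op_cat C) (op_ideal I) = op_cat (quot_cat C I)"
  unfolding quot_cat_def op_cat_def op_ideal_def by (simp add: fun_eq_iff) blast


section \<open>\<open>K\<close>-linear functors\<close>

record ('o, 'm, 'p, 'n) kfun =
  fobj :: "'o \<Rightarrow> 'p"
  fmor :: "'o \<Rightarrow> 'o \<Rightarrow> 'm \<Rightarrow> 'n"

definition k_functor ::
  "('k, 'r) ring_scheme \<Rightarrow> ('o, 'k, 'm) kcat \<Rightarrow> ('p, 'k, 'n) kcat \<Rightarrow> ('o, 'm, 'p, 'n) kfun \<Rightarrow> bool" where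
  "k_functor K C D F \<longleftrightarrow>
     fobj F \<in> Ob C \<rightarrow> Ob D \<and>
     (\<forall>x\<in>Ob C. \<forall>y\<in>Ob C. linear_map K (Hom C x y) (Hom D (fobj F x) (fobj F y)) (fmor F x y)) \<and>
     (\<forall>x\<in>Ob C. fmor F x x (Id C x) = Id D (fobj F x)) \<and>
     (\<forall>x\<in>Ob C. \<forall>y\<in>Ob C. \<forall>z\<in>Ob C. \<forall>f\<in>carrier (Hom C x y). \<forall>g\<in>carrier (Hom C y z).
        fmor F x z (Comp C x y z g f) =
          Comp D (fobj F x) (fobj F y) (fobj F z) (fmor F y z g) (fmor F x y f))"

definition full_functor ::
  "('o, 'k, 'm) kcat \<Rightarrow> ('p, 'k, 'n) kcat \<Rightarrow> ('o, 'm, 'p, 'n) kfun \<Rightarrow> bool" where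
  "full_functor C D F \<longleftrightarrow>
     (\<forall>x\<in>Ob C. \<forall>y\<in>Ob C.
        fmor F x y ` carrier (Hom C x y) = carrier (Hom D (fobj F x) (fobj F y)))"

definition identity_on_objects ::
  "('o, 'k, 'm) kcat \<Rightarrow> ('o, 'k, 'n) kcat \<Rightarrow> ('o, 'm, 'o, 'n) kfun \<Rightarrow> bool" where
  "identity_on_objects C D F \<longleftrightarrow> Ob D = Ob C \<and> (\<forall>x\<in>Ob C. fobj F x = x)"

definition quot_proj ::
  "('o, 'k, 'm) kcat \<Rightarrow> ('o \<Rightarrow> 'o \<Rightarrow> 'm set) \<Rightarrow> ('o, 'm, 'o, 'm set) kfun" where
  "quot_proj C I = \<lparr>fobj = (\<lambda>x. x), fmor = (\<lambda>x y f. I x y +>\<^bsub>Hom C x y\<^esub> f)\<rparr>"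

text \<open>\<open>F \<otimes> G\<close> for functors \<open>F\<close>, \<open>G\<close> with codomains \<open>C'\<close>, \<open>D'\<close>.\<close>

definition tensor_fun ::
  "('k, 'r) ring_scheme \<Rightarrow> ('o', 'k, 'm') kcat \<Rightarrow> ('p', 'k, 'n') kcat
     \<Rightarrow> ('o, 'm, 'o', 'm') kfun \<Rightarrow> ('p, 'n, 'p', 'n') kfun
     \<Rightarrow> ('o \<times> 'p, ('m \<times> 'n \<Rightarrow> 'k) set, 'o' \<times> 'p', ('m' \<times> 'n' \<Rightarrow> 'k) set) kfun" where
  "tensor_fun K C' D' F G =
     \<lparr>fobj = (\<lambda>(c, d). (fobj F c, fobj G d)),
      fmor = (\<lambda>(c, d) (c', d').
        let V = Hom C' (fobj F c) (fobj F c'); W = Hom D' (fobj G d) (fobj G d') in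
        tensor_lift K (tensor_module K V W)
          (\<lambda>f g. tensor_elt K V W (fmor F c c' f) (fmor G d d' g)))\<rparr>"

definition functor_kernel ::
  "('o, 'k, 'm) kcat \<Rightarrow> ('p, 'k, 'n) kcat \<Rightarrow> ('o, 'm, 'p, 'n) kfun \<Rightarrow> 'o \<Rightarrow> 'o \<Rightarrow> 'm set" where
  "functor_kernel C D F =
     (\<lambda>x y. {f \<in> carrier (Hom C x y). fmor F x y f = \<zero>\<^bsub>Hom D (fobj F x) (fobj F y)\<^esub>})"


section \<open>The category \<open>Mod(C)\<close>\<close>

text \<open>
  A \<open>C\<close>-module is a covariant \<open>K\<close>-linear functor from \<open>C\<close> to \<open>K\<close>-vector spaces. The type \<open>'u\<close>
  plays the role of the universe: the vector spaces in question have their carriers inside \<open>'u\<close>.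
  See \<open>small_k_category\<close> below for the size condition.
\<close>

record ('o, 'm, 'k, 'u) kmod =
  val :: "'o \<Rightarrow> ('k, 'u) module"
  act :: "'o \<Rightarrow> 'o \<Rightarrow> 'm \<Rightarrow> 'u \<Rightarrow> 'u"

definition k_module ::
  "('k, 'r) ring_scheme \<Rightarrow> ('o, 'k, 'm) kcat \<Rightarrow> ('o, 'm, 'k, 'u) kmod \<Rightarrow> bool" where
  "k_module K C F \<longleftrightarrow>
     (\<forall>x\<in>Ob C. module K (val F x)) \<and>
     (\<forall>x\<in>Ob C. \<forall>y\<in>Ob C. bilinear_map K (Hom C x y) (val F x) (val F y) (act F x y)) \<and>
     (\<forall>x\<in>Ob C. \<forall>v\<in>carrier (val F x). act F x x (Id C x) v = v) \<and>
     (\<forall>x\<in>Ob C. \<forall>y\<in>Ob C. \<forall>z\<in>Ob C. \<forall>f\<in>carrier (Hom C x y). \<forall>g\<in>carrier (Hom C y z).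
        \<forall>v\<in>carrier (val F x). act F x z (Comp C x y z g f) v = act F y z g (act F x y f v))"

text \<open>
  The vector space of natural transformations from \<open>F\<close> to \<open>G\<close>. They are extensional functions,
  so that HOL equality is equality of natural transformations.
\<close>

definition nat_hom ::
  "('k, 'r) ring_scheme \<Rightarrow> ('o, 'k, 'm) kcat \<Rightarrow> ('o, 'm, 'k, 'u) kmod \<Rightarrow> ('o, 'm, 'k, 'u) kmod
     \<Rightarrow> ('k, 'o \<Rightarrow> 'u \<Rightarrow> 'u) module" where
  "nat_hom K C F G =
     \<lparr>carrier = {\<eta> \<in> (\<Pi>\<^sub>E x\<in>Ob C. carrier (val F x) \<rightarrow>\<^sub>E carrier (val G x)).
        (\<forall>x\<in>Ob C. linear_map K (val F x) (val G x) (\<eta> x)) \<and>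
        (\<forall>x\<in>Ob C. \<forall>y\<in>Ob C. \<forall>f\<in>carrier (Hom C x y). \<forall>v\<in>carrier (val F x).
           \<eta> y (act F x y f v) = act G x y f (\<eta> x v))},
      mult = undefined, one = undefined,
      zero = (\<lambda>x\<in>Ob C. \<lambda>v\<in>carrier (val F x). \<zero>\<^bsub>val G x\<^esub>),
      add = (\<lambda>\<eta> \<theta>. \<lambda>x\<in>Ob C. \<lambda>v\<in>carrier (val F x). \<eta> x v \<oplus>\<^bsub>val G x\<^esub> \<theta> x v),
      smult = (\<lambda>a \<eta>. \<lambda>x\<in>Ob C. \<lambda>v\<in>carrier (val F x). a \<odot>\<^bsub>val G x\<^esub> \<eta> x v)\<rparr>"

text \<open>\<open>nt_comp C F \<eta> \<theta>\<close> is \<open>\<eta> \<circ> \<theta>\<close>, where \<open>F\<close> is the source of \<open>\<theta>\<close>.\<close>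

definition nt_comp ::
  "('o, 'k, 'm) kcat \<Rightarrow> ('o, 'm, 'k, 'u) kmod \<Rightarrow> ('o \<Rightarrow> 'u \<Rightarrow> 'u) \<Rightarrow> ('o \<Rightarrow> 'u \<Rightarrow> 'u) \<Rightarrow> 'o \<Rightarrow> 'u \<Rightarrow> 'u" where
  "nt_comp C F \<eta> \<theta> = (\<lambda>x\<in>Ob C. \<lambda>v\<in>carrier (val F x). \<eta> x (\<theta> x v))"

text \<open>The exact functor \<open>F \<mapsto> F \<circ> \<phi>\<close> on modules and on natural transformations.\<close>

definition mod_pullback ::
  "('o, 'm, 'p, 'n) kfun \<Rightarrow> ('p, 'n, 'k, 'u) kmod \<Rightarrow> ('o, 'm, 'k, 'u) kmod" where
  "mod_pullback \<phi> F =
     \<lparr>val = (\<lambda>x. val F (fobj \<phi> x)),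
      act = (\<lambda>x y f. act F (fobj \<phi> x) (fobj \<phi> y) (fmor \<phi> x y f))\<rparr>"

definition nt_pullback ::
  "('o, 'k, 'm) kcat \<Rightarrow> ('o, 'm, 'p, 'n) kfun \<Rightarrow> ('p \<Rightarrow> 'u \<Rightarrow> 'u) \<Rightarrow> 'o \<Rightarrow> 'u \<Rightarrow> 'u" where
  "nt_pullback C \<phi> \<eta> = (\<lambda>x\<in>Ob C. \<eta> (fobj \<phi> x))"

text \<open>Exactness in \<open>Mod(C)\<close> is computed objectwise; in particular epimorphisms are the objectwise
  surjections.\<close>

definition nt_surj ::
  "('o, 'k, 'm) kcat \<Rightarrow> ('o, 'm, 'k, 'u) kmod \<Rightarrow> ('o, 'm, 'k, 'u) kmod \<Rightarrow> ('o \<Rightarrow> 'u \<Rightarrow> 'u) \<Rightarrow> bool" where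
  "nt_surj C F G \<eta> \<longleftrightarrow> (\<forall>x\<in>Ob C. \<eta> x ` carrier (val F x) = carrier (val G x))"

text \<open>Exactness of \<open>F \<rightarrow> G \<rightarrow> H\<close> at \<open>G\<close>, for \<open>\<theta> : F \<rightarrow> G\<close> and \<open>\<eta> : G \<rightarrow> H\<close>.\<close>

definition nt_exact ::
  "('o, 'k, 'm) kcat \<Rightarrow> ('o, 'm, 'k, 'u) kmod \<Rightarrow> ('o, 'm, 'k, 'u) kmod \<Rightarrow> ('o, 'm, 'k, 'u) kmod
     \<Rightarrow> ('o \<Rightarrow> 'u \<Rightarrow> 'u) \<Rightarrow> ('o \<Rightarrow> 'u \<Rightarrow> 'u) \<Rightarrow> bool" where
  "nt_exact C F G H \<theta> \<eta> \<longleftrightarrow>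
     (\<forall>x\<in>Ob C. \<theta> x ` carrier (val F x) = {v \<in> carrier (val G x). \<eta> x v = \<zero>\<^bsub>val H x\<^esub>})"

definition projective_module ::
  "('k, 'r) ring_scheme \<Rightarrow> ('o, 'k, 'm) kcat \<Rightarrow> ('o, 'm, 'k, 'u) kmod \<Rightarrow> bool" where
  "projective_module K C P \<longleftrightarrow> k_module K C P \<and>
     (\<forall>(M :: ('o, 'm, 'k, 'u) kmod) (N :: ('o, 'm, 'k, 'u) kmod).
        \<forall>e\<in>carrier (nat_hom K C M N). \<forall>h\<in>carrier (nat_hom K C P N).
        k_module K C M \<and> k_module K C N \<and> nt_surj C M N e \<longrightarrow>
        (\<exists>h'\<in>carrier (nat_hom K C P M). nt_comp C P e h' = h))"


section \<open>Ext\<close>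

text \<open>\<open>rdiff R n\<close> is the differential \<open>R\<^sub>n\<^sub>+\<^sub>1 \<rightarrow> R\<^sub>n\<close>.\<close>

record ('o, 'm, 'k, 'u) resolution =
  rmod :: "nat \<Rightarrow> ('o, 'm, 'k, 'u) kmod"
  rdiff :: "nat \<Rightarrow> 'o \<Rightarrow> 'u \<Rightarrow> 'u"
  raug :: "'o \<Rightarrow> 'u \<Rightarrow> 'u"

definition projective_resolution ::
  "('k, 'r) ring_scheme \<Rightarrow> ('o, 'k, 'm) kcat \<Rightarrow> ('o, 'm, 'k, 'u) kmod
     \<Rightarrow> ('o, 'm, 'k, 'u) resolution \<Rightarrow> bool" where
  "projective_resolution K C F R \<longleftrightarrow>
     (\<forall>n. projective_module K C (rmod R n)) \<and>
     (\<forall>n. rdiff R n \<in> carrier (nat_hom K C (rmod R (Suc n)) (rmod R n))) \<and>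
     raug R \<in> carrier (nat_hom K C (rmod R 0) F) \<and>
     nt_surj C (rmod R 0) F (raug R) \<and>
     nt_exact C (rmod R (Suc 0)) (rmod R 0) F (rdiff R 0) (raug R) \<and>
     (\<forall>n. nt_exact C (rmod R (Suc (Suc n))) (rmod R (Suc n)) (rmod R n) (rdiff R (Suc n)) (rdiff R n))"

definition proj_res ::
  "('k, 'r) ring_scheme \<Rightarrow> ('o, 'k, 'm) kcat \<Rightarrow> ('o, 'm, 'k, 'u) kmod
     \<Rightarrow> ('o, 'm, 'k, 'u) resolution" where
  "proj_res K C F = (SOME R. projective_resolution K C F R)"

text \<open>Cocycles and coboundaries of the complex \<open>Hom(R\<^sub>\<bullet>, G)\<close>.\<close>

definition cocycles ::
  "('k, 'r) ring_scheme \<Rightarrow> ('o, 'k, 'm) kcat \<Rightarrow> ('o, 'm, 'k, 'u) resolution \<Rightarrow> ('o, 'm, 'k, 'u) kmod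
     \<Rightarrow> nat \<Rightarrow> ('o \<Rightarrow> 'u \<Rightarrow> 'u) set" where
  "cocycles K C R G i =
     {\<eta> \<in> carrier (nat_hom K C (rmod R i) G).
        nt_comp C (rmod R (Suc i)) \<eta> (rdiff R i) = \<zero>\<^bsub>nat_hom K C (rmod R (Suc i)) G\<^esub>}"

definition coboundaries ::
  "('k, 'r) ring_scheme \<Rightarrow> ('o, 'k, 'm) kcat \<Rightarrow> ('o, 'm, 'k, 'u) resolution \<Rightarrow> ('o, 'm, 'k, 'u) kmod
     \<Rightarrow> nat \<Rightarrow> ('o \<Rightarrow> 'u \<Rightarrow> 'u) set" where
  "coboundaries K C R G i =
     (case i of
        0 \<Rightarrow> {\<zero>\<^bsub>nat_hom K C (rmod R 0) G\<^esub>}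
      | Suc j \<Rightarrow> (\<lambda>\<theta>. nt_comp C (rmod R (Suc j)) \<theta> (rdiff R j)) ` carrier (nat_hom K C (rmod R j) G))"

text \<open>\<open>Ext\<^sup>i\<close> as the \<open>i\<close>-th derived functor of \<open>Hom\<close>, computed from the chosen projective resolution.\<close>

definition Ext ::
  "('k, 'r) ring_scheme \<Rightarrow> ('o, 'k, 'm) kcat \<Rightarrow> nat \<Rightarrow> ('o, 'm, 'k, 'u) kmod \<Rightarrow> ('o, 'm, 'k, 'u) kmod
     \<Rightarrow> ('k, ('o \<Rightarrow> 'u \<Rightarrow> 'u) set) module" where
  "Ext K C i F G =
     (let R = proj_res K C F in
      quot_module ((nat_hom K C (rmod R i) G)\<lparr>carrier := cocycles K C R G i\<rparr>) (coboundaries K C R G i))"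

text \<open>
  \<open>f\<close> is a chain map from the resolution \<open>Q\<close> of \<open>F \<circ> \<phi>\<close> to the pullback along \<open>\<phi>\<close> of the
  resolution \<open>P\<close> of \<open>F\<close>, lifting the identity of \<open>F \<circ> \<phi>\<close>.
\<close>

definition comparison_map ::
  "('k, 'r) ring_scheme \<Rightarrow> ('o, 'k, 'm) kcat \<Rightarrow> ('o, 'm, 'p, 'n) kfun
     \<Rightarrow> ('o, 'm, 'k, 'u) resolution \<Rightarrow> ('p, 'n, 'k, 'u) resolution
     \<Rightarrow> (nat \<Rightarrow> 'o \<Rightarrow> 'u \<Rightarrow> 'u) \<Rightarrow> bool" where
  "comparison_map K C \<phi> Q P f \<longleftrightarrow>
     (\<forall>n. f n \<in> carrier (nat_hom K C (rmod Q n) (mod_pullback \<phi> (rmod P n)))) \<and>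
     nt_comp C (rmod Q 0) (nt_pullback C \<phi> (raug P)) (f 0) = raug Q \<and>
     (\<forall>n. nt_comp C (rmod Q (Suc n)) (nt_pullback C \<phi> (rdiff P n)) (f (Suc n)) =
           nt_comp C (rmod Q (Suc n)) (f n) (rdiff Q n))"

text \<open>
  The canonical map \<open>Ext\<^sup>i(F, G) \<rightarrow> Ext\<^sup>i(F \<circ> \<phi>, G \<circ> \<phi>)\<close> induced by the exact functor
  \<open>F \<mapsto> F \<circ> \<phi>\<close>: pull back a cocycle on \<open>P\<^sub>i\<close> and precompose with the comparison map.
\<close>

definition ext_map ::
  "('k, 'r) ring_scheme \<Rightarrow> ('o, 'k, 'm) kcat \<Rightarrow> ('p, 'k, 'n) kcat \<Rightarrow> ('o, 'm, 'p, 'n) kfun \<Rightarrow> nat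
     \<Rightarrow> ('p, 'n, 'k, 'u) kmod \<Rightarrow> ('p, 'n, 'k, 'u) kmod
     \<Rightarrow> ('p \<Rightarrow> 'u \<Rightarrow> 'u) set \<Rightarrow> ('o \<Rightarrow> 'u \<Rightarrow> 'u) set" where
  "ext_map K C D \<phi> i F G X =
     (let P = proj_res K D F;
          Q = proj_res K C (mod_pullback \<phi> F);
          f = (SOME f. comparison_map K C \<phi> Q P f);
          G' = mod_pullback \<phi> G
      in \<Union>\<eta>\<in>X. coboundaries K C Q G' i +>\<^bsub>nat_hom K C (rmod Q i) G'\<^esub>
                 nt_comp C (rmod Q i) (nt_pullback C \<phi> \<eta>) (f i))"


section \<open>Homological epimorphisms\<close>

text \<open>
  \<open>C\<close> is small relative to the universe \<open>'u\<close>: up to bijection, \<open>K\<close>, the object set and all morphism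
  sets of \<open>C\<close> are subsets of the infinite type \<open>'u\<close>. This ensures that \<open>Mod(C)\<close>, with modules
  valued in \<open>'u\<close>, has enough projectives (direct sums of representables), and likewise for the
  quotients and the enveloping category of \<open>C\<close>. Apart from this, \<open>'u\<close> is arbitrary.
\<close>

definition small_k_category ::
  "'u itself \<Rightarrow> ('k, 'r) ring_scheme \<Rightarrow> ('o, 'k, 'm) kcat \<Rightarrow> bool" where
  "small_k_category U K C \<longleftrightarrow> k_category K C \<and>
     infinite (UNIV :: 'u set) \<and>
     carrier K \<lesssim> (UNIV :: 'u set) \<and>
     Ob C \<lesssim> (UNIV :: 'u set) \<and>
     (\<forall>x\<in>Ob C. \<forall>y\<in>Ob C. carrier (Hom C x y) \<lesssim> (UNIV :: 'u set))"

definition strongly_idempotent ::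
  "'u itself \<Rightarrow> ('k, 'r) ring_scheme \<Rightarrow> ('o, 'k, 'm) kcat \<Rightarrow> ('o \<Rightarrow> 'o \<Rightarrow> 'm set) \<Rightarrow> bool" where
  "strongly_idempotent U K C I \<longleftrightarrow> two_sided_ideal K C I \<and>
     (\<forall>(F :: ('o, 'm set, 'k, 'u) kmod) (F' :: ('o, 'm set, 'k, 'u) kmod) i.
        k_module K (quot_cat C I) F \<and> k_module K (quot_cat C I) F' \<longrightarrow>
        linear_iso K
          (Ext K (quot_cat C I) i F F')
          (Ext K C i (mod_pullback (quot_proj C I) F) (mod_pullback (quot_proj C I) F'))
          (ext_map K C (quot_cat C I) (quot_proj C I) i F F'))"

text \<open>
  A full functor which is the identity on objects is identified with the canonical projection onto
  the quotient of its source by its kernel.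
\<close>

definition homological_epimorphism ::
  "'u itself \<Rightarrow> ('k, 'r) ring_scheme \<Rightarrow> ('o, 'k, 'm) kcat \<Rightarrow> ('o, 'k, 'n) kcat
     \<Rightarrow> ('o, 'm, 'o, 'n) kfun \<Rightarrow> bool" where
  "homological_epimorphism U K C D \<phi> \<longleftrightarrow>
     k_functor K C D \<phi> \<and> identity_on_objects C D \<phi> \<and> full_functor C D \<phi> \<and>
     strongly_idempotent U K C (functor_kernel C D \<phi>)"

end

theory Submission
 imports Defs
begin

text \<open>
 An ideal \<open>J\<close> of \<open>D\<close> is strongly idempotent iff every projective resolution over \<open>D\<close> of a module
 killed by \<open>J\<close> stays exact after reduction modulo \<open>J\<close>, that is, iff Tor against \<open>D/J\<close> vanishes on it.
 In this case the reduction is a projective resolution over \<open>D/J\<close>, so both compute the same Ext;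
 conversely, surjectivity of the Ext maps, tested on a killed quotient of a term of the resolution,
 yields the exactness.

 Vanishing for left modules gives vanishing for right modules: the sections of a free resolution of
 the bimodule \<open>C\<close> are projective resolutions on either side, and exactness of its reduction is a
 left-right symmetric condition. This settles the right modules \<open>(C/I)(-, y)\<close>; every killed right module
 is a quotient of a sum of these, and dimension shifting does the rest. Finally, the reduction over
 \<open>C\<^sup>o\<^sup>p \<otimes> C\<close> modulo the kernel of \<open>\<pi>\<^sup>e\<close> is the reduction in one variable followed by the
 reduction in the other one, and the sections of free modules over the tensor product are projective in each
 variable, also after reduction in the other.
\<close>

section \<open>Linear algebra\<close>

text \<open>After \<open>strongly_idempotent_iff\<close> no Ext occurs any more: the argument is
  about \<open>exm\<close>, exactness of \<open>X/JX\<close> stated on elements. This form needs no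
  tensor product of functors, and it shows why the order of two reductions is irrelevant: dividing
  by the span of \<open>IB\<close> and then by that of \<open>IA\<close> asks for exactness modulo
  the sum of both spans.

  The obstacle behind the detour through bimodules is that the hypothesis speaks of covariant
  \<open>C\<close>-modules only, whereas one factor of the enveloping category is
  \<open>op_cat C\<close>.

  A second constraint is the universe \<open>'u\<close>: all modules must have their carriers in
  this one type. Quotients are therefore carried by chosen representatives (\<open>quotk\<close>),
  direct sums and representables are transported along injections (\<open>trk\<close>), and
  resolutions exist because the cardinalities fit.

  That the ground ring is a field enters through the splitting of linear maps. It replaces bases of
  morphism spaces when sections of free modules are shown to be projective.\<close>

abbreviation (input) infix_zero ("\<zero>[_]") where "\<zero>[V] \<equiv> \<zero>\<^bsub>V\<^esub>"
abbreviation (input) infix_add ("(_ \<oplus>[_]/ _)" [65, 0, 66] 65) where "u \<oplus>[V] v \<equiv> u \<oplus>\<^bsub>V\<^esub> v"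
abbreviation (input) infix_minus ("(_ \<ominus>[_]/ _)" [65, 0, 66] 65) where "u \<ominus>[V] v \<equiv> u \<ominus>\<^bsub>V\<^esub> v"
abbreviation (input) infix_uminus ("\<ominus>[_] _" [0, 81] 80) where "\<ominus>[V] v \<equiv> \<ominus>\<^bsub>V\<^esub> v"
abbreviation (input) infix_smult ("(_ \<odot>[_]/ _)" [70, 0, 71] 70) where "a \<odot>[V] v \<equiv> a \<odot>\<^bsub>V\<^esub> v"
abbreviation (input) infix_coset ("(_ +>[_]/ _)" [60, 0, 61] 60) where "N +>[V] v \<equiv> N +>\<^bsub>V\<^esub> v"
abbreviation (input) el where "el F x \<equiv> carrier (val F x)"
abbreviation (input) Mor where "Mor C x y \<equiv> carrier (Hom C x y)"

locale kfield = field K for K :: "('k, 'r) ring_scheme" (structure)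
begin

lemma linD:
 assumes "linear_map K V W f"
 shows lin_closed: "v \<in> carrier V ==> f v \<in> carrier W"
  and lin_add: "[|u \<in> carrier V; v \<in> carrier V|] ==> f (u \<oplus>[V] v) = f u \<oplus>[W] f v"
  and lin_smult: "[|a \<in> carrier K; v \<in> carrier V|] ==> f (a \<odot>[V] v) = a \<odot>[W] f v"
 using assms unfolding linear_map_def by auto

lemma linI:
 assumes "\<And>v. v \<in> carrier V ==> f v \<in> carrier W"
  and "\<And>u v. [|u \<in> carrier V; v \<in> carrier V|] ==> f (u \<oplus>[V] v) = f u \<oplus>[W] f v"
  and "\<And>a v. [|a \<in> carrier K; v \<in> carrier V|] ==> f (a \<odot>[V] v) = a \<odot>[W] f v"
 shows "linear_map K V W f"
 using assms unfolding linear_map_def by auto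

lemma module_zero: "module K V ==> \<zero>[V] \<in> carrier V"
 and module_add: "module K V ==> u \<in> carrier V ==> v \<in> carrier V ==> u \<oplus>[V] v \<in> carrier V"
 and module_smult: "module K V ==> a \<in> carrier K ==> v \<in> carrier V ==> a \<odot>[V] v \<in> carrier V"
 and module_neg: "module K V ==> v \<in> carrier V ==> \<ominus>[V] v \<in> carrier V"
 and module_minus: "module K V ==> u \<in> carrier V ==> v \<in> carrier V ==> u \<ominus>[V] v \<in> carrier V"
proof -
 assume "module K V"
 then interpret V: module K V .
 show "\<zero>[V] \<in> carrier V" by simp
 show "u \<in> carrier V ==> v \<in> carrier V ==> u \<oplus>[V] v \<in> carrier V" by simp
 show "a \<in> carrier K ==> v \<in> carrier V ==> a \<odot>[V] v \<in> carrier V" by simp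
 show "v \<in> carrier V ==> \<ominus>[V] v \<in> carrier V" by simp
 show "u \<in> carrier V ==> v \<in> carrier V ==> u \<ominus>[V] v \<in> carrier V" by simp
qed

lemma neg_smult:
 assumes "module K V" "v \<in> carrier V"
 shows "\<ominus>[V] v = (\<ominus> \<one>) \<odot>[V] v"
proof -
 interpret V: module K V by fact
 show ?thesis using assms(2) V.smult_l_minus[of "\<one>" v] by simp
qed

lemma lin_zero:
 assumes "module K V" "module K W" "linear_map K V W f"
 shows "f \<zero>[V] = \<zero>[W]"
proof -
 interpret V: module K V by fact
 interpret W: module K W by fact
 have "f \<zero>[V] = f (\<zero> \<odot>[V] \<zero>[V])" by simp
 also have "\<dots> = \<zero> \<odot>[W] f \<zero>[V]" by (rule lin_smult[OF assms(3)]) auto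
 also have "\<dots> = \<zero>[W]" using lin_closed[OF assms(3)] by simp
 finally show ?thesis .
qed

lemma lin_neg:
 assumes "module K V" "module K W" "linear_map K V W f" "v \<in> carrier V"
 shows "f (\<ominus>[V] v) = \<ominus>[W] f v"
 using assms neg_smult[OF assms(1,4)] neg_smult[OF assms(2) lin_closed[OF assms(3,4)]]
 by (simp add: lin_smult[OF assms(3)])

lemma lin_minus:
 assumes "module K V" "module K W" "linear_map K V W f" "u \<in> carrier V" "v \<in> carrier V"
 shows "f (u \<ominus>[V] v) = f u \<ominus>[W] f v"
 using assms by (simp add: a_minus_def lin_add[OF assms(3)] lin_neg[OF assms(1-3)] module_neg)

lemma lin_id: "linear_map K V V (\<lambda>v. v)"
 by (simp add: linear_map_def)

lemma lin_comp:
 "linear_map K V W f ==> linear_map K W X g ==> linear_map K V X (\<lambda>v. g (f v))"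
 by (auto simp: linear_map_def Pi_def)

lemma lin_const_zero: "module K W ==> linear_map K V W (\<lambda>_. \<zero>[W])"
proof -
 assume "module K W" then interpret W: module K W .
 show ?thesis by (auto simp: linear_map_def)
qed

lemma lin_plus:
 assumes "module K W" "linear_map K V W f" "linear_map K V W g"
 shows "linear_map K V W (\<lambda>v. f v \<oplus>[W] g v)"
proof -
 interpret W: module K W by fact
 show ?thesis
  by (rule linI) (auto simp: linD[OF assms(2)] linD[OF assms(3)] W.smult_r_distr W.a_ac)
qed

lemma lin_scale:
 assumes "module K W" "linear_map K V W f" "a \<in> carrier K"
 shows "linear_map K V W (\<lambda>v. a \<odot>[W] f v)"
proof -
 interpret W: module K W by fact
 show ?thesis
  using assms(3) by (intro linI)
   (auto simp: linD[OF assms(2)] W.smult_r_distr W.smult_assoc1[symmetric] m_comm)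
qed

lemma lin_uminus:
 assumes "module K W" "linear_map K V W f"
 shows "linear_map K V W (\<lambda>v. \<ominus>[W] f v)"
proof -
 interpret W: module K W by fact
 show ?thesis
  by (rule linI) (auto simp: linD[OF assms(2)] W.minus_add W.smult_r_minus)
qed

lemma lin_cong:
 assumes "module K V" "\<And>v. v \<in> carrier V ==> f v = g v" "linear_map K V W f"
 shows "linear_map K V W g"
 using assms by (auto simp: linear_map_def Pi_def module_add module_smult)

lemma submoduleD:
 assumes "module K V" "submodule N K V"
 shows sub_carrier: "n \<in> N ==> n \<in> carrier V"
  and sub_zero: "\<zero>[V] \<in> N"
  and sub_add: "[|m \<in> N; n \<in> N|] ==> m \<oplus>[V] n \<in> N"
  and sub_smult: "[|a \<in> carrier K; n \<in> N|] ==> a \<odot>[V] n \<in> N"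
  and sub_neg: "n \<in> N ==> \<ominus>[V] n \<in> N"
  and sub_minus: "[|m \<in> N; n \<in> N|] ==> m \<ominus>[V] n \<in> N"
proof -
 interpret V: module K V by fact
 note E = V.submoduleE[OF assms(2)]
 show "n \<in> N ==> n \<in> carrier V" using E(1) by auto
 show add: "[|m \<in> N; n \<in> N|] ==> m \<oplus>[V] n \<in> N" for m n using E by auto
 show "[|a \<in> carrier K; n \<in> N|] ==> a \<odot>[V] n \<in> N" using E by auto
 show neg: "n \<in> N ==> \<ominus>[V] n \<in> N" for n using E by auto
 show "\<zero>[V] \<in> N"
 proof -
  obtain n where n: "n \<in> N" using E(2) by auto
  then have "n \<oplus>[V] \<ominus>[V] n \<in> N" using add neg by simp
  then show ?thesis using n E(1) V.r_neg by auto
 qed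
 show "[|m \<in> N; n \<in> N|] ==> m \<ominus>[V] n \<in> N" using add neg by (simp add: a_minus_def)
qed

lemma submodI:
 assumes "module K V" "N \<subseteq> carrier V" "\<zero>[V] \<in> N"
  and "\<And>u v. [|u \<in> N; v \<in> N|] ==> u \<oplus>[V] v \<in> N"
  and "\<And>a v. [|a \<in> carrier K; v \<in> N|] ==> a \<odot>[V] v \<in> N"
 shows "submodule N K V"
proof -
 interpret V: module K V by fact
 show ?thesis
 proof (rule V.submoduleI)
  fix a assume "a \<in> N"
  then show "\<ominus>[V] a \<in> N"
   using assms(2,5) neg_smult[OF assms(1), of a] by auto
 qed (use assms in auto)
qed

lemma submodule_zero: "module K V ==> submodule {\<zero>[V]} K V"
proof -
 assume "module K V" then interpret V: module K V .
 show ?thesis by (rule submodI) (auto intro: V.module_axioms)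
qed

lemma submodule_carrier: "module K V ==> submodule (carrier V) K V"
 by (rule module.carrier_is_submodule)

lemma submodule_module:
 "module K V ==> submodule N K V ==> module K (V\<lparr>carrier := N\<rparr>)"
 by (rule submodule.submodule_is_module)

lemma submodule_image:
 assumes "module K V" "module K W" "linear_map K V W f" "submodule N K V"
 shows "submodule (f ` N) K W"
proof -
 note N = submoduleD[OF assms(1,4)]
 note f = linD[OF assms(3)]
 show ?thesis
 proof (rule submodI[OF assms(2)])
  show "f ` N \<subseteq> carrier W" using N f by auto
  show "\<zero>[W] \<in> f ` N" using lin_zero[OF assms(1-3)] N(2) by force
  fix u v assume "u \<in> f ` N" "v \<in> f ` N"
  then show "u \<oplus>[W] v \<in> f ` N" using N f by (auto simp flip: f(2))
 next
  fix a v assume "a \<in> carrier K" "v \<in> f ` N"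
  then show "a \<odot>[W] v \<in> f ` N" using N f by (auto simp flip: f(3))
 qed
qed

lemma submodule_preimage:
 assumes "module K V" "module K W" "linear_map K V W f" "submodule N K W"
 shows "submodule {v \<in> carrier V. f v \<in> N} K V"
proof -
 interpret V: module K V by fact
 note N = submoduleD[OF assms(2,4)]
 note f = linD[OF assms(3)]
 show ?thesis
  by (rule submodI[OF assms(1)]) (auto simp: f N lin_zero[OF assms(1-3)])
qed

lemma submodule_kernel:
 assumes "module K V" "module K W" "linear_map K V W f"
 shows "submodule {v \<in> carrier V. f v = \<zero>[W]} K V"
 using submodule_preimage[OF assms submodule_zero[OF assms(2)]] by simp

text \<open>Occurs mostly as \<open>J F + Z\<close>: dividing \<open>F\<close> by \<open>Z\<close>
  and then by \<open>J\<close> is the same as dividing by this sum.\<close>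

definition ssum :: "('k, 'v) module => 'v set => 'v set => 'v set" where
 "ssum V A B = {a \<oplus>[V] b | a b. a \<in> A \<and> b \<in> B}"

lemma ssumI: "a \<in> A ==> b \<in> B ==> a \<oplus>[V] b \<in> ssum V A B"
 by (auto simp: ssum_def)

lemma submodule_ssum:
 assumes "module K V" "submodule A K V" "submodule B K V"
 shows "submodule (ssum V A B) K V"
proof -
 interpret V: module K V by fact
 note A = submoduleD[OF assms(1,2)]
 note B = submoduleD[OF assms(1,3)]
 show ?thesis
 proof (rule submodI[OF assms(1)])
  show "ssum V A B \<subseteq> carrier V" using A B by (auto simp: ssum_def)
  show "\<zero>[V] \<in> ssum V A B" using ssumI[OF A(2) B(2), of V] by simp
 next
  fix u v assume "u \<in> ssum V A B" "v \<in> ssum V A B"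
  then obtain a b a' b' where u: "a \<in> A" "b \<in> B" "u = a \<oplus>[V] b"
   and v: "a' \<in> A" "b' \<in> B" "v = a' \<oplus>[V] b'" by (auto simp: ssum_def)
  have "u \<oplus>[V] v = (a \<oplus>[V] a') \<oplus>[V] (b \<oplus>[V] b')"
   using u v A B by (simp add: V.a_ac)
  then show "u \<oplus>[V] v \<in> ssum V A B" using u v A B by (auto intro: ssumI)
 next
  fix c v assume "c \<in> carrier K" "v \<in> ssum V A B"
  then obtain a b where "a \<in> A" "b \<in> B" "c \<in> carrier K" "v = a \<oplus>[V] b" by (auto simp: ssum_def)
  then show "c \<odot>[V] v \<in> ssum V A B"
   using A B ssumI[of "c \<odot>[V] a" A "c \<odot>[V] b" B V] by (simp add: V.smult_r_distr)
 qed
qed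

lemma ssum_left: "module K V ==> submodule A K V ==> submodule B K V ==> a \<in> A ==> a \<in> ssum V A B"
proof -
 assume *: "module K V" "submodule A K V" "submodule B K V" "a \<in> A"
 interpret V: module K V by fact
 show ?thesis using ssumI[OF *(4) sub_zero[OF *(1,3)], of V] sub_carrier[OF *(1,2,4)] by simp
qed

lemma ssum_right: "module K V ==> submodule A K V ==> submodule B K V ==> b \<in> B ==> b \<in> ssum V A B"
proof -
 assume *: "module K V" "submodule A K V" "submodule B K V" "b \<in> B"
 interpret V: module K V by fact
 show ?thesis using ssumI[OF sub_zero[OF *(1,2)] *(4), of V] sub_carrier[OF *(1,3,4)] by simp
qed

lemma ssum_subset:
 assumes "module K V" "submodule N K V" "A \<subseteq> N" "B \<subseteq> N"
 shows "ssum V A B \<subseteq> N"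
 using assms sub_add[OF assms(1,2)] by (auto simp: ssum_def)

lemma ssum_comm:
 assumes "module K V" "A \<subseteq> carrier V" "B \<subseteq> carrier V"
 shows "ssum V A B = ssum V B A"
proof -
 interpret V: module K V by fact
 have "ssum V A B \<subseteq> ssum V B A" if "A \<subseteq> carrier V" "B \<subseteq> carrier V" for A B
 proof
  fix x assume "x \<in> ssum V A B"
  then obtain a b where "a \<in> A" "b \<in> B" "x = a \<oplus>[V] b" by (auto simp: ssum_def)
  then have "x = b \<oplus>[V] a" using that V.a_comm by blast
  then show "x \<in> ssum V B A" using \<open>a \<in> A\<close> \<open>b \<in> B\<close> by (simp add: ssumI)
 qed
 then show ?thesis using assms by blast
qed

lemma sub_cancel:
 assumes "module K V" "submodule N K V" "n \<in> N" "v \<in> carrier V" "n \<oplus>[V] v \<in> N"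
 shows "v \<in> N"
proof -
 interpret V: module K V by fact
 have n: "n \<in> carrier V" using sub_carrier[OF assms(1,2,3)] .
 have "\<ominus>[V] n \<oplus>[V] (n \<oplus>[V] v) \<in> N"
  using sub_add[OF assms(1,2) sub_neg[OF assms(1,2,3)] assms(5)] .
 then show ?thesis unfolding V.r_neg1[OF n assms(4)] .
qed

lemma minus_add_cancel:
 assumes "module K V" "u \<in> carrier V" "v \<in> carrier V"
 shows "(u \<ominus>[V] v) \<oplus>[V] v = u"
proof -
 interpret V: module K V by fact
 show ?thesis using assms(2,3) by (simp add: a_minus_def V.a_assoc V.l_neg)
qed

lemma minus_eq_zero:
 assumes "module K V" "u \<in> carrier V" "v \<in> carrier V"
 shows "u \<ominus>[V] v = \<zero>[V] \<longleftrightarrow> u = v"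
proof -
 interpret V: module K V by fact
 show ?thesis
 proof
  assume "u \<ominus>[V] v = \<zero>[V]"
  then show "u = v" using minus_add_cancel[OF assms] V.l_zero[OF assms(3)] by simp
 next
  assume "u = v"
  then show "u \<ominus>[V] v = \<zero>[V]" using V.r_neg[OF assms(3)] by (simp add: a_minus_def)
 qed
qed

lemma minus_self: "module K V ==> u \<in> carrier V ==> u \<ominus>[V] u = \<zero>[V]"
 by (simp add: minus_eq_zero)

subsection \<open>Lifting linear maps along surjections\<close>

text \<open>A maximal subspace \<open>C\<close> meeting the kernel of \<open>e\<close> trivially has
  the same image as \<open>M\<close>: otherwise the line through some \<open>m\<close> whose image
  is missed could be added to it. So \<open>e\<close> becomes injective on \<open>C\<close> without
  loss of image, a splitting obtained without bases.\<close>

lemma linear_section: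
 assumes M: "module K M" and N: "module K N" and e: "linear_map K M N e"
 shows "\<exists>C. submodule C K M \<and> (\<forall>c\<in>C. e c = \<zero>[N] --> c = \<zero>[M]) \<and> e ` C = e ` carrier M"
proof -
 interpret M: module K M by fact
 interpret N: module K N by fact
 note eD = linD[OF e]
 have e0: "e \<zero>[M] = \<zero>[N]" by (rule lin_zero[OF M N e])
 define good where "good C \<longleftrightarrow> submodule C K M \<and> (\<forall>c\<in>C. e c = \<zero>[N] --> c = \<zero>[M])" for C
 have "\<exists>C\<in>{C. good C}. \<forall>X\<in>{C. good C}. C \<subseteq> X --> X = C"
 proof (rule subset_Zorn_nonempty)
  show "{C. good C} \<noteq> {}" using submodule_zero[OF M] unfolding good_def by blast
  fix \<C> assume C: "\<C> \<noteq> {}" "subset.chain {C. good C} \<C>"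
  then have g: "submodule C K M" "\<And>c. c \<in> C ==> e c = \<zero>[N] ==> c = \<zero>[M]" if "C \<in> \<C>" for C
   using that by (auto simp: subset.chain_def good_def)
  have "submodule (\<Union>\<C>) K M"
  proof (rule submodI[OF M])
   fix u v assume "u \<in> \<Union>\<C>" "v \<in> \<Union>\<C>"
   then obtain A B where AB: "A \<in> \<C>" "B \<in> \<C>" "u \<in> A" "v \<in> B" by blast
   moreover have "A \<subseteq> B \<or> B \<subseteq> A" using C(2) AB by (auto simp: subset_chain_def)
   ultimately show "u \<oplus>[M] v \<in> \<Union>\<C>" using sub_add[OF M g(1)] by blast
  qed (use C(1) sub_zero[OF M g(1)] sub_carrier[OF M g(1)] sub_smult[OF M g(1)] in blast)+
  then show "\<Union>\<C> \<in> {C. good C}" using g(2) unfolding good_def by blast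
 qed
 then obtain C where C: "good C" and max: "\<And>X. good X ==> C \<subseteq> X ==> X = C" by auto
 have Cs: "submodule C K M" and Cz: "\<And>c. c \<in> C ==> e c = \<zero>[N] ==> c = \<zero>[M]" using C by (auto simp: good_def)
 note Cc = sub_carrier[OF M Cs]
 have "e m \<in> e ` C" if m: "m \<in> carrier M" for m
 proof (rule ccontr)
  assume n: "e m \<notin> e ` C"
  let ?L = "(\<lambda>a. a \<odot>[M] m) ` carrier K"
  have L: "submodule ?L K M"
  proof (rule submodI[OF M])
   show "\<zero>[M] \<in> ?L" using M.smult_l_null[OF m] by (intro image_eqI[of _ _ \<zero>]) simp_all
   show "u \<oplus>[M] v \<in> ?L" if "u \<in> ?L" "v \<in> ?L" for u v using that m by (auto simp: M.smult_l_distr[symmetric])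
   show "a \<odot>[M] v \<in> ?L" if "a \<in> carrier K" "v \<in> ?L" for a v using that m by (auto simp: M.smult_assoc1[symmetric])
  qed (use m in auto)
  have "good (ssum M C ?L)"
   unfolding good_def
  proof (intro conjI ballI impI submodule_ssum[OF M Cs L])
   fix x assume "x \<in> ssum M C ?L" and x0: "e x = \<zero>[N]"
   then obtain c a where x: "c \<in> C" "a \<in> carrier K" "x = c \<oplus>[M] a \<odot>[M] m" by (auto simp: ssum_def)
   have s: "e c \<oplus>[N] a \<odot>[N] e m = \<zero>[N]" using x0 x m Cc by (simp add: eD)
   \<comment> \<open>A nonzero coefficient \<open>a\<close> could be inverted, and
     \<open>e m\<close> would be the image of an element of \<open>C\<close>. This is where the
     ground ring has to be a field.\<close>
   have "a = \<zero>"
   proof (rule ccontr)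
    assume "a \<noteq> \<zero>"
    then have a: "inv a \<in> carrier K" "inv a \<otimes> a = \<one>" using x(2) field_Units by auto
    have "a \<odot>[N] e m = \<ominus>[N] e c"
     using s x m Cc[OF x(1)] by (metis N.a_comm N.minus_equality N.smult_closed eD(1))
    then have "inv a \<odot>[N] (a \<odot>[N] e m) = inv a \<odot>[N] e (\<ominus>[M] c)" using lin_neg[OF M N e Cc[OF x(1)]] by simp
    then have "e m = e (inv a \<odot>[M] (\<ominus>[M] c))"
     using a x m Cc[OF x(1)] by (simp add: eD N.smult_assoc1[symmetric])
    then show False using n sub_smult[OF M Cs a(1) sub_neg[OF M Cs x(1)]] by blast
   qed
   then show "x = \<zero>[M]" using x x0 Cz[of c] Cc m by simp
  qed
  then have "ssum M C ?L = C" by (rule max) (use ssum_left[OF M Cs L] in blast)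
  moreover have "m \<in> ?L" using m by (intro image_eqI[of _ _ \<one>]) simp_all
  ultimately show False using n ssum_right[OF M Cs L] by blast
 qed
 then show ?thesis using Cs Cz Cc by blast
qed

text \<open>The lift takes values in the complement from \<open>linear_section\<close>, on which
  \<open>e\<close> is injective: hence it is linear, and zero wherever \<open>h\<close> is. The last
  property lets the lift of a map that kills an ideal kill it as well, as
  \<open>relproj_bilinear\<close> requires.\<close>

lemma linear_lift:
 assumes V: "module K V" and M: "module K M" and N: "module K N"
  and h: "linear_map K V N h" and e: "linear_map K M N e"
  and surj: "\<And>v. v \<in> carrier V ==> h v \<in> e ` carrier M"
 shows "\<exists>h'. linear_map K V M h' \<and> (\<forall>v\<in>carrier V. e (h' v) = h v \<and> (h v = \<zero>[N] --> h' v = \<zero>[M]))"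
proof -
 obtain C where C: "submodule C K M" and z: "\<And>c. c \<in> C ==> e c = \<zero>[N] ==> c = \<zero>[M]" and im: "e ` C = e ` carrier M"
  using linear_section[OF M N e] by blast
 note Cc = sub_carrier[OF M C] and hD = linD[OF h] and eD = linD[OF e]
 have uq: "c = c'" if "c \<in> C" "c' \<in> C" "e c = e c'" for c c'
 proof -
  have "e (c \<ominus>[M] c') = \<zero>[N]" using lin_minus[OF M N e Cc Cc] that minus_self[OF N eD(1)[OF Cc]] by simp
  then show ?thesis using z[OF sub_minus[OF M C]] minus_eq_zero[OF M Cc Cc] that by simp
 qed
 define h' where "h' v = (SOME c. c \<in> C \<and> e c = h v)" for v
 have h': "h' v \<in> C" "e (h' v) = h v" if "v \<in> carrier V" for v
 proof -
  have "\<exists>c. c \<in> C \<and> e c = h v" using surj[OF that] im by (metis imageE)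
  from someI_ex[OF this] show "h' v \<in> C" "e (h' v) = h v" unfolding h'_def by blast+
 qed
 have "linear_map K V M h'"
 proof (rule linI)
  show "h' v \<in> carrier M" if "v \<in> carrier V" for v by (rule Cc[OF h'(1)[OF that]])
  show "h' (u \<oplus>[V] v) = h' u \<oplus>[M] h' v" if "u \<in> carrier V" "v \<in> carrier V" for u v
   by (rule uq) (use that h' sub_add[OF M C] module_add[OF V] in \<open>simp_all add: eD hD Cc\<close>)
  show "h' (a \<odot>[V] v) = a \<odot>[M] h' v" if "a \<in> carrier K" "v \<in> carrier V" for a v
   by (rule uq) (use that h' sub_smult[OF M C] module_smult[OF V] in \<open>simp_all add: eD hD Cc\<close>)
 qed
 then show ?thesis using h' z by metis
qed

text \<open>The module axioms are equations, so they may be checked after applying a jointly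
  injective family of linear maps. This covers direct sums (\<open>dsv_module\<close>) and spaces of
  natural transformations (\<open>nat_hom_module\<close>).\<close>

lemma module_of_eval:
 assumes V: "\<And>s. s \<in> S ==> module K (V s)"
  and c: "\<zero>[W] \<in> carrier W" "\<And>u v. u \<in> carrier W ==> v \<in> carrier W ==> u \<oplus>[W] v \<in> carrier W"
   "\<And>a v. a \<in> carrier K ==> v \<in> carrier W ==> a \<odot>[W] v \<in> carrier W"
  and l: "\<And>s. s \<in> S ==> linear_map K W (V s) (ev s)" "\<And>s. s \<in> S ==> ev s \<zero>[W] = \<zero>[V s]"
  and x: "\<And>u v. u \<in> carrier W ==> v \<in> carrier W ==> (\<And>s. s \<in> S ==> ev s u = ev s v) ==> u = v"
 shows "module K W"
proof -
 note e = lin_closed[OF l(1)] lin_add[OF l(1)] lin_smult[OF l(1)] l(2)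
 have eq: "u = v" if "u \<in> carrier W" "v \<in> carrier W" "\<And>s. s \<in> S ==> module K (V s) ==> ev s u = ev s v" for u v
  by (rule x) (use that V in blast)+
 have a: "abelian_group W"
 proof (rule abelian_groupI)
  fix u assume u: "u \<in> carrier W"
  show "\<zero>[W] \<oplus>[W] u = u"
   by (rule eq) (use u in \<open>simp_all add: c e module.axioms(2) abelian_group.axioms(1) abelian_monoid.l_zero\<close>)
  \<comment> \<open>The hypotheses speak of addition and scalar multiplication only, so the inverse
    is taken to be \<open>(\<ominus> \<one>) \<odot>[W] u\<close>.\<close>
  show "\<exists>v\<in>carrier W. v \<oplus>[W] u = \<zero>[W]"
  proof (rule bexI, rule eq)
   fix s assume s: "s \<in> S" and "module K (V s)"
   interpret V: module K "V s" by fact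
   show "ev s ((\<ominus> \<one>) \<odot>[W] u \<oplus>[W] u) = ev s \<zero>[W]"
    using s u neg_smult[OF V.module_axioms, symmetric] by (simp add: c e V.l_neg)
  qed (use u c in simp_all)
  fix v assume v: "v \<in> carrier W"
  show "u \<oplus>[W] v = v \<oplus>[W] u"
   by (rule eq) (use u v in \<open>simp_all add: c e module.axioms(2) abelian_group.axioms(1) abelian_monoid.a_comm\<close>)
  fix w assume w: "w \<in> carrier W"
  show "u \<oplus>[W] v \<oplus>[W] w = u \<oplus>[W] (v \<oplus>[W] w)"
   by (rule eq) (use u v w in \<open>simp_all add: c e module.axioms(2) abelian_group.axioms(1) abelian_monoid.a_assoc\<close>)
 qed (rule c; assumption?)+
 show ?thesis
 proof (rule moduleI[OF is_cring a])
  fix a u assume a: "a \<in> carrier K" and u: "u \<in> carrier W"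
  show "a \<odot>[W] u \<in> carrier W" by (rule c(3)[OF a u])
  fix b assume b: "b \<in> carrier K"
  show "(a \<oplus> b) \<odot>[W] u = a \<odot>[W] u \<oplus>[W] b \<odot>[W] u"
   by (rule eq) (use a b u in \<open>simp_all add: c e module.smult_l_distr\<close>)
  show "(a \<otimes> b) \<odot>[W] u = a \<odot>[W] (b \<odot>[W] u)"
   by (rule eq) (use a b u in \<open>simp_all add: c e module.smult_assoc1\<close>)
 next
  fix a u v assume a: "a \<in> carrier K" and u: "u \<in> carrier W" and v: "v \<in> carrier W"
  show "a \<odot>[W] (u \<oplus>[W] v) = a \<odot>[W] u \<oplus>[W] a \<odot>[W] v"
   by (rule eq) (use a u v in \<open>simp_all add: c e module.smult_r_distr\<close>)
 next
  fix u assume u: "u \<in> carrier W"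
  show "\<one> \<odot>[W] u = u" by (rule eq) (use u in \<open>simp_all add: c e module.smult_one\<close>)
 qed
qed

subsection \<open>Quotients, free modules and tensor products\<close>

lemma coset_mem: "x \<in> N +>[M] v \<longleftrightarrow> (\<exists>n\<in>N. x = n \<oplus>[M] v)"
 by (auto simp: a_r_coset_def')

lemma module_subgroup:
 assumes "module K M" "submodule N K M"
 shows "abelian_subgroup N M"
proof -
 interpret M: module K M by fact
 show ?thesis
 proof (rule abelian_subgroupI3)
  show "additive_subgroup N M"
   using submodule.axioms(1)[OF assms(2)] by (rule additive_subgroupI)
  show "abelian_group M" by (rule M.abelian_group_axioms)
 qed
qed

lemma coset_self:
 assumes "module K M" "submodule N K M" "v \<in> carrier M"
 shows "v \<in> N +>[M] v"
proof -
 interpret M: module K M by fact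
 show ?thesis using sub_zero[OF assms(1,2)] assms(3) by (force simp: coset_mem)
qed

lemma coset_eq_iff:
 assumes "module K M" "submodule N K M" "v \<in> carrier M" "w \<in> carrier M"
 shows "N +>[M] v = N +>[M] w \<longleftrightarrow> v \<ominus>[M] w \<in> N"
proof -
 interpret M: module K M by fact
 interpret S: abelian_subgroup N M by (rule module_subgroup[OF assms(1,2)])
 show ?thesis
 proof
  assume "N +>[M] v = N +>[M] w"
  then have "v \<in> N +>[M] w" using coset_self[OF assms(1-3)] by simp
  then show "v \<ominus>[M] w \<in> N" by (rule S.a_rcos_module_imp[OF assms(4), unfolded a_minus_def[symmetric]])
 next
  assume "v \<ominus>[M] w \<in> N"
  then have "v \<in> N +>[M] w"
   using S.a_rcos_module_rev[OF assms(4,3)] by (simp add: a_minus_def)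
  then show "N +>[M] v = N +>[M] w" using S.a_repr_independence'[OF _ assms(4)] by simp
 qed
qed

lemma coset_mem_iff:
 assumes "module K M" "submodule N K M" "v \<in> carrier M"
 shows "x \<in> N +>[M] v \<longleftrightarrow> x \<in> carrier M \<and> x \<ominus>[M] v \<in> N"
proof -
 interpret M: module K M by fact
 interpret S: abelian_subgroup N M by (rule module_subgroup[OF assms(1,2)])
 show ?thesis
 proof
  assume x: "x \<in> N +>[M] v"
  then have "x \<in> carrier M" using assms(3) sub_carrier[OF assms(1,2)] by (auto simp: coset_mem)
  then show "x \<in> carrier M \<and> x \<ominus>[M] v \<in> N"
   using S.a_rcos_module_imp[OF assms(3) x] by (simp add: a_minus_def)
 next
  assume "x \<in> carrier M \<and> x \<ominus>[M] v \<in> N"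
  then show "x \<in> N +>[M] v"
   using S.a_rcos_module_rev[OF assms(3)] by (simp add: a_minus_def)
 qed
qed

lemma qm_carrier: "carrier (quot_module M N) = {N +>[M] v | v. v \<in> carrier M}"
 by (auto simp: quot_module_def A_RCOSETS_def RCOSETS_def a_r_coset_def)

lemma qm_carrierI: "v \<in> carrier M ==> N +>[M] v \<in> carrier (quot_module M N)"
 by (auto simp: qm_carrier)

lemma qm_zero: "\<zero>[quot_module M N] = N"
 by (simp add: quot_module_def)

lemma qm_zero_coset:
 assumes "module K M" "submodule N K M"
 shows "N +>[M] \<zero>[M] = N"
proof -
 interpret M: module K M by fact
 show ?thesis
  using sub_carrier[OF assms] by (rule_tac M.a_coset_add_zero) auto
qed

lemma coset_zero_iff:
 assumes "module K M" "submodule N K M" "v \<in> carrier M"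
 shows "N +>[M] v = N \<longleftrightarrow> v \<in> N"
proof -
 interpret M: module K M by fact
 have "v \<ominus>[M] \<zero>[M] = v" using assms(3) by (simp add: a_minus_def)
 then show ?thesis using coset_eq_iff[OF assms, of "\<zero>[M]"] qm_zero_coset[OF assms(1,2)] by simp
qed

lemma qm_add:
 assumes "module K M" "submodule N K M" "v \<in> carrier M" "w \<in> carrier M"
 shows "(N +>[M] v) \<oplus>[quot_module M N] (N +>[M] w) = N +>[M] (v \<oplus>[M] w)"
proof -
 interpret S: abelian_subgroup N M by (rule module_subgroup[OF assms(1,2)])
 show ?thesis using S.a_rcos_sum[OF assms(3,4)] by (simp add: quot_module_def)
qed

lemma qm_smult:
 assumes "module K M" "submodule N K M" "a \<in> carrier K" "v \<in> carrier M"
 shows "a \<odot>[quot_module M N] (N +>[M] v) = N +>[M] (a \<odot>[M] v)"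
proof -
 interpret M: module K M by fact
 have "N +>[M] (a \<odot>[M] x) = N +>[M] (a \<odot>[M] v)" if x: "x \<in> N +>[M] v" for x
 proof -
  have xc: "x \<in> carrier M" "x \<ominus>[M] v \<in> N" using x coset_mem_iff[OF assms(1,2,4)] by auto
  have "a \<odot>[M] x \<ominus>[M] a \<odot>[M] v = a \<odot>[M] (x \<ominus>[M] v)"
   using xc(1) assms(3,4) by (simp add: a_minus_def M.smult_r_distr M.smult_r_minus)
  then show ?thesis
   using coset_eq_iff[OF assms(1,2)] xc assms(3,4) sub_smult[OF assms(1,2,3)] by simp
 qed
 moreover have "N +>[M] v \<noteq> {}" using coset_self[OF assms(1,2,4)] by blast
 ultimately show ?thesis by (simp add: quot_module_def)
qed

lemma qm_module:
 assumes "module K M" "submodule N K M"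
 shows "module K (quot_module M N)"
proof -
 interpret M: module K M by fact
 let ?Q = "quot_module M N"
 note q = qm_add[OF assms] qm_smult[OF assms]
 have ex: "\<exists>v\<in>carrier M. X = N +>[M] v" if "X \<in> carrier ?Q" for X
  using that by (auto simp: qm_carrier)
 have z: "\<zero>[?Q] = N +>[M] \<zero>[M]" using qm_zero_coset[OF assms] by (simp add: qm_zero)
 show ?thesis
 proof (rule moduleI)
  show "cring K" by (rule is_cring)
  show "abelian_group ?Q"
  proof (rule abelian_groupI)
   fix X assume "X \<in> carrier ?Q"
   then obtain v where v: "v \<in> carrier M" "X = N +>[M] v" using ex by auto
   show "\<exists>Y\<in>carrier ?Q. Y \<oplus>[?Q] X = \<zero>[?Q]"
    using v by (intro bexI[of _ "N +>[M] (\<ominus>[M] v)"]) (auto simp: q z M.l_neg intro: qm_carrierI)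
  qed (auto simp: z q M.a_ac qm_carrierI dest!: ex)
 qed (auto simp: z q qm_carrierI M.smult_l_distr M.smult_r_distr M.smult_assoc1 dest!: ex)
qed

lemma qm_proj_linear:
 assumes "module K M" "submodule N K M"
 shows "linear_map K M (quot_module M N) (\<lambda>v. N +>[M] v)"
 by (rule linI) (simp_all add: qm_carrierI qm_add[OF assms] qm_smult[OF assms])

text \<open>This is how the representatives chosen by \<open>SOME\<close> in
  \<open>tensor_lift\<close>, \<open>rp\<close> and \<open>desc\<close> become irrelevant.\<close>

lemma lin_coset:
 assumes "module K M" "submodule N K M" "module K W" "linear_map K M W f"
  and "\<And>n. n \<in> N ==> f n = \<zero>[W]" and "v \<in> carrier M" "x \<in> N +>[M] v"
 shows "f x = f v"
proof -
 have x: "x \<in> carrier M" "x \<ominus>[M] v \<in> N" using assms(7) coset_mem_iff[OF assms(1,2,6)] by auto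
 have "f x \<ominus>[W] f v = \<zero>[W]"
  using assms(5)[OF x(2)] lin_minus[OF assms(1,3,4) x(1) assms(6)] by simp
 then show ?thesis
  using minus_eq_zero[OF assms(3)] lin_closed[OF assms(4)] x(1) assms(6) by simp
qed

lemma submodule_equalizer:
 assumes "module K V" "module K W" "linear_map K V W f" "linear_map K V W g"
 shows "submodule {v \<in> carrier V. f v = g v} K V"
proof -
 interpret V: module K V by fact
 show ?thesis
  by (rule submodI[OF assms(1)])
   (auto simp: linD[OF assms(3)] linD[OF assms(4)] lin_zero[OF assms(1,2,3)] lin_zero[OF assms(1,2,4)])
qed

lemma submodule_span:
 assumes "module K M" "X \<subseteq> carrier M"
 shows "submodule (module_span K M X) K M" "X \<subseteq> module_span K M X"
proof -
 show "X \<subseteq> module_span K M X" by (auto simp: module_span_def)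
 have c: "module_span K M X \<subseteq> carrier M"
  using submodule_carrier[OF assms(1)] assms(2) by (auto simp: module_span_def)
 show "submodule (module_span K M X) K M"
  using c by (intro submodI[OF assms(1)])
   (auto simp: module_span_def sub_zero[OF assms(1)] sub_add[OF assms(1)] sub_smult[OF assms(1)])
qed

lemma module_span_least: "submodule N K M ==> X \<subseteq> N ==> module_span K M X \<subseteq> N"
 by (auto simp: module_span_def)

lemma free_carrier:
 "f \<in> carrier (free_module K S) \<longleftrightarrow>
   finite {s. f s \<noteq> \<zero>} \<and> {s. f s \<noteq> \<zero>} \<subseteq> S \<and> (\<forall>s. f s \<in> carrier K)"
 by (fastforce simp: free_module_def)

lemma free_ops:
 "\<zero>[free_module K S] = (\<lambda>s. \<zero>)"
 "f \<oplus>[free_module K S] g = (\<lambda>s. f s \<oplus> g s)"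
 "a \<odot>[free_module K S] f = (\<lambda>s. a \<otimes> f s)"
 by (simp_all add: free_module_def)

lemma finite_support_add:
 "finite {s. f s \<noteq> \<zero>} ==> finite {s. g s \<noteq> \<zero>} ==> finite {s. f s \<oplus> g s \<noteq> \<zero>}"
 by (rule finite_subset[of _ "{s. f s \<noteq> \<zero>} \<union> {s. g s \<noteq> \<zero>}"]) auto

lemma free_add_closed:
 assumes "f \<in> carrier (free_module K S)" "g \<in> carrier (free_module K S)"
 shows "(\<lambda>s. f s \<oplus> g s) \<in> carrier (free_module K S)"
proof -
 have "{s. f s \<oplus> g s \<noteq> \<zero>} \<subseteq> {s. f s \<noteq> \<zero>} \<union> {s. g s \<noteq> \<zero>}" by auto
 then show ?thesis using assms finite_support_add[of f g] unfolding free_carrier by auto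
qed

lemma free_smult_closed:
 assumes "f \<in> carrier (free_module K S)" "a \<in> carrier K"
 shows "(\<lambda>s. a \<otimes> f s) \<in> carrier (free_module K S)"
proof -
 have "{s. a \<otimes> f s \<noteq> \<zero>} \<subseteq> {s. f s \<noteq> \<zero>}" using assms(2) by auto
 then show ?thesis using assms unfolding free_carrier by (auto dest: finite_subset)
qed

lemma free_module_module: "module K (free_module K S)"
proof (rule moduleI)
 let ?L = "free_module K S"
 have c: "f s \<in> carrier K" if "f \<in> carrier ?L" for f s using that by (simp add: free_carrier)
 have z: "(\<lambda>s. \<zero>) \<in> carrier ?L" by (simp add: free_carrier)
 show "cring K" by (rule is_cring)
 show "abelian_group ?L"
 proof (rule abelian_groupI)
  fix f assume f: "f \<in> carrier ?L"
  show "\<exists>g\<in>carrier ?L. g \<oplus>[?L] f = \<zero>[?L]"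
  proof
   show "(\<lambda>s. (\<ominus> \<one>) \<otimes> f s) \<in> carrier ?L" by (rule free_smult_closed[OF f]) simp
   show "(\<lambda>s. (\<ominus> \<one>) \<otimes> f s) \<oplus>[?L] f = \<zero>[?L]"
    using c[OF f] by (simp add: free_ops l_minus l_neg)
  qed
 qed (auto simp: free_ops free_add_closed z c a_ac fun_eq_iff)
 fix a f assume a: "a \<in> carrier K" and f: "f \<in> carrier (free_module K S)"
 show "a \<odot>[free_module K S] f \<in> carrier (free_module K S)"
  using free_smult_closed[OF f a] by (simp add: free_ops)
qed (auto simp: free_ops fun_eq_iff l_distr r_distr m_assoc free_carrier)

lemma free_gen_closed: "s \<in> S ==> free_gen K s \<in> carrier (free_module K S)"
 by (auto simp: free_carrier free_gen_def)

text \<open>Induction on a finite set containing the support: clearing the value at \<open>a\<close>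
  changes \<open>f\<close> by a multiple of the generator at \<open>a\<close>.\<close>

lemma free_induct:
 assumes N: "submodule N K (free_module K S)" and gen: "\<And>s. s \<in> S ==> free_gen K s \<in> N"
  and f: "f \<in> carrier (free_module K S)"
 shows "f \<in> N"
proof -
 let ?L = "free_module K S"
 note ND = submoduleD[OF free_module_module N]
 have "\<forall>f\<in>carrier ?L. {s. f s \<noteq> \<zero>} \<subseteq> A --> f \<in> N" if "finite A" for A
  using that
 proof (induction A)
  case empty
  show ?case
  proof (intro ballI impI)
   fix f assume "f \<in> carrier ?L" "{s. f s \<noteq> \<zero>} \<subseteq> {}"
   then have "f = \<zero>[?L]" by (auto simp: free_ops)
   then show "f \<in> N" using ND(2) by simp
  qed
 next
  case (insert a A)
  show ?case
  proof (intro ballI impI)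
   fix f assume f: "f \<in> carrier ?L" "{s. f s \<noteq> \<zero>} \<subseteq> insert a A"
   show "f \<in> N"
   proof (cases "a \<in> S")
    case False
    then have "{s. f s \<noteq> \<zero>} \<subseteq> A" using f by (auto simp: free_carrier)
    then show ?thesis using insert f by auto
   next
    case True
    let ?g = "f(a := \<zero>)"
    have sub: "{s. ?g s \<noteq> \<zero>} \<subseteq> {s. f s \<noteq> \<zero>}" by auto
    have g: "?g \<in> carrier ?L"
     using f(1) sub finite_subset[OF sub] unfolding free_carrier by auto
    have gA: "{s. ?g s \<noteq> \<zero>} \<subseteq> A" using f(2) by auto
    have fa: "f a \<in> carrier K" using f(1) by (simp add: free_carrier)
    have "f = ?g \<oplus>[?L] f a \<odot>[?L] free_gen K a"
     using f(1) by (auto simp: free_ops free_gen_def fun_eq_iff free_carrier)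
    then show ?thesis using ND(3)[OF _ ND(4)[OF fa gen[OF True]]] insert(3) g gA by metis
   qed
  qed
 qed
 then show ?thesis using f by (auto simp: free_carrier)
qed

lemma free_lift_eq:
 assumes "module K M" "f \<in> carrier (free_module K S)" "\<And>s. s \<in> S ==> g s \<in> carrier M"
  and "finite A" "{s. f s \<noteq> \<zero>} \<subseteq> A" "A \<subseteq> S"
 shows "free_lift K M g f = (\<Oplus>\<^bsub>M\<^esub>s\<in>A. f s \<odot>[M] g s)"
proof -
 interpret M: module K M by fact
 show ?thesis unfolding free_lift_def
  using assms by (intro M.add.finprod_mono_neutral_cong_left) (auto simp: free_carrier)
qed

lemma free_lift_linear:
 assumes M: "module K M" and g: "\<And>s. s \<in> S ==> g s \<in> carrier M"
 shows "linear_map K (free_module K S) M (free_lift K M g)"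
proof -
 interpret M: module K M by fact
 interpret L: module K "free_module K S" by (rule free_module_module)
 let ?s = "\<lambda>f. {s. f s \<noteq> \<zero>}"
 have c: "f s \<in> carrier K" if "f \<in> carrier (free_module K S)" for f s
  using that by (simp add: free_carrier)
 show ?thesis
 proof (rule linI)
  fix f assume f: "f \<in> carrier (free_module K S)"
  show "free_lift K M g f \<in> carrier M"
   unfolding free_lift_def using f g by (intro M.finsum_closed) (auto simp: free_carrier)
  fix a assume a: "a \<in> carrier K"
  have sub: "?s (\<lambda>s. a \<otimes> f s) \<subseteq> ?s f" using a by auto
  have "free_lift K M g (a \<odot>[free_module K S] f) = (\<Oplus>\<^bsub>M\<^esub>s\<in>?s f. (a \<otimes> f s) \<odot>[M] g s)"
   unfolding free_ops using sub f a g
   by (intro free_lift_eq[OF M free_smult_closed[OF f a] g]) (auto simp: free_carrier)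
  also have "\<dots> = (\<Oplus>\<^bsub>M\<^esub>s\<in>?s f. a \<odot>[M] (f s \<odot>[M] g s))"
   using f a g by (intro M.finsum_cong') (auto simp: free_carrier M.smult_assoc1)
  also have "\<dots> = a \<odot>[M] free_lift K M g f"
   unfolding free_lift_def using f a g
   by (intro M.finsum_smult_ldistr[symmetric]) (auto simp: free_carrier)
  finally show "free_lift K M g (a \<odot>[free_module K S] f) = a \<odot>[M] free_lift K M g f" .
 next
  fix f f' assume f: "f \<in> carrier (free_module K S)" "f' \<in> carrier (free_module K S)"
  let ?A = "?s f \<union> ?s f'"
  have A: "finite ?A" "?A \<subseteq> S" using f by (auto simp: free_carrier)
  have sub: "?s (\<lambda>s. f s \<oplus> f' s) \<subseteq> ?A" by auto
  have "free_lift K M g (f \<oplus>[free_module K S] f') = (\<Oplus>\<^bsub>M\<^esub>s\<in>?A. (f s \<oplus> f' s) \<odot>[M] g s)"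
   unfolding free_ops by (rule free_lift_eq[OF M free_add_closed[OF f] g A(1) sub A(2)])
  also have "\<dots> = (\<Oplus>\<^bsub>M\<^esub>s\<in>?A. f s \<odot>[M] g s \<oplus>[M] f' s \<odot>[M] g s)"
   using A g c[OF f(1)] c[OF f(2)] by (intro M.finsum_cong') (auto simp: M.smult_l_distr)
  also have "\<dots> = (\<Oplus>\<^bsub>M\<^esub>s\<in>?A. f s \<odot>[M] g s) \<oplus>[M] (\<Oplus>\<^bsub>M\<^esub>s\<in>?A. f' s \<odot>[M] g s)"
   using A g c[OF f(1)] c[OF f(2)] by (intro M.finsum_addf) auto
  also have "\<dots> = free_lift K M g f \<oplus>[M] free_lift K M g f'"
   using free_lift_eq[OF M f(1) g A(1) _ A(2)] free_lift_eq[OF M f(2) g A(1) _ A(2)] by simp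
  finally show "free_lift K M g (f \<oplus>[free_module K S] f') = free_lift K M g f \<oplus>[M] free_lift K M g f'" .
 qed
qed

lemma free_lift_gen:
 assumes M: "module K M" and g: "\<And>s. s \<in> S ==> g s \<in> carrier M" and s: "s \<in> S"
 shows "free_lift K M g (free_gen K s) = g s"
proof -
 interpret M: module K M by fact
 have "free_lift K M g (free_gen K s) = (\<Oplus>\<^bsub>M\<^esub>t\<in>{s}. free_gen K s t \<odot>[M] g t)"
  using s by (intro free_lift_eq[OF M free_gen_closed[OF s] g]) (auto simp: free_gen_def)
 then show ?thesis using g[OF s] by (simp add: free_gen_def)
qed

lemma bilinD:
 assumes "bilinear_map K U V W b"
 shows bilin_right: "u \<in> carrier U ==> linear_map K V W (b u)"
  and bilin_left: "v \<in> carrier V ==> linear_map K U W (\<lambda>u. b u v)"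
  and bilin_closed: "u \<in> carrier U ==> v \<in> carrier V ==> b u v \<in> carrier W"
 using assms unfolding bilinear_map_def linear_map_def by auto

lemma bilin_simps:
 assumes "bilinear_map K U V W b"
 shows "u \<in> carrier U ==> u' \<in> carrier U ==> v \<in> carrier V ==> b (u \<oplus>[U] u') v = b u v \<oplus>[W] b u' v"
  and "u \<in> carrier U ==> v \<in> carrier V ==> v' \<in> carrier V ==> b u (v \<oplus>[V] v') = b u v \<oplus>[W] b u v'"
  and "a \<in> carrier K ==> u \<in> carrier U ==> v \<in> carrier V ==> b (a \<odot>[U] u) v = a \<odot>[W] b u v"
  and "a \<in> carrier K ==> u \<in> carrier U ==> v \<in> carrier V ==> b u (a \<odot>[V] v) = a \<odot>[W] b u v"
 using assms unfolding bilinear_map_def linear_map_def by auto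

text \<open>The bilinearity relations before taking their span. With a name for them,
  \<open>tensor_relations\<close> can be used through its minimality.\<close>

definition tensor_gens :: "('k, 'v) module => ('k, 'w) module => ('v \<times> 'w => 'k) set" where
 "tensor_gens V W = (let L = free_module K (carrier V \<times> carrier W); g = (\<lambda>v w. free_gen K (v, w)) in
   {g (v \<oplus>[V] v') w \<ominus>[L] (g v w \<oplus>[L] g v' w) | v v' w. v \<in> carrier V \<and> v' \<in> carrier V \<and> w \<in> carrier W} \<union>
   {g v (w \<oplus>[W] w') \<ominus>[L] (g v w \<oplus>[L] g v w') | v w w'. v \<in> carrier V \<and> w \<in> carrier W \<and> w' \<in> carrier W} \<union>
   {g (a \<odot>[V] v) w \<ominus>[L] (a \<odot>[L] g v w) | a v w. a \<in> carrier K \<and> v \<in> carrier V \<and> w \<in> carrier W} \<union>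
   {g v (a \<odot>[W] w) \<ominus>[L] (a \<odot>[L] g v w) | a v w. a \<in> carrier K \<and> v \<in> carrier V \<and> w \<in> carrier W})"

lemma tensor_relations_submodule:
 assumes V: "module K V" and W: "module K W"
 shows "submodule (tensor_relations K V W) K (free_module K (carrier V \<times> carrier W))" (is ?sub)
  and tensor_relations_least: "submodule N K (free_module K (carrier V \<times> carrier W)) ==>
   tensor_gens V W \<subseteq> N ==> tensor_relations K V W \<subseteq> N"
  and tensor_gens_subset: "tensor_gens V W \<subseteq> tensor_relations K V W"
proof -
 let ?L = "free_module K (carrier V \<times> carrier W)"
 interpret V: module K V by fact
 interpret W: module K W by fact
 note L = free_module_module[of "carrier V \<times> carrier W"]
 have R: "tensor_relations K V W = module_span K ?L (tensor_gens V W)"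
  unfolding tensor_relations_def tensor_gens_def Let_def ..
 have gc: "free_gen K (v, w) \<in> carrier ?L" if "v \<in> carrier V" "w \<in> carrier W" for v w
  using that by (auto intro: free_gen_closed)
 have Xc: "tensor_gens V W \<subseteq> carrier ?L"
  unfolding tensor_gens_def Let_def
  by (intro Un_least subsetI; clarsimp)
   (intro module_minus[OF L] module_add[OF L] module_smult[OF L] gc; simp)+
 show ?sub "tensor_gens V W \<subseteq> tensor_relations K V W" unfolding R by (rule submodule_span[OF L Xc])+
 show "tensor_relations K V W \<subseteq> N" if "submodule N K ?L" "tensor_gens V W \<subseteq> N"
  unfolding R by (rule module_span_least[OF that])
qed

lemma tensor_module_module:
 "module K V ==> module K W ==> module K (tensor_module K V W)"
 unfolding tensor_module_def by (intro qm_module free_module_module tensor_relations_submodule)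

lemma tensor_elt_bilinear:
 assumes V: "module K V" and W: "module K W"
 shows "bilinear_map K V W (tensor_module K V W) (tensor_elt K V W)"
proof -
 let ?L = "free_module K (carrier V \<times> carrier W)"
 note L = free_module_module[of "carrier V \<times> carrier W"]
 note R = tensor_relations_submodule(1)[OF V W]
 have gc: "free_gen K (v, w) \<in> carrier ?L" if "v \<in> carrier V" "w \<in> carrier W" for v w
  using that by (auto intro: free_gen_closed)
 have mem: "x \<in> tensor_relations K V W" if "x \<in> tensor_gens V W" for x using tensor_gens_subset[OF V W] that by blast
 note ops = qm_carrierI qm_add[OF L R] qm_smult[OF L R] coset_eq_iff[OF L R] gc
  module_add[OF L] module_smult[OF L] module_add[OF V] module_add[OF W] module_smult[OF V] module_smult[OF W]
 show ?thesis
  unfolding bilinear_map_def tensor_module_def tensor_elt_def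
  by (intro conjI ballI linI; simp add: ops; intro mem; unfold tensor_gens_def Let_def; blast)
qed

text \<open>The linear extension of \<open>b\<close> to the free module vanishes on the generating
  relations, hence on their span. It is therefore constant on cosets, and the representative picked
  by \<open>tensor_lift\<close> is harmless.\<close>

lemma tensor_lift_coset:
 assumes V: "module K V" and W: "module K W" and M: "module K M" and b: "bilinear_map K V W M b"
  and t: "t \<in> carrier (free_module K (carrier V \<times> carrier W))"
 shows "tensor_lift K M b (tensor_relations K V W +>[free_module K (carrier V \<times> carrier W)] t)
  = free_lift K M (\<lambda>(v, w). b v w) t"
proof -
 let ?L = "free_module K (carrier V \<times> carrier W)"
 note L = free_module_module[of "carrier V \<times> carrier W"]
 note R = tensor_relations_submodule(1)[OF V W]
 interpret M: module K M by fact
 let ?f = "free_lift K M (\<lambda>(v, w). b v w)"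
 note bD = bilinD[OF b]
 have bc: "\<And>s. s \<in> carrier V \<times> carrier W ==> (\<lambda>(v, w). b v w) s \<in> carrier M" using bD(3) by auto
 have fl: "linear_map K ?L M ?f" by (rule free_lift_linear[OF M bc])
 have fg: "?f (free_gen K (v, w)) = b v w" if "v \<in> carrier V" "w \<in> carrier W" for v w
  using free_lift_gen[OF M bc, where s = "(v, w)"] that by simp
 have gc: "free_gen K (v, w) \<in> carrier ?L" if "v \<in> carrier V" "w \<in> carrier W" for v w
  using that by (auto intro: free_gen_closed)
 note ops = gc lin_minus[OF L M fl] linD[OF fl] fg bilin_simps[OF b] module_minus[OF L] minus_self[OF M]
  module_add[OF L] module_smult[OF L] module_add[OF V] module_add[OF W] module_smult[OF V] module_smult[OF W] bD(3)
 have "tensor_relations K V W \<subseteq> {v \<in> carrier ?L. ?f v = \<zero>[M]}"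
  by (rule tensor_relations_least[OF V W submodule_kernel[OF L M fl]])
   (unfold tensor_gens_def Let_def, auto simp: ops)
 then have k: "\<And>n. n \<in> tensor_relations K V W ==> ?f n = \<zero>[M]" by auto
 show ?thesis unfolding tensor_lift_def
  using someI[of "\<lambda>x. x \<in> tensor_relations K V W +>[?L] t", OF coset_self[OF L R t]]
  by (intro lin_coset[OF L R M fl k t])
qed

lemma tensor_lift_linear:
 assumes V: "module K V" and W: "module K W" and M: "module K M" and b: "bilinear_map K V W M b"
 shows "linear_map K (tensor_module K V W) M (tensor_lift K M b)"
proof -
 let ?L = "free_module K (carrier V \<times> carrier W)"
 note L = free_module_module[of "carrier V \<times> carrier W"]
 note R = tensor_relations_submodule(1)[OF V W]
 have bc: "\<And>s. s \<in> carrier V \<times> carrier W ==> (\<lambda>(v, w). b v w) s \<in> carrier M"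
  using bilinD(3)[OF b] by auto
 note fl = free_lift_linear[OF M bc]
 note ops = tensor_lift_coset[OF V W M b] linD[OF fl] qm_add[OF L R] qm_smult[OF L R]
   module_add[OF L] module_smult[OF L]
 show ?thesis unfolding tensor_module_def
  by (rule linI) (auto simp: qm_carrier ops)
qed

lemma tensor_lift_elt:
 assumes V: "module K V" and W: "module K W" and M: "module K M" and b: "bilinear_map K V W M b"
  and v: "v \<in> carrier V" "w \<in> carrier W"
 shows "tensor_lift K M b (tensor_elt K V W v w) = b v w"
proof -
 have bc: "\<And>s. s \<in> carrier V \<times> carrier W ==> (\<lambda>(v, w). b v w) s \<in> carrier M"
  using bilinD(3)[OF b] by auto
 show ?thesis
  using v tensor_lift_coset[OF V W M b free_gen_closed[where s = "(v, w)"]] free_lift_gen[OF M bc, where s = "(v, w)"]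
  by (simp add: tensor_elt_def)
qed

lemma tensor_induct:
 assumes V: "module K V" and W: "module K W" and N: "submodule N K (tensor_module K V W)"
  and gen: "\<And>v w. v \<in> carrier V ==> w \<in> carrier W ==> tensor_elt K V W v w \<in> N"
  and X: "X \<in> carrier (tensor_module K V W)"
 shows "X \<in> N"
proof -
 let ?L = "free_module K (carrier V \<times> carrier W)"
 let ?R = "tensor_relations K V W"
 note L = free_module_module[of "carrier V \<times> carrier W"]
 note R = tensor_relations_submodule(1)[OF V W]
 have T: "tensor_module K V W = quot_module ?L ?R" by (simp add: tensor_module_def)
 obtain t where t: "t \<in> carrier ?L" "X = ?R +>[?L] t" using X by (auto simp: T qm_carrier)
 have "t \<in> {v \<in> carrier ?L. ?R +>[?L] v \<in> N}"
 proof (rule free_induct[OF submodule_preimage[OF L qm_module[OF L R] qm_proj_linear[OF L R]]])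
  show "submodule N K (quot_module ?L ?R)" using N by (simp add: T)
  show "free_gen K s \<in> {v \<in> carrier ?L. ?R +>[?L] v \<in> N}" if "s \<in> carrier V \<times> carrier W" for s
   using that gen free_gen_closed[OF that] by (auto simp: tensor_elt_def)
 qed (rule t(1))
 then show ?thesis using t by simp
qed

text \<open>The equalizer of two linear maps is a submodule, so agreement on pure tensors suffices.
  Later identities in tensor categories are reduced to pure tensors in this way, one argument at a
  time.\<close>

lemma tensor_ext:
 assumes V: "module K V" and W: "module K W" and M: "module K M"
  and f: "linear_map K (tensor_module K V W) M f" and g: "linear_map K (tensor_module K V W) M g"
  and eq: "\<And>v w. v \<in> carrier V ==> w \<in> carrier W ==> f (tensor_elt K V W v w) = g (tensor_elt K V W v w)"
  and X: "X \<in> carrier (tensor_module K V W)"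
 shows "f X = g X"
proof -
 note T = tensor_module_module[OF V W]
 have "X \<in> {X \<in> carrier (tensor_module K V W). f X = g X}"
  using tensor_induct[OF V W submodule_equalizer[OF T M f g] _ X] eq
   bilinD(3)[OF tensor_elt_bilinear[OF V W]] by simp
 then show ?thesis by simp
qed

end

section \<open>Categories\<close>

subsection \<open>Cardinalities\<close>

lemma times_lepoll_infinite:
 assumes "infinite (UNIV :: 'u set)" "A \<lesssim> (UNIV :: 'u set)" "B \<lesssim> (UNIV :: 'u set)"
 shows "A \<times> B \<lesssim> (UNIV :: 'u set)"
proof -
 have "(UNIV :: 'u set) \<times> (UNIV :: 'u set) \<approx> (UNIV :: 'u set)"
  unfolding eqpoll_iff_card_of_ordIso by (rule card_of_Times_same_infinite[OF assms(1)])
 then show ?thesis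
  using times_lepoll_mono[OF assms(2,3)] lepoll_trans2 by blast
qed

lemma lists_lepoll_infinite:
 assumes "infinite (UNIV :: 'u set)"
 shows "(UNIV :: 'u list set) \<lesssim> (UNIV :: 'u set)"
proof -
 obtain e :: "'u \<times> 'u => 'u" where e: "inj e"
  using times_lepoll_infinite[OF assms lepoll_refl lepoll_refl] by (auto simp: lepoll_def)
 obtain i :: "nat => 'u" where i: "inj i"
  using assms infinite_le_lepoll[of "UNIV :: 'u set"] by (auto simp: lepoll_def)
 \<comment> \<open>Folding with the pairing \<open>e\<close> separates lists of equal length only;
   the length is recorded separately through \<open>i\<close>.\<close>
 define g where "g xs = foldr (\<lambda>x y. e (x, y)) xs (i 0)" for xs :: "'u list"
 have "length xs = length ys ==> g xs = g ys ==> xs = ys" for xs ys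
  by (induction xs ys rule: list_induct2) (auto simp: g_def dest: injD[OF e])
 then have "inj (\<lambda>xs. e (i (length xs), g xs))"
  by (intro injI) (metis e i injD prod.inject)
 then show ?thesis by (auto simp: lepoll_def)
qed

text \<open>Such a function is determined by its graph over the support, a finite subset of
  \<open>A \<times> B\<close>, hence by a list over a set no larger than \<open>'u\<close>. The
  default \<open>k\<close> may vary with the argument, as it does for direct sums.\<close>

lemma finite_support_lepoll:
 assumes "infinite (UNIV :: 'u set)" "A \<lesssim> (UNIV :: 'u set)" "B \<lesssim> (UNIV :: 'u set)"
 shows "{f. f ` A \<subseteq> B \<and> {x. f x \<noteq> k x} \<subseteq> A \<and> finite {x. f x \<noteq> k x}} \<lesssim> (UNIV :: 'u set)"
proof -
 have AB: "A \<times> B \<lesssim> (UNIV :: 'u set)" by (rule times_lepoll_infinite[OF assms])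
 have "Fpow (A \<times> B) = set ` lists (A \<times> B)"
  unfolding Fpow_def by (auto simp: image_iff) (metis finite_list in_listsI subsetD)
 then have "Fpow (A \<times> B) \<lesssim> lists (A \<times> B)" by (simp add: image_lepoll)
 also have "lists (A \<times> B) \<lesssim> lists (UNIV :: 'u set)" by (rule lists_lepoll_mono[OF AB])
 also have "lists (UNIV :: 'u set) \<lesssim> (UNIV :: 'u set)"
  using lists_lepoll_infinite[OF assms(1)] by (simp add: lists_UNIV)
 finally show ?thesis using lepoll_restricted_funspace lepoll_trans by blast
qed

subsection \<open>Opposite, tensor and quotient categories\<close>

context kfield
begin

abbreviation (input) thom where
 "thom A B a a' b b' \<equiv> tensor_module K (Hom A a a') (Hom B b b')"

abbreviation (input) telt where
 "telt A B a a' b b' \<equiv> tensor_elt K (Hom A a a') (Hom B b b')"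

lemma catD:
 assumes "k_category K C"
 shows hom_mod: "x \<in> Ob C ==> y \<in> Ob C ==> module K (Hom C x y)"
  and id_in: "x \<in> Ob C ==> Id C x \<in> Mor C x x"
  and comp_bilin: "x \<in> Ob C ==> y \<in> Ob C ==> z \<in> Ob C ==>
   bilinear_map K (Hom C y z) (Hom C x y) (Hom C x z) (Comp C x y z)"
  and comp_idl: "x \<in> Ob C ==> y \<in> Ob C ==> f \<in> Mor C x y ==> Comp C x y y (Id C y) f = f"
  and comp_idr: "x \<in> Ob C ==> y \<in> Ob C ==> f \<in> Mor C x y ==> Comp C x x y f (Id C x) = f"
  and comp_assoc: "w \<in> Ob C ==> x \<in> Ob C ==> y \<in> Ob C ==> z \<in> Ob C ==>
   f \<in> Mor C w x ==> g \<in> Mor C x y ==> h \<in> Mor C y z ==>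
   Comp C w x z (Comp C x y z h g) f = Comp C w y z h (Comp C w x y g f)"
 using assms unfolding k_category_def by auto

lemma comp_in:
 assumes "k_category K C" "x \<in> Ob C" "y \<in> Ob C" "z \<in> Ob C"
  "f \<in> Mor C x y" "g \<in> Mor C y z"
 shows "Comp C x y z g f \<in> Mor C x z"
 using bilin_closed[OF comp_bilin[OF assms(1-4)] assms(6,5)] .

lemma bilin_flip: "bilinear_map K V W M b ==> bilinear_map K W V M (\<lambda>w v. b v w)"
 unfolding bilinear_map_def by auto

lemma op_simps [simp]:
 "Ob (op_cat C) = Ob C" "Hom (op_cat C) x y = Hom C y x" "Id (op_cat C) = Id C"
 "Comp (op_cat C) x y z g f = Comp C z y x f g"
 by (simp_all add: op_cat_def)

lemma op_category:
 assumes "k_category K C"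
 shows "k_category K (op_cat C)"
proof -
 note C = catD[OF assms]
 have "Comp (op_cat C) x y z = (\<lambda>g f. Comp C z y x f g)" for x y z by (simp add: fun_eq_iff)
 then show ?thesis
  unfolding k_category_def using C bilin_flip[OF C(3)] by auto
qed

text \<open>The nested lift is the shape of \<open>Comp\<close> in \<open>tensor_cat\<close>. At a
  fixed \<open>Y\<close> the inner lift is bilinear in \<open>p\<close> and \<open>q\<close>, by
  comparison on pure tensors, so that the outer lift is well behaved; linearity in \<open>Y\<close>
  is again checked on pure tensors.\<close>

lemma tensor_lift2:
 assumes V': "module K V'" and W': "module K W'" and V: "module K V" and W: "module K W" and M: "module K M"
  and b1: "\<And>p q. p \<in> carrier V' ==> q \<in> carrier W' ==> bilinear_map K V W M (\<beta> p q)"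
  and b2: "\<And>f g. f \<in> carrier V ==> g \<in> carrier W ==> bilinear_map K V' W' M (\<lambda>p q. \<beta> p q f g)"
 defines "L \<equiv> \<lambda>X Y. tensor_lift K M (\<lambda>p q. tensor_lift K M (\<beta> p q) Y) X"
 shows "bilinear_map K (tensor_module K V' W') (tensor_module K V W) M L"
  and "\<And>p q f g. p \<in> carrier V' ==> q \<in> carrier W' ==> f \<in> carrier V ==> g \<in> carrier W ==>
   L (tensor_elt K V' W' p q) (tensor_elt K V W f g) = \<beta> p q f g"
proof -
 let ?T = "tensor_module K V W" and ?T' = "tensor_module K V' W'"
 note T = tensor_module_module[OF V W] and T' = tensor_module_module[OF V' W']
 note l1 = tensor_lift_linear[OF V W M b1] and e1 = tensor_lift_elt[OF V W M b1]
 have inner: "bilinear_map K V' W' M (\<lambda>p q. tensor_lift K M (\<beta> p q) Y)" if Y: "Y \<in> carrier ?T" for Y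
  unfolding bilinear_map_def
 proof (intro conjI ballI linI)
  fix p q assume pq: "p \<in> carrier V'" "q \<in> carrier W'"
  show "tensor_lift K M (\<beta> p q) Y \<in> carrier M" using lin_closed[OF l1[OF pq] Y] .
  then show "tensor_lift K M (\<beta> p q) Y \<in> carrier M" .
  fix a assume a: "a \<in> carrier K"
  show "tensor_lift K M (\<beta> p (a \<odot>[W'] q)) Y = a \<odot>[M] tensor_lift K M (\<beta> p q) Y"
   by (rule tensor_ext[OF V W M l1[OF pq(1) module_smult[OF W' a pq(2)]] lin_scale[OF M l1[OF pq] a] _ Y])
    (simp add: e1 pq a module_smult[OF W'] bilin_simps[OF b2])
  show "tensor_lift K M (\<beta> (a \<odot>[V'] p) q) Y = a \<odot>[M] tensor_lift K M (\<beta> p q) Y"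
   by (rule tensor_ext[OF V W M l1[OF module_smult[OF V' a pq(1)] pq(2)] lin_scale[OF M l1[OF pq] a] _ Y])
    (simp add: e1 pq a module_smult[OF V'] bilin_simps[OF b2])
 next
  fix p q q' assume pq: "p \<in> carrier V'" "q \<in> carrier W'" "q' \<in> carrier W'"
  show "tensor_lift K M (\<beta> p (q \<oplus>[W'] q')) Y = tensor_lift K M (\<beta> p q) Y \<oplus>[M] tensor_lift K M (\<beta> p q') Y"
   by (rule tensor_ext[OF V W M l1[OF pq(1) module_add[OF W' pq(2,3)]]
      lin_plus[OF M l1[OF pq(1,2)] l1[OF pq(1,3)]] _ Y])
    (simp add: e1 pq module_add[OF W'] bilin_simps[OF b2])
 next
  fix q p p' assume pq: "q \<in> carrier W'" "p \<in> carrier V'" "p' \<in> carrier V'"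
  show "tensor_lift K M (\<beta> (p \<oplus>[V'] p') q) Y = tensor_lift K M (\<beta> p q) Y \<oplus>[M] tensor_lift K M (\<beta> p' q) Y"
   by (rule tensor_ext[OF V W M l1[OF module_add[OF V' pq(2,3)] pq(1)]
      lin_plus[OF M l1[OF pq(2,1)] l1[OF pq(3,1)]] _ Y])
    (simp add: e1 pq module_add[OF V'] bilin_simps[OF b2])
 qed
 note l2 = tensor_lift_linear[OF V' W' M inner] and e2 = tensor_lift_elt[OF V' W' M inner]
 show "L (tensor_elt K V' W' p q) (tensor_elt K V W f g) = \<beta> p q f g"
  if "p \<in> carrier V'" "q \<in> carrier W'" "f \<in> carrier V" "g \<in> carrier W" for p q f g
  using that e2 bilin_closed[OF tensor_elt_bilinear[OF V W]] e1 by (simp add: L_def)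
 show "bilinear_map K ?T' ?T M L"
  unfolding bilinear_map_def
 proof (intro conjI ballI)
  show lX: "linear_map K ?T' M (\<lambda>X. L X Y)" if "Y \<in> carrier ?T" for Y
   unfolding L_def by (rule l2[OF that])
  fix X assume X: "X \<in> carrier ?T'"
  show "linear_map K ?T M (L X)"
  proof (rule linI)
   fix Y assume Y: "Y \<in> carrier ?T"
   show "L X Y \<in> carrier M" by (rule lin_closed[OF lX[OF Y] X])
   fix a assume a: "a \<in> carrier K"
   show "L X (a \<odot>[?T] Y) = a \<odot>[M] L X Y"
    by (rule tensor_ext[OF V' W' M lX[OF module_smult[OF T a Y]] lin_scale[OF M lX[OF Y] a] _ X])
     (simp add: L_def e2 a Y module_smult[OF T] lin_smult[OF l1])
  next
   fix Y Y' assume Y: "Y \<in> carrier ?T" "Y' \<in> carrier ?T"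
   show "L X (Y \<oplus>[?T] Y') = L X Y \<oplus>[M] L X Y'"
    by (rule tensor_ext[OF V' W' M lX[OF module_add[OF T Y]] lin_plus[OF M lX[OF Y(1)] lX[OF Y(2)]] _ X])
     (simp add: L_def e2 Y module_add[OF T] lin_add[OF l1])
  qed
 qed
qed

lemma tensor_cat_simps [simp]:
 "Ob (tensor_cat K C D) = Ob C \<times> Ob D"
 "Hom (tensor_cat K C D) (c, d) (c', d') = thom C D c c' d d'"
 "Id (tensor_cat K C D) (c, d) = telt C D c c d d (Id C c) (Id D d)"
 by (simp_all add: tensor_cat_def)

lemma bilin_comp:
 assumes "bilinear_map K V' W' M b" "linear_map K V V' f" "linear_map K W W' g"
 shows "bilinear_map K V W M (\<lambda>v w. b (f v) (g w))"
 unfolding bilinear_map_def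
proof (intro conjI ballI)
 fix v assume "v \<in> carrier V"
 then show "linear_map K W M (\<lambda>w. b (f v) (g w))"
  by (rule lin_comp[OF assms(3) bilin_right[OF assms(1) lin_closed[OF assms(2)]]])
next
 fix w assume "w \<in> carrier W"
 then show "linear_map K V M (\<lambda>v. b (f v) (g w))"
  by (rule lin_comp[OF assms(2) bilin_left[OF assms(1) lin_closed[OF assms(3)]]])
qed

lemma tensor_comp:
 assumes C: "k_category K C" and D: "k_category K D"
  and o: "c \<in> Ob C" "c' \<in> Ob C" "c'' \<in> Ob C" "d \<in> Ob D" "d' \<in> Ob D" "d'' \<in> Ob D"
 shows tensor_comp_bilin: "bilinear_map K (Hom (tensor_cat K C D) (c', d') (c'', d'')) (Hom (tensor_cat K C D) (c, d) (c', d'))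
   (Hom (tensor_cat K C D) (c, d) (c'', d'')) (Comp (tensor_cat K C D) (c, d) (c', d') (c'', d''))"
  and tensor_comp_elt: "\<And>f g f' g'. f \<in> Mor C c c' ==> f' \<in> Mor C c' c'' ==>
   g \<in> Mor D d d' ==> g' \<in> Mor D d' d'' ==>
   Comp (tensor_cat K C D) (c, d) (c', d') (c'', d'')
    (telt C D c' c'' d' d'' f' g') (telt C D c c' d d' f g) =
   telt C D c c'' d d'' (Comp C c c' c'' f' f) (Comp D d d' d'' g' g)"
proof -
 let ?\<beta> = "\<lambda>f' g' f g. telt C D c c'' d d'' (Comp C c c' c'' f' f) (Comp D d d' d'' g' g)"
 have eq: "Comp (tensor_cat K C D) (c, d) (c', d') (c'', d'') = (\<lambda>X Y.
   tensor_lift K (thom C D c c'' d d'') (\<lambda>f' g'.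
    tensor_lift K (thom C D c c'' d d'') (?\<beta> f' g') Y) X)"
  by (simp add: tensor_cat_def Let_def)
 note C1 = hom_mod[OF C] and D1 = hom_mod[OF D]
 note te = tensor_elt_bilinear[OF C1[OF o(1,3)] D1[OF o(4,6)]]
 note cb = comp_bilin[OF C o(1-3)] and db = comp_bilin[OF D o(4-6)]
 note T = tensor_lift2[where V = "Hom C c c'" and W = "Hom D d d'" and V' = "Hom C c' c''" and W' = "Hom D d' d''"
   and M = "thom C D c c'' d d''" and \<beta> = ?\<beta>,
   OF C1[OF o(2,3)] D1[OF o(5,6)] C1[OF o(1,2)] D1[OF o(4,5)] tensor_module_module[OF C1[OF o(1,3)] D1[OF o(4,6)]]
    bilin_comp[OF te bilin_right[OF cb] bilin_right[OF db]]
    bilin_comp[OF te bilin_left[OF cb] bilin_left[OF db]], simplified]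
 show "bilinear_map K (Hom (tensor_cat K C D) (c', d') (c'', d'')) (Hom (tensor_cat K C D) (c, d) (c', d'))
   (Hom (tensor_cat K C D) (c, d) (c'', d'')) (Comp (tensor_cat K C D) (c, d) (c', d') (c'', d''))"
  unfolding eq using T(1) by simp
 show "Comp (tensor_cat K C D) (c, d) (c', d') (c'', d'')
    (telt C D c' c'' d' d'' f' g') (telt C D c c' d d' f g) = ?\<beta> f' g' f g"
  if "f \<in> Mor C c c'" "f' \<in> Mor C c' c''" "g \<in> Mor D d d'" "g' \<in> Mor D d' d''"
  for f g f' g'
  unfolding eq using T(2)[OF that(2,4,1,3)] by simp
qed

lemma tensor_elt_in:
 "k_category K C ==> k_category K D ==> c \<in> Ob C ==> c' \<in> Ob C ==> d \<in> Ob D ==> d' \<in> Ob D ==>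
  f \<in> Mor C c c' ==> g \<in> Mor D d d' ==>
  telt C D c c' d d' f g \<in> Mor (tensor_cat K C D) (c, d) (c', d')"
 using bilin_closed[OF tensor_elt_bilinear[OF hom_mod hom_mod]] by simp

lemma tensor_category:
 assumes C: "k_category K C" and D: "k_category K D"
 shows "k_category K (tensor_cat K C D)"
proof -
 let ?T = "tensor_cat K C D"
 note Cm = hom_mod[OF C] and Dm = hom_mod[OF D]
 note bl = tensor_comp_bilin[OF C D] and ce = tensor_comp_elt[OF C D]
 note Tm = tensor_module_module[OF Cm Dm]
 have ein: "telt C D c c' d d' f g \<in> carrier (thom C D c c' d d')"
  if "c \<in> Ob C" "c' \<in> Ob C" "d \<in> Ob D" "d' \<in> Ob D" "f \<in> Mor C c c'" "g \<in> Mor D d d'" for c c' d d' f g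
  using tensor_elt_in[OF C D that] by simp
 note cin = comp_in[OF C] and din = comp_in[OF D]
 have unit: "Comp ?T (c, d) (c', d') (c', d') (Id ?T (c', d')) X = X \<and> Comp ?T (c, d) (c, d) (c', d') X (Id ?T (c, d)) = X"
  if o: "c \<in> Ob C" "c' \<in> Ob C" "d \<in> Ob D" "d' \<in> Ob D"
   and X: "X \<in> carrier (thom C D c c' d d')" for c c' d d' X
 proof
  have i: "Id ?T (c', d') \<in> Mor ?T (c', d') (c', d')" "Id ?T (c, d) \<in> Mor ?T (c, d) (c, d)"
   using ein o id_in[OF C] id_in[OF D] by simp_all
  let ?M = "thom C D c c' d d'"
  have l: "linear_map K ?M ?M (\<lambda>X. Comp ?T (c, d) (c', d') (c', d') (Id ?T (c', d')) X)"
   "linear_map K ?M ?M (\<lambda>X. Comp ?T (c, d) (c, d) (c', d') X (Id ?T (c, d)))"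
   using bilin_right[OF bl[OF o(1,2,2,3,4,4)] i(1)] bilin_left[OF bl[OF o(1,1,2,3,3,4)] i(2)] by simp_all
  note te = tensor_ext[OF Cm[OF o(1,2)] Dm[OF o(3,4)] Tm[OF o] _ lin_id _ X]
  show "Comp ?T (c, d) (c', d') (c', d') (Id ?T (c', d')) X = X"
   by (rule te[OF l(1)]) (simp add: o ce id_in[OF C] id_in[OF D] comp_idl[OF C] comp_idl[OF D])
  show "Comp ?T (c, d) (c, d) (c', d') X (Id ?T (c, d)) = X"
   by (rule te[OF l(2)]) (simp add: o ce id_in[OF C] id_in[OF D] comp_idr[OF C] comp_idr[OF D])
 qed
 have assoc: "Comp ?T (a, a') (b, b') (d, d') (Comp ?T (b, b') (c, c') (d, d') H G) F =
   Comp ?T (a, a') (c, c') (d, d') H (Comp ?T (a, a') (b, b') (c, c') G F)"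
  if o: "a \<in> Ob C" "b \<in> Ob C" "c \<in> Ob C" "d \<in> Ob C" "a' \<in> Ob D" "b' \<in> Ob D" "c' \<in> Ob D" "d' \<in> Ob D"
   and F: "F \<in> carrier (thom C D a b a' b')"
   and G: "G \<in> carrier (thom C D b c b' c')"
   and H: "H \<in> carrier (thom C D c d c' d')"
  for a b c d a' b' c' d' F G H
 proof -
  have bil: "bilinear_map K (thom C D y z y' z') (thom C D x y x' y')
    (thom C D x z x' z') (Comp ?T (x, x') (y, y') (z, z'))"
   if "x \<in> Ob C" "y \<in> Ob C" "z \<in> Ob C" "x' \<in> Ob D" "y' \<in> Ob D" "z' \<in> Ob D" for x y z x' y' z'
   using bl[OF that] by simp
  note bc = bilin_closed[OF bil]
  note M = Tm[OF o(1,4,5,8)]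
  show ?thesis
  \<comment> \<open>Both sides are linear in each of \<open>F\<close>, \<open>G\<close>,
    \<open>H\<close>; replacing them by pure tensors in this order leaves the associativity of
    \<open>C\<close> and of \<open>D\<close>.\<close>
  proof (rule tensor_ext[OF Cm[OF o(1,2)] Dm[OF o(5,6)] M _ _ _ F])
   show "linear_map K (thom C D a b a' b') (thom C D a d a' d')
     (Comp ?T (a, a') (b, b') (d, d') (Comp ?T (b, b') (c, c') (d, d') H G))"
    using o H G by (intro bilin_right[OF bil] bc) auto
   show "linear_map K (thom C D a b a' b') (thom C D a d a' d')
     (\<lambda>F. Comp ?T (a, a') (c, c') (d, d') H (Comp ?T (a, a') (b, b') (c, c') G F))"
    by (rule lin_comp[OF bilin_right[OF bil] bilin_right[OF bil]]) (use o H G in auto)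
   fix f f' assume f: "f \<in> Mor C a b" "f' \<in> Mor D a' b'"
   let ?f = "telt C D a b a' b' f f'"
   have fi: "?f \<in> carrier (thom C D a b a' b')" using ein o f by auto
   show "Comp ?T (a, a') (b, b') (d, d') (Comp ?T (b, b') (c, c') (d, d') H G) ?f =
    Comp ?T (a, a') (c, c') (d, d') H (Comp ?T (a, a') (b, b') (c, c') G ?f)"
   proof (rule tensor_ext[OF Cm[OF o(2,3)] Dm[OF o(6,7)] M _ _ _ G])
    show "linear_map K (thom C D b c b' c') (thom C D a d a' d')
     (\<lambda>G. Comp ?T (a, a') (b, b') (d, d') (Comp ?T (b, b') (c, c') (d, d') H G) ?f)"
     by (rule lin_comp[OF bilin_right[OF bil] bilin_left[OF bil]]) (use o H fi in auto)
    show "linear_map K (thom C D b c b' c') (thom C D a d a' d')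
     (\<lambda>G. Comp ?T (a, a') (c, c') (d, d') H (Comp ?T (a, a') (b, b') (c, c') G ?f))"
     by (rule lin_comp[OF bilin_left[OF bil] bilin_right[OF bil]]) (use o H fi in auto)
    fix g g' assume g: "g \<in> Mor C b c" "g' \<in> Mor D b' c'"
    let ?g = "telt C D b c b' c' g g'"
    have gi: "?g \<in> carrier (thom C D b c b' c')" using ein o g by auto
    show "Comp ?T (a, a') (b, b') (d, d') (Comp ?T (b, b') (c, c') (d, d') H ?g) ?f =
     Comp ?T (a, a') (c, c') (d, d') H (Comp ?T (a, a') (b, b') (c, c') ?g ?f)"
    proof (rule tensor_ext[OF Cm[OF o(3,4)] Dm[OF o(7,8)] M _ _ _ H])
     show "linear_map K (thom C D c d c' d') (thom C D a d a' d')
      (\<lambda>H. Comp ?T (a, a') (b, b') (d, d') (Comp ?T (b, b') (c, c') (d, d') H ?g) ?f)"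
      by (rule lin_comp[OF bilin_left[OF bil] bilin_left[OF bil]]) (use o gi fi in auto)
     show "linear_map K (thom C D c d c' d') (thom C D a d a' d')
      (\<lambda>H. Comp ?T (a, a') (c, c') (d, d') H (Comp ?T (a, a') (b, b') (c, c') ?g ?f))"
      by (rule bilin_left[OF bil bc]) (use o gi fi in auto)
     fix h h' assume h: "h \<in> Mor C c d" "h' \<in> Mor D c' d'"
     show "Comp ?T (a, a') (b, b') (d, d') (Comp ?T (b, b') (c, c') (d, d') (telt C D c d c' d' h h') ?g) ?f =
      Comp ?T (a, a') (c, c') (d, d') (telt C D c d c' d' h h') (Comp ?T (a, a') (b, b') (c, c') ?g ?f)"
      using o f g h by (simp add: ce cin din comp_assoc[OF C] comp_assoc[OF D])
    qed
   qed
  qed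
 qed
 show ?thesis unfolding k_category_def
  using Tm bl unit assoc ein id_in[OF C] id_in[OF D] by (auto simp: tensor_cat_simps(3))
qed

section \<open>Two-sided ideals and quotient categories\<close>

lemma idealD:
 assumes "two_sided_ideal K C I"
 shows ideal_sub: "x \<in> Ob C ==> y \<in> Ob C ==> submodule (I x y) K (Hom C x y)"
  and ideal_left: "x \<in> Ob C ==> y \<in> Ob C ==> z \<in> Ob C ==> f \<in> I x y ==> g \<in> Mor C y z ==>
   Comp C x y z g f \<in> I x z"
  and ideal_right: "x \<in> Ob C ==> y \<in> Ob C ==> z \<in> Ob C ==> f \<in> Mor C x y ==> g \<in> I y z ==>
   Comp C x y z g f \<in> I x z"
 using assms unfolding two_sided_ideal_def by auto

lemma ideal_carrier:
 assumes "k_category K C" "two_sided_ideal K C I" "x \<in> Ob C" "y \<in> Ob C" "f \<in> I x y"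
 shows "f \<in> Mor C x y"
 using sub_carrier[OF hom_mod[OF assms(1,3,4)] ideal_sub[OF assms(2-4)] assms(5)] .

lemma op_two_sided_ideal:
 assumes "two_sided_ideal K C I"
 shows "two_sided_ideal K (op_cat C) (op_ideal I)"
 using assms unfolding two_sided_ideal_def op_ideal_def by auto

lemma quot_simps [simp]:
 "Ob (quot_cat C I) = Ob C"
 "Hom (quot_cat C I) x y = quot_module (Hom C x y) (I x y)"
 "Id (quot_cat C I) x = I x x +>[Hom C x x] Id C x"
 by (simp_all add: quot_cat_def)

text \<open>The union over all representatives collapses: changing first the right factor and then
  the left one alters the composite by elements of the ideal only.\<close>

lemma quot_comp:
 assumes C: "k_category K C" and I: "two_sided_ideal K C I"
  and o: "x \<in> Ob C" "y \<in> Ob C" "z \<in> Ob C" and f: "f \<in> Mor C x y" and g: "g \<in> Mor C y z"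
 shows "Comp (quot_cat C I) x y z (I y z +>[Hom C y z] g) (I x y +>[Hom C x y] f) =
  I x z +>[Hom C x z] Comp C x y z g f"
proof -
 note xy = hom_mod[OF C o(1,2)] ideal_sub[OF I o(1,2)]
 note yz = hom_mod[OF C o(2,3)] ideal_sub[OF I o(2,3)]
 note xz = hom_mod[OF C o(1,3)] ideal_sub[OF I o(1,3)]
 note b = comp_bilin[OF C o]
 interpret H: module K "Hom C x z" by (rule xz(1))
 have "I x z +>[Hom C x z] Comp C x y z g' f' = I x z +>[Hom C x z] Comp C x y z g f"
  if g': "g' \<in> I y z +>[Hom C y z] g" and f': "f' \<in> I x y +>[Hom C x y] f" for g' f'
 proof -
  have gc: "g' \<in> Mor C y z" "g' \<ominus>[Hom C y z] g \<in> I y z" using g' coset_mem_iff[OF yz g] by auto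
  have fc: "f' \<in> Mor C x y" "f' \<ominus>[Hom C x y] f \<in> I x y" using f' coset_mem_iff[OF xy f] by auto
  have "Comp C x y z g' f' \<ominus>[Hom C x z] Comp C x y z g' f = Comp C x y z g' (f' \<ominus>[Hom C x y] f)"
   using lin_minus[OF xy(1) xz(1) bilin_right[OF b gc(1)] fc(1) f] by simp
  then have 1: "I x z +>[Hom C x z] Comp C x y z g' f' = I x z +>[Hom C x z] Comp C x y z g' f"
   using coset_eq_iff[OF xz] bilin_closed[OF b gc(1)] fc f ideal_left[OF I o] gc by simp
  have "Comp C x y z g' f \<ominus>[Hom C x z] Comp C x y z g f = Comp C x y z (g' \<ominus>[Hom C y z] g) f"
   using lin_minus[OF yz(1) xz(1) bilin_left[OF b f] gc(1) g] by simp
  then have 2: "I x z +>[Hom C x z] Comp C x y z g' f = I x z +>[Hom C x z] Comp C x y z g f"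
   using coset_eq_iff[OF xz] bilin_closed[OF b _ f] gc g f ideal_right[OF I o] by simp
  show ?thesis using 1 2 by simp
 qed
 then have "Comp (quot_cat C I) x y z (I y z +>[Hom C y z] g) (I x y +>[Hom C x y] f) =
  (\<Union>g'\<in>I y z +>[Hom C y z] g. \<Union>f'\<in>I x y +>[Hom C x y] f. I x z +>[Hom C x z] Comp C x y z g f)"
  by (simp add: quot_cat_def)
 then show ?thesis using coset_self[OF yz g] coset_self[OF xy f] by auto
qed

lemma quot_category:
 assumes C: "k_category K C" and I: "two_sided_ideal K C I"
 shows "k_category K (quot_cat C I)"
proof -
 let ?Q = "quot_cat C I"
 note q = quot_comp[OF C I]
 have ex: "\<exists>f\<in>Mor C x y. X = I x y +>[Hom C x y] f"
  if "X \<in> carrier (quot_module (Hom C x y) (I x y))" for x y X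
  using that by (auto simp: qm_carrier)
 note ops = q qm_carrierI comp_in[OF C] qm_add[OF hom_mod[OF C] ideal_sub[OF I]] qm_smult[OF hom_mod[OF C] ideal_sub[OF I]]
  module_add[OF hom_mod[OF C]] module_smult[OF hom_mod[OF C]] bilin_simps[OF comp_bilin[OF C]] id_in[OF C]
  comp_idl[OF C] comp_idr[OF C] comp_assoc[OF C]
 show ?thesis
  unfolding k_category_def quot_simps
 proof (intro conjI ballI)
  show "module K (quot_module (Hom C x y) (I x y))" if "x \<in> Ob C" "y \<in> Ob C" for x y
   by (rule qm_module[OF hom_mod[OF C that] ideal_sub[OF I that]])
  show "bilinear_map K (quot_module (Hom C y z) (I y z)) (quot_module (Hom C x y) (I x y))
    (quot_module (Hom C x z) (I x z)) (Comp ?Q x y z)" if "x \<in> Ob C" "y \<in> Ob C" "z \<in> Ob C" for x y z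
   unfolding bilinear_map_def
   by (intro conjI ballI linI) (use that in \<open>auto dest!: ex simp: ops\<close>)
 qed (auto dest!: ex simp: ops)
qed

subsection \<open>Functors\<close>

lemma functorD:
 assumes "k_functor K C D F"
 shows fun_ob: "x \<in> Ob C ==> fobj F x \<in> Ob D"
  and fun_lin: "x \<in> Ob C ==> y \<in> Ob C ==> linear_map K (Hom C x y) (Hom D (fobj F x) (fobj F y)) (fmor F x y)"
  and fun_id: "x \<in> Ob C ==> fmor F x x (Id C x) = Id D (fobj F x)"
  and fun_comp: "x \<in> Ob C ==> y \<in> Ob C ==> z \<in> Ob C ==> f \<in> Mor C x y ==> g \<in> Mor C y z ==>
   fmor F x z (Comp C x y z g f) = Comp D (fobj F x) (fobj F y) (fobj F z) (fmor F y z g) (fmor F x y f)"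
 using assms unfolding k_functor_def by auto

lemma quot_proj_simps [simp]:
 "fobj (quot_proj C I) x = x" "fmor (quot_proj C I) x y f = I x y +>[Hom C x y] f"
 by (simp_all add: quot_proj_def)

lemma quot_proj_functor:
 assumes C: "k_category K C" and I: "two_sided_ideal K C I"
 shows "k_functor K C (quot_cat C I) (quot_proj C I)"
proof -
 have *: "fmor (quot_proj C I) x y = (\<lambda>f. I x y +>[Hom C x y] f)" for x y by (simp add: fun_eq_iff)
 show ?thesis
  unfolding k_functor_def *
  using qm_proj_linear[OF hom_mod[OF C] ideal_sub[OF I]] by (auto simp: quot_comp[OF C I])
qed

lemma quot_proj_full: "full_functor C (quot_cat C I) (quot_proj C I)"
 unfolding full_functor_def by (auto simp: qm_carrier)

lemma tensor_fun_simps [simp]: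
 "fobj (tensor_fun K C' D' F G) (c, d) = (fobj F c, fobj G d)"
 "fmor (tensor_fun K C' D' F G) (c, d) (c', d') =
   tensor_lift K (thom C' D' (fobj F c) (fobj F c') (fobj G d) (fobj G d'))
    (\<lambda>f g. telt C' D' (fobj F c) (fobj F c') (fobj G d) (fobj G d') (fmor F c c' f) (fmor G d d' g))"
 by (simp_all add: tensor_fun_def Let_def)

lemma tensor_map:
 assumes V: "module K V" and W: "module K W" and V': "module K V'" and W': "module K W'"
  and f: "linear_map K V V' f" and g: "linear_map K W W' g"
 defines "t \<equiv> tensor_lift K (tensor_module K V' W') (\<lambda>v w. tensor_elt K V' W' (f v) (g w))"
 shows tensor_map_linear: "linear_map K (tensor_module K V W) (tensor_module K V' W') t"
  and tensor_map_elt: "\<And>v w. v \<in> carrier V ==> w \<in> carrier W ==>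
   t (tensor_elt K V W v w) = tensor_elt K V' W' (f v) (g w)"
proof -
 note b = bilin_comp[OF tensor_elt_bilinear[OF V' W'] f g]
 note T = tensor_module_module[OF V' W']
 show "linear_map K (tensor_module K V W) (tensor_module K V' W') t"
  unfolding t_def by (rule tensor_lift_linear[OF V W T b])
 show "t (tensor_elt K V W v w) = tensor_elt K V' W' (f v) (g w)" if "v \<in> carrier V" "w \<in> carrier W" for v w
  unfolding t_def by (rule tensor_lift_elt[OF V W T b that])
qed

lemma tensor_functor:
 assumes C: "k_category K C" and D: "k_category K D" and C': "k_category K C'" and D': "k_category K D'"
  and F: "k_functor K C C' F" and G: "k_functor K D D' G"
 shows "k_functor K (tensor_cat K C D) (tensor_cat K C' D') (tensor_fun K C' D' F G)"
proof -
 let ?T = "tensor_cat K C D" and ?T' = "tensor_cat K C' D'" and ?F = "tensor_fun K C' D' F G"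
 note o = fun_ob[OF F] fun_ob[OF G]
 have lin: "linear_map K (Hom ?T (c, d) (c', d')) (Hom ?T' (fobj F c, fobj G d) (fobj F c', fobj G d')) (fmor ?F (c, d) (c', d'))"
  and elt: "\<And>f g. f \<in> Mor C c c' ==> g \<in> Mor D d d' ==>
   fmor ?F (c, d) (c', d') (telt C D c c' d d' f g) =
   telt C' D' (fobj F c) (fobj F c') (fobj G d) (fobj G d') (fmor F c c' f) (fmor G d d' g)"
  if "c \<in> Ob C" "c' \<in> Ob C" "d \<in> Ob D" "d' \<in> Ob D" for c c' d d'
  unfolding tensor_fun_simps tensor_cat_simps
  by (rule tensor_map_linear[OF hom_mod[OF C that(1,2)] hom_mod[OF D that(3,4)]
     hom_mod[OF C' o(1)[OF that(1)] o(1)[OF that(2)]] hom_mod[OF D' o(2)[OF that(3)] o(2)[OF that(4)]]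
     fun_lin[OF F that(1,2)] fun_lin[OF G that(3,4)]],
    rule tensor_map_elt[OF hom_mod[OF C that(1,2)] hom_mod[OF D that(3,4)]
     hom_mod[OF C' o(1)[OF that(1)] o(1)[OF that(2)]] hom_mod[OF D' o(2)[OF that(3)] o(2)[OF that(4)]]
     fun_lin[OF F that(1,2)] fun_lin[OF G that(3,4)]])
 have comp: "fmor ?F (a, a') (c, c') (Comp ?T (a, a') (b, b') (c, c') X Y) =
   Comp ?T' (fobj F a, fobj G a') (fobj F b, fobj G b') (fobj F c, fobj G c')
    (fmor ?F (b, b') (c, c') X) (fmor ?F (a, a') (b, b') Y)"
  if p: "a \<in> Ob C" "b \<in> Ob C" "c \<in> Ob C" "a' \<in> Ob D" "b' \<in> Ob D" "c' \<in> Ob D"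
   and X: "X \<in> Mor ?T (b, b') (c, c')" and Y: "Y \<in> Mor ?T (a, a') (b, b')"
  for a b c a' b' c' X Y
 proof -
  note bl = tensor_comp_bilin[OF C D p]
  note bl' = tensor_comp_bilin[OF C' D' o(1)[OF p(1)] o(1)[OF p(2)] o(1)[OF p(3)] o(2)[OF p(4)] o(2)[OF p(5)] o(2)[OF p(6)]]
  note l3 = lin[OF p(1,3,4,6)] and l2 = lin[OF p(2,3,5,6)] and l1 = lin[OF p(1,2,4,5)]
  have m: "module K (Hom ?T' (fobj F a, fobj G a') (fobj F c, fobj G c'))"
   using p o by (intro hom_mod[OF tensor_category[OF C' D']]) auto
  have "X \<in> carrier (thom C D b c b' c')" using X by simp
  then show ?thesis
  proof (rule tensor_ext[OF hom_mod[OF C p(2,3)] hom_mod[OF D p(5,6)] m, rotated 3])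
   show "linear_map K (thom C D b c b' c') (Hom ?T' (fobj F a, fobj G a') (fobj F c, fobj G c'))
     (\<lambda>X. fmor ?F (a, a') (c, c') (Comp ?T (a, a') (b, b') (c, c') X Y))"
    using lin_comp[OF bilin_left[OF bl Y] l3] by simp
   show "linear_map K (thom C D b c b' c') (Hom ?T' (fobj F a, fobj G a') (fobj F c, fobj G c'))
     (\<lambda>X. Comp ?T' (fobj F a, fobj G a') (fobj F b, fobj G b') (fobj F c, fobj G c')
      (fmor ?F (b, b') (c, c') X) (fmor ?F (a, a') (b, b') Y))"
    using lin_comp[OF l2 bilin_left[OF bl' lin_closed[OF l1 Y]]] by simp
   fix g g' assume g: "g \<in> Mor C b c" "g' \<in> Mor D b' c'"
   let ?g = "telt C D b c b' c' g g'"
   have gi: "?g \<in> Mor ?T (b, b') (c, c')" using tensor_elt_in[OF C D p(2,3,5,6) g] .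
   have "Y \<in> carrier (thom C D a b a' b')" using Y by simp
   then show "fmor ?F (a, a') (c, c') (Comp ?T (a, a') (b, b') (c, c') ?g Y) =
    Comp ?T' (fobj F a, fobj G a') (fobj F b, fobj G b') (fobj F c, fobj G c')
     (fmor ?F (b, b') (c, c') ?g) (fmor ?F (a, a') (b, b') Y)"
   proof (rule tensor_ext[OF hom_mod[OF C p(1,2)] hom_mod[OF D p(4,5)] m, rotated 3])
    show "linear_map K (thom C D a b a' b') (Hom ?T' (fobj F a, fobj G a') (fobj F c, fobj G c'))
      (\<lambda>Y. fmor ?F (a, a') (c, c') (Comp ?T (a, a') (b, b') (c, c') ?g Y))"
     using lin_comp[OF bilin_right[OF bl gi] l3] by simp
    show "linear_map K (thom C D a b a' b') (Hom ?T' (fobj F a, fobj G a') (fobj F c, fobj G c'))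
      (\<lambda>Y. Comp ?T' (fobj F a, fobj G a') (fobj F b, fobj G b') (fobj F c, fobj G c')
       (fmor ?F (b, b') (c, c') ?g) (fmor ?F (a, a') (b, b') Y))"
     using lin_comp[OF l1 bilin_right[OF bl' lin_closed[OF l2 gi]]] by simp
    fix f f' assume f: "f \<in> Mor C a b" "f' \<in> Mor D a' b'"
    show "fmor ?F (a, a') (c, c') (Comp ?T (a, a') (b, b') (c, c') ?g (telt C D a b a' b' f f')) =
     Comp ?T' (fobj F a, fobj G a') (fobj F b, fobj G b') (fobj F c, fobj G c')
      (fmor ?F (b, b') (c, c') ?g) (fmor ?F (a, a') (b, b') (telt C D a b a' b' f f'))"
     using p f g
     by (simp add: elt tensor_comp_elt[OF C D] comp_in[OF C] comp_in[OF D] tensor_comp_elt[OF C' D'] o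
       lin_closed[OF fun_lin[OF F]] lin_closed[OF fun_lin[OF G]] fun_comp[OF F] fun_comp[OF G]
       del: tensor_fun_simps(2))
   qed
  qed
 qed
 show ?thesis
  unfolding k_functor_def
  using o lin comp elt id_in[OF C] id_in[OF D] fun_id[OF F] fun_id[OF G]
  by (auto simp del: tensor_fun_simps(2) tensor_cat_simps(2))
qed

text \<open>The image of a linear map is a submodule, and by fullness of both factors it contains
  all pure tensors.\<close>

lemma tensor_full:
 assumes C: "k_category K C" and D: "k_category K D" and C': "k_category K C'" and D': "k_category K D'"
  and F: "k_functor K C C' F" and G: "k_functor K D D' G"
  and full: "full_functor C C' F" "full_functor D D' G"
 shows "full_functor (tensor_cat K C D) (tensor_cat K C' D') (tensor_fun K C' D' F G)"
proof -
 have "fmor (tensor_fun K C' D' F G) (c, d) (c', d') ` Mor (tensor_cat K C D) (c, d) (c', d') =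
   Mor (tensor_cat K C' D') (fobj F c, fobj G d) (fobj F c', fobj G d')"
  if p: "c \<in> Ob C" "d \<in> Ob D" "c' \<in> Ob C" "d' \<in> Ob D" for c d c' d'
 proof -
  let ?V = "Hom C c c'" and ?W = "Hom D d d'"
  let ?V' = "Hom C' (fobj F c) (fobj F c')" and ?W' = "Hom D' (fobj G d) (fobj G d')"
  note m = hom_mod[OF C p(1,3)] hom_mod[OF D p(2,4)]
   hom_mod[OF C' fun_ob[OF F p(1)] fun_ob[OF F p(3)]] hom_mod[OF D' fun_ob[OF G p(2)] fun_ob[OF G p(4)]]
  note t = tensor_map_linear[OF m fun_lin[OF F p(1,3)] fun_lin[OF G p(2,4)]]
  note te = tensor_map_elt[OF m fun_lin[OF F p(1,3)] fun_lin[OF G p(2,4)]]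
  let ?t = "fmor (tensor_fun K C' D' F G) (c, d) (c', d')"
  note T = tensor_module_module[OF m(1,2)] tensor_module_module[OF m(3,4)]
  have cV: "carrier ?V' = fmor F c c' ` carrier ?V" and cW: "carrier ?W' = fmor G d d' ` carrier ?W"
   using full p unfolding full_functor_def by simp_all
  have "X \<in> ?t ` carrier (tensor_module K ?V ?W)" if X: "X \<in> carrier (tensor_module K ?V' ?W')" for X
  proof (rule tensor_induct[OF m(3,4) _ _ X])
   show "submodule (?t ` carrier (tensor_module K ?V ?W)) K (tensor_module K ?V' ?W')"
    using submodule_image[OF T t submodule_carrier[OF T(1)]] by simp
   fix v w assume "v \<in> carrier ?V'" "w \<in> carrier ?W'"
   then obtain f g where f: "f \<in> carrier ?V" "g \<in> carrier ?W" and "v = fmor F c c' f" "w = fmor G d d' g"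
    using cV cW by auto
   then have "tensor_elt K ?V' ?W' v w = ?t (tensor_elt K ?V ?W f g)" using te by simp
   then show "tensor_elt K ?V' ?W' v w \<in> ?t ` carrier (tensor_module K ?V ?W)"
    using bilin_closed[OF tensor_elt_bilinear[OF m(1,2)] f] by blast
  qed
  then show ?thesis using lin_closed[OF t] by auto
 qed
 then show ?thesis unfolding full_functor_def by auto
qed

lemma functor_kernel_ideal:
 assumes C: "k_category K C" and D: "k_category K D" and F: "k_functor K C D F"
 shows "two_sided_ideal K C (functor_kernel C D F)"
proof -
 note o = fun_ob[OF F] and lin = fun_lin[OF F]
 note m = hom_mod[OF C] and m' = hom_mod[OF D]
 note b = comp_bilin[OF D]
 have z: "Comp D x y z g \<zero>[Hom D x y] = \<zero>[Hom D x z]"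
  if "x \<in> Ob D" "y \<in> Ob D" "z \<in> Ob D" "g \<in> Mor D y z" for x y z g
  using lin_zero[OF m'[OF that(1,2)] m'[OF that(1,3)] bilin_right[OF b[OF that(1-3)] that(4)]] .
 have z': "Comp D x y z \<zero>[Hom D y z] f = \<zero>[Hom D x z]"
  if "x \<in> Ob D" "y \<in> Ob D" "z \<in> Ob D" "f \<in> Mor D x y" for x y z f
  using lin_zero[OF m'[OF that(2,3)] m'[OF that(1,3)] bilin_left[OF b[OF that(1-3)] that(4)]] .
 show ?thesis
  unfolding two_sided_ideal_def
 proof (intro conjI ballI)
  show "submodule (functor_kernel C D F x y) K (Hom C x y)" if "x \<in> Ob C" "y \<in> Ob C" for x y
   unfolding functor_kernel_def using submodule_kernel[OF m[OF that] m'[OF o o] lin[OF that]] that by simp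
 qed (auto simp: functor_kernel_def comp_in[OF C] fun_comp[OF F] o lin_closed[OF lin] z z')
qed

text \<open>\<open>homological_epimorphism\<close> is stated with the kernel of the functor instead
  of \<open>I\<close>. The two are compared between objects only, since \<open>I\<close> is
  unconstrained elsewhere; \<open>gdn_cong\<close> is suited to that.\<close>

lemma kernel_quot_proj:
 assumes C: "k_category K C" and I: "two_sided_ideal K C I" and "x \<in> Ob C" "y \<in> Ob C"
 shows "functor_kernel C (quot_cat C I) (quot_proj C I) x y = I x y"
 using coset_zero_iff[OF hom_mod[OF C assms(3,4)] ideal_sub[OF I assms(3,4)]] ideal_carrier[OF C I assms(3,4)]
 by (auto simp: functor_kernel_def qm_zero)

text \<open>The projection modulo \<open>N\<close> factors through the tensor product of the two quotients.\<close>

lemma tensor_quotient_kernel: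
 assumes V: "module K V" and W: "module K W" and V0: "submodule V0 K V" and W0: "submodule W0 K W"
  and N: "submodule N K (tensor_module K V W)"
  and N1: "\<And>v w. v \<in> V0 ==> w \<in> carrier W ==> tensor_elt K V W v w \<in> N"
  and N2: "\<And>v w. v \<in> carrier V ==> w \<in> W0 ==> tensor_elt K V W v w \<in> N"
  and X: "X \<in> carrier (tensor_module K V W)"
  and X0: "tensor_lift K (tensor_module K (quot_module V V0) (quot_module W W0))
   (\<lambda>v w. tensor_elt K (quot_module V V0) (quot_module W W0) (V0 +>[V] v) (W0 +>[W] w)) X
   = \<zero>[tensor_module K (quot_module V V0) (quot_module W W0)]"
 shows "X \<in> N"
proof -
 let ?T = "tensor_module K V W" and ?V' = "quot_module V V0" and ?W' = "quot_module W W0"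
 let ?Q = "quot_module ?T N" and ?e = "tensor_elt K V W"
 note T = tensor_module_module[OF V W]
 note Q = qm_module[OF T N]
 note eb = tensor_elt_bilinear[OF V W]
 note V' = qm_module[OF V V0] and W' = qm_module[OF W W0]
 \<comment> \<open>A map from the tensor product of the quotients back to the quotient by
   \<open>N\<close>. Choosing other representatives changes the tensor by elements of
   \<open>N\<close>, because of \<open>N1\<close> and \<open>N2\<close>.\<close>
 define \<beta> where "\<beta> P R = N +>[?T] ?e (SOME p. p \<in> P) (SOME r. r \<in> R)" for P R
 have b: "bilinear_map K V W ?Q (\<lambda>v w. N +>[?T] ?e v w)"
  unfolding bilinear_map_def
  using lin_comp[OF bilin_right[OF eb] qm_proj_linear[OF T N]] lin_comp[OF bilin_left[OF eb] qm_proj_linear[OF T N]]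
  by auto
 have \<beta>: "\<beta> (V0 +>[V] v) (W0 +>[W] w) = N +>[?T] ?e v w" if v: "v \<in> carrier V" and w: "w \<in> carrier W" for v w
 proof -
  let ?p = "SOME p. p \<in> V0 +>[V] v" and ?r = "SOME r. r \<in> W0 +>[W] w"
  have p: "?p \<in> V0 +>[V] v" by (rule someI[of "\<lambda>x. x \<in> V0 +>[V] v", OF coset_self[OF V V0 v]])
  have r: "?r \<in> W0 +>[W] w" by (rule someI[of "\<lambda>x. x \<in> W0 +>[W] w", OF coset_self[OF W W0 w]])
  have rc: "?r \<in> carrier W" using r coset_mem_iff[OF W W0 w] by simp
  have z: "N +>[?T] ?e n x = \<zero>[?Q]" if "n \<in> V0" "x \<in> carrier W" for n x
   using coset_zero_iff[OF T N] bilin_closed[OF eb] that sub_carrier[OF V V0] N1 by (simp add: qm_zero)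
  have z': "N +>[?T] ?e x n = \<zero>[?Q]" if "n \<in> W0" "x \<in> carrier V" for n x
   using coset_zero_iff[OF T N] bilin_closed[OF eb] that sub_carrier[OF W W0] N2 by (simp add: qm_zero)
  have "N +>[?T] ?e ?p ?r = N +>[?T] ?e v ?r"
   by (rule lin_coset[OF V V0 Q bilin_left[OF b rc] _ v p]) (rule z[OF _ rc])
  also have "\<dots> = N +>[?T] ?e v w"
   by (rule lin_coset[OF W W0 Q bilin_right[OF b v] _ w r]) (rule z'[OF _ v])
  finally show ?thesis unfolding \<beta>_def .
 qed
 have ex: "\<exists>v\<in>carrier V. P = V0 +>[V] v" if "P \<in> carrier ?V'" for P using that by (auto simp: qm_carrier)
 have ex': "\<exists>w\<in>carrier W. P = W0 +>[W] w" if "P \<in> carrier ?W'" for P using that by (auto simp: qm_carrier)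
 have \<beta>b: "bilinear_map K ?V' ?W' ?Q \<beta>"
  unfolding bilinear_map_def
  by (intro conjI ballI linI)
   (auto dest!: ex ex' simp: \<beta> qm_add[OF V V0] qm_smult[OF V V0] qm_add[OF W W0] qm_smult[OF W W0]
    module_add[OF V] module_add[OF W] module_smult[OF V] module_smult[OF W] bilin_simps[OF b] bilin_closed[OF b])
 let ?\<Psi> = "tensor_lift K ?Q \<beta>"
 let ?\<Phi> = "tensor_lift K (tensor_module K ?V' ?W') (\<lambda>v w. tensor_elt K ?V' ?W' (V0 +>[V] v) (W0 +>[W] w))"
 note \<Phi> = tensor_map_linear[OF V W V' W' qm_proj_linear[OF V V0] qm_proj_linear[OF W W0]]
 note \<Phi>e = tensor_map_elt[OF V W V' W' qm_proj_linear[OF V V0] qm_proj_linear[OF W W0]]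
 note \<Psi> = tensor_lift_linear[OF V' W' Q \<beta>b]
 note T' = tensor_module_module[OF V' W']
 \<comment> \<open>\<open>?\<Psi>\<close> undoes \<open>?\<Phi>\<close> up to \<open>N\<close>, so
   whatever \<open>?\<Phi>\<close> kills lies in \<open>N\<close>.\<close>
 have "?\<Psi> (?\<Phi> X) = N +>[?T] X"
  by (rule tensor_ext[OF V W Q lin_comp[OF \<Phi> \<Psi>] qm_proj_linear[OF T N] _ X])
   (simp add: \<Phi>e tensor_lift_elt[OF V' W' Q \<beta>b] qm_carrierI \<beta>)
 moreover have "?\<Psi> (?\<Phi> X) = N" using X0 lin_zero[OF T' Q \<Psi>] by (simp add: qm_zero)
 ultimately show ?thesis using coset_zero_iff[OF T N X] by simp
qed

subsection \<open>Smallness\<close>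

lemma small_catD:
 assumes "small_k_category TYPE('u) K C"
 shows small_cat: "k_category K C" and small_inf: "infinite (UNIV :: 'u set)"
  and small_field: "carrier K \<lesssim> (UNIV :: 'u set)" and small_ob: "Ob C \<lesssim> (UNIV :: 'u set)"
  and small_hom: "x \<in> Ob C ==> y \<in> Ob C ==> Mor C x y \<lesssim> (UNIV :: 'u set)"
 using assms unfolding small_k_category_def by auto

lemma small_op: "small_k_category TYPE('u) K C ==> small_k_category TYPE('u) K (op_cat C)"
 using op_category[of C] unfolding small_k_category_def by auto

lemma small_quot:
 assumes C: "small_k_category TYPE('u) K C" and I: "two_sided_ideal K C I"
 shows "small_k_category TYPE('u) K (quot_cat C I)"
proof -
 have "carrier (quot_module (Hom C x y) (I x y)) \<lesssim> (UNIV :: 'u set)" if "x \<in> Ob C" "y \<in> Ob C" for x y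
 proof -
  have "carrier (quot_module (Hom C x y) (I x y)) = (\<lambda>v. I x y +>[Hom C x y] v) ` Mor C x y"
   by (auto simp: qm_carrier)
  then show ?thesis
   using image_lepoll lepoll_trans small_hom[OF C that] by metis
 qed
 then show ?thesis
  using quot_category[OF small_cat[OF C] I] small_catD[OF C] unfolding small_k_category_def by simp
qed

text \<open>Every element is the coset of a finitely supported function, so the free module already
  bounds the cardinality.\<close>

lemma small_tensor_module:
 assumes "infinite (UNIV :: 'u set)" "carrier K \<lesssim> (UNIV :: 'u set)"
  "carrier V \<lesssim> (UNIV :: 'u set)" "carrier W \<lesssim> (UNIV :: 'u set)"
 shows "carrier (tensor_module K V W) \<lesssim> (UNIV :: 'u set)"
proof -
 let ?A = "carrier V \<times> carrier W"
 have "carrier (tensor_module K V W) \<lesssim> carrier (free_module K ?A)"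
  unfolding tensor_module_def qm_carrier by (simp add: setcompr_eq_image image_lepoll)
 also have "\<dots> \<lesssim> {f. f ` ?A \<subseteq> carrier K \<and> {x. f x \<noteq> \<zero>} \<subseteq> ?A \<and> finite {x. f x \<noteq> \<zero>}}"
  by (rule subset_imp_lepoll) (auto simp: free_carrier)
 also have "\<dots> \<lesssim> (UNIV :: 'u set)"
  by (rule finite_support_lepoll[OF assms(1) times_lepoll_infinite[OF assms(1,3,4)] assms(2)])
 finally show ?thesis .
qed

lemma small_tensor:
 assumes C: "small_k_category TYPE('u) K C" and D: "small_k_category TYPE('u) K D"
 shows "small_k_category TYPE('u) K (tensor_cat K C D)"
 unfolding small_k_category_def
 using tensor_category[OF small_cat[OF C] small_cat[OF D]] small_catD[OF C] small_catD[OF D]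
  times_lepoll_infinite[OF small_inf[OF C] small_ob[OF C] small_ob[OF D]]
  small_tensor_module[OF small_inf[OF C] small_field[OF C] small_hom[OF C] small_hom[OF D]]
 by auto

section \<open>Modules over a category\<close>

lemma kmodD:
 assumes "k_module K D F"
 shows val_mod: "x \<in> Ob D ==> module K (val F x)"
  and act_bilin: "x \<in> Ob D ==> y \<in> Ob D ==> bilinear_map K (Hom D x y) (val F x) (val F y) (act F x y)"
  and act_id: "x \<in> Ob D ==> v \<in> el F x ==> act F x x (Id D x) v = v"
  and act_comp: "x \<in> Ob D ==> y \<in> Ob D ==> z \<in> Ob D ==> f \<in> Mor D x y ==> g \<in> Mor D y z ==>
   v \<in> el F x ==> act F x z (Comp D x y z g f) v = act F y z g (act F x y f v)"
 using assms unfolding k_module_def by auto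

lemma act_in:
 "k_module K D F ==> x \<in> Ob D ==> y \<in> Ob D ==> f \<in> Mor D x y ==> v \<in> el F x ==>
  act F x y f v \<in> el F y"
 by (rule bilin_closed[OF act_bilin])

lemma act_lin:
 "k_module K D F ==> x \<in> Ob D ==> y \<in> Ob D ==> f \<in> Mor D x y ==>
  linear_map K (val F x) (val F y) (act F x y f)"
 by (rule bilin_right[OF act_bilin])

text \<open>Natural transformations as arbitrary functions, compared on carriers only. In contrast
  to \<open>nat_hom\<close> they need not be extensional, and source and target may be valued in
  different types, as in the transport into the universe; \<open>restr\<close> leads back to
  \<open>nat_hom\<close>.\<close>

definition nt :: "('o, 'k, 'm) kcat => ('o, 'm, 'k, 'u) kmod => ('o, 'm, 'k, 'w) kmod => ('o => 'u => 'w) => bool" where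
 "nt D F G \<eta> \<longleftrightarrow> (\<forall>x\<in>Ob D. linear_map K (val F x) (val G x) (\<eta> x)) \<and>
   (\<forall>x\<in>Ob D. \<forall>y\<in>Ob D. \<forall>f\<in>Mor D x y. \<forall>v\<in>el F x.
    \<eta> y (act F x y f v) = act G x y f (\<eta> x v))"

lemma ntD:
 assumes "nt D F G \<eta>"
 shows nt_lin: "x \<in> Ob D ==> linear_map K (val F x) (val G x) (\<eta> x)"
  and nt_nat: "x \<in> Ob D ==> y \<in> Ob D ==> f \<in> Mor D x y ==> v \<in> el F x ==>
   \<eta> y (act F x y f v) = act G x y f (\<eta> x v)"
  and nt_in: "x \<in> Ob D ==> v \<in> el F x ==> \<eta> x v \<in> el G x"
  and nt_add: "x \<in> Ob D ==> u \<in> el F x ==> v \<in> el F x ==>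
   \<eta> x (u \<oplus>[val F x] v) = \<eta> x u \<oplus>[val G x] \<eta> x v"
  and nt_smult: "x \<in> Ob D ==> a \<in> carrier K ==> v \<in> el F x ==>
   \<eta> x (a \<odot>[val F x] v) = a \<odot>[val G x] \<eta> x v"
 using assms unfolding nt_def linear_map_def by auto

lemma ntI:
 assumes "\<And>x. x \<in> Ob D ==> linear_map K (val F x) (val G x) (\<eta> x)"
  and "\<And>x y f v. x \<in> Ob D ==> y \<in> Ob D ==> f \<in> Mor D x y ==> v \<in> el F x ==>
   \<eta> y (act F x y f v) = act G x y f (\<eta> x v)"
 shows "nt D F G \<eta>"
 using assms unfolding nt_def by auto

lemma nt_zero_at:
 "k_module K D F ==> k_module K D G ==> nt D F G \<eta> ==> x \<in> Ob D ==> \<eta> x \<zero>[val F x] = \<zero>[val G x]"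
 by (rule lin_zero[OF val_mod val_mod nt_lin])

lemma nt_minus_at:
 "k_module K D F ==> k_module K D G ==> nt D F G \<eta> ==> x \<in> Ob D ==> u \<in> el F x ==> v \<in> el F x ==>
  \<eta> x (u \<ominus>[val F x] v) = \<eta> x u \<ominus>[val G x] \<eta> x v"
 by (rule lin_minus[OF val_mod val_mod nt_lin])

lemma nt_id: "nt D F F (\<lambda>x v. v)"
 by (simp add: nt_def lin_id)

lemma nt_compose: "nt D F G \<eta> ==> nt D G H \<theta> ==> nt D F H (\<lambda>x v. \<theta> x (\<eta> x v))"
 by (rule ntI) (auto simp: nt_nat nt_in intro: lin_comp nt_lin)

lemma nt_cong:
 assumes F: "k_module K D F" and eq: "\<And>x v. x \<in> Ob D ==> v \<in> el F x ==> \<eta> x v = \<theta> x v"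
  and n: "nt D F G \<eta>"
 shows "nt D F G \<theta>"
proof (rule ntI)
 show "linear_map K (val F x) (val G x) (\<theta> x)" if "x \<in> Ob D" for x
  by (rule lin_cong[OF val_mod[OF F that] eq[OF that] nt_lin[OF n that]])
qed (simp add: eq[symmetric] act_in[OF F] nt_nat[OF n])

lemma nt_zero:
 assumes "k_module K D G"
 shows "nt D F G (\<lambda>x v. \<zero>[val G x])"
 by (rule ntI) (auto simp: lin_const_zero[OF val_mod[OF assms]] lin_zero[OF val_mod[OF assms] val_mod[OF assms] act_lin[OF assms]])

lemma nt_plus:
 assumes G: "k_module K D G" and n: "nt D F G \<eta>" "nt D F G \<theta>"
 shows "nt D F G (\<lambda>x v. \<eta> x v \<oplus>[val G x] \<theta> x v)"
 by (rule ntI) (auto simp: nt_nat[OF n(1)] nt_nat[OF n(2)] nt_in[OF n(1)] nt_in[OF n(2)]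
   lin_add[OF act_lin[OF G]] intro: lin_plus[OF val_mod[OF G] nt_lin[OF n(1)] nt_lin[OF n(2)]])

lemma nt_scale:
 assumes G: "k_module K D G" and n: "nt D F G \<eta>" and a: "a \<in> carrier K"
 shows "nt D F G (\<lambda>x v. a \<odot>[val G x] \<eta> x v)"
 by (rule ntI) (auto simp: nt_nat[OF n(1)] nt_in[OF n(1)] a
   lin_smult[OF act_lin[OF G]] intro: lin_scale[OF val_mod[OF G] nt_lin[OF n] a])

lemma nt_uminus:
 assumes G: "k_module K D G" and n: "nt D F G \<eta>"
 shows "nt D F G (\<lambda>x v. \<ominus>[val G x] \<eta> x v)"
 by (rule ntI) (auto simp: nt_nat[OF n(1)] nt_in[OF n(1)]
   lin_neg[OF val_mod[OF G] val_mod[OF G] act_lin[OF G]] intro: lin_uminus[OF val_mod[OF G] nt_lin[OF n(1)]])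

lemma nt_diff:
 assumes G: "k_module K D G" and n: "nt D F G \<eta>" "nt D F G \<theta>"
 shows "nt D F G (\<lambda>x v. \<eta> x v \<ominus>[val G x] \<theta> x v)"
 unfolding a_minus_def by (rule nt_plus[OF G n(1) nt_uminus[OF G n(2)]])

section \<open>Submodules of modules over a category\<close>

definition subf :: "('o, 'k, 'm) kcat => ('o, 'm, 'k, 'u) kmod => ('o => 'u set) => bool" where
 "subf D F Z \<longleftrightarrow> (\<forall>x\<in>Ob D. submodule (Z x) K (val F x)) \<and>
   (\<forall>x\<in>Ob D. \<forall>y\<in>Ob D. \<forall>f\<in>Mor D x y. \<forall>v\<in>Z x. act F x y f v \<in> Z y)"

lemma subfD:
 assumes "subf D F Z"
 shows subf_sub: "x \<in> Ob D ==> submodule (Z x) K (val F x)"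
  and subf_act: "x \<in> Ob D ==> y \<in> Ob D ==> f \<in> Mor D x y ==> v \<in> Z x ==> act F x y f v \<in> Z y"
 using assms unfolding subf_def by auto

lemma subf_in: "k_module K D F ==> subf D F Z ==> x \<in> Ob D ==> v \<in> Z x ==> v \<in> el F x"
 by (rule sub_carrier[OF val_mod subf_sub])

lemma subf_zero: "k_module K D F ==> subf D F (\<lambda>x. {\<zero>[val F x]})"
 unfolding subf_def
 by (auto simp: submodule_zero[OF val_mod] lin_zero[OF val_mod val_mod act_lin])

lemma subf_carrier: "k_module K D F ==> subf D F (\<lambda>x. el F x)"
 unfolding subf_def by (auto simp: submodule_carrier[OF val_mod] act_in)

lemma subf_image:
 assumes F: "k_module K D F" and G: "k_module K D G" and n: "nt D F G \<eta>" and Z: "subf D F Z"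
 shows "subf D G (\<lambda>x. \<eta> x ` Z x)"
 unfolding subf_def
 using submodule_image[OF val_mod[OF F] val_mod[OF G] nt_lin[OF n] subf_sub[OF Z]]
  nt_nat[OF n, symmetric] subf_act[OF Z] subf_in[OF F Z] by auto

lemma subf_preimage:
 assumes F: "k_module K D F" and G: "k_module K D G" and n: "nt D F G \<eta>" and Z: "subf D G Z"
 shows "subf D F (\<lambda>x. {v \<in> el F x. \<eta> x v \<in> Z x})"
 unfolding subf_def
 using submodule_preimage[OF val_mod[OF F] val_mod[OF G] nt_lin[OF n] subf_sub[OF Z]]
  nt_nat[OF n] subf_act[OF Z] act_in[OF F] by auto

lemma subf_kernel:
 assumes F: "k_module K D F" and G: "k_module K D G" and n: "nt D F G \<eta>"
 shows "subf D F (\<lambda>x. {v \<in> el F x. \<eta> x v = \<zero>[val G x]})"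
 using subf_preimage[OF F G n subf_zero[OF G]] by simp

lemma subf_ssum:
 assumes F: "k_module K D F" and A: "subf D F A" and B: "subf D F B"
 shows "subf D F (\<lambda>x. ssum (val F x) (A x) (B x))"
 unfolding subf_def
proof (intro conjI ballI)
 show "submodule (ssum (val F x) (A x) (B x)) K (val F x)" if "x \<in> Ob D" for x
  by (rule submodule_ssum[OF val_mod[OF F that] subf_sub[OF A that] subf_sub[OF B that]])
 fix x y f v assume o: "x \<in> Ob D" "y \<in> Ob D" "f \<in> Mor D x y" and "v \<in> ssum (val F x) (A x) (B x)"
 then obtain a b where ab: "a \<in> A x" "b \<in> B x" "v = a \<oplus>[val F x] b" by (auto simp: ssum_def)
 have "act F x y f v = act F x y f a \<oplus>[val F y] act F x y f b"
  using ab lin_add[OF act_lin[OF F o]] subf_in[OF F A o(1)] subf_in[OF F B o(1)] by simp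
 then show "act F x y f v \<in> ssum (val F y) (A y) (B y)"
  using ab subf_act[OF A o] subf_act[OF B o] by (auto intro: ssumI)
qed

definition subk :: "('o, 'm, 'k, 'u) kmod => ('o => 'u set) => ('o, 'm, 'k, 'u) kmod" where
 "subk F Z = \<lparr>val = (\<lambda>x. (val F x)\<lparr>carrier := Z x\<rparr>), act = act F\<rparr>"

lemma subk_simps [simp]: "val (subk F Z) x = (val F x)\<lparr>carrier := Z x\<rparr>" "act (subk F Z) = act F"
 by (simp_all add: subk_def)

lemma subk_module:
 assumes F: "k_module K D F" and Z: "subf D F Z" and D: "k_category K D"
 shows "k_module K D (subk F Z)"
proof -
 note zc = subf_in[OF F Z]
 note b = act_bilin[OF F]
 show ?thesis
  unfolding k_module_def subk_simps
 proof (intro conjI ballI)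
  show "module K ((val F x)\<lparr>carrier := Z x\<rparr>)" if "x \<in> Ob D" for x
   by (rule submodule_module[OF val_mod[OF F that] subf_sub[OF Z that]])
  show "bilinear_map K (Hom D x y) ((val F x)\<lparr>carrier := Z x\<rparr>) ((val F y)\<lparr>carrier := Z y\<rparr>) (act F x y)"
   if o: "x \<in> Ob D" "y \<in> Ob D" for x y
   unfolding bilinear_map_def
   by (intro conjI ballI linI) (use o in \<open>auto simp: subf_act[OF Z] bilin_simps[OF b] zc\<close>)
 qed (auto simp: act_id[OF F] act_comp[OF F] zc)
qed

lemma subk_incl: "k_module K D F ==> subf D F Z ==> nt D (subk F Z) F (\<lambda>x v. v)"
 unfolding nt_def linear_map_def by (auto simp: subf_in)

lemma subk_into:
 assumes "nt D G F \<eta>" "\<And>x v. x \<in> Ob D ==> v \<in> el G x ==> \<eta> x v \<in> Z x"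
 shows "nt D G (subk F Z) \<eta>"
 using assms unfolding nt_def linear_map_def by auto

text \<open>A structure whose operations are computed by applying \<open>p\<close> to those of
  \<open>V\<close> inherits the axioms. Through \<open>kmod_image\<close> this serves quotients on
  representatives and transports along encodings, where the elements of \<open>W\<close> are not
  cosets.\<close>

lemma module_image:
 assumes V: "module K V" and c: "carrier W = p ` carrier V" and z: "\<zero>[W] = p \<zero>[V]"
  and a: "\<And>u v. u \<in> carrier V ==> v \<in> carrier V ==> p u \<oplus>[W] p v = p (u \<oplus>[V] v)"
  and s: "\<And>r v. r \<in> carrier K ==> v \<in> carrier V ==> r \<odot>[W] p v = p (r \<odot>[V] v)"
 shows "module K W" "linear_map K V W p"
proof -
 interpret V: module K V by fact
 show "linear_map K V W p" by (rule linI) (auto simp: c a s)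
 show "module K W"
 proof (rule moduleI)
  show "cring K" by (rule is_cring)
  show "abelian_group W"
  proof (rule abelian_groupI)
   fix X assume "X \<in> carrier W"
   then obtain v where v: "v \<in> carrier V" "X = p v" using c by auto
   show "\<exists>Y\<in>carrier W. Y \<oplus>[W] X = \<zero>[W]"
    using v by (intro bexI[of _ "p (\<ominus>[V] v)"]) (auto simp: a z c V.l_neg)
  qed (auto simp: c z a V.a_ac)
 qed (auto simp: c z a s V.smult_l_distr V.smult_r_distr V.smult_assoc1)
qed

lemma kmod_image:
 assumes D: "k_category K D" and F: "k_module K D F"
  and c: "\<And>x. x \<in> Ob D ==> el G x = p x ` el F x"
  and z: "\<And>x. x \<in> Ob D ==> \<zero>[val G x] = p x \<zero>[val F x]"
  and a: "\<And>x u v. x \<in> Ob D ==> u \<in> el F x ==> v \<in> el F x ==>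
   p x u \<oplus>[val G x] p x v = p x (u \<oplus>[val F x] v)"
  and s: "\<And>x r v. x \<in> Ob D ==> r \<in> carrier K ==> v \<in> el F x ==> r \<odot>[val G x] p x v = p x (r \<odot>[val F x] v)"
  and n: "\<And>x y f v. x \<in> Ob D ==> y \<in> Ob D ==> f \<in> Mor D x y ==> v \<in> el F x ==>
   act G x y f (p x v) = p y (act F x y f v)"
 shows "k_module K D G" "nt D F G p"
proof -
 note m = module_image[OF val_mod[OF F] c z a s]
 note b = act_bilin[OF F]
 show "nt D F G p" by (rule ntI) (simp_all add: m(2) n)
 show "k_module K D G"
  unfolding k_module_def
 proof (intro conjI ballI)
  show "module K (val G x)" if "x \<in> Ob D" for x using m(1) that by simp
  show "bilinear_map K (Hom D x y) (val G x) (val G y) (act G x y)" if o: "x \<in> Ob D" "y \<in> Ob D" for x y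
   unfolding bilinear_map_def
   by (intro conjI ballI linI)
    (use o in \<open>auto simp: c a s n act_in[OF F] bilin_simps[OF b] module_add[OF val_mod[OF F]]
     module_smult[OF val_mod[OF F]] module_add[OF hom_mod[OF D]] module_smult[OF hom_mod[OF D]]\<close>)
 qed (auto simp: c n id_in[OF D] comp_in[OF D] act_in[OF F] act_id[OF F] act_comp[OF F])
qed

subsection \<open>Quotient modules\<close>

text \<open>The quotient is carried by a system of representatives, so that it stays in the universe.\<close>

definition rp :: "('o, 'm, 'k, 'u) kmod => ('o => 'u set) => 'o => 'u => 'u" where
 "rp F Z x v = (SOME w. w \<in> Z x +>[val F x] v)"

definition quotk :: "('o, 'm, 'k, 'u) kmod => ('o => 'u set) => ('o, 'm, 'k, 'u) kmod" where
 "quotk F Z =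
   \<lparr>val = (\<lambda>x. \<lparr>carrier = rp F Z x ` el F x, mult = undefined, one = undefined,
    zero = rp F Z x \<zero>[val F x], add = (\<lambda>u v. rp F Z x (u \<oplus>[val F x] v)),
    smult = (\<lambda>a u. rp F Z x (a \<odot>[val F x] u))\<rparr>),
   act = (\<lambda>x y f u. rp F Z y (act F x y f u))\<rparr>"

lemma rp_props:
 assumes F: "k_module K D F" and Z: "subf D F Z" and x: "x \<in> Ob D"
 shows rp_mem: "v \<in> el F x ==> rp F Z x v \<in> Z x +>[val F x] v"
  and rp_in: "v \<in> el F x ==> rp F Z x v \<in> el F x"
  and rp_diff: "v \<in> el F x ==> rp F Z x v \<ominus>[val F x] v \<in> Z x"
  and rp_eq_iff: "v \<in> el F x ==> w \<in> el F x ==>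
   rp F Z x v = rp F Z x w \<longleftrightarrow> v \<ominus>[val F x] w \<in> Z x"
  and rp_rp: "v \<in> el F x ==> rp F Z x (rp F Z x v) = rp F Z x v"
proof -
 note m = val_mod[OF F x] and sm = subf_sub[OF Z x]
 have mem: "rp F Z x v \<in> Z x +>[val F x] v" if "v \<in> el F x" for v
  unfolding rp_def by (rule someI[of "\<lambda>w. w \<in> Z x +>[val F x] v", OF coset_self[OF m sm that]])
 note mi = coset_mem_iff[OF m sm]
 have cin: "rp F Z x v \<in> el F x" if "v \<in> el F x" for v using mem[OF that] mi[OF that] by simp
 have df: "rp F Z x v \<ominus>[val F x] v \<in> Z x" if "v \<in> el F x" for v using mem[OF that] mi[OF that] by simp
 have eq: "rp F Z x v = rp F Z x w \<longleftrightarrow> v \<ominus>[val F x] w \<in> Z x"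
  if v: "v \<in> el F x" and w: "w \<in> el F x" for v w
 proof
  assume "v \<ominus>[val F x] w \<in> Z x"
  then show "rp F Z x v = rp F Z x w" using coset_eq_iff[OF m sm v w] by (simp add: rp_def)
 next
  have c: "Z x +>[val F x] rp F Z x u = Z x +>[val F x] u" if "u \<in> el F x" for u
   using coset_eq_iff[OF m sm cin[OF that] that] df[OF that] by simp
  assume "rp F Z x v = rp F Z x w"
  then show "v \<ominus>[val F x] w \<in> Z x" using c[OF v] c[OF w] coset_eq_iff[OF m sm v w] by simp
 qed
 show "v \<in> el F x ==> rp F Z x v \<in> Z x +>[val F x] v" by (rule mem)
 show "v \<in> el F x ==> rp F Z x v \<in> el F x" by (rule cin)
 show "v \<in> el F x ==> rp F Z x v \<ominus>[val F x] v \<in> Z x" by (rule df)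
 show "v \<in> el F x ==> w \<in> el F x ==>
   rp F Z x v = rp F Z x w \<longleftrightarrow> v \<ominus>[val F x] w \<in> Z x" by (rule eq)
 show "v \<in> el F x ==> rp F Z x (rp F Z x v) = rp F Z x v" using eq[OF cin] df by simp
qed

lemma rp_lin:
 assumes F: "k_module K D F" and Z: "subf D F Z" and x: "x \<in> Ob D" and G: "k_module K D G" and n: "nt D F G h"
  and h0: "\<And>v. v \<in> Z x ==> h x v = \<zero>[val G x]" and v: "v \<in> el F x"
 shows "h x (rp F Z x v) = h x v"
 by (rule lin_coset[OF val_mod[OF F x] subf_sub[OF Z x] val_mod[OF G x] nt_lin[OF n x] h0 v rp_mem[OF F Z x v]])

text \<open>Well-definedness of the map that \<open>h\<close> induces from \<open>F/Z\<close> to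
  \<open>G/Y\<close>, in terms of representatives.\<close>

lemma rp_lin_sub:
 assumes F: "k_module K D F" and Z: "subf D F Z" and G: "k_module K D G" and Y: "subf D G Y"
  and x: "x \<in> Ob D" and n: "linear_map K (val F x) (val G x) h"
  and hZ: "\<And>v. v \<in> Z x ==> h v \<in> Y x" and v: "v \<in> el F x"
 shows "rp G Y x (h (rp F Z x v)) = rp G Y x (h v)"
 using rp_eq_iff[OF G Y x lin_closed[OF n] lin_closed[OF n]] rp_in[OF F Z x v] v
  lin_minus[OF val_mod[OF F x] val_mod[OF G x] n rp_in[OF F Z x v] v, symmetric] hZ rp_diff[OF F Z x v] by simp

lemma quotk_module:
 assumes D: "k_category K D" and F: "k_module K D F" and Z: "subf D F Z"
 shows "k_module K D (quotk F Z)" and quotk_proj: "nt D F (quotk F Z) (rp F Z)"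
proof -
 note ri = rp_in[OF F Z]
 have 1: "rp F Z x (rp F Z x u \<oplus>[val F x] rp F Z x v) = rp F Z x (u \<oplus>[val F x] v)"
  if x: "x \<in> Ob D" and u: "u \<in> el F x" and v: "v \<in> el F x" for x u v
 proof -
  note m = val_mod[OF F x] and sm = subf_sub[OF Z x]
  interpret M: module K "val F x" by (rule m)
  have "(rp F Z x u \<oplus>[val F x] rp F Z x v) \<ominus>[val F x] (u \<oplus>[val F x] v) =
   (rp F Z x u \<ominus>[val F x] u) \<oplus>[val F x] (rp F Z x v \<ominus>[val F x] v)"
   using u v ri[OF x] by (simp add: a_minus_def M.minus_add M.a_ac)
  then show ?thesis
   using rp_eq_iff[OF F Z x] u v ri[OF x] rp_diff[OF F Z x] sub_add[OF m sm] by simp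
 qed
 have 2: "rp F Z x (r \<odot>[val F x] rp F Z x v) = rp F Z x (r \<odot>[val F x] v)"
  if x: "x \<in> Ob D" and r: "r \<in> carrier K" and v: "v \<in> el F x" for x r v
  by (rule rp_lin_sub[OF F Z F Z x lin_scale[OF val_mod[OF F x] lin_id r] sub_smult[OF val_mod[OF F x] subf_sub[OF Z x] r] v])
 have 3: "rp F Z y (act F x y f (rp F Z x v)) = rp F Z y (act F x y f v)"
  if x: "x \<in> Ob D" and y: "y \<in> Ob D" and f: "f \<in> Mor D x y" and v: "v \<in> el F x" for x y f v
 proof -
  note al = act_lin[OF F x y f]
  show ?thesis
   using rp_eq_iff[OF F Z y lin_closed[OF al] lin_closed[OF al]] ri[OF x v] v
    lin_minus[OF val_mod[OF F x] val_mod[OF F y] al ri[OF x v] v, symmetric] subf_act[OF Z x y f rp_diff[OF F Z x v]]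
   by simp
 qed
 have s: "el (quotk F Z) x = rp F Z x ` el F x"
  "\<zero>[val (quotk F Z) x] = rp F Z x \<zero>[val F x]"
  "u \<oplus>[val (quotk F Z) x] v = rp F Z x (u \<oplus>[val F x] v)"
  "r \<odot>[val (quotk F Z) x] v = rp F Z x (r \<odot>[val F x] v)"
  "act (quotk F Z) x y f v = rp F Z y (act F x y f v)" for x y f r u v
  by (simp_all add: quotk_def)
 note im = kmod_image[OF D F, of "quotk F Z" "rp F Z", unfolded s, OF refl refl 1 2 3]
 show "k_module K D (quotk F Z)" by (rule im(1))
 show "nt D F (quotk F Z) (rp F Z)" by (rule im(2))
qed

lemma quotk_elem:
 assumes F: "k_module K D F" and Z: "subf D F Z" and x: "x \<in> Ob D" and u: "u \<in> el (quotk F Z) x"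
 shows "u \<in> el F x" "rp F Z x u = u"
 using u rp_in[OF F Z x] rp_rp[OF F Z x] by (auto simp: quotk_def)

lemma quotk_surj: "rp F Z x ` el F x = el (quotk F Z) x"
 by (simp add: quotk_def)

lemma quotk_in: "v \<in> el F x ==> rp F Z x v \<in> el (quotk F Z) x"
 by (simp add: quotk_def)

lemma quotk_zero_iff:
 assumes F: "k_module K D F" and Z: "subf D F Z" and x: "x \<in> Ob D" and v: "v \<in> el F x"
 shows "rp F Z x v = \<zero>[val (quotk F Z) x] \<longleftrightarrow> v \<in> Z x"
proof -
 interpret M: module K "val F x" by (rule val_mod[OF F x])
 have "v \<ominus>[val F x] \<zero>[val F x] = v" using v by (simp add: a_minus_def)
 then show ?thesis using rp_eq_iff[OF F Z x v, of "\<zero>[val F x]"] by (simp add: quotk_def)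
qed

text \<open>The elements of \<open>quotk F Z\<close> are elements of \<open>F\<close>, so the
  factorization of \<open>h\<close> through the quotient is \<open>h\<close> itself and no new
  function has to be defined.\<close>

lemma quotk_out:
 assumes F: "k_module K D F" and Z: "subf D F Z" and G: "k_module K D G" and n: "nt D F G h"
  and h0: "\<And>x v. x \<in> Ob D ==> v \<in> Z x ==> h x v = \<zero>[val G x]"
 shows "nt D (quotk F Z) G h"
proof -
 have r: "h x (rp F Z x v) = h x v" if "x \<in> Ob D" "v \<in> el F x" for x v
  by (rule rp_lin[OF F Z that(1) G n h0[OF that(1)] that(2)])
 note e = quotk_elem[OF F Z]
 note m = module_add[OF val_mod[OF F]] module_smult[OF val_mod[OF F]] act_in[OF F]
 show ?thesis
 proof (rule ntI)
  show "linear_map K (val (quotk F Z) x) (val G x) (h x)" if x: "x \<in> Ob D" for x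
  proof (rule linI)
   fix u assume "u \<in> el (quotk F Z) x"
   note u = e(1)[OF x this]
   show "h x u \<in> el G x" by (rule nt_in[OF n x u])
   fix a assume a: "a \<in> carrier K"
   show "h x (a \<odot>[val (quotk F Z) x] u) = a \<odot>[val G x] h x u"
    using r[OF x m(2)[OF x a u]] nt_smult[OF n x a u] by (simp add: quotk_def)
  next
   fix u v assume "u \<in> el (quotk F Z) x" "v \<in> el (quotk F Z) x"
   note uv = e(1)[OF x this(1)] e(1)[OF x this(2)]
   show "h x (u \<oplus>[val (quotk F Z) x] v) = h x u \<oplus>[val G x] h x v"
    using r[OF x m(1)[OF x uv]] nt_add[OF n x uv] by (simp add: quotk_def)
  qed
  fix x y f v assume o: "x \<in> Ob D" "y \<in> Ob D" "f \<in> Mor D x y" "v \<in> el (quotk F Z) x"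
  have v: "v \<in> el F x" by (rule e(1)[OF o(1,4)])
  have "h y (rp F Z y (act F x y f v)) = h y (act F x y f v)" by (rule r[OF o(2) act_in[OF F o(1-3) v]])
  then show "h y (act (quotk F Z) x y f v) = act G x y f (h x v)"
   using nt_nat[OF n o(1-3) v] by (simp add: quotk_def)
 qed
qed

subsection \<open>The submodule generated by an ideal\<close>

text \<open>The submodule \<open>J F\<close>: finite sums of elements \<open>j v\<close>, built one
  summand at a time. The quotient by it is the tensor product of \<open>D/J\<close> with
  \<open>F\<close>, the functor whose derived functors are at issue.\<close>

inductive_set jsp :: "('o, 'k, 'm) kcat => ('o => 'o => 'm set) => ('o, 'm, 'k, 'u) kmod => 'o => 'u set"
 for D J F y where
 jsp_zero: "\<zero>[val F y] \<in> jsp D J F y"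
| jsp_step: "x \<in> Ob D ==> j \<in> J x y ==> v \<in> el F x ==> s \<in> jsp D J F y ==>
  act F x y j v \<oplus>[val F y] s \<in> jsp D J F y"

text \<open>These are the modules that come from \<open>D/J\<close>, see \<open>pb_module\<close>
  and \<open>desc_module\<close>.\<close>

definition killed :: "('o, 'k, 'm) kcat => ('o => 'o => 'm set) => ('o, 'm, 'k, 'u) kmod => bool" where
 "killed D J F \<longleftrightarrow> (\<forall>x\<in>Ob D. \<forall>y\<in>Ob D. \<forall>j\<in>J x y. \<forall>v\<in>el F x. act F x y j v = \<zero>[val F y])"

lemma killedD: "killed D J F ==> x \<in> Ob D ==> y \<in> Ob D ==> j \<in> J x y ==> v \<in> el F x ==>
  act F x y j v = \<zero>[val F y]"
 unfolding killed_def by auto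

lemma jsp_least:
 assumes F: "k_module K D F" and y: "y \<in> Ob D" and N: "submodule N K (val F y)"
  and g: "\<And>x j v. x \<in> Ob D ==> j \<in> J x y ==> v \<in> el F x ==> act F x y j v \<in> N"
  and v: "v \<in> jsp D J F y"
 shows "v \<in> N"
 using v by induction (auto simp: sub_zero[OF val_mod[OF F y] N] intro: sub_add[OF val_mod[OF F y] N] g)

text \<open>Scalars and morphisms of \<open>D\<close> are absorbed by the ideal:
  \<open>a (j v) = (a j) v\<close> and \<open>f (j v) = (f j) v\<close>.\<close>

lemma jsp_subf:
 assumes D: "k_category K D" and J: "two_sided_ideal K D J" and F: "k_module K D F"
 shows "subf D F (jsp D J F)"
  and jsp_act: "x \<in> Ob D ==> y \<in> Ob D ==> j \<in> J x y ==> v \<in> el F x ==> act F x y j v \<in> jsp D J F y"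
proof -
 note jc = ideal_carrier[OF D J]
 have c: "jsp D J F y \<subseteq> el F y" if y: "y \<in> Ob D" for y
  using jsp_least[OF F y submodule_carrier[OF val_mod[OF F y]]] act_in[OF F _ y] jc[OF _ y] by blast
 have sm: "submodule (jsp D J F y) K (val F y)" if y: "y \<in> Ob D" for y
 proof (rule submodI[OF val_mod[OF F y] c[OF y] jsp_zero])
  interpret M: module K "val F y" by (rule val_mod[OF F y])
  fix u v assume u: "u \<in> jsp D J F y" and v: "v \<in> jsp D J F y"
  have vc: "v \<in> el F y" using c[OF y] v by auto
  show "u \<oplus>[val F y] v \<in> jsp D J F y"
   using u
  proof induction
   case jsp_zero then show ?case using v vc by simp
  next
   case (jsp_step x j w s)
   have "s \<in> el F y" "act F x y j w \<in> el F y"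
    using jsp_step c[OF y] act_in[OF F _ y jc[OF _ y]] by auto
   then show ?case using jsp.jsp_step[OF jsp_step(1-3,5)] vc by (simp add: M.a_assoc)
  qed
 next
  interpret M: module K "val F y" by (rule val_mod[OF F y])
  fix a v assume a: "a \<in> carrier K" and v: "v \<in> jsp D J F y"
  show "a \<odot>[val F y] v \<in> jsp D J F y"
   using v
  proof induction
   case jsp_zero then show ?case using a by (simp add: jsp.jsp_zero)
  next
   case (jsp_step x j w s)
   have sc: "s \<in> el F y" "act F x y j w \<in> el F y"
    using jsp_step c[OF y] act_in[OF F _ y jc[OF _ y]] by auto
   have "a \<odot>[val F y] act F x y j w = act F x y (a \<odot>[Hom D x y] j) w"
    using bilin_simps(3)[OF act_bilin[OF F jsp_step(1) y] a jc[OF jsp_step(1) y jsp_step(2)] jsp_step(3)] by simp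
   moreover have "a \<odot>[Hom D x y] j \<in> J x y"
    by (rule sub_smult[OF hom_mod[OF D jsp_step(1) y] ideal_sub[OF J jsp_step(1) y] a jsp_step(2)])
   ultimately show ?case using jsp.jsp_step[OF jsp_step(1) _ jsp_step(3,5)] sc a by (simp add: M.smult_r_distr)
  qed
 qed
 show ja: "act F x y j v \<in> jsp D J F y" if o: "x \<in> Ob D" "y \<in> Ob D" and j: "j \<in> J x y" and v: "v \<in> el F x" for x y j v
 proof -
  interpret M: module K "val F y" by (rule val_mod[OF F o(2)])
  show ?thesis using jsp_step[of x D j J y v F, OF o(1) j v jsp_zero] act_in[OF F o jc[OF o j] v] by simp
 qed
 show "subf D F (jsp D J F)"
  unfolding subf_def
 proof (intro conjI ballI)
  show "submodule (jsp D J F x) K (val F x)" if "x \<in> Ob D" for x using sm[OF that] .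
  fix y z f v assume y: "y \<in> Ob D" and z: "z \<in> Ob D" and f: "f \<in> Mor D y z" and v: "v \<in> jsp D J F y"
  have "v \<in> {v \<in> el F y. act F y z f v \<in> jsp D J F z}"
  proof (rule jsp_least[OF F y submodule_preimage[OF val_mod[OF F y] val_mod[OF F z] act_lin[OF F y z f] sm[OF z]] _ v])
   fix x j v assume x: "x \<in> Ob D" and j: "j \<in> J x y" and v: "v \<in> el F x"
   have "act F y z f (act F x y j v) = act F x z (Comp D x y z f j) v"
    using act_comp[OF F x y z jc[OF x y j] f v] by simp
   then show "act F x y j v \<in> {v \<in> el F y. act F y z f v \<in> jsp D J F z}"
    using ja[OF x z ideal_left[OF J x y z j f] v] act_in[OF F x y jc[OF x y j] v] by simp
  qed
  then show "act F y z f v \<in> jsp D J F z" by simp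
 qed
qed

lemma jsp_nt:
 assumes D: "k_category K D" and J: "two_sided_ideal K D J" and F: "k_module K D F" and G: "k_module K D G"
  and n: "nt D F G \<eta>" and y: "y \<in> Ob D" and v: "v \<in> jsp D J F y"
 shows "\<eta> y v \<in> jsp D J G y"
proof -
 have "v \<in> {v \<in> el F y. \<eta> y v \<in> jsp D J G y}"
  using jsp_act[OF D J G] nt_nat[OF n _ y ideal_carrier[OF D J _ y]] nt_in[OF n] y act_in[OF F _ y ideal_carrier[OF D J _ y]]
  by (intro jsp_least[OF F y subf_sub[OF subf_preimage[OF F G n jsp_subf(1)[OF D J G]] y] _ v]) auto
 then show ?thesis by simp
qed

text \<open>Right exactness of the reduction on elements: preimages can be chosen in
  \<open>J F\<close> because each generator \<open>j (\<eta> w)\<close> is the image of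
  \<open>j w\<close>.\<close>

lemma jsp_surj:
 assumes D: "k_category K D" and J: "two_sided_ideal K D J" and F: "k_module K D F" and G: "k_module K D G"
  and n: "nt D F G \<eta>" and s: "\<And>x. x \<in> Ob D ==> \<eta> x ` el F x = el G x"
  and y: "y \<in> Ob D" and v: "v \<in> jsp D J G y"
 shows "\<exists>w\<in>jsp D J F y. \<eta> y w = v"
proof -
 have "v \<in> \<eta> y ` jsp D J F y"
 proof (rule jsp_least[OF G y subf_sub[OF subf_image[OF F G n jsp_subf(1)[OF D J F]] y] _ v])
  fix x j v assume x: "x \<in> Ob D" and j: "j \<in> J x y" and v: "v \<in> el G x"
  obtain w where w: "w \<in> el F x" "v = \<eta> x w" using s[OF x] v by auto
  have "act G x y j v = \<eta> y (act F x y j w)"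
   using nt_nat[OF n x y ideal_carrier[OF D J x y j] w(1)] w(2) by simp
  then show "act G x y j v \<in> \<eta> y ` jsp D J F y"
   using jsp_act[OF D J F x y j w(1)] by simp
 qed
 then show ?thesis by auto
qed

lemma killed_jsp:
 assumes F: "k_module K D F" and k: "killed D J F" and y: "y \<in> Ob D" and v: "v \<in> jsp D J F y"
 shows "v = \<zero>[val F y]"
 using jsp_least[OF F y submodule_zero[OF val_mod[OF F y]] _ v] killedD[OF k _ y] by blast

lemma killed_subk: "k_module K D F ==> subf D F Z ==> killed D J F ==> killed D J (subk F Z)"
 unfolding killed_def by (auto simp: subf_in)

lemma killed_quotk:
 assumes D: "k_category K D" and J: "two_sided_ideal K D J" and F: "k_module K D F" and Z: "subf D F Z"
  and k: "\<And>x y j v. x \<in> Ob D ==> y \<in> Ob D ==> j \<in> J x y ==> v \<in> el F x ==> act F x y j v \<in> Z y"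
 shows "killed D J (quotk F Z)"
 unfolding killed_def
proof (intro ballI)
 fix x y j v assume *: "x \<in> Ob D" "y \<in> Ob D" "j \<in> J x y" "v \<in> el (quotk F Z) x"
 have v: "v \<in> el F x" by (rule quotk_elem(1)[OF F Z *(1,4)])
 have "rp F Z y (act F x y j v) = \<zero>[val (quotk F Z) y]"
  using quotk_zero_iff[OF F Z *(2) act_in[OF F *(1,2) ideal_carrier[OF D J *(1-3)] v]] k[OF *(1-3) v] by simp
 then show "act (quotk F Z) x y j v = \<zero>[val (quotk F Z) y]" by (simp add: quotk_def)
qed

subsection \<open>Projective modules\<close>

definition restr :: "('o, 'k, 'm) kcat => ('o, 'm, 'k, 'u) kmod => ('o => 'u => 'u) => 'o => 'u => 'u" where
 "restr D F \<eta> = (\<lambda>x\<in>Ob D. \<lambda>v\<in>el F x. \<eta> x v)"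

lemma restr_apply [simp]: "x \<in> Ob D ==> v \<in> el F x ==> restr D F \<eta> x v = \<eta> x v"
 by (simp add: restr_def)

lemma nat_hom_nt: "\<eta> \<in> carrier (nat_hom K D F G) ==> nt D F G \<eta>"
 by (auto simp: nat_hom_def nt_def)

lemma nat_homD: "\<eta> \<in> carrier (nat_hom K D F G) ==> restr D F \<eta> = \<eta>"
 unfolding nat_hom_def restr_def
 by (auto simp: fun_eq_iff PiE_iff extensional_def restrict_def)

lemma nt_nat_hom:
 assumes F: "k_module K D F" and n: "nt D F G \<eta>"
 shows "restr D F \<eta> \<in> carrier (nat_hom K D F G)"
proof -
 have "nt D F G (restr D F \<eta>)" by (rule nt_cong[OF F _ n]) simp
 then show ?thesis
  by (auto simp: nat_hom_def nt_def restr_def nt_in[OF n])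
qed

lemma nat_hom_eqI:
 assumes "\<eta> \<in> carrier (nat_hom K D F G)" "\<theta> \<in> carrier (nat_hom K D F G)"
  and "\<And>x v. x \<in> Ob D ==> v \<in> el F x ==> \<eta> x v = \<theta> x v"
 shows "\<eta> = \<theta>"
proof -
 have "restr D F \<eta> = restr D F \<theta>" unfolding restr_def using assms(3) by (intro ext) (auto simp: restrict_def)
 then show ?thesis using nat_homD[OF assms(1)] nat_homD[OF assms(2)] by simp
qed

lemma proj_module: "projective_module K D P ==> k_module K D P"
 by (simp add: projective_module_def)

text \<open>Projectivity in terms of \<open>nt\<close>, so that lifts may be given by arbitrary
  functions and are made extensional only at the end.\<close>

lemma projI:
 fixes P :: "('o, 'm, 'k, 'u) kmod"
 assumes P: "k_module K D P"
  and l: "\<And>(M :: ('o, 'm, 'k, 'u) kmod) (N :: ('o, 'm, 'k, 'u) kmod) e h. k_module K D M ==> k_module K D N ==>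
   nt D M N e ==> nt D P N h ==> (\<And>x. x \<in> Ob D ==> e x ` el M x = el N x) ==>
   \<exists>h'. nt D P M h' \<and> (\<forall>x\<in>Ob D. \<forall>v\<in>el P x. e x (h' x v) = h x v)"
 shows "projective_module K D P"
 unfolding projective_module_def
proof (intro conjI allI ballI impI P)
 fix M N :: "('o, 'm, 'k, 'u) kmod" and e h
 assume e: "e \<in> carrier (nat_hom K D M N)" and h: "h \<in> carrier (nat_hom K D P N)"
  and a: "k_module K D M \<and> k_module K D N \<and> nt_surj D M N e"
 obtain h' where h': "nt D P M h'" "\<forall>x\<in>Ob D. \<forall>v\<in>el P x. e x (h' x v) = h x v"
  using l[of M N e h] a nat_hom_nt[OF e] nat_hom_nt[OF h] by (auto simp: nt_surj_def)
 show "\<exists>h'\<in>carrier (nat_hom K D P M). nt_comp D P e h' = h"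
 proof (rule bexI[OF _ nt_nat_hom[OF P h'(1)]])
  have "nt_comp D P e (restr D P h') = restr D P h"
   unfolding nt_comp_def restr_def using h'(2) by (intro ext) (auto simp: restrict_def)
  then show "nt_comp D P e (restr D P h') = h" using nat_homD[OF h] by simp
 qed
qed

lemma proj_lift_surj:
 fixes P :: "('o, 'm, 'k, 'u) kmod" and M N :: "('o, 'm, 'k, 'u) kmod"
 assumes P: "projective_module K D P" and M: "k_module K D M" and N: "k_module K D N"
  and e: "nt D M N e" and h: "nt D P N h"
  and s: "\<And>x. x \<in> Ob D ==> e x ` el M x = el N x"
 shows "\<exists>h'. nt D P M h' \<and> (\<forall>x\<in>Ob D. \<forall>v\<in>el P x. e x (h' x v) = h x v)"
proof -
 note Pm = proj_module[OF P]
 have "nt_surj D M N (restr D M e)" unfolding nt_surj_def using s by simp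
 then obtain h' where h': "h' \<in> carrier (nat_hom K D P M)" "nt_comp D P (restr D M e) h' = restr D P h"
  using P nt_nat_hom[OF M e] nt_nat_hom[OF Pm h] M N unfolding projective_module_def by blast
 note n = nat_hom_nt[OF h'(1)]
 have "e x (h' x v) = h x v" if "x \<in> Ob D" "v \<in> el P x" for x v
  using fun_cong[OF fun_cong[OF h'(2), of x], of v] that nt_in[OF n that] by (simp add: nt_comp_def)
 then show ?thesis using n by auto
qed

text \<open>The target is cut down to the image of \<open>e\<close>, a submodule onto which
  \<open>e\<close> is surjective.\<close>

lemma proj_lift:
 fixes P :: "('o, 'm, 'k, 'u) kmod" and M N :: "('o, 'm, 'k, 'u) kmod"
 assumes D: "k_category K D" and P: "projective_module K D P" and M: "k_module K D M" and N: "k_module K D N"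
  and e: "nt D M N e" and h: "nt D P N h"
  and s: "\<And>x v. x \<in> Ob D ==> v \<in> el P x ==> h x v \<in> e x ` el M x"
 shows "\<exists>h'. nt D P M h' \<and> (\<forall>x\<in>Ob D. \<forall>v\<in>el P x. e x (h' x v) = h x v)"
proof -
 let ?Z = "\<lambda>x. e x ` el M x"
 have Z: "subf D N ?Z" by (rule subf_image[OF M N e subf_carrier[OF M]])
 show ?thesis
  by (rule proj_lift_surj[OF P M subk_module[OF N Z D] subk_into[OF e] subk_into[OF h s]]) auto
qed

section \<open>Direct sums and representable modules\<close>

text \<open>Values outside \<open>S\<close> are fixed to \<open>undefined\<close>, so that equality
  of families is decided on \<open>S\<close>.\<close>

definition dsv :: "'s set => ('s => ('k, 'u) module) => ('k, 's => 'u) module" where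
 "dsv S V = \<lparr>carrier = {f. (\<forall>s\<in>S. f s \<in> carrier (V s)) \<and> (\<forall>s. s \<notin> S --> f s = undefined) \<and>
    finite {s\<in>S. f s \<noteq> \<zero>[V s]}},
   mult = undefined, one = undefined,
   zero = (\<lambda>s. if s \<in> S then \<zero>[V s] else undefined),
   add = (\<lambda>f g s. if s \<in> S then f s \<oplus>[V s] g s else undefined),
   smult = (\<lambda>a f s. if s \<in> S then a \<odot>[V s] f s else undefined)\<rparr>"

definition di :: "'s set => ('s => ('k, 'u) module) => 's => 'u => 's => 'u" where
 "di S V s v = (\<lambda>t. if t = s then v else if t \<in> S then \<zero>[V t] else undefined)"

lemma dsv_carrier:
 "f \<in> carrier (dsv S V) \<longleftrightarrow> (\<forall>s\<in>S. f s \<in> carrier (V s)) \<and> (\<forall>s. s \<notin> S --> f s = undefined) \<and>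
    finite {s\<in>S. f s \<noteq> \<zero>[V s]}"
 by (simp add: dsv_def)

lemma dsv_ops:
 "\<zero>[dsv S V] = (\<lambda>s. if s \<in> S then \<zero>[V s] else undefined)"
 "f \<oplus>[dsv S V] g = (\<lambda>s. if s \<in> S then f s \<oplus>[V s] g s else undefined)"
 "a \<odot>[dsv S V] f = (\<lambda>s. if s \<in> S then a \<odot>[V s] f s else undefined)"
 by (simp_all add: dsv_def)

lemma dsv_ext:
 "f \<in> carrier (dsv S V) ==> g \<in> carrier (dsv S V) ==> (\<And>s. s \<in> S ==> f s = g s) ==> f = g"
 unfolding dsv_carrier by (intro ext) metis

lemma dsv_pointwise:
 assumes V: "\<And>s. s \<in> S ==> module K (V s)" and f: "f \<in> carrier (dsv S V)"
  and h: "\<And>s. s \<in> S ==> h s (f s) \<in> carrier (W s)" "\<And>s. s \<in> S ==> h s \<zero>[V s] = \<zero>[W s]"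
 shows "(\<lambda>s. if s \<in> S then h s (f s) else undefined) \<in> carrier (dsv S W)"
proof -
 have "{s\<in>S. (if s \<in> S then h s (f s) else undefined) \<noteq> \<zero>[W s]} \<subseteq> {s\<in>S. f s \<noteq> \<zero>[V s]}"
  using h(2) by auto
 then have "finite {s\<in>S. (if s \<in> S then h s (f s) else undefined) \<noteq> \<zero>[W s]}"
  using f finite_subset unfolding dsv_carrier by blast
 then show ?thesis using f h(1) unfolding dsv_carrier by simp
qed

lemma dsv_module:
 assumes V: "\<And>s. s \<in> S ==> module K (V s)"
 shows "module K (dsv S V)"
proof -
 have sm: "(\<lambda>s. if s \<in> S then a \<odot>[V s] f s else undefined) \<in> carrier (dsv S V)"
  if a: "a \<in> carrier K" and f: "f \<in> carrier (dsv S V)" for a f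
  using f a by (intro dsv_pointwise[OF V, where h = "\<lambda>s v. a \<odot>[V s] v"])
   (auto simp: dsv_carrier module_smult[OF V] module.smult_r_null[OF V])
 have ad: "(\<lambda>s. if s \<in> S then f s \<oplus>[V s] g s else undefined) \<in> carrier (dsv S V)"
  if f: "f \<in> carrier (dsv S V)" and g: "g \<in> carrier (dsv S V)" for f g
 proof -
  have z: "\<zero>[V s] \<oplus>[V s] \<zero>[V s] = \<zero>[V s]" if "s \<in> S" for s
  proof -
   interpret V: module K "V s" by (rule V[OF that])
   show ?thesis by simp
  qed
  have "{s\<in>S. (if s \<in> S then f s \<oplus>[V s] g s else undefined) \<noteq> \<zero>[V s]} \<subseteq>
    {s\<in>S. f s \<noteq> \<zero>[V s]} \<union> {s\<in>S. g s \<noteq> \<zero>[V s]}"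
   using z by auto
  then have "finite {s\<in>S. (if s \<in> S then f s \<oplus>[V s] g s else undefined) \<noteq> \<zero>[V s]}"
   using f g finite_subset[OF _ finite_UnI] unfolding dsv_carrier by blast
  then show ?thesis using f g module_add[OF V] unfolding dsv_carrier by auto
 qed
 have ze: "(\<lambda>s. if s \<in> S then \<zero>[V s] else undefined) \<in> carrier (dsv S V)"
  using module_zero[OF V] by (auto simp: dsv_carrier)
 have pt: "f s \<in> carrier (V s)" if "f \<in> carrier (dsv S V)" "s \<in> S" for f s using that by (simp add: dsv_carrier)
 show ?thesis
  by (rule module_of_eval[where ev = "\<lambda>s f. f s", OF V]) (auto simp: dsv_ops ze ad sm pt linear_map_def intro: dsv_ext)
qed

lemma dsv_comp: "s \<in> S ==> linear_map K (dsv S V) (V s) (\<lambda>f. f s)"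
 by (rule linI) (auto simp: dsv_carrier dsv_ops)

lemma di_linear:
 assumes V: "\<And>s. s \<in> S ==> module K (V s)" and s: "s \<in> S"
 shows "linear_map K (V s) (dsv S V) (di S V s)"
proof -
 have f: "finite {t \<in> S. di S V s v t \<noteq> \<zero>[V t]}" for v
  by (rule finite_subset[of _ "{s}"]) (auto simp: di_def)
 have z: "\<zero>[V t] \<oplus>[V t] \<zero>[V t] = \<zero>[V t]" "a \<in> carrier K ==> a \<odot>[V t] \<zero>[V t] = \<zero>[V t]" if "t \<in> S" for t a
 proof -
  interpret V: module K "V t" by (rule V[OF that])
  show "\<zero>[V t] \<oplus>[V t] \<zero>[V t] = \<zero>[V t]" "a \<in> carrier K ==> a \<odot>[V t] \<zero>[V t] = \<zero>[V t]" by simp_all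
 qed
 show ?thesis
 proof (rule linI)
  fix v assume "v \<in> carrier (V s)"
  then show "di S V s v \<in> carrier (dsv S V)"
   using f s module_zero[OF V] by (auto simp: dsv_carrier di_def)
 qed (use s z in \<open>auto simp: dsv_ops di_def fun_eq_iff\<close>)
qed

text \<open>A family is the finite sum of its components; the induction runs over a finite set
  containing the support and removes one component at a time.\<close>

lemma dsv_mem:
 assumes V: "\<And>s. s \<in> S ==> module K (V s)" and N: "submodule N K (dsv S V)"
  and f: "f \<in> carrier (dsv S V)" and m: "\<And>s. s \<in> S ==> di S V s (f s) \<in> N"
 shows "f \<in> N"
proof -
 have DM: "module K (dsv S V)" by (rule dsv_module[OF V])
 note ND = submoduleD[OF DM N]
 have "\<forall>f\<in>carrier (dsv S V). {s\<in>S. f s \<noteq> \<zero>[V s]} \<subseteq> A --> (\<forall>s\<in>S. di S V s (f s) \<in> N) --> f \<in> N"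
  if "finite A" for A
  using that
 proof (induction A)
  case empty
  have "f = \<zero>[dsv S V]" if "f \<in> carrier (dsv S V)" "{s\<in>S. f s \<noteq> \<zero>[V s]} \<subseteq> {}" for f
   using that by (intro dsv_ext[OF that(1) module_zero[OF DM]]) (auto simp: dsv_ops)
  then show ?case using ND(2) by auto
 next
  case (insert a A)
  show ?case
  proof (intro ballI impI)
   fix f assume f: "f \<in> carrier (dsv S V)" and sp: "{s\<in>S. f s \<noteq> \<zero>[V s]} \<subseteq> insert a A"
    and fn: "\<forall>s\<in>S. di S V s (f s) \<in> N"
   show "f \<in> N"
   proof (cases "a \<in> S")
    case False
    then show ?thesis using insert(3) f sp fn by auto
   next
    case True
    let ?g = "f(a := \<zero>[V a])"
    have sub: "{s\<in>S. ?g s \<noteq> \<zero>[V s]} \<subseteq> {s\<in>S. f s \<noteq> \<zero>[V s]}" by auto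
    have g: "?g \<in> carrier (dsv S V)"
     using f sub finite_subset[OF sub] module_zero[OF V[OF True]] True unfolding dsv_carrier by auto
    have gA: "{s\<in>S. ?g s \<noteq> \<zero>[V s]} \<subseteq> A" using sp by auto
    have dz: "di S V a \<zero>[V a] = \<zero>[dsv S V]"
     by (rule lin_zero[OF V[OF True] DM di_linear[where V = V, OF V True]])
    have gn: "\<forall>s\<in>S. di S V s (?g s) \<in> N" using fn dz ND(2) by auto
    have fs: "f s \<in> carrier (V s)" if "s \<in> S" for s using f that by (simp add: dsv_carrier)
    have "f = di S V a (f a) \<oplus>[dsv S V] ?g"
    proof (rule dsv_ext[OF f module_add[OF DM lin_closed[OF di_linear[where V = V, OF V True] fs[OF True]] g]])
     fix s assume s: "s \<in> S"
     interpret V: module K "V s" by (rule V[OF s])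
     show "f s = (di S V a (f a) \<oplus>[dsv S V] ?g) s"
      using s V.l_zero[OF fs[OF s]] V.r_zero[OF fs[OF s]] by (auto simp: dsv_ops di_def)
    qed
    then show ?thesis using ND(3)[of "di S V a (f a)" ?g] fn True insert(3) g gA gn by simp
   qed
  qed
 qed
 then show ?thesis using f m by (auto simp: dsv_carrier)
qed

definition dso :: "'s set => ('s => ('k, 'u) module) => ('k, 'w) module => ('s => 'u => 'w) => ('s => 'u) => 'w" where
 "dso S V W h f = (\<Oplus>\<^bsub>W\<^esub>s\<in>{s\<in>S. f s \<noteq> \<zero>[V s]}. h s (f s))"

lemma dso_props:
 assumes V: "\<And>s. s \<in> S ==> module K (V s)" and W: "module K W" and h: "\<And>s. s \<in> S ==> linear_map K (V s) W (h s)"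
 shows dso_linear: "linear_map K (dsv S V) W (dso S V W h)"
  and dso_di: "s \<in> S ==> v \<in> carrier (V s) ==> dso S V W h (di S V s v) = h s v"
proof -
 interpret W: module K W by fact
 let ?s = "\<lambda>f. {s\<in>S. f s \<noteq> \<zero>[V s]}"
 have hz: "h s \<zero>[V s] = \<zero>[W]" if "s \<in> S" for s by (rule lin_zero[OF V[OF that] W h[OF that]])
 have hc: "h s (f s) \<in> carrier W" if "f \<in> carrier (dsv S V)" "s \<in> S" for f s
  using that lin_closed[OF h] by (simp add: dsv_carrier)
 have eq: "dso S V W h f = (\<Oplus>\<^bsub>W\<^esub>s\<in>A. h s (f s))"
  if "f \<in> carrier (dsv S V)" "finite A" "?s f \<subseteq> A" "A \<subseteq> S" for f A
  unfolding dso_def using that hc[OF that(1)]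
  by (intro W.add.finprod_mono_neutral_cong_left) (auto simp: hz)
 have DM: "module K (dsv S V)" by (rule dsv_module[OF V])
 show "linear_map K (dsv S V) W (dso S V W h)"
 proof (rule linI)
  fix f assume f: "f \<in> carrier (dsv S V)"
  have fin: "finite (?s f)" using f by (simp add: dsv_carrier)
  have fs: "f s \<in> carrier (V s)" if "s \<in> S" for s using f that by (simp add: dsv_carrier)
  show "dso S V W h f \<in> carrier W" unfolding dso_def using hc[OF f] by (intro W.finsum_closed) auto
  fix a assume a: "a \<in> carrier K"
  have sub: "?s (a \<odot>[dsv S V] f) \<subseteq> ?s f" using module.smult_r_null[OF V a] by (auto simp: dsv_ops)
  have "dso S V W h (a \<odot>[dsv S V] f) = (\<Oplus>\<^bsub>W\<^esub>s\<in>?s f. h s ((a \<odot>[dsv S V] f) s))"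
   by (rule eq[OF module_smult[OF DM a f] fin sub]) auto
  also have "\<dots> = (\<Oplus>\<^bsub>W\<^esub>s\<in>?s f. a \<odot>[W] h s (f s))"
   using a hc[OF f] fs by (intro W.finsum_cong') (auto simp: dsv_ops lin_smult[OF h])
  also have "\<dots> = a \<odot>[W] dso S V W h f"
   unfolding dso_def using fin a hc[OF f] by (intro W.finsum_smult_ldistr[symmetric]) auto
  finally show "dso S V W h (a \<odot>[dsv S V] f) = a \<odot>[W] dso S V W h f" .
 next
  fix f g assume f: "f \<in> carrier (dsv S V)" and g: "g \<in> carrier (dsv S V)"
  let ?A = "?s f \<union> ?s g"
  have A: "finite ?A" "?A \<subseteq> S" using f g by (auto simp: dsv_carrier)
  have fs: "f s \<in> carrier (V s)" "g s \<in> carrier (V s)" if "s \<in> S" for s using f g that by (simp_all add: dsv_carrier)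
  have z: "\<zero>[V s] \<oplus>[V s] \<zero>[V s] = \<zero>[V s]" if "s \<in> S" for s
  proof -
   interpret V: module K "V s" by (rule V[OF that])
   show ?thesis by simp
  qed
  have sub: "?s (f \<oplus>[dsv S V] g) \<subseteq> ?A" using z by (auto simp: dsv_ops)
  have "dso S V W h (f \<oplus>[dsv S V] g) = (\<Oplus>\<^bsub>W\<^esub>s\<in>?A. h s ((f \<oplus>[dsv S V] g) s))"
   by (rule eq[OF module_add[OF DM f g] A(1) sub A(2)])
  also have "\<dots> = (\<Oplus>\<^bsub>W\<^esub>s\<in>?A. h s (f s) \<oplus>[W] h s (g s))"
   using A hc[OF f] hc[OF g] fs by (intro W.finsum_cong') (auto simp: dsv_ops lin_add[OF h])
  also have "\<dots> = (\<Oplus>\<^bsub>W\<^esub>s\<in>?A. h s (f s)) \<oplus>[W] (\<Oplus>\<^bsub>W\<^esub>s\<in>?A. h s (g s))"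
   using A hc[OF f] hc[OF g] by (intro W.finsum_addf) auto
  also have "\<dots> = dso S V W h f \<oplus>[W] dso S V W h g"
   using eq[OF f A(1) _ A(2)] eq[OF g A(1) _ A(2)] by simp
  finally show "dso S V W h (f \<oplus>[dsv S V] g) = dso S V W h f \<oplus>[W] dso S V W h g" .
 qed
 show "dso S V W h (di S V s v) = h s v" if s: "s \<in> S" and v: "v \<in> carrier (V s)"
 proof -
  have "dso S V W h (di S V s v) = (\<Oplus>\<^bsub>W\<^esub>t\<in>{s}. h t (di S V s v t))"
   using s by (intro eq[OF lin_closed[OF di_linear[where V = V, OF V s] v]]) (auto simp: di_def)
  then show ?thesis using lin_closed[OF h[OF s] v] by (simp add: di_def)
 qed
qed

subsection \<open>Transport into the universe\<close>

definition uenc :: "'a set => 'a => 'u" where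
 "uenc A = (SOME e. inj_on e A)"

lemma uenc_inj: "A \<lesssim> (UNIV :: 'u set) ==> inj_on (uenc A :: 'a => 'u) A"
 unfolding uenc_def lepoll_def by (rule someI_ex[of "\<lambda>e. inj_on e A"]) auto

text \<open>Transport of structure along an injection of each carrier into \<open>'u\<close>. It
  brings representables (valued in morphisms), direct sums (valued in functions) and the bimodule
  \<open>C\<close> into the universe. The encoding at \<open>x\<close> depends on the carrier at
  \<open>x\<close> only, which \<open>sec_projective\<close> exploits.\<close>

definition trk :: "('o, 'm, 'k, 'w) kmod => ('o, 'm, 'k, 'u) kmod" where
 "trk F = \<lparr>val = (\<lambda>x. let A = el F x; e = uenc A; d = inv_into A e in
    \<lparr>carrier = e ` A, mult = undefined, one = undefined, zero = e \<zero>[val F x],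
    add = (\<lambda>u v. e (d u \<oplus>[val F x] d v)), smult = (\<lambda>a u. e (a \<odot>[val F x] d u))\<rparr>),
   act = (\<lambda>x y f u. uenc (el F y) (act F x y f (inv_into (el F x) (uenc (el F x)) u)))\<rparr>"

definition tre :: "('o, 'm, 'k, 'w) kmod => 'o => 'w => 'u" where
 "tre F x = uenc (el F x)"

definition trd :: "('o, 'm, 'k, 'w) kmod => 'o => 'u => 'w" where
 "trd F x = inv_into (el F x) (uenc (el F x))"

lemma trk_props:
 fixes F :: "('o, 'm, 'k, 'w) kmod"
 assumes D: "k_category K D" and F: "k_module K D F"
  and small: "\<And>x. x \<in> Ob D ==> el F x \<lesssim> (UNIV :: 'u set)"
 shows trk_module: "k_module K D (trk F :: ('o, 'm, 'k, 'u) kmod)"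
  and tre_nt: "nt D F (trk F :: ('o, 'm, 'k, 'u) kmod) (tre F)"
  and trd_nt: "nt D (trk F :: ('o, 'm, 'k, 'u) kmod) F (trd F)"
  and trd_tre: "x \<in> Ob D ==> v \<in> el F x ==> trd F x (tre F x v :: 'u) = v"
  and tre_trd: "x \<in> Ob D ==> u \<in> el (trk F :: ('o, 'm, 'k, 'u) kmod) x ==> tre F x (trd F x u) = u"
proof -
 let ?G = "trk F :: ('o, 'm, 'k, 'u) kmod"
 have s: "el ?G x = tre F x ` el F x" "\<zero>[val ?G x] = tre F x \<zero>[val F x]"
  "u \<oplus>[val ?G x] v = tre F x (trd F x u \<oplus>[val F x] trd F x v)"
  "a \<odot>[val ?G x] v = tre F x (a \<odot>[val F x] trd F x v)"
  "act ?G x y f v = tre F y (act F x y f (trd F x v))" for x y f a u v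
  by (simp_all add: trk_def tre_def trd_def Let_def)
 have dt: "trd F x (tre F x v :: 'u) = v" if "x \<in> Ob D" "v \<in> el F x" for x v
  unfolding trd_def tre_def by (rule inv_into_f_f[OF uenc_inj[OF small[OF that(1)]] that(2)])
 note im = kmod_image[OF D F, of ?G "tre F", unfolded s, OF refl refl]
 show g: "k_module K D ?G" by (rule im(1)) (simp_all add: dt)
 show "nt D F ?G (tre F)" by (rule im(2)) (simp_all add: dt)
 show "x \<in> Ob D ==> v \<in> el F x ==> trd F x (tre F x v :: 'u) = v" by (rule dt)
 show "x \<in> Ob D ==> u \<in> el ?G x ==> tre F x (trd F x u) = u" by (auto simp: s dt)
 show "nt D ?G F (trd F)"
  by (intro ntI linI) (auto simp: s dt act_in[OF F] module_add[OF val_mod[OF F]] module_smult[OF val_mod[OF F]])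
qed

subsection \<open>Direct sums of modules\<close>

definition dsr :: "'s set => ('s => ('o, 'm, 'k, 'u) kmod) => ('o, 'm, 'k, 's => 'u) kmod" where
 "dsr S M = \<lparr>val = (\<lambda>x. dsv S (\<lambda>s. val (M s) x)),
   act = (\<lambda>x y \<phi> f s. if s \<in> S then act (M s) x y \<phi> (f s) else undefined)\<rparr>"

lemma dsr_simps [simp]:
 "val (dsr S M) x = dsv S (\<lambda>s. val (M s) x)"
 "act (dsr S M) x y \<phi> f = (\<lambda>s. if s \<in> S then act (M s) x y \<phi> (f s) else undefined)"
 by (simp_all add: dsr_def)

lemma dsr_module:
 assumes D: "k_category K D" and M: "\<And>s. s \<in> S ==> k_module K D (M s)"
 shows "k_module K D (dsr S M)"
proof -
 have m: "module K (dsv S (\<lambda>s. val (M s) x))" if "x \<in> Ob D" for x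
  by (rule dsv_module[OF val_mod[OF M that]])
 have pt: "f s \<in> el (M s) x" if "f \<in> carrier (dsv S (\<lambda>s. val (M s) x))" "s \<in> S" for f s x
  using that by (simp add: dsv_carrier)
 have cl: "(\<lambda>s. if s \<in> S then act (M s) x y \<phi> (f s) else undefined) \<in> carrier (dsv S (\<lambda>s. val (M s) y))"
  if o: "x \<in> Ob D" "y \<in> Ob D" "\<phi> \<in> Mor D x y" and f: "f \<in> carrier (dsv S (\<lambda>s. val (M s) x))" for x y \<phi> f
  by (rule dsv_pointwise[OF val_mod[OF M o(1)] f])
   (simp_all add: act_in[OF M o] pt[OF f] lin_zero[OF val_mod[OF M o(1)] val_mod[OF M o(2)] act_lin[OF M o]] M)
 show ?thesis
  unfolding k_module_def dsr_simps(1)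
 proof (intro conjI ballI)
  show "module K (dsv S (\<lambda>s. val (M s) x))" if "x \<in> Ob D" for x by (rule m[OF that])
  show "bilinear_map K (Hom D x y) (dsv S (\<lambda>s. val (M s) x)) (dsv S (\<lambda>s. val (M s) y)) (act (dsr S M) x y)"
   if o: "x \<in> Ob D" "y \<in> Ob D" for x y
   unfolding bilinear_map_def
  proof (intro conjI ballI linI)
   fix \<phi> f assume \<phi>: "\<phi> \<in> Mor D x y" and f: "f \<in> carrier (dsv S (\<lambda>s. val (M s) x))"
   show "act (dsr S M) x y \<phi> f \<in> carrier (dsv S (\<lambda>s. val (M s) y))" using cl[OF o \<phi> f] by simp
   then show "act (dsr S M) x y \<phi> f \<in> carrier (dsv S (\<lambda>s. val (M s) y))" .
  qed (auto simp: dsv_ops fun_eq_iff pt bilin_simps[OF act_bilin[OF M o]])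
  show "act (dsr S M) x x (Id D x) f = f"
   if "x \<in> Ob D" "f \<in> carrier (dsv S (\<lambda>s. val (M s) x))" for x f
   using that(2) by (intro ext) (simp add: act_id[OF M that(1)] dsv_carrier)
 qed (auto simp: fun_eq_iff pt act_comp[OF M])
qed

definition dsum :: "'s set => ('s => ('o, 'm, 'k, 'u) kmod) => ('o, 'm, 'k, 'u) kmod" where
 "dsum S M = trk (dsr S M)"

definition dcmp :: "'s set => ('s => ('o, 'm, 'k, 'u) kmod) => 's => 'o => 'u => 'u" where
 "dcmp S M s x u = trd (dsr S M) x u s"

definition dinj :: "'s set => ('s => ('o, 'm, 'k, 'u) kmod) => 's => 'o => 'u => 'u" where
 "dinj S M s x v = tre (dsr S M) x (di S (\<lambda>s. val (M s) x) s v)"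

definition dout :: "'s set => ('s => ('o, 'm, 'k, 'u) kmod) => ('o, 'm, 'k, 'w) kmod => ('s => 'o => 'u => 'w) => 'o => 'u => 'w" where
 "dout S M N h x u = dso S (\<lambda>s. val (M s) x) (val N x) (\<lambda>s. h s x) (trd (dsr S M) x u)"

text \<open>The interface to direct sums. Afterwards \<open>dsum\<close> is unfolded only in
  \<open>sec_projective\<close>, where two direct sums have to be equal and not just
  isomorphic.\<close>

lemma dsum_props:
 fixes M :: "'s => ('o, 'm, 'k, 'u) kmod"
 assumes D: "k_category K D" and M: "\<And>s. s \<in> S ==> k_module K D (M s)"
  and inf: "infinite (UNIV :: 'u set)" and S: "S \<lesssim> (UNIV :: 'u set)"
 shows dsum_module: "k_module K D (dsum S M)"
  and dcmp_nt: "s \<in> S ==> nt D (dsum S M) (M s) (dcmp S M s)"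
  and dinj_nt: "s \<in> S ==> nt D (M s) (dsum S M) (dinj S M s)"
  and dcmp_dinj: "x \<in> Ob D ==> s \<in> S ==> t \<in> S ==> v \<in> el (M s) x ==>
   dcmp S M t x (dinj S M s x v) = (if t = s then v else \<zero>[val (M t) x])"
  and dsum_ext: "x \<in> Ob D ==> u \<in> el (dsum S M) x ==> v \<in> el (dsum S M) x ==>
   (\<And>s. s \<in> S ==> dcmp S M s x u = dcmp S M s x v) ==> u = v"
  and dsum_finite: "x \<in> Ob D ==> u \<in> el (dsum S M) x ==> finite {s\<in>S. dcmp S M s x u \<noteq> \<zero>[val (M s) x]}"
  and dsum_make: "x \<in> Ob D ==> (\<And>s. s \<in> S ==> f s \<in> el (M s) x) ==> finite {s\<in>S. f s \<noteq> \<zero>[val (M s) x]} ==>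
   \<exists>u\<in>el (dsum S M) x. \<forall>s\<in>S. dcmp S M s x u = f s"
  and dsum_mem: "x \<in> Ob D ==> submodule N K (val (dsum S M) x) ==> u \<in> el (dsum S M) x ==>
   (\<And>s. s \<in> S ==> dinj S M s x (dcmp S M s x u) \<in> N) ==> u \<in> N"
  and dout_nt: "k_module K D P ==> (\<And>s. s \<in> S ==> nt D (M s) P (h s)) ==> nt D (dsum S M) P (dout S M P h)"
  and dout_dinj: "k_module K D P ==> (\<And>s. s \<in> S ==> nt D (M s) P (h s)) ==> x \<in> Ob D ==> s \<in> S ==>
   v \<in> el (M s) x ==> dout S M P h x (dinj S M s x v) = h s x v"
proof -
 let ?R = "dsr S M" and ?V = "\<lambda>x s. val (M s) x"
 have R: "k_module K D ?R" by (rule dsr_module[OF D M])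
 \<comment> \<open>On \<open>S\<close> the families are zero with finitely many exceptions, off
   \<open>S\<close> they are \<open>undefined\<close>; this is the default \<open>?k\<close> handed
   to \<open>finite_support_lepoll\<close>.\<close>
 have small: "el ?R x \<lesssim> (UNIV :: 'u set)" for x
 proof -
  let ?k = "\<lambda>s. if s \<in> S then \<zero>[val (M s) x] else undefined"
  have "el ?R x \<subseteq> {f. f ` S \<subseteq> UNIV \<and> {s. f s \<noteq> ?k s} \<subseteq> S \<and> finite {s. f s \<noteq> ?k s}}"
  proof
   fix f assume f: "f \<in> el ?R x"
   have "{s. f s \<noteq> ?k s} = {s\<in>S. f s \<noteq> \<zero>[val (M s) x]}" using f by (auto simp: dsv_carrier)
   then show "f \<in> {f. f ` S \<subseteq> UNIV \<and> {s. f s \<noteq> ?k s} \<subseteq> S \<and> finite {s. f s \<noteq> ?k s}}"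
    using f by (auto simp: dsv_carrier)
  qed
  then show ?thesis
   by (rule lepoll_trans[OF subset_imp_lepoll finite_support_lepoll[OF inf S lepoll_refl]])
 qed
 note t = trk_props[OF D R small]
 have V: "module K (?V x s)" if "x \<in> Ob D" "s \<in> S" for x s by (rule val_mod[OF M[OF that(2)] that(1)])
 show dm: "k_module K D (dsum S M)" unfolding dsum_def by (rule t(1))
 have dec: "nt D (dsum S M) ?R (trd ?R)" unfolding dsum_def by (rule t(3))
 have enc: "nt D ?R (dsum S M) (tre ?R)" unfolding dsum_def by (rule t(2))
 have de: "trd ?R x (tre ?R x v :: 'u) = v" if "x \<in> Ob D" "v \<in> carrier (dsv S (?V x))" for x v
  using t(4)[of x v] that by simp
 have ed: "tre ?R x (trd ?R x u) = u" if "x \<in> Ob D" "u \<in> el (dsum S M) x" for x u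
  using t(5)[of x u] that unfolding dsum_def by simp
 have dc: "trd ?R x u \<in> carrier (dsv S (?V x))" if "x \<in> Ob D" "u \<in> el (dsum S M) x" for x u
  using nt_in[OF dec that] by simp
 have ec: "tre ?R x f \<in> el (dsum S M) x" if "x \<in> Ob D" "f \<in> carrier (dsv S (?V x))" for x f
  using nt_in[OF enc that(1)] that(2) by simp
 have dil: "linear_map K (val (M s) x) (dsv S (?V x)) (di S (?V x) s)" if "x \<in> Ob D" "s \<in> S" for x s
  by (rule di_linear[OF V[OF that(1)] that(2)])
 show "nt D (dsum S M) (M s) (dcmp S M s)" if s: "s \<in> S"
 proof -
  have "nt D ?R (M s) (\<lambda>x f. f s)"
   using s dsv_comp[OF s] by (intro ntI) simp_all
  from nt_compose[OF dec this] show ?thesis unfolding dcmp_def .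
 qed
 have din: "nt D (M s) ?R (\<lambda>x. di S (?V x) s)" if s: "s \<in> S" for s
 proof (rule ntI)
  fix x y f v assume o: "x \<in> Ob D" "y \<in> Ob D" "f \<in> Mor D x y" and v: "v \<in> el (M s) x"
  show "di S (?V y) s (act (M s) x y f v) = act ?R x y f (di S (?V x) s v)"
   using s lin_zero[OF val_mod[OF M o(1)] val_mod[OF M o(2)] act_lin[OF M o]]
   by (intro ext) (auto simp: di_def)
 qed (simp add: dil s)
 show dn: "nt D (M s) (dsum S M) (dinj S M s)" if s: "s \<in> S" for s
  unfolding dinj_def by (rule nt_compose[OF din[OF s] enc])
 show "dcmp S M t x (dinj S M s x v) = (if t = s then v else \<zero>[val (M t) x])"
  if "x \<in> Ob D" "s \<in> S" "t \<in> S" "v \<in> el (M s) x"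
  unfolding dcmp_def dinj_def
  using de[OF that(1) lin_closed[OF dil[OF that(1,2)] that(4)]] that(2,3) by (auto simp: di_def)
 show "u = v" if x: "x \<in> Ob D" and u: "u \<in> el (dsum S M) x" and v: "v \<in> el (dsum S M) x"
  and e: "\<And>s. s \<in> S ==> dcmp S M s x u = dcmp S M s x v"
  using dsv_ext[OF dc[OF x u] dc[OF x v]] e ed[OF x u] ed[OF x v] unfolding dcmp_def by metis
 show "finite {s\<in>S. dcmp S M s x u \<noteq> \<zero>[val (M s) x]}" if "x \<in> Ob D" "u \<in> el (dsum S M) x"
  using dc[OF that] unfolding dcmp_def dsv_carrier by simp
 show "\<exists>u\<in>el (dsum S M) x. \<forall>s\<in>S. dcmp S M s x u = f s"
  if x: "x \<in> Ob D" and f: "\<And>s. s \<in> S ==> f s \<in> el (M s) x" "finite {s\<in>S. f s \<noteq> \<zero>[val (M s) x]}"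
 proof -
  let ?f = "\<lambda>s. if s \<in> S then f s else undefined"
  have "{s\<in>S. ?f s \<noteq> \<zero>[val (M s) x]} = {s\<in>S. f s \<noteq> \<zero>[val (M s) x]}" by auto
  then have c: "?f \<in> carrier (dsv S (?V x))" using f by (auto simp: dsv_carrier)
  show ?thesis by (rule bexI[OF _ ec[OF x c]]) (simp add: dcmp_def de[OF x c])
 qed
 show "u \<in> N" if x: "x \<in> Ob D" and N: "submodule N K (val (dsum S M) x)" and u: "u \<in> el (dsum S M) x"
  and m: "\<And>s. s \<in> S ==> dinj S M s x (dcmp S M s x u) \<in> N"
 proof -
  let ?N = "{f \<in> el ?R x. tre ?R x f \<in> N}"
  have N': "submodule ?N K (dsv S (?V x))"
   using submodule_preimage[OF val_mod[OF R x] val_mod[OF dm x] nt_lin[OF enc x] N] by simp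
  have "trd ?R x u \<in> ?N"
  proof (rule dsv_mem[OF V[OF x] N' dc[OF x u]])
   fix s assume s: "s \<in> S"
   have "trd ?R x u s \<in> el (M s) x" using dc[OF x u] s by (simp add: dsv_carrier)
   then show "di S (?V x) s (trd ?R x u s) \<in> ?N"
    using m[OF s] lin_closed[OF dil[OF x s]] by (simp add: dinj_def dcmp_def)
  qed
  then show ?thesis using ed[OF x u] by simp
 qed
 fix P :: "('o, 'm, 'k, 'w) kmod" and h
 assume P: "k_module K D P" and h: "\<And>s. s \<in> S ==> nt D (M s) P (h s)"
 note hl = nt_lin[OF h]
 have dl: "linear_map K (dsv S (?V x)) (val P x) (dso S (?V x) (val P x) (\<lambda>s. h s x))" if x: "x \<in> Ob D" for x
  by (rule dso_linear[where V = "?V x" and h = "\<lambda>s. h s x", OF V[OF x] val_mod[OF P x] hl[OF _ x]])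
 have dd: "dso S (?V x) (val P x) (\<lambda>s. h s x) (di S (?V x) s v) = h s x v"
  if x: "x \<in> Ob D" and "s \<in> S" "v \<in> el (M s) x" for x s v
  by (rule dso_di[where V = "?V x" and h = "\<lambda>s. h s x", OF V[OF x] val_mod[OF P x] hl[OF _ x] that(2,3)])
 have "nt D ?R P (\<lambda>x. dso S (?V x) (val P x) (\<lambda>s. h s x))"
 proof (rule ntI)
  fix x y \<phi> f assume o: "x \<in> Ob D" "y \<in> Ob D" "\<phi> \<in> Mor D x y" and f: "f \<in> el ?R x"
  let ?l = "\<lambda>f. dso S (?V y) (val P y) (\<lambda>s. h s y) (act ?R x y \<phi> f)"
  let ?r = "\<lambda>f. act P x y \<phi> (dso S (?V x) (val P x) (\<lambda>s. h s x) f)"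
  have l: "linear_map K (val ?R x) (val P y) ?l"
   using lin_comp[OF act_lin[OF R o]] dl[OF o(2)] by simp
  have r: "linear_map K (val ?R x) (val P y) ?r"
   using lin_comp[OF _ act_lin[OF P o]] dl[OF o(1)] by simp
  have "f \<in> {f \<in> el ?R x. ?l f = ?r f}"
  proof (rule dsv_mem[OF V[OF o(1)]])
   show "submodule {f \<in> el ?R x. ?l f = ?r f} K (dsv S (?V x))"
    using submodule_equalizer[OF val_mod[OF R o(1)] val_mod[OF P o(2)] l r] by simp
   show "f \<in> carrier (dsv S (?V x))" using f by simp
   fix s assume s: "s \<in> S"
   have fs: "f s \<in> el (M s) x" using f s by (simp add: dsv_carrier)
   have "act ?R x y \<phi> (di S (?V x) s (f s)) = di S (?V y) s (act (M s) x y \<phi> (f s))"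
    using nt_nat[OF din[OF s] o fs] by simp
   then show "di S (?V x) s (f s) \<in> {f \<in> el ?R x. ?l f = ?r f}"
    using lin_closed[OF dil[OF o(1) s] fs] dd[OF o(2) s act_in[OF M[OF s] o fs]] dd[OF o(1) s fs]
     nt_nat[OF h[OF s] o fs] by (simp del: dsr_simps(2))
  qed
  then show "?l f = ?r f" by simp
 qed (simp add: dl)
 then show "nt D (dsum S M) P (dout S M P h)" unfolding dout_def by (rule nt_compose[OF dec])
 show "dout S M P h x (dinj S M s x v) = h s x v" if x: "x \<in> Ob D" and s: "s \<in> S" and v: "v \<in> el (M s) x"
  for x s v
  unfolding dout_def dinj_def using de[OF x lin_closed[OF dil[OF x s] v]] dd[OF x s v] by simp
qed

subsection \<open>Representable and free modules\<close>

definition hrep :: "('o, 'k, 'm) kcat => 'o => ('o, 'm, 'k, 'm) kmod" where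
 "hrep D x = \<lparr>val = (\<lambda>y. Hom D x y), act = (\<lambda>y z g f. Comp D x y z g f)\<rparr>"

lemma hrep_simps [simp]: "val (hrep D x) y = Hom D x y" "act (hrep D x) y z g f = Comp D x y z g f"
 by (simp_all add: hrep_def)

lemma hrep_module:
 assumes D: "k_category K D" and x: "x \<in> Ob D"
 shows "k_module K D (hrep D x)"
proof -
 have "act (hrep D x) y z = Comp D x y z" for y z by (simp add: fun_eq_iff)
 then show ?thesis
  unfolding k_module_def
  using hom_mod[OF D x] comp_bilin[OF D x] comp_idl[OF D x] comp_assoc[OF D x] by simp
qed

definition repu :: "('o, 'k, 'm) kcat => 'o => ('o, 'm, 'k, 'u) kmod" where
 "repu D x = trk (hrep D x)"

definition ru :: "('o, 'k, 'm) kcat => 'o => 'o => 'm => 'u" where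
 "ru D x = tre (hrep D x)"

text \<open>\<open>repu D x\<close> is \<open>D(x, -)\<close> seen through the encoding
  \<open>ru\<close>; \<open>yon\<close> is the existence half of the Yoneda lemma.\<close>

lemma repu_props:
 fixes D :: "('o, 'k, 'm) kcat"
 assumes sD: "small_k_category TYPE('u) K D" and x: "x \<in> Ob D"
 shows repu_module: "k_module K D (repu D x :: ('o, 'm, 'k, 'u) kmod)"
  and ru_lin: "y \<in> Ob D ==> linear_map K (Hom D x y) (val (repu D x :: ('o, 'm, 'k, 'u) kmod) y) (ru D x y)"
  and ru_surj: "y \<in> Ob D ==> u \<in> el (repu D x :: ('o, 'm, 'k, 'u) kmod) y ==> \<exists>f\<in>Mor D x y. u = ru D x y f"
  and ru_act: "y \<in> Ob D ==> z \<in> Ob D ==> f \<in> Mor D x y ==> g \<in> Mor D y z ==>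
   act (repu D x :: ('o, 'm, 'k, 'u) kmod) y z g (ru D x y f) = ru D x z (Comp D x y z g f)"
  and yon: "k_module K D N ==> v \<in> el N x ==>
   \<exists>h. nt D (repu D x :: ('o, 'm, 'k, 'u) kmod) N h \<and> (\<forall>y\<in>Ob D. \<forall>f\<in>Mor D x y. h y (ru D x y f) = act N x y f v)"
proof -
 let ?H = "hrep D x"
 note D = small_cat[OF sD]
 note H = hrep_module[OF D x]
 have small: "el ?H y \<lesssim> (UNIV :: 'u set)" if "y \<in> Ob D" for y using small_hom[OF sD x that] by simp
 note t = trk_props[OF D H small]
 show "k_module K D (repu D x :: ('o, 'm, 'k, 'u) kmod)" unfolding repu_def by (rule t(1))
 have e: "nt D ?H (repu D x :: ('o, 'm, 'k, 'u) kmod) (ru D x)" unfolding repu_def ru_def by (rule t(2))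
 have d: "nt D (repu D x :: ('o, 'm, 'k, 'u) kmod) ?H (trd ?H)" unfolding repu_def by (rule t(3))
 show "linear_map K (Hom D x y) (val (repu D x :: ('o, 'm, 'k, 'u) kmod) y) (ru D x y)" if "y \<in> Ob D"
  using nt_lin[OF e that] by simp
 show "\<exists>f\<in>Mor D x y. u = ru D x y f" if "y \<in> Ob D" "u \<in> el (repu D x :: ('o, 'm, 'k, 'u) kmod) y"
  using nt_in[OF d that] t(5)[OF _ that(1), of u, symmetric] that(2) unfolding ru_def repu_def
  by (intro bexI[of _ "trd ?H y u"]) simp_all
 show "act (repu D x :: ('o, 'm, 'k, 'u) kmod) y z g (ru D x y f) = ru D x z (Comp D x y z g f)"
  if "y \<in> Ob D" "z \<in> Ob D" "f \<in> Mor D x y" "g \<in> Mor D y z"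
  using nt_nat[OF e that(1,2,4)] that(3) by simp
 fix N v assume N: "k_module K D N" and v: "v \<in> el N x"
 have "nt D ?H N (\<lambda>y f. act N x y f v)"
  by (rule ntI) (use bilin_left[OF act_bilin[OF N x] v] act_comp[OF N x _ _ _ _ v] in auto)
 from nt_compose[OF d this] have "nt D (repu D x :: ('o, 'm, 'k, 'u) kmod) N (\<lambda>y u. act N x y (trd ?H y u) v)" .
 moreover have "act N x y (trd ?H y (ru D x y f :: 'u)) v = act N x y f v" if "y \<in> Ob D" "f \<in> Mor D x y" for y f
  using t(4)[OF _ that(1), of f] that(2) unfolding ru_def by simp
 ultimately show "\<exists>h. nt D (repu D x :: ('o, 'm, 'k, 'u) kmod) N h \<and> (\<forall>y\<in>Ob D. \<forall>f\<in>Mor D x y. h y (ru D x y f) = act N x y f v)"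
  by blast
qed

lemma ru_in:
 fixes D :: "('o, 'k, 'm) kcat"
 assumes "small_k_category TYPE('u) K D" "x \<in> Ob D" "y \<in> Ob D" "f \<in> Mor D x y"
 shows "ru D x y f \<in> el (repu D x :: ('o, 'm, 'k, 'u) kmod) y"
 by (rule lin_closed[OF ru_lin[OF assms(1-3)] assms(4)])

lemma ru_id_act:
 fixes D :: "('o, 'k, 'm) kcat"
 assumes sD: "small_k_category TYPE('u) K D" and x: "x \<in> Ob D" and y: "y \<in> Ob D" and f: "f \<in> Mor D x y"
 shows "act (repu D x :: ('o, 'm, 'k, 'u) kmod) x y f (ru D x x (Id D x)) = ru D x y f"
 using ru_act[OF sD x x y id_in[OF small_cat[OF sD] x] f] comp_idr[OF small_cat[OF sD] x y f] by simp

text \<open>By Yoneda a map out of \<open>D(x, -)\<close> is determined by its value at the identity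
  of \<open>x\<close>, and this value is lifted along the surjection \<open>e x\<close>.\<close>

lemma repu_proj:
 fixes D :: "('o, 'k, 'm) kcat"
 assumes sD: "small_k_category TYPE('u) K D" and x: "x \<in> Ob D"
 shows "projective_module K D (repu D x :: ('o, 'm, 'k, 'u) kmod)"
proof (rule projI[OF repu_module[OF assms]])
 note D = small_cat[OF sD]
 let ?R = "repu D x :: ('o, 'm, 'k, 'u) kmod" and ?i = "ru D x x (Id D x) :: 'u"
 have i: "?i \<in> el ?R x" by (rule ru_in[OF sD x x id_in[OF D x]])
 fix M N :: "('o, 'm, 'k, 'u) kmod" and e h
 assume M: "k_module K D M" and N: "k_module K D N" and e: "nt D M N e" and h: "nt D ?R N h"
  and s: "\<And>x. x \<in> Ob D ==> e x ` el M x = el N x"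
 obtain m where m: "m \<in> el M x" "e x m = h x ?i" using s[OF x] nt_in[OF h x i] by (metis imageE)
 obtain h' where h': "nt D ?R M h'" "\<forall>y\<in>Ob D. \<forall>f\<in>Mor D x y. h' y (ru D x y f) = act M x y f m"
  using yon[OF sD x M m(1)] by blast
 have "e y (h' y v) = h y v" if y: "y \<in> Ob D" and v: "v \<in> el ?R y" for y v
 proof -
  obtain f where f: "f \<in> Mor D x y" "v = ru D x y f" using ru_surj[OF sD x y v] by auto
  have "e y (h' y v) = act N x y f (h x ?i)" using f y h'(2) nt_nat[OF e x y f(1) m(1)] m(2) by simp
  also have "\<dots> = h y v" using nt_nat[OF h x y f(1) i] ru_id_act[OF sD x y f(1)] f(2) by simp
  finally show ?thesis .
 qed
 then show "\<exists>h'. nt D ?R M h' \<and> (\<forall>x\<in>Ob D. \<forall>v\<in>el ?R x. e x (h' x v) = h x v)" using h'(1) by blast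
qed

lemma dsum_nt_eq:
 fixes M :: "'s => ('o, 'm, 'k, 'u) kmod"
 assumes D: "k_category K D" and M: "\<And>s. s \<in> S ==> k_module K D (M s)"
  and inf: "infinite (UNIV :: 'u set)" and S: "S \<lesssim> (UNIV :: 'u set)"
  and P: "k_module K D P" and g: "nt D (dsum S M) P g" and h: "nt D (dsum S M) P h"
  and eq: "\<And>s v. s \<in> S ==> v \<in> el (M s) x ==> g x (dinj S M s x v) = h x (dinj S M s x v)"
  and x: "x \<in> Ob D" and u: "u \<in> el (dsum S M) x"
 shows "g x u = h x u"
proof -
 note d = dsum_props[OF D M inf S]
 have dm: "k_module K D (dsum S M)" by (rule d(1))
 have dc: "nt D (dsum S M) (M s) (dcmp S M s)" if "s \<in> S" for s by (rule d(2)) (use that in auto)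
 have dn: "nt D (M s) (dsum S M) (dinj S M s)" if "s \<in> S" for s by (rule d(3)) (use that in auto)
 let ?N = "{u \<in> el (dsum S M) x. g x u = h x u}"
 have "u \<in> ?N"
 proof (rule dsum_mem[OF D M inf S x _ u])
  show "submodule ?N K (val (dsum S M) x)"
   by (rule submodule_equalizer[OF val_mod[OF dm x] val_mod[OF P x] nt_lin[OF g x] nt_lin[OF h x]])
 qed (use eq nt_in[OF dc x] nt_in[OF dn x] u in auto)
 then show ?thesis by simp
qed

lemma dsum_proj:
 fixes M :: "'s => ('o, 'm, 'k, 'u) kmod"
 assumes D: "k_category K D" and inf: "infinite (UNIV :: 'u set)" and S: "S \<lesssim> (UNIV :: 'u set)"
  and p: "\<And>s. s \<in> S ==> projective_module K D (M s)"
 shows "projective_module K D (dsum S M)"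
proof -
 have Mm: "k_module K D (M s)" if "s \<in> S" for s by (rule proj_module[OF p[OF that]])
 have dm: "k_module K D (dsum S M)" by (rule dsum_module[OF D Mm inf S])
 have dn: "nt D (M s) (dsum S M) (dinj S M s)" if "s \<in> S" for s by (rule dinj_nt[OF D Mm inf S that])
 show ?thesis
 proof (rule projI[OF dm])
  fix A B :: "('o, 'm, 'k, 'u) kmod" and e h
  assume A: "k_module K D A" and B: "k_module K D B" and e: "nt D A B e" and h: "nt D (dsum S M) B h"
   and s: "\<And>x. x \<in> Ob D ==> e x ` el A x = el B x"
  have "\<exists>h'. nt D (M s) A h' \<and> (\<forall>x\<in>Ob D. \<forall>v\<in>el (M s) x. e x (h' x v) = h x (dinj S M s x v))"
   if "s \<in> S" for s
   by (rule proj_lift_surj[OF p[OF that] A B e nt_compose[OF dn[OF that] h] s])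
  then obtain h' where h': "\<And>s. s \<in> S ==> nt D (M s) A (h' s)"
   "\<And>s x v. s \<in> S ==> x \<in> Ob D ==> v \<in> el (M s) x ==> e x (h' s x v) = h x (dinj S M s x v)"
   by metis
  have o: "nt D (dsum S M) A (dout S M A h')" by (rule dout_nt[OF D Mm inf S A h'(1)])
  have "e x (dout S M A h' x u) = h x u" if x: "x \<in> Ob D" and u: "u \<in> el (dsum S M) x" for x u
  proof (rule dsum_nt_eq[where M = M, OF D Mm inf S B nt_compose[OF o e] h _ x u])
   fix s v assume sv: "s \<in> S" "v \<in> el (M s) x"
   show "e x (dout S M A h' x (dinj S M s x v)) = h x (dinj S M s x v)"
    using dout_dinj[where M = M and h = h', OF D Mm inf S A h'(1) x sv] h'(2)[OF sv(1) x sv(2)] by simp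
  qed
  then show "\<exists>h'. nt D (dsum S M) A h' \<and> (\<forall>x\<in>Ob D. \<forall>v\<in>el (dsum S M) x. e x (h' x v) = h x v)"
   using o by blast
 qed
qed

definition fc :: "('o, 'k, 'm) kcat => ('o, 'm, 'k, 'u) kmod => ('o, 'm, 'k, 'u) kmod" where
 "fc D M = dsum (SIGMA x:Ob D. el M x) (\<lambda>s. repu D (fst s))"

text \<open>Direct sums of representables. The index type is that of the canonical cover
  \<open>fc\<close>, because no quantifier ranges over index types; \<open>xs\<close> is an
  arbitrary map, so repetitions are allowed.\<close>

definition isfree :: "('o, 'k, 'm) kcat => ('o, 'm, 'k, 'u) kmod => bool" where
 "isfree D P \<longleftrightarrow> (\<exists>(S :: ('o \<times> 'u) set) xs. S \<lesssim> (UNIV :: 'u set) \<and> xs ` S \<subseteq> Ob D \<and> P = dsum S (\<lambda>s. repu D (xs s)))"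

lemma fc_index_small:
 fixes M :: "('o, 'm, 'k, 'u) kmod"
 assumes sD: "small_k_category TYPE('u) K D"
 shows "(SIGMA x:Ob D. el M x) \<lesssim> (UNIV :: 'u set)"
proof -
 have "(SIGMA x:Ob D. el M x) \<subseteq> Ob D \<times> (UNIV :: 'u set)" by auto
 then show ?thesis
  using times_lepoll_infinite[OF small_inf[OF sD] small_ob[OF sD] lepoll_refl] subset_imp_lepoll lepoll_trans by blast
qed

lemma fc_free:
 fixes M :: "('o, 'm, 'k, 'u) kmod"
 assumes sD: "small_k_category TYPE('u) K D"
 shows "isfree D (fc D M)"
 unfolding isfree_def fc_def
 by (rule exI[of _ "SIGMA x:Ob D. el M x"], rule exI[of _ fst]) (use fc_index_small[OF sD] in auto)

lemma free_proj:
 fixes P :: "('o, 'm, 'k, 'u) kmod"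
 assumes sD: "small_k_category TYPE('u) K D" and P: "isfree D P"
 shows "projective_module K D P"
proof -
 obtain S :: "('o \<times> 'u) set" and xs where S: "S \<lesssim> (UNIV :: 'u set)" "xs ` S \<subseteq> Ob D" "P = dsum S (\<lambda>s. repu D (xs s))"
  using P unfolding isfree_def by auto
 show ?thesis unfolding S(3)
  by (rule dsum_proj[OF small_cat[OF sD] small_inf[OF sD] S(1)]) (use S(2) repu_proj[OF sD] in auto)
qed

text \<open>The summand at \<open>(x, v)\<close> is mapped by Yoneda so that the identity of
  \<open>x\<close> goes to \<open>v\<close>; thus every element is hit.\<close>

lemma fc_cover:
 fixes M :: "('o, 'm, 'k, 'u) kmod"
 assumes sD: "small_k_category TYPE('u) K D" and M: "k_module K D M"
 shows "\<exists>p. nt D (fc D M) M p \<and> (\<forall>x\<in>Ob D. p x ` el (fc D M) x = el M x)"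
proof -
 note D = small_cat[OF sD]
 let ?S = "SIGMA x:Ob D. el M x"
 let ?R = "\<lambda>s. repu D (fst s) :: ('o, 'm, 'k, 'u) kmod"
 have R: "k_module K D (?R s)" if "s \<in> ?S" for s using that repu_module[OF sD] by auto
 have "\<exists>h. nt D (?R s) M h \<and> (\<forall>y\<in>Ob D. \<forall>f\<in>Mor D (fst s) y. h y (ru D (fst s) y f) = act M (fst s) y f (snd s))"
  if "s \<in> ?S" for s
  using that yon[OF sD _ M, of "fst s" "snd s"] by auto
 then obtain h where h: "\<And>s. s \<in> ?S ==> nt D (?R s) M (h s)"
  "\<And>s y f. s \<in> ?S ==> y \<in> Ob D ==> f \<in> Mor D (fst s) y ==> h s y (ru D (fst s) y f) = act M (fst s) y f (snd s)"
  by metis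
 note S = fc_index_small[OF sD, of M]
 let ?p = "dout ?S ?R M h"
 have n: "nt D (fc D M) M ?p" unfolding fc_def by (rule dout_nt[OF D R small_inf[OF sD] S M h(1)])
 have "v \<in> ?p x ` el (fc D M) x" if x: "x \<in> Ob D" and v: "v \<in> el M x" for x v
 proof -
  have s: "(x, v) \<in> ?S" using x v by simp
  let ?i = "ru D x x (Id D x) :: 'u"
  have i: "?i \<in> el (?R (x, v)) x" using ru_in[OF sD x x id_in[OF D x]] by simp
  have "dinj ?S ?R (x, v) x ?i \<in> el (fc D M) x"
   unfolding fc_def by (rule nt_in[OF dinj_nt[where M = ?R, OF D R small_inf[OF sD] S s] x i])
  moreover have "?p x (dinj ?S ?R (x, v) x ?i) = v"
   using dout_dinj[where M = ?R and h = h, OF D R small_inf[OF sD] S M h(1) x s i] h(2)[OF s x, of "Id D x"] id_in[OF D x]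
    act_id[OF M x v] by simp
  ultimately show ?thesis by (metis imageI)
 qed
 then show ?thesis using n nt_in[OF n] by (intro exI[of _ ?p]) auto
qed

section \<open>Resolutions\<close>

text \<open>Resolutions are indexed with the augmentation built in: \<open>X 0\<close> is the resolved module and
 \<open>\<delta> n\<close> maps \<open>X (Suc n)\<close> to \<open>X n\<close>.\<close>

definition exseq :: "('o, 'k, 'm) kcat => (nat => ('o, 'm, 'k, 'u) kmod) => (nat => 'o => 'u => 'u) => bool" where
 "exseq D X \<delta> \<longleftrightarrow> (\<forall>n. k_module K D (X n)) \<and> (\<forall>n. nt D (X (Suc n)) (X n) (\<delta> n)) \<and>
   (\<forall>x\<in>Ob D. \<delta> 0 x ` el (X (Suc 0)) x = el (X 0) x) \<and>
   (\<forall>n. \<forall>x\<in>Ob D. \<delta> (Suc n) x ` el (X (Suc (Suc n))) x =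
    {v \<in> el (X (Suc n)) x. \<delta> n x v = \<zero>[val (X n) x]})"

definition projseq :: "('o, 'k, 'm) kcat => (nat => ('o, 'm, 'k, 'u) kmod) => bool" where
 "projseq D X \<longleftrightarrow> (\<forall>n. projective_module K D (X (Suc n)))"

lemma exseqD:
 assumes "exseq D X \<delta>"
 shows ex_mod: "k_module K D (X n)" and ex_nt: "nt D (X (Suc n)) (X n) (\<delta> n)"
  and ex_surj: "x \<in> Ob D ==> v \<in> el (X 0) x ==> \<exists>w\<in>el (X (Suc 0)) x. \<delta> 0 x w = v"
  and ex_lift: "x \<in> Ob D ==> v \<in> el (X (Suc n)) x ==> \<delta> n x v = \<zero>[val (X n) x] ==>
   \<exists>w\<in>el (X (Suc (Suc n))) x. \<delta> (Suc n) x w = v"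
  and ex_dd: "x \<in> Ob D ==> w \<in> el (X (Suc (Suc n))) x ==> \<delta> n x (\<delta> (Suc n) x w) = \<zero>[val (X n) x]"
proof -
 show "k_module K D (X n)" "nt D (X (Suc n)) (X n) (\<delta> n)" using assms by (auto simp: exseq_def)
 have s: "\<delta> 0 x ` el (X (Suc 0)) x = el (X 0) x" if "x \<in> Ob D"
  using assms that by (auto simp: exseq_def)
 have e: "\<delta> (Suc n) x ` el (X (Suc (Suc n))) x =
    {v \<in> el (X (Suc n)) x. \<delta> n x v = \<zero>[val (X n) x]}" if "x \<in> Ob D"
  using assms that by (auto simp: exseq_def)
 show "\<exists>w\<in>el (X (Suc 0)) x. \<delta> 0 x w = v" if "x \<in> Ob D" "v \<in> el (X 0) x"
  using s[OF that(1)] that(2) by (metis imageE)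
 show "\<exists>w\<in>el (X (Suc (Suc n))) x. \<delta> (Suc n) x w = v"
  if "x \<in> Ob D" "v \<in> el (X (Suc n)) x" "\<delta> n x v = \<zero>[val (X n) x]"
 proof -
  have "v \<in> \<delta> (Suc n) x ` el (X (Suc (Suc n))) x" unfolding e[OF that(1)] using that by simp
  then show ?thesis by auto
 qed
 show "\<delta> n x (\<delta> (Suc n) x w) = \<zero>[val (X n) x]" if "x \<in> Ob D" "w \<in> el (X (Suc (Suc n))) x"
 proof -
  have "\<delta> (Suc n) x w \<in> \<delta> (Suc n) x ` el (X (Suc (Suc n))) x" using that by simp
  then show ?thesis unfolding e[OF that(1)] by simp
 qed
qed

lemma exseqI:
 assumes m: "\<And>n. k_module K D (X n)" and n: "\<And>n. nt D (X (Suc n)) (X n) (\<delta> n)"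
  and s: "\<And>x v. x \<in> Ob D ==> v \<in> el (X 0) x ==> \<exists>w\<in>el (X (Suc 0)) x. \<delta> 0 x w = v"
  and l: "\<And>n x v. x \<in> Ob D ==> v \<in> el (X (Suc n)) x ==> \<delta> n x v = \<zero>[val (X n) x] ==>
   \<exists>w\<in>el (X (Suc (Suc n))) x. \<delta> (Suc n) x w = v"
  and d: "\<And>n x w. x \<in> Ob D ==> w \<in> el (X (Suc (Suc n))) x ==> \<delta> n x (\<delta> (Suc n) x w) = \<zero>[val (X n) x]"
 shows "exseq D X \<delta>"
 unfolding exseq_def
proof (intro conjI allI ballI)
 fix x assume x: "x \<in> Ob D"
 show "\<delta> 0 x ` el (X (Suc 0)) x = el (X 0) x"
  using s[OF x] nt_in[OF n x] by force
 fix k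
 show "\<delta> (Suc k) x ` el (X (Suc (Suc k))) x =
    {v \<in> el (X (Suc k)) x. \<delta> k x v = \<zero>[val (X k) x]}" (is "?L = ?R")
 proof
  show "?L \<subseteq> ?R" using d[OF x] nt_in[OF n x] by auto
  show "?R \<subseteq> ?L" using l[OF x] by blast
 qed
qed (simp_all add: m n)

lemma free_resolution:
 fixes M :: "('o, 'm, 'k, 'u) kmod"
 assumes sD: "small_k_category TYPE('u) K D" and M: "k_module K D M"
 shows "\<exists>X \<delta>. X 0 = M \<and> exseq D X \<delta> \<and> (\<forall>n. isfree D (X (Suc n)))"
proof -
 note D = small_cat[OF sD]
 define cov :: "('o, 'm, 'k, 'u) kmod => 'o => 'u => 'u" where
  "cov N = (SOME p. nt D (fc D N) N p \<and> (\<forall>x\<in>Ob D. p x ` el (fc D N) x = el N x))" for N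
 have cov: "nt D (fc D N) N (cov N) \<and> (\<forall>x\<in>Ob D. cov N x ` el (fc D N) x = el N x)"
  if "k_module K D N" for N
  unfolding cov_def by (rule someI_ex[OF fc_cover[OF sD that]])
 define ker where "ker N = subk (fc D N) (\<lambda>x. {v \<in> el (fc D N) x. cov N x v = \<zero>[val N x]})" for N
 have fm: "k_module K D (fc D N)" for N :: "('o, 'm, 'k, 'u) kmod"
  by (rule proj_module[OF free_proj[OF sD fc_free[OF sD]]])
 have sf: "subf D (fc D N) (\<lambda>x. {v \<in> el (fc D N) x. cov N x v = \<zero>[val N x]})" if "k_module K D N" for N
  using subf_kernel[OF fm that] cov[OF that] by blast
 have km: "k_module K D (ker N)" if "k_module K D N" for N
  unfolding ker_def by (rule subk_module[OF fm sf[OF that] D])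
 \<comment> \<open>The \<open>n\<close>-th syzygy, with \<open>M\<close> itself as the zeroth. The
   term \<open>X (Suc n)\<close> is the free cover of \<open>Z n\<close>, and the differential is
   this cover followed by the inclusion of \<open>Z n\<close> into \<open>X n\<close>.\<close>
 define Z where "Z n = (ker ^^ n) M" for n
 have Z: "k_module K D (Z n)" for n by (induction n) (auto simp: Z_def M km)
 define X where "X n = (case n of 0 => M | Suc n => fc D (Z n))" for n
 have XS: "X (Suc n) = fc D (Z n)" for n by (simp add: X_def)
 have XZ: "el (Z (Suc n)) x = {v \<in> el (X (Suc n)) x. cov (Z n) x v = \<zero>[val (Z n) x]}" for n x
  by (simp add: XS Z_def ker_def)
 have zz: "\<zero>[val (Z n) x] = \<zero>[val (X n) x]" for n x by (cases n) (auto simp: X_def Z_def ker_def)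
 have Zn: "nt D (Z n) (X n) (\<lambda>x v. v)" for n
 proof (cases n)
  case 0 then show ?thesis by (simp add: X_def Z_def nt_id)
 next
  case (Suc m)
  then show ?thesis using subk_incl[OF fm sf[OF Z[of m]]] by (simp add: X_def Z_def ker_def)
 qed
 have cs: "cov (Z n) x ` el (X (Suc n)) x = el (Z n) x" if "x \<in> Ob D" for n x
  using cov[OF Z[of n]] that by (simp add: XS)
 have dn: "nt D (X (Suc n)) (X n) (cov (Z n))" for n
  using nt_compose[OF conjunct1[OF cov[OF Z]] Zn, of n] by (simp add: XS)
 have "exseq D X (\<lambda>n. cov (Z n))"
  unfolding exseq_def
 proof (intro conjI allI ballI)
  show "k_module K D (X n)" for n by (cases n) (simp_all add: X_def M fm)
  show "nt D (X (Suc n)) (X n) (cov (Z n))" for n by (rule dn)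
  fix x assume x: "x \<in> Ob D"
  show "cov (Z 0) x ` el (X (Suc 0)) x = el (X 0) x"
   using cs[OF x, of 0] by (simp add: X_def Z_def)
  show "cov (Z (Suc n)) x ` el (X (Suc (Suc n))) x =
    {v \<in> el (X (Suc n)) x. cov (Z n) x v = \<zero>[val (X n) x]}" for n
   using cs[OF x, of "Suc n"] XZ[of n x] zz[of n x] by simp
 qed
 then show ?thesis using fc_free[OF sD] by (intro exI[of _ X] exI[of _ "\<lambda>n. cov (Z n)"]) (simp add: X_def)
qed

lemma comparison:
 fixes X Y :: "nat => ('o, 'm, 'k, 'u) kmod"
 assumes D: "k_category K D" and X: "exseq D X \<delta>" "projseq D X" and Y: "exseq D Y \<epsilon>"
  and \<eta>: "nt D (X 0) (Y 0) \<eta>"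
 shows "\<exists>f. f 0 = \<eta> \<and> (\<forall>n. nt D (X n) (Y n) (f n)) \<and>
  (\<forall>n. \<forall>x\<in>Ob D. \<forall>v\<in>el (X (Suc n)) x. \<epsilon> n x (f (Suc n) x v) = f n x (\<delta> n x v))"
proof -
 \<comment> \<open>The last clause is the invariant of the construction: it places \<open>f\<close>
   after \<open>\<delta> n\<close> in the image of \<open>\<epsilon> n\<close>, which is what the
   next lift requires.\<close>
 define P where "P n f \<longleftrightarrow> (n = 0 --> f = \<eta>) \<and> nt D (X n) (Y n) f \<and>
  (\<forall>x\<in>Ob D. \<forall>v\<in>el (X (Suc n)) x. f x (\<delta> n x v) \<in> \<epsilon> n x ` el (Y (Suc n)) x)" for n f
 define Q where "Q n f g \<longleftrightarrow> (\<forall>x\<in>Ob D. \<forall>v\<in>el (X (Suc n)) x. \<epsilon> n x (g x v) = f x (\<delta> n x v))"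
  for n and f g :: "'o => 'u => 'u"
 note Xn = ex_nt[OF X(1)] and Xm = ex_mod[OF X(1)] and Ym = ex_mod[OF Y] and Yn = ex_nt[OF Y]
 have "\<exists>f. \<forall>n. P n (f n) \<and> Q n (f n) (f (Suc n))"
 proof (rule dependent_nat_choice)
  have "\<eta> x (\<delta> 0 x v) \<in> \<epsilon> 0 x ` el (Y (Suc 0)) x" if "x \<in> Ob D" "v \<in> el (X (Suc 0)) x" for x v
   using ex_surj[OF Y that(1) nt_in[OF \<eta> that(1) nt_in[OF Xn that]]] by (metis imageI)
  then show "\<exists>f. P 0 f" using \<eta> by (auto simp: P_def)
  fix f n assume f: "P n f"
  then have fn: "nt D (X n) (Y n) f" by (simp add: P_def)
  have "\<exists>g. nt D (X (Suc n)) (Y (Suc n)) g \<and> (\<forall>x\<in>Ob D. \<forall>v\<in>el (X (Suc n)) x. \<epsilon> n x (g x v) = f x (\<delta> n x v))"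
   using f X(2) by (intro proj_lift[OF D _ Ym Ym Yn nt_compose[OF Xn fn]]) (auto simp: P_def projseq_def)
  then obtain g where g: "nt D (X (Suc n)) (Y (Suc n)) g"
   "\<And>x v. x \<in> Ob D ==> v \<in> el (X (Suc n)) x ==> \<epsilon> n x (g x v) = f x (\<delta> n x v)" by blast
  have "g x (\<delta> (Suc n) x v) \<in> \<epsilon> (Suc n) x ` el (Y (Suc (Suc n))) x"
   if x: "x \<in> Ob D" and v: "v \<in> el (X (Suc (Suc n))) x" for x v
  proof -
   note dv = nt_in[OF Xn x v]
   have "\<epsilon> n x (g x (\<delta> (Suc n) x v)) = \<zero>[val (Y n) x]"
    using g(2)[OF x dv] ex_dd[OF X(1) x v] nt_zero_at[OF Xm Ym fn x] by simp
   then show ?thesis using ex_lift[OF Y x nt_in[OF g(1) x dv]] by (metis imageI)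
  qed
  then show "\<exists>g. P (Suc n) g \<and> Q n f g" using g by (auto simp: P_def Q_def)
 qed
 then obtain f where f: "\<And>n. P n (f n)" "\<And>n. Q n (f n) (f (Suc n))" by auto
 show ?thesis using f by (intro exI[of _ f]) (auto simp: P_def Q_def)
qed

text \<open>The homotopy may start with zero because the two chain maps agree on \<open>X 0\<close>.
  This start makes it compatible with degree 0 of \<open>coboundary\<close>.\<close>

lemma homotopy:
 fixes X Y :: "nat => ('o, 'm, 'k, 'u) kmod"
 assumes D: "k_category K D" and X: "exseq D X \<delta>" "projseq D X" and Y: "exseq D Y \<epsilon>"
  and f: "\<And>n. nt D (X n) (Y n) (f n)" "\<And>n x v. x \<in> Ob D ==> v \<in> el (X (Suc n)) x ==>
   \<epsilon> n x (f (Suc n) x v) = f n x (\<delta> n x v)"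
  and g: "\<And>n. nt D (X n) (Y n) (g n)" "\<And>n x v. x \<in> Ob D ==> v \<in> el (X (Suc n)) x ==>
   \<epsilon> n x (g (Suc n) x v) = g n x (\<delta> n x v)"
  and fg0: "\<And>x v. x \<in> Ob D ==> v \<in> el (X 0) x ==> f 0 x v = g 0 x v"
 shows "\<exists>h. (\<forall>n. nt D (X n) (Y (Suc n)) (h n)) \<and>
  (\<forall>x\<in>Ob D. \<forall>v\<in>el (X 0) x. h 0 x v = \<zero>[val (Y (Suc 0)) x]) \<and>
  (\<forall>n. \<forall>x\<in>Ob D. \<forall>v\<in>el (X (Suc n)) x.
   f (Suc n) x v = g (Suc n) x v \<oplus>[val (Y (Suc n)) x]
    (\<epsilon> (Suc n) x (h (Suc n) x v) \<oplus>[val (Y (Suc n)) x] h n x (\<delta> n x v)))"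
proof -
 note Xn = ex_nt[OF X(1)] and Xm = ex_mod[OF X(1)] and Ym = ex_mod[OF Y] and Yn = ex_nt[OF Y]
 \<comment> \<open>Invariant: on boundaries, \<open>\<epsilon> n\<close> after \<open>h\<close> is
   already the difference of \<open>f n\<close> and \<open>g n\<close>. It makes
   \<open>f - g - h \<delta>\<close> a cycle in the next degree, and a lift of that is the next
   \<open>h\<close>.\<close>
 define P where "P n h \<longleftrightarrow> (n = 0 --> h = (\<lambda>x v. \<zero>[val (Y (Suc 0)) x])) \<and> nt D (X n) (Y (Suc n)) h \<and>
  (\<forall>x\<in>Ob D. \<forall>v\<in>el (X (Suc n)) x. \<epsilon> n x (h x (\<delta> n x v)) = f n x (\<delta> n x v) \<ominus>[val (Y n) x] g n x (\<delta> n x v))"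
  for n h
 define Q where "Q n h h' \<longleftrightarrow> (\<forall>x\<in>Ob D. \<forall>v\<in>el (X (Suc n)) x.
   f (Suc n) x v = g (Suc n) x v \<oplus>[val (Y (Suc n)) x]
    (\<epsilon> (Suc n) x (h' x v) \<oplus>[val (Y (Suc n)) x] h x (\<delta> n x v)))" for n h h'
 have "\<exists>h. \<forall>n. P n (h n) \<and> Q n (h n) (h (Suc n))"
 proof (rule dependent_nat_choice)
  show "\<exists>h. P 0 h"
  proof (rule exI)
   show "P 0 (\<lambda>x v. \<zero>[val (Y (Suc 0)) x])"
    unfolding P_def
    by (auto simp: nt_zero[OF Ym] nt_zero_at[OF Ym Ym Yn] fg0 nt_in[OF Xn] minus_self[OF val_mod[OF Ym]] nt_in[OF g(1)])
  qed
 next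
  fix h n assume h: "P n h"
  then have hn: "nt D (X n) (Y (Suc n)) h" and hd: "\<And>x v. x \<in> Ob D ==> v \<in> el (X (Suc n)) x ==>
   \<epsilon> n x (h x (\<delta> n x v)) = f n x (\<delta> n x v) \<ominus>[val (Y n) x] g n x (\<delta> n x v)" by (auto simp: P_def)
  let ?k = "\<lambda>x v. (f (Suc n) x v \<ominus>[val (Y (Suc n)) x] g (Suc n) x v) \<ominus>[val (Y (Suc n)) x] h x (\<delta> n x v)"
  have fgn: "nt D (X (Suc n)) (Y (Suc n)) (\<lambda>x v. f (Suc n) x v \<ominus>[val (Y (Suc n)) x] g (Suc n) x v)"
   by (rule nt_diff[OF Ym f(1) g(1)])
  have hdn: "nt D (X (Suc n)) (Y (Suc n)) (\<lambda>x v. h x (\<delta> n x v))" by (rule nt_compose[OF Xn hn])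
  have kn: "nt D (X (Suc n)) (Y (Suc n)) ?k" by (rule nt_diff[OF Ym fgn hdn])
  have "?k x v \<in> \<epsilon> (Suc n) x ` el (Y (Suc (Suc n))) x" if x: "x \<in> Ob D" and v: "v \<in> el (X (Suc n)) x" for x v
  proof -
   have "\<epsilon> n x (?k x v) = (\<epsilon> n x (f (Suc n) x v) \<ominus>[val (Y n) x] \<epsilon> n x (g (Suc n) x v)) \<ominus>[val (Y n) x] \<epsilon> n x (h x (\<delta> n x v))"
    using nt_minus_at[OF Ym Ym Yn x nt_in[OF fgn x v] nt_in[OF hdn x v]]
     nt_minus_at[OF Ym Ym Yn x nt_in[OF f(1) x v] nt_in[OF g(1) x v]] by simp
   also have "\<dots> = \<zero>[val (Y n) x]"
    unfolding f(2)[OF x v] g(2)[OF x v] hd[OF x v]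
    by (rule minus_self[OF val_mod[OF Ym x] module_minus[OF val_mod[OF Ym x]]]) (intro nt_in[OF f(1) x] nt_in[OF g(1) x] nt_in[OF Xn x v])+
   finally show ?thesis using ex_lift[OF Y x nt_in[OF kn x v]] by (metis imageI)
  qed
  then have "\<exists>h'. nt D (X (Suc n)) (Y (Suc (Suc n))) h' \<and> (\<forall>x\<in>Ob D. \<forall>v\<in>el (X (Suc n)) x. \<epsilon> (Suc n) x (h' x v) = ?k x v)"
   using X(2) by (intro proj_lift[OF D _ Ym Ym Yn kn]) (auto simp: projseq_def)
  then obtain h' where h': "nt D (X (Suc n)) (Y (Suc (Suc n))) h'"
   "\<And>x v. x \<in> Ob D ==> v \<in> el (X (Suc n)) x ==> \<epsilon> (Suc n) x (h' x v) = ?k x v" by blast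
  have q: "Q n h h'"
   unfolding Q_def
  proof (intro ballI)
   fix x v assume x: "x \<in> Ob D" and v: "v \<in> el (X (Suc n)) x"
   interpret M: module K "val (Y (Suc n)) x" by (rule val_mod[OF Ym x])
   have c: "f (Suc n) x v \<in> el (Y (Suc n)) x" "g (Suc n) x v \<in> el (Y (Suc n)) x"
    "h x (\<delta> n x v) \<in> el (Y (Suc n)) x"
    using nt_in[OF f(1) x v] nt_in[OF g(1) x v] nt_in[OF hdn x v] by auto
   have "g (Suc n) x v \<oplus>[val (Y (Suc n)) x] (?k x v \<oplus>[val (Y (Suc n)) x] h x (\<delta> n x v)) =
    g (Suc n) x v \<oplus>[val (Y (Suc n)) x] (f (Suc n) x v \<ominus>[val (Y (Suc n)) x] g (Suc n) x v)"
    using minus_add_cancel[OF M.module_axioms _ c(3)] c by simp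
   also have "\<dots> = f (Suc n) x v"
    using minus_add_cancel[OF M.module_axioms c(1,2)] c M.a_comm by simp
   finally show "f (Suc n) x v = g (Suc n) x v \<oplus>[val (Y (Suc n)) x]
    (\<epsilon> (Suc n) x (h' x v) \<oplus>[val (Y (Suc n)) x] h x (\<delta> n x v))" using h'(2)[OF x v] by simp
  qed
  have "\<epsilon> (Suc n) x (h' x (\<delta> (Suc n) x v)) = f (Suc n) x (\<delta> (Suc n) x v) \<ominus>[val (Y (Suc n)) x] g (Suc n) x (\<delta> (Suc n) x v)"
   if x: "x \<in> Ob D" and v: "v \<in> el (X (Suc (Suc n))) x" for x v
  proof -
   note dv = nt_in[OF Xn x v]
   interpret M: module K "val (Y (Suc n)) x" by (rule val_mod[OF Ym x])
   have c: "f (Suc n) x (\<delta> (Suc n) x v) \<ominus>[val (Y (Suc n)) x] g (Suc n) x (\<delta> (Suc n) x v) \<in> el (Y (Suc n)) x"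
    by (rule nt_in[OF fgn x dv])
   show ?thesis
    using h'(2)[OF x dv] ex_dd[OF X(1) x v] nt_zero_at[OF Xm Ym hn x] c by (simp add: a_minus_def)
  qed
  then show "\<exists>h'. P (Suc n) h' \<and> Q n h h'" using h'(1) q by (auto simp: P_def)
 qed
 then obtain h where h: "\<And>n. P n (h n)" "\<And>n. Q n (h n) (h (Suc n))" by auto
 show ?thesis using h by (intro exI[of _ h]) (auto simp: P_def Q_def)
qed

subsection \<open>Exactness modulo an ideal\<close>

text \<open>Exactness of \<open>X/JX\<close> at the term \<open>X (Suc n)\<close>, spelled out on
  elements. With the augmentation as \<open>\<delta> 0\<close>, this term has degree
  \<open>n\<close> in the resolution, so for positive \<open>n\<close> the condition is the
  vanishing of Tor in degree \<open>n\<close>.\<close>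

definition exm :: "('o, 'k, 'm) kcat => ('o => 'o => 'm set) => (nat => ('o, 'm, 'k, 'u) kmod) => (nat => 'o => 'u => 'u) => nat => bool" where
 "exm D J X \<delta> n \<longleftrightarrow> (\<forall>x\<in>Ob D. \<forall>z\<in>el (X (Suc n)) x. \<delta> n x z \<in> jsp D J (X n) x -->
   (\<exists>j\<in>jsp D J (X (Suc n)) x. \<exists>w\<in>el (X (Suc (Suc n))) x. z = j \<oplus>[val (X (Suc n)) x] \<delta> (Suc n) x w))"

lemma exmD:
 "exm D J X \<delta> n ==> x \<in> Ob D ==> z \<in> el (X (Suc n)) x ==> \<delta> n x z \<in> jsp D J (X n) x ==>
   \<exists>j\<in>jsp D J (X (Suc n)) x. \<exists>w\<in>el (X (Suc (Suc n))) x. z = j \<oplus>[val (X (Suc n)) x] \<delta> (Suc n) x w"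
 unfolding exm_def by blast

text \<open>Degree 0 is right exactness: an element of \<open>J (X 0)\<close> is the image of some
  \<open>j\<close> in \<open>J (X (Suc 0))\<close>, and subtracting \<open>j\<close> from
  \<open>z\<close> leaves a cycle.\<close>

lemma exm_right:
 assumes D: "k_category K D" and J: "two_sided_ideal K D J" and X: "exseq D X \<delta>"
 shows "exm D J X \<delta> 0"
 unfolding exm_def
proof (intro ballI impI)
 note Xm = ex_mod[OF X] and Xn = ex_nt[OF X]
 fix x z assume x: "x \<in> Ob D" and z: "z \<in> el (X (Suc 0)) x" and dz: "\<delta> 0 x z \<in> jsp D J (X 0) x"
 have s: "\<delta> 0 x ` el (X (Suc 0)) x = el (X 0) x" if "x \<in> Ob D" for x
  using X that by (simp add: exseq_def)
 obtain j where j: "j \<in> jsp D J (X (Suc 0)) x" "\<delta> 0 x j = \<delta> 0 x z"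
  using jsp_surj[OF D J Xm Xm Xn s x dz] by blast
 have jc: "j \<in> el (X (Suc 0)) x" by (rule subf_in[OF Xm jsp_subf(1)[OF D J Xm] x j(1)])
 have "\<delta> 0 x (z \<ominus>[val (X (Suc 0)) x] j) = \<zero>[val (X 0) x]"
  using nt_minus_at[OF Xm Xm Xn x z jc] j(2) minus_self[OF val_mod[OF Xm x] nt_in[OF Xn x z]] by simp
 then obtain w where w: "w \<in> el (X (Suc (Suc 0))) x" "\<delta> (Suc 0) x w = z \<ominus>[val (X (Suc 0)) x] j"
  using ex_lift[OF X x module_minus[OF val_mod[OF Xm x] z jc]] by blast
 interpret M: module K "val (X (Suc 0)) x" by (rule val_mod[OF Xm x])
 have "z = j \<oplus>[val (X (Suc 0)) x] \<delta> (Suc 0) x w"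
  using w(2) minus_add_cancel[OF M.module_axioms z jc] M.a_comm[OF M.minus_closed[OF z jc] jc] by simp
 then show "\<exists>j\<in>jsp D J (X (Suc 0)) x. \<exists>w\<in>el (X (Suc (Suc 0))) x. z = j \<oplus>[val (X (Suc 0)) x] \<delta> (Suc 0) x w"
  using j(1) w(1) by blast
qed

text \<open>Chain maps \<open>a\<close> and \<open>b\<close> over \<open>\<theta>\<close> and
  \<open>\<eta>\<close> transport the problem to \<open>X\<close> and back. The composite of
  \<open>b\<close> after \<open>a\<close> differs from the identity by a homotopy, whose terms at
  \<open>z\<close> are a boundary and an element of \<open>J X'\<close>. It suffices that
  \<open>X' 0\<close> is a retract of \<open>X 0\<close>.\<close>

lemma exm_indep:
 fixes X X' :: "nat => ('o, 'm, 'k, 'u) kmod"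
 assumes D: "k_category K D" and J: "two_sided_ideal K D J" and X: "exseq D X \<delta>" "projseq D X"
  and X': "exseq D X' \<delta>'" "projseq D X'"
  and \<eta>: "nt D (X 0) (X' 0) \<eta>" and \<theta>: "nt D (X' 0) (X 0) \<theta>"
  and inv: "\<And>x v. x \<in> Ob D ==> v \<in> el (X' 0) x ==> \<eta> x (\<theta> x v) = v"
  and e: "exm D J X \<delta> n"
 shows "exm D J X' \<delta>' n"
proof -
 note Xm = ex_mod[OF X(1)] and Xn = ex_nt[OF X(1)] and Ym = ex_mod[OF X'(1)] and Yn = ex_nt[OF X'(1)]
 obtain a where a: "a 0 = \<theta>" "\<And>n. nt D (X' n) (X n) (a n)"
  "\<And>n x v. x \<in> Ob D ==> v \<in> el (X' (Suc n)) x ==> \<delta> n x (a (Suc n) x v) = a n x (\<delta>' n x v)"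
  using comparison[OF D X' X(1) \<theta>] by blast
 obtain b where b: "b 0 = \<eta>" "\<And>n. nt D (X n) (X' n) (b n)"
  "\<And>n x v. x \<in> Ob D ==> v \<in> el (X (Suc n)) x ==> \<delta>' n x (b (Suc n) x v) = b n x (\<delta> n x v)"
  using comparison[OF D X X'(1) \<eta>] by blast
 have "\<exists>h. (\<forall>n. nt D (X' n) (X' (Suc n)) (h n)) \<and>
  (\<forall>x\<in>Ob D. \<forall>v\<in>el (X' 0) x. h 0 x v = \<zero>[val (X' (Suc 0)) x]) \<and>
  (\<forall>n. \<forall>x\<in>Ob D. \<forall>v\<in>el (X' (Suc n)) x.
   b (Suc n) x (a (Suc n) x v) = v \<oplus>[val (X' (Suc n)) x]
    (\<delta>' (Suc n) x (h (Suc n) x v) \<oplus>[val (X' (Suc n)) x] h n x (\<delta>' n x v)))"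
  by (rule homotopy[OF D X' X'(1), where f = "\<lambda>n x v. b n x (a n x v)" and g = "\<lambda>n x v. v"])
   (use a b inv in \<open>auto intro: nt_compose[OF a(2) b(2)] nt_id simp: nt_in[OF a(2)]\<close>)
 then obtain h where h: "\<And>n. nt D (X' n) (X' (Suc n)) (h n)"
  "\<And>n x v. x \<in> Ob D ==> v \<in> el (X' (Suc n)) x ==> b (Suc n) x (a (Suc n) x v) = v \<oplus>[val (X' (Suc n)) x]
    (\<delta>' (Suc n) x (h (Suc n) x v) \<oplus>[val (X' (Suc n)) x] h n x (\<delta>' n x v))" by blast
 show ?thesis
  unfolding exm_def
 proof (intro ballI impI)
  fix x z assume x: "x \<in> Ob D" and z: "z \<in> el (X' (Suc n)) x" and dz: "\<delta>' n x z \<in> jsp D J (X' n) x"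
  note sub = subf_sub[OF jsp_subf(1)[OF D J Ym] x]
  note jc = subf_in[OF Xm jsp_subf(1)[OF D J Xm] x] subf_in[OF Ym jsp_subf(1)[OF D J Ym] x]
  have "\<delta> n x (a (Suc n) x z) \<in> jsp D J (X n) x"
   using a(3)[OF x z] jsp_nt[OF D J Ym Xm a(2) x dz] by simp
  then obtain j w where j: "j \<in> jsp D J (X (Suc n)) x" and w: "w \<in> el (X (Suc (Suc n))) x"
   and az: "a (Suc n) x z = j \<oplus>[val (X (Suc n)) x] \<delta> (Suc n) x w"
   using exmD[OF e x nt_in[OF a(2) x z]] by blast
  let ?M = "val (X' (Suc n)) x"
  interpret M: module K ?M by (rule val_mod[OF Ym x])
  let ?hz = "h (Suc n) x z" and ?hd = "h n x (\<delta>' n x z)" and ?bj = "b (Suc n) x j" and ?bw = "b (Suc (Suc n)) x w"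
  have hz: "?hz \<in> el (X' (Suc (Suc n))) x" by (rule nt_in[OF h(1) x z])
  have bw: "?bw \<in> el (X' (Suc (Suc n))) x" by (rule nt_in[OF b(2) x w])
  have hd: "?hd \<in> jsp D J (X' (Suc n)) x" by (rule jsp_nt[OF D J Ym Ym h(1) x dz])
  have bj: "?bj \<in> jsp D J (X' (Suc n)) x" by (rule jsp_nt[OF D J Xm Ym b(2) x j])
  have c: "?hd \<in> carrier ?M" "?bj \<in> carrier ?M" "\<delta>' (Suc n) x ?hz \<in> carrier ?M" "\<delta>' (Suc n) x ?bw \<in> carrier ?M"
   using jc(2)[OF hd] jc(2)[OF bj] nt_in[OF Yn x hz] nt_in[OF Yn x bw] by auto
  have "z \<oplus>[?M] (\<delta>' (Suc n) x ?hz \<oplus>[?M] ?hd) = b (Suc n) x (a (Suc n) x z)" using h(2)[OF x z] by simp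
  also have "\<dots> = ?bj \<oplus>[?M] \<delta>' (Suc n) x ?bw"
   unfolding az using nt_add[OF b(2) x jc(1)[OF j] nt_in[OF Xn x w]] b(3)[OF x w] by simp
  finally have eq: "z \<oplus>[?M] (\<delta>' (Suc n) x ?hz \<oplus>[?M] ?hd) = ?bj \<oplus>[?M] \<delta>' (Suc n) x ?bw" .
  have "z = (?bj \<oplus>[?M] \<delta>' (Suc n) x ?bw) \<ominus>[?M] (\<delta>' (Suc n) x ?hz \<oplus>[?M] ?hd)"
   unfolding eq[symmetric] using z c by (simp add: a_minus_def M.a_assoc M.r_neg)
  also have "\<dots> = (?bj \<ominus>[?M] ?hd) \<oplus>[?M] (\<delta>' (Suc n) x ?bw \<ominus>[?M] \<delta>' (Suc n) x ?hz)"
   using c by (simp add: a_minus_def M.minus_add M.a_ac)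
  also have "\<delta>' (Suc n) x ?bw \<ominus>[?M] \<delta>' (Suc n) x ?hz = \<delta>' (Suc n) x (?bw \<ominus>[val (X' (Suc (Suc n))) x] ?hz)"
   using nt_minus_at[OF Ym Ym Yn x bw hz] by simp
  finally show "\<exists>j\<in>jsp D J (X' (Suc n)) x. \<exists>w\<in>el (X' (Suc (Suc n))) x. z = j \<oplus>[?M] \<delta>' (Suc n) x w"
   using sub_minus[OF M.module_axioms sub bj hd] module_minus[OF val_mod[OF Ym x] bw hz] by blast
 qed
qed

subsection \<open>Modules acyclic with respect to an ideal\<close>

text \<open>\<open>gdn D J M n\<close> expresses the vanishing of \<open>Tor\<^sub>n(D/J, M)\<close> for \<open>n > 0\<close>.\<close>

definition gdn :: "('o, 'k, 'm) kcat => ('o => 'o => 'm set) => ('o, 'm, 'k, 'u) kmod => nat => bool" where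
 "gdn D J M n \<longleftrightarrow> (\<forall>X \<delta>. exseq D X \<delta> --> projseq D X --> X 0 = M --> exm D J X \<delta> n)"

text \<open>One projective resolution of a module having \<open>M\<close> as a retract decides the
  vanishing for \<open>M\<close>, by \<open>exm_indep\<close>.\<close>

lemma gdnI:
 fixes X :: "nat => ('o, 'm, 'k, 'u) kmod" and M :: "('o, 'm, 'k, 'u) kmod"
 assumes "k_category K D" "two_sided_ideal K D J" "exseq D X \<delta>" "projseq D X"
  and "nt D (X 0) M \<eta>" "nt D M (X 0) \<theta>"
  and "\<And>x v. x \<in> Ob D ==> v \<in> el M x ==> \<eta> x (\<theta> x v) = v"
  and "exm D J X \<delta> n"
 shows "gdn D J M n"
 unfolding gdn_def
proof (intro allI impI)
 fix X' \<delta>' assume X': "exseq D X' \<delta>'" "projseq D X'" "X' 0 = M"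
 show "exm D J X' \<delta>' n"
  using exm_indep[OF assms(1-4) X'(1,2), of \<eta> \<theta> n] X'(3) assms(5-8) by blast
qed

lemma gdnD: "gdn D J (X 0) n ==> exseq D X \<delta> ==> projseq D X ==> exm D J X \<delta> n"
 unfolding gdn_def by blast

lemma free_projseq:
 assumes "small_k_category TYPE('u) K D" "\<And>n. isfree D (X (Suc n) :: ('o, 'm, 'k, 'u) kmod)"
 shows "projseq D X"
 unfolding projseq_def using free_proj[OF assms(1)] assms(2) by blast

lemma gdn_iso:
 fixes M N :: "('o, 'm, 'k, 'u) kmod"
 assumes sD: "small_k_category TYPE('u) K D" and J: "two_sided_ideal K D J" and M: "k_module K D M"
  and \<eta>: "nt D M N \<eta>" and \<theta>: "nt D N M \<theta>"
  and inv: "\<And>x v. x \<in> Ob D ==> v \<in> el N x ==> \<eta> x (\<theta> x v) = v"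
  and g: "gdn D J M n"
 shows "gdn D J N n"
proof -
 obtain X \<delta> where X: "X 0 = M" "exseq D X \<delta>" "\<And>n. isfree D (X (Suc n))" using free_resolution[OF sD M] by blast
 have p: "projseq D X" by (rule free_projseq[where X = X, OF sD X(3)])
 have e: "exm D J X \<delta> n" using gdnD[of D J X] g X p by simp
 show ?thesis
  using gdnI[OF small_cat[OF sD] J X(2) p, of N \<eta> \<theta> n] X(1) \<eta> \<theta> inv e by blast
qed

lemma gdn_zero:
 "k_category K D ==> two_sided_ideal K D J ==> gdn D J M 0"
 unfolding gdn_def using exm_right by blast

text \<open>For projective \<open>M\<close> this is a projective resolution
  (\<open>gdn_proj\<close>); in \<open>sec_subf\<close> it puts a single module into the shape of a
  sequence.\<close>

lemma id_exseq:
 assumes D: "k_category K D" and M: "k_module K D M"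
 shows "exseq D (\<lambda>n. if n \<le> 1 then M else subk M (\<lambda>x. {\<zero>[val M x]})) (\<lambda>n x v. v)"
proof (rule exseqI)
 let ?X = "\<lambda>n :: nat. if n \<le> 1 then M else subk M (\<lambda>x. {\<zero>[val M x]})"
 show "k_module K D (?X n)" for n by (simp add: M subk_module[OF M subf_zero[OF M] D])
 show "nt D (?X (Suc n)) (?X n) (\<lambda>x v. v)" for n
  using nt_id subk_incl[OF M subf_zero[OF M]] by (cases "n = 0"; cases "n = 1") auto
qed (use module_zero[OF val_mod[OF M]] in \<open>auto split: if_splits\<close>)

text \<open>The resolution from \<open>id_exseq\<close> is zero beyond degree 1, which leaves
  nothing to reduce in positive degrees.\<close>

lemma gdn_proj:
 fixes M :: "('o, 'm, 'k, 'u) kmod"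
 assumes D: "k_category K D" and J: "two_sided_ideal K D J" and M: "projective_module K D M"
 shows "gdn D J M n"
proof (cases n)
 case 0 then show ?thesis using gdn_zero[OF D J] by simp
next
 case (Suc m)
 let ?O = "subk M (\<lambda>x. {\<zero>[val M x]})"
 note Mm = proj_module[OF M]
 note Om = subk_module[OF Mm subf_zero[OF Mm] D]
 have Op: "projective_module K D ?O"
 proof (rule projI[OF Om])
  fix A B :: "('o, 'm, 'k, 'u) kmod" and e h
  assume A: "k_module K D A" and B: "k_module K D B" and e: "nt D A B e" and h: "nt D ?O B h"
  have "e x \<zero>[val A x] = h x v" if "x \<in> Ob D" "v \<in> el ?O x" for x v
   using nt_zero_at[OF A B e that(1)] nt_zero_at[OF Om B h that(1)] that(2) by simp
  then show "\<exists>h'. nt D ?O A h' \<and> (\<forall>x\<in>Ob D. \<forall>v\<in>el ?O x. e x (h' x v) = h x v)"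
   using nt_zero[OF A, of ?O] by blast
 qed
 define X where "X n = (if n \<le> 1 then M else ?O)" for n :: nat
 have X: "exseq D X (\<lambda>n x v. v)" unfolding X_def by (rule id_exseq[OF D Mm])
 have p: "projseq D X" using M Op by (auto simp: projseq_def X_def)
 have "exm D J X (\<lambda>n x v. v) n"
  unfolding exm_def
 proof (intro ballI impI)
  fix x z assume x: "x \<in> Ob D" and z: "z \<in> el (X (Suc n)) x"
  interpret V: module K "val M x" by (rule val_mod[OF Mm x])
  have "\<zero>[val (X (Suc n)) x] \<in> jsp D J (X (Suc n)) x" by (rule jsp_zero)
  then show "\<exists>j\<in>jsp D J (X (Suc n)) x. \<exists>w\<in>el (X (Suc (Suc n))) x. z = j \<oplus>[val (X (Suc n)) x] w"
   using z Suc by (intro bexI[of _ "\<zero>[val (X (Suc n)) x]"]) (auto simp: X_def)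
 qed
 then show ?thesis
  by (intro gdnI[where X = X and \<eta> = "\<lambda>x v. v" and \<theta> = "\<lambda>x v. v", OF D J X p]) (simp_all add: X_def nt_id)
qed

section \<open>Direct sums of resolutions\<close>

lemma dsum_map:
 fixes M M' :: "'s => ('o, 'm, 'k, 'u) kmod"
 assumes D: "k_category K D" and inf: "infinite (UNIV :: 'u set)" and S: "S \<lesssim> (UNIV :: 'u set)"
  and M: "\<And>s. s \<in> S ==> k_module K D (M s)" and M': "\<And>s. s \<in> S ==> k_module K D (M' s)"
  and g: "\<And>s. s \<in> S ==> nt D (M s) (M' s) (g s)"
 shows "\<exists>G. nt D (dsum S M) (dsum S M') G \<and>
  (\<forall>s\<in>S. \<forall>x\<in>Ob D. \<forall>u\<in>el (dsum S M) x. dcmp S M' s x (G x u) = g s x (dcmp S M s x u))"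
proof -
 have n: "nt D (M s) (dsum S M') (\<lambda>x v. dinj S M' s x (g s x v))" if "s \<in> S" for s
  by (rule nt_compose[OF g[OF that] dinj_nt[where M = M', OF D M' inf S that]])
 have dm': "k_module K D (dsum S M')" by (rule dsum_module[OF D M' inf S])
 let ?h = "\<lambda>s x v. dinj S M' s x (g s x v)"
 let ?G = "dout S M (dsum S M') ?h"
 have Gn: "nt D (dsum S M) (dsum S M') ?G" by (rule dout_nt[OF D M inf S dm' n])
 have "dcmp S M' t x (?G x u) = g t x (dcmp S M t x u)"
  if t: "t \<in> S" and x: "x \<in> Ob D" and u: "u \<in> el (dsum S M) x" for t x u
 proof (rule dsum_nt_eq[where M = M and g = "\<lambda>x u. dcmp S M' t x (?G x u)" and h = "\<lambda>x u. g t x (dcmp S M t x u)",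
    OF D M inf S M'[OF t] _ _ _ x u])
  show "nt D (dsum S M) (M' t) (\<lambda>x u. dcmp S M' t x (?G x u))"
   by (rule nt_compose[OF Gn dcmp_nt[where M = M', OF D M' inf S t]])
  show "nt D (dsum S M) (M' t) (\<lambda>x u. g t x (dcmp S M t x u))"
   by (rule nt_compose[OF dcmp_nt[where M = M, OF D M inf S t] g[OF t]])
  fix s v assume s: "s \<in> S" and v: "v \<in> el (M s) x"
  have "?G x (dinj S M s x v) = dinj S M' s x (g s x v)"
   by (rule dout_dinj[where M = M and h = ?h, OF D M inf S dm' n x s v])
  then show "dcmp S M' t x (?G x (dinj S M s x v)) = g t x (dcmp S M t x (dinj S M s x v))"
   using dcmp_dinj[where M = M', OF D M' inf S x s t nt_in[OF g[OF s] x v]]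
    dcmp_dinj[where M = M, OF D M inf S x s t v] nt_zero_at[OF M[OF t] M'[OF t] g[OF t] x] by auto
 qed
 then show ?thesis using Gn by blast
qed

text \<open>Witnesses chosen in each component need not form a finitely supported family. Taking
  zero wherever the component of \<open>u\<close> vanishes repairs this, which is why
  \<open>Q\<close> must accept zero there.\<close>

lemma dsum_choose:
 fixes M N :: "'s => ('o, 'm, 'k, 'u) kmod"
 assumes D: "k_category K D" and inf: "infinite (UNIV :: 'u set)" and S: "S \<lesssim> (UNIV :: 'u set)"
  and M: "\<And>s. s \<in> S ==> k_module K D (M s)" and N: "\<And>s. s \<in> S ==> k_module K D (N s)"
  and x: "x \<in> Ob D" and u: "u \<in> el (dsum S N) x"
  and w: "\<And>s. s \<in> S ==> \<exists>w\<in>el (M s) x. Q s w"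
  and z: "\<And>s. s \<in> S ==> dcmp S N s x u = \<zero>[val (N s) x] ==> Q s \<zero>[val (M s) x]"
 shows "\<exists>w\<in>el (dsum S M) x. \<forall>s\<in>S. Q s (dcmp S M s x w)"
proof -
 define f where "f s = (if dcmp S N s x u = \<zero>[val (N s) x] then \<zero>[val (M s) x]
  else (SOME w. w \<in> el (M s) x \<and> Q s w))" for s
 have f: "f s \<in> el (M s) x \<and> Q s (f s)" if s: "s \<in> S" for s
 proof (cases "dcmp S N s x u = \<zero>[val (N s) x]")
  case True
  then show ?thesis using z[OF s] module_zero[OF val_mod[OF M[OF s] x]] by (simp add: f_def)
 next
  case False
  then show ?thesis using someI_ex[of "\<lambda>w. w \<in> el (M s) x \<and> Q s w"] w[OF s] by (auto simp: f_def)
 qed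
 have "finite {s\<in>S. f s \<noteq> \<zero>[val (M s) x]}"
  by (rule finite_subset[OF _ dsum_finite[where M = N, OF D N inf S x u]]) (auto simp: f_def)
 then obtain v where v: "v \<in> el (dsum S M) x" "\<forall>s\<in>S. dcmp S M s x v = f s"
  using dsum_make[where M = M and f = f, OF D M inf S x] f by blast
 then show ?thesis using f v by (intro bexI[of _ v]) simp_all
qed

text \<open>Reduction commutes with direct sums: components stay in the span by naturality, and
  conversely an element is the finite sum of its injected components.\<close>

lemma dsum_jsp:
 fixes M :: "'s => ('o, 'm, 'k, 'u) kmod"
 assumes D: "k_category K D" and J: "two_sided_ideal K D J" and inf: "infinite (UNIV :: 'u set)" and S: "S \<lesssim> (UNIV :: 'u set)"
  and M: "\<And>s. s \<in> S ==> k_module K D (M s)" and x: "x \<in> Ob D" and u: "u \<in> el (dsum S M) x"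
 shows "u \<in> jsp D J (dsum S M) x \<longleftrightarrow> (\<forall>s\<in>S. dcmp S M s x u \<in> jsp D J (M s) x)"
proof -
 have dm: "k_module K D (dsum S M)" by (rule dsum_module[OF D M inf S])
 have dc: "nt D (dsum S M) (M s) (dcmp S M s)" if "s \<in> S" for s by (rule dcmp_nt[OF D M inf S that])
 have dn: "nt D (M s) (dsum S M) (dinj S M s)" if "s \<in> S" for s by (rule dinj_nt[OF D M inf S that])
 show ?thesis
 proof
  assume "u \<in> jsp D J (dsum S M) x"
  then show "\<forall>s\<in>S. dcmp S M s x u \<in> jsp D J (M s) x" using jsp_nt[OF D J dm M dc x] by blast
 next
  assume a: "\<forall>s\<in>S. dcmp S M s x u \<in> jsp D J (M s) x"
  show "u \<in> jsp D J (dsum S M) x"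
   by (rule dsum_mem[OF D M inf S x subf_sub[OF jsp_subf(1)[OF D J dm] x] u])
    (use a jsp_nt[OF D J M dm dn x] in auto)
 qed
qed

lemma dsum_killed:
 fixes M :: "'s => ('o, 'm, 'k, 'u) kmod"
 assumes D: "k_category K D" and J: "two_sided_ideal K D J" and inf: "infinite (UNIV :: 'u set)" and S: "S \<lesssim> (UNIV :: 'u set)"
  and M: "\<And>s. s \<in> S ==> k_module K D (M s)" and k: "\<And>s. s \<in> S ==> killed D J (M s)"
 shows "killed D J (dsum S M)"
 unfolding killed_def
proof (intro ballI)
 fix x y j v assume o: "x \<in> Ob D" "y \<in> Ob D" and j: "j \<in> J x y" and v: "v \<in> el (dsum S M) x"
 have dm: "k_module K D (dsum S M)" by (rule dsum_module[OF D M inf S])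
 have dc: "nt D (dsum S M) (M s) (dcmp S M s)" if "s \<in> S" for s by (rule dcmp_nt[OF D M inf S that])
 note jc = ideal_carrier[OF D J o j]
 show "act (dsum S M) x y j v = \<zero>[val (dsum S M) y]"
 proof (rule dsum_ext[where M = M, OF D M inf S o(2) act_in[OF dm o jc v] module_zero[OF val_mod[OF dm o(2)]]])
  fix s assume s: "s \<in> S"
  show "dcmp S M s y (act (dsum S M) x y j v) = dcmp S M s y \<zero>[val (dsum S M) y]"
   using nt_nat[OF dc[OF s] o jc v] nt_zero_at[OF dm M[OF s] dc[OF s] o(2)]
    killedD[OF k[OF s] o j nt_in[OF dc[OF s] o(1) v]] by simp
 qed auto
qed

text \<open>All conditions hold componentwise; the witnesses are assembled by
  \<open>dsum_choose\<close>.\<close>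

lemma dsum_resolution:
 fixes X :: "'s => nat => ('o, 'm, 'k, 'u) kmod"
 assumes D: "k_category K D" and J: "two_sided_ideal K D J" and inf: "infinite (UNIV :: 'u set)" and S: "S \<lesssim> (UNIV :: 'u set)"
  and X: "\<And>s. s \<in> S ==> exseq D (X s) (\<delta> s)" and p: "\<And>s. s \<in> S ==> projseq D (X s)"
  and e: "\<And>s n. s \<in> S ==> exm D J (X s) (\<delta> s) n"
 shows "\<exists>dU. exseq D (\<lambda>n. dsum S (\<lambda>s. X s n)) dU \<and> projseq D (\<lambda>n. dsum S (\<lambda>s. X s n)) \<and>
  (\<forall>n. exm D J (\<lambda>n. dsum S (\<lambda>s. X s n)) dU n)"
proof -
 let ?U = "\<lambda>n. dsum S (\<lambda>s. X s n)" and ?c = "\<lambda>n. dcmp S (\<lambda>s. X s n)"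
 have M: "k_module K D (X s n)" if "s \<in> S" for s n by (rule ex_mod[OF X[OF that]])
 have dm: "k_module K D (?U n)" for n by (rule dsum_module[OF D M inf S])
 have cn: "nt D (?U n) (X s n) (?c n s)" if "s \<in> S" for s n by (rule dcmp_nt[OF D M inf S that])
 have xn: "nt D (X s (Suc n)) (X s n) (\<delta> s n)" if "s \<in> S" for s n by (rule ex_nt[OF X[OF that]])
 have "\<exists>dU. \<forall>n. nt D (?U (Suc n)) (?U n) (dU n) \<and>
  (\<forall>s\<in>S. \<forall>x\<in>Ob D. \<forall>u\<in>el (?U (Suc n)) x. ?c n s x (dU n x u) = \<delta> s n x (?c (Suc n) s x u))"
  by (rule choice, rule allI, rule dsum_map[OF D inf S M M xn])
 then obtain dU where d: "\<And>n. nt D (?U (Suc n)) (?U n) (dU n)"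
  and dc: "\<And>n s x u. s \<in> S ==> x \<in> Ob D ==> u \<in> el (?U (Suc n)) x ==> ?c n s x (dU n x u) = \<delta> s n x (?c (Suc n) s x u)"
  by blast
 have eqI: "u = v" if "x \<in> Ob D" "u \<in> el (?U n) x" "v \<in> el (?U n) x"
  "\<And>s. s \<in> S ==> ?c n s x u = ?c n s x v" for n x u v
  by (rule dsum_ext[where M = "\<lambda>s. X s n", OF D M inf S that])
 have cz: "?c n s x \<zero>[val (?U n) x] = \<zero>[val (X s n) x]" if "s \<in> S" "x \<in> Ob D" for n s x
  by (rule nt_zero_at[OF dm M[OF that(1)] cn[OF that(1)] that(2)])
 have \<delta>z: "\<delta> s n x \<zero>[val (X s (Suc n)) x] = \<zero>[val (X s n) x]" if "s \<in> S" "x \<in> Ob D" for n s x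
  by (rule nt_zero_at[OF M[OF that(1)] M[OF that(1)] xn[OF that(1)] that(2)])
 have choose: "\<exists>w\<in>el (?U n) x. \<forall>s\<in>S. Q s (?c n s x w)"
  if "x \<in> Ob D" "u \<in> el (?U m) x" "\<And>s. s \<in> S ==> \<exists>w\<in>el (X s n) x. Q s w"
   "\<And>s. s \<in> S ==> ?c m s x u = \<zero>[val (X s m) x] ==> Q s \<zero>[val (X s n) x]" for n m x u Q
  by (rule dsum_choose[where M = "\<lambda>s. X s n" and N = "\<lambda>s. X s m", OF D inf S M M that])
 have ex: "exseq D ?U dU"
 proof (rule exseqI)
  fix x v assume x: "x \<in> Ob D" and v: "v \<in> el (?U 0) x"
  have "\<exists>w\<in>el (?U (Suc 0)) x. \<forall>s\<in>S. \<delta> s 0 x (?c (Suc 0) s x w) = ?c 0 s x v"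
   by (rule choose[OF x v]) (use ex_surj[OF X x] nt_in[OF cn x v] \<delta>z x in auto)
  then obtain w where w: "w \<in> el (?U (Suc 0)) x" "\<And>s. s \<in> S ==> \<delta> s 0 x (?c (Suc 0) s x w) = ?c 0 s x v" by blast
  have "dU 0 x w = v" by (rule eqI[OF x nt_in[OF d x w(1)] v]) (simp add: dc[OF _ x w(1)] w(2))
  then show "\<exists>w\<in>el (?U (Suc 0)) x. dU 0 x w = v" using w(1) by blast
 next
  fix n x v assume x: "x \<in> Ob D" and v: "v \<in> el (?U (Suc n)) x" and z: "dU n x v = \<zero>[val (?U n) x]"
  have "\<exists>w\<in>el (?U (Suc (Suc n))) x. \<forall>s\<in>S. \<delta> s (Suc n) x (?c (Suc (Suc n)) s x w) = ?c (Suc n) s x v"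
  proof (rule choose[OF x v])
   fix s assume s: "s \<in> S"
   have "\<delta> s n x (?c (Suc n) s x v) = \<zero>[val (X s n) x]" using dc[OF s x v] z cz[OF s x] by simp
   then show "\<exists>w\<in>el (X s (Suc (Suc n))) x. \<delta> s (Suc n) x w = ?c (Suc n) s x v"
    using ex_lift[OF X[OF s] x nt_in[OF cn[OF s] x v]] by blast
  qed (use \<delta>z x in auto)
  then obtain w where w: "w \<in> el (?U (Suc (Suc n))) x"
   "\<And>s. s \<in> S ==> \<delta> s (Suc n) x (?c (Suc (Suc n)) s x w) = ?c (Suc n) s x v" by blast
  have "dU (Suc n) x w = v" by (rule eqI[OF x nt_in[OF d x w(1)] v]) (simp add: dc[OF _ x w(1)] w(2))
  then show "\<exists>w\<in>el (?U (Suc (Suc n))) x. dU (Suc n) x w = v" using w(1) by blast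
 next
  fix n x w assume x: "x \<in> Ob D" and w: "w \<in> el (?U (Suc (Suc n))) x"
  note dw = nt_in[OF d x w]
  show "dU n x (dU (Suc n) x w) = \<zero>[val (?U n) x]"
   by (rule eqI[OF x nt_in[OF d x dw] module_zero[OF val_mod[OF dm x]]])
    (simp add: dc[OF _ x dw] dc[OF _ x w] cz x ex_dd[OF X x nt_in[OF cn x w]])
 qed (rule dm d)+
 have pr: "projseq D ?U" unfolding projseq_def using p by (intro allI dsum_proj[OF D inf S]) (auto simp: projseq_def)
 have em: "exm D J ?U dU n" for n
  unfolding exm_def
 proof (intro ballI impI)
  fix x z assume x: "x \<in> Ob D" and z: "z \<in> el (?U (Suc n)) x" and dz: "dU n x z \<in> jsp D J (?U n) x"
  \<comment> \<open>Only the \<open>w\<close> are chosen by components. The part in \<open>J\<close>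
    is recovered afterwards as \<open>z\<close> minus the boundary, by
    \<open>dsum_jsp\<close>.\<close>
  let ?Q = "\<lambda>s w. \<exists>j\<in>jsp D J (X s (Suc n)) x. ?c (Suc n) s x z = j \<oplus>[val (X s (Suc n)) x] \<delta> s (Suc n) x w"
  have "\<exists>w\<in>el (?U (Suc (Suc n))) x. \<forall>s\<in>S. ?Q s (?c (Suc (Suc n)) s x w)"
  proof (rule choose[OF x z, of "Suc (Suc n)" ?Q])
   fix s assume s: "s \<in> S"
   have "\<delta> s n x (?c (Suc n) s x z) \<in> jsp D J (X s n) x"
    using dc[OF s x z] jsp_nt[OF D J dm M[OF s] cn[OF s] x dz] by simp
   then show "\<exists>w\<in>el (X s (Suc (Suc n))) x. ?Q s w" using exmD[OF e[OF s] x nt_in[OF cn[OF s] x z]] by blast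
   interpret V: module K "val (X s (Suc n)) x" by (rule val_mod[OF M[OF s] x])
   show "?Q s \<zero>[val (X s (Suc (Suc n))) x]" if "?c (Suc n) s x z = \<zero>[val (X s (Suc n)) x]"
    using that \<delta>z[OF s x] by (intro bexI[of _ "\<zero>[val (X s (Suc n)) x]"]) (auto intro: jsp_zero)
  qed
  then obtain w where w: "w \<in> el (?U (Suc (Suc n))) x" "\<And>s. s \<in> S ==> ?Q s (?c (Suc (Suc n)) s x w)" by blast
  let ?dw = "dU (Suc n) x w"
  note dw = nt_in[OF d x w(1)]
  have zc: "z \<ominus>[val (?U (Suc n)) x] ?dw \<in> el (?U (Suc n)) x" by (rule module_minus[OF val_mod[OF dm x] z dw])
  have "\<forall>s\<in>S. ?c (Suc n) s x (z \<ominus>[val (?U (Suc n)) x] ?dw) \<in> jsp D J (X s (Suc n)) x"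
  proof
   fix s assume s: "s \<in> S"
   obtain j where j: "j \<in> jsp D J (X s (Suc n)) x"
    "?c (Suc n) s x z = j \<oplus>[val (X s (Suc n)) x] \<delta> s (Suc n) x (?c (Suc (Suc n)) s x w)" using w(2)[OF s] by blast
   interpret V: module K "val (X s (Suc n)) x" by (rule val_mod[OF M[OF s] x])
   have jc: "j \<in> el (X s (Suc n)) x" by (rule subf_in[OF M[OF s] jsp_subf(1)[OF D J M[OF s]] x j(1)])
   have dc': "\<delta> s (Suc n) x (?c (Suc (Suc n)) s x w) \<in> el (X s (Suc n)) x"
    by (rule nt_in[OF xn[OF s] x nt_in[OF cn[OF s] x w(1)]])
   have "?c (Suc n) s x (z \<ominus>[val (?U (Suc n)) x] ?dw) = j"
    unfolding nt_minus_at[OF dm M[OF s] cn[OF s] x z dw] dc[OF s x w(1)] j(2)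
    using jc dc' by (simp add: a_minus_def V.a_assoc V.r_neg)
   then show "?c (Suc n) s x (z \<ominus>[val (?U (Suc n)) x] ?dw) \<in> jsp D J (X s (Suc n)) x" using j(1) by simp
  qed
  then have "z \<ominus>[val (?U (Suc n)) x] ?dw \<in> jsp D J (?U (Suc n)) x"
   using dsum_jsp[where M = "\<lambda>s. X s (Suc n)", OF D J inf S M x zc] by simp
  then show "\<exists>j\<in>jsp D J (?U (Suc n)) x. \<exists>w\<in>el (?U (Suc (Suc n))) x. z = j \<oplus>[val (?U (Suc n)) x] dU (Suc n) x w"
   using minus_add_cancel[OF val_mod[OF dm x] z dw, symmetric] w(1) by blast
 qed
 show ?thesis using ex pr em by blast
qed

section \<open>Sums of two modules and mapping cones\<close>

definition bs :: "('o, 'm, 'k, 'u) kmod => ('o, 'm, 'k, 'u) kmod => ('o, 'm, 'k, 'u) kmod" where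
 "bs A B = dsum (UNIV :: bool set) (\<lambda>b. if b then A else B)"

definition bl :: "('o, 'm, 'k, 'u) kmod => ('o, 'm, 'k, 'u) kmod => 'o => 'u => 'u" where
 "bl A B = dcmp UNIV (\<lambda>b. if b then A else B) True"

definition br :: "('o, 'm, 'k, 'u) kmod => ('o, 'm, 'k, 'u) kmod => 'o => 'u => 'u" where
 "br A B = dcmp UNIV (\<lambda>b. if b then A else B) False"

definition bp :: "('o, 'm, 'k, 'u) kmod => ('o, 'm, 'k, 'u) kmod => 'o => 'u => 'u => 'u" where
 "bp A B x u v = dinj UNIV (\<lambda>b. if b then A else B) True x u \<oplus>[val (bs A B) x]
   dinj UNIV (\<lambda>b. if b then A else B) False x v"

lemma bs_props:
 fixes A B :: "('o, 'm, 'k, 'u) kmod"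
 assumes D: "k_category K D" and inf: "infinite (UNIV :: 'u set)" and A: "k_module K D A" and B: "k_module K D B"
 shows bs_module: "k_module K D (bs A B)"
  and bl_nt: "nt D (bs A B) A (bl A B)" and br_nt: "nt D (bs A B) B (br A B)"
  and bp_nt: "nt D C A f ==> nt D C B g ==> nt D C (bs A B) (\<lambda>x v. bp A B x (f x v) (g x v))"
  and bp_in: "x \<in> Ob D ==> u \<in> el A x ==> v \<in> el B x ==> bp A B x u v \<in> el (bs A B) x"
  and bl_bp: "x \<in> Ob D ==> u \<in> el A x ==> v \<in> el B x ==> bl A B x (bp A B x u v) = u"
  and br_bp: "x \<in> Ob D ==> u \<in> el A x ==> v \<in> el B x ==> br A B x (bp A B x u v) = v"
  and bs_ext: "x \<in> Ob D ==> w \<in> el (bs A B) x ==> w' \<in> el (bs A B) x ==>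
   bl A B x w = bl A B x w' ==> br A B x w = br A B x w' ==> w = w'"
  and bs_jsp: "two_sided_ideal K D J ==> x \<in> Ob D ==> w \<in> el (bs A B) x ==>
   w \<in> jsp D J (bs A B) x \<longleftrightarrow> bl A B x w \<in> jsp D J A x \<and> br A B x w \<in> jsp D J B x"
  and bs_proj: "projective_module K D A ==> projective_module K D B ==> projective_module K D (bs A B)"
proof -
 let ?M = "\<lambda>b. if b then A else B"
 have M: "k_module K D (?M s)" if "s \<in> UNIV" for s using A B by simp
 have S: "(UNIV :: bool set) \<lesssim> (UNIV :: 'u set)" by (rule finite_lepoll_infinite[OF inf]) simp
 show m: "k_module K D (bs A B)" unfolding bs_def by (rule dsum_module[OF D M inf S])
 have c: "nt D (bs A B) (?M s) (dcmp UNIV ?M s)" for s unfolding bs_def by (rule dcmp_nt[OF D M inf S]) simp_all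
 have i: "nt D (?M s) (bs A B) (dinj UNIV ?M s)" for s unfolding bs_def by (rule dinj_nt[OF D M inf S]) simp_all
 show l: "nt D (bs A B) A (bl A B)" using c[of True] by (simp add: bl_def)
 show r: "nt D (bs A B) B (br A B)" using c[of False] by (simp add: br_def)
 have i1: "nt D A (bs A B) (dinj UNIV ?M True)" using i[of True] by simp
 have i2: "nt D B (bs A B) (dinj UNIV ?M False)" using i[of False] by simp
 show "nt D C (bs A B) (\<lambda>x v. bp A B x (f x v) (g x v))" if "nt D C A f" "nt D C B g"
  unfolding bp_def by (rule nt_plus[OF m nt_compose[OF that(1) i1] nt_compose[OF that(2) i2]])
 show "bp A B x u v \<in> el (bs A B) x" if "x \<in> Ob D" "u \<in> el A x" "v \<in> el B x"
  unfolding bp_def by (rule module_add[OF val_mod[OF m that(1)] nt_in[OF i1 that(1,2)] nt_in[OF i2 that(1,3)]])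
 have dd: "dcmp UNIV ?M t x (dinj UNIV ?M s x v) = (if t = s then v else \<zero>[val (?M t) x])"
  if "x \<in> Ob D" "v \<in> el (?M s) x" for t s x v
  by (rule dcmp_dinj[where M = ?M, OF D M inf S that(1) UNIV_I UNIV_I that(2)])
 show "bl A B x (bp A B x u v) = u" if x: "x \<in> Ob D" and u: "u \<in> el A x" and v: "v \<in> el B x"
 proof -
  interpret V: module K "val A x" by (rule val_mod[OF A x])
  show ?thesis
   using nt_add[OF l x nt_in[OF i1 x u] nt_in[OF i2 x v]] dd[OF x, of u True True] dd[OF x, of v False True] u v
   by (simp add: bp_def bl_def)
 qed
 show "br A B x (bp A B x u v) = v" if x: "x \<in> Ob D" and u: "u \<in> el A x" and v: "v \<in> el B x"
 proof -
  interpret V: module K "val B x" by (rule val_mod[OF B x])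
  show ?thesis
   using nt_add[OF r x nt_in[OF i1 x u] nt_in[OF i2 x v]] dd[OF x, of u True False] dd[OF x, of v False False] u v
   by (simp add: bp_def br_def)
 qed
 show "w = w'" if "x \<in> Ob D" "w \<in> el (bs A B) x" "w' \<in> el (bs A B) x"
  "bl A B x w = bl A B x w'" "br A B x w = br A B x w'"
 proof (rule dsum_ext[where M = ?M, OF D M inf S that(1)])
  show "w \<in> el (dsum UNIV ?M) x" "w' \<in> el (dsum UNIV ?M) x" using that by (simp_all add: bs_def)
  fix s show "dcmp UNIV ?M s x w = dcmp UNIV ?M s x w'" using that(4,5) by (cases s) (simp_all add: bl_def br_def)
 qed auto
 show "w \<in> jsp D J (bs A B) x \<longleftrightarrow> bl A B x w \<in> jsp D J A x \<and> br A B x w \<in> jsp D J B x"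
  if "two_sided_ideal K D J" "x \<in> Ob D" "w \<in> el (bs A B) x"
  using dsum_jsp[where M = ?M, OF D that(1) inf S M that(2), of w] that(3)
  by (auto simp: bs_def bl_def br_def all_bool_eq split: if_splits)
 show "projective_module K D (bs A B)" if "projective_module K D A" "projective_module K D B"
  unfolding bs_def by (rule dsum_proj[OF D inf S]) (use that in auto)
qed

text \<open>The mapping cone of \<open>a : V \<rightarrow> U\<close> resolves the cokernel of \<open>a 0\<close> when \<open>a 0\<close> is injective.\<close>

lemma cone_resolution:
 fixes U V :: "nat => ('o, 'm, 'k, 'u) kmod" and M :: "('o, 'm, 'k, 'u) kmod"
 assumes D: "k_category K D" and J: "two_sided_ideal K D J" and inf: "infinite (UNIV :: 'u set)"
  and U: "exseq D U \<delta>" "projseq D U" and V: "exseq D V \<epsilon>" "projseq D V" and M: "k_module K D M"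
  and i: "nt D (V 0) (U 0) i" and p: "nt D (U 0) M p"
  and inj: "\<And>x v. x \<in> Ob D ==> v \<in> el (V 0) x ==> i x v = \<zero>[val (U 0) x] ==> v = \<zero>[val (V 0) x]"
  and psurj: "\<And>x v. x \<in> Ob D ==> v \<in> el M x ==> \<exists>u\<in>el (U 0) x. p x u = v"
  and pker: "\<And>x u. x \<in> Ob D ==> u \<in> el (U 0) x ==> p x u = \<zero>[val M x] ==> \<exists>v\<in>el (V 0) x. i x v = u"
  and pi: "\<And>x v. x \<in> Ob D ==> v \<in> el (V 0) x ==> p x (i x v) = \<zero>[val M x]"
  and k: "killed D J (U 0)" and eU: "\<And>n. exm D J U \<delta> n" and eV: "\<And>m. n = Suc m ==> exm D J V \<epsilon> n"
 shows "gdn D J M (Suc n)"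
proof -
 note Um = ex_mod[OF U(1)] and Un = ex_nt[OF U(1)] and Vm = ex_mod[OF V(1)] and Vn = ex_nt[OF V(1)]
 note Ud = ex_dd[OF U(1)] and Vd = ex_dd[OF V(1)] and Ul = ex_lift[OF U(1)] and Vl = ex_lift[OF V(1)]
 obtain a' where a'0: "a' 0 = i" and a'n: "\<And>n. nt D (V n) (U n) (a' n)"
  and a'c: "\<And>n x v. x \<in> Ob D ==> v \<in> el (V (Suc n)) x ==> \<delta> n x (a' (Suc n) x v) = a' n x (\<epsilon> n x v)"
  using comparison[OF D V U(1) i] by blast
 \<comment> \<open>Alternating signs make the chain map anticommute with the differentials, as the
   cone requires.\<close>
 define a where "a n = (if even n then a' n else (\<lambda>x v. \<ominus>[val (U n) x] a' n x v))" for n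
 have a0: "a 0 = i" using a'0 by (simp add: a_def)
 have an: "nt D (V n) (U n) (a n)" for n using a'n nt_uminus[OF Um a'n] by (simp add: a_def)
 have ac: "\<delta> n x (a (Suc n) x v) = \<ominus>[val (U n) x] a n x (\<epsilon> n x v)" if x: "x \<in> Ob D" and v: "v \<in> el (V (Suc n)) x" for n x v
 proof -
  interpret X: module K "val (U n) x" by (rule val_mod[OF Um x])
  show ?thesis
   using a'c[OF x v] lin_neg[OF val_mod[OF Um x] val_mod[OF Um x] nt_lin[OF Un x] nt_in[OF a'n x v]]
    nt_in[OF a'n x nt_in[OF Vn x v]] by (simp add: a_def)
 qed
 define C where "C n = bs (U (Suc (Suc n))) (V (Suc n))" for n
 define l where "l n = bl (U (Suc (Suc n))) (V (Suc n))" for n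
 define r where "r n = br (U (Suc (Suc n))) (V (Suc n))" for n
 define b where "b n = bp (U (Suc (Suc n))) (V (Suc n))" for n
 note defs = C_def l_def r_def b_def
 have Cm: "k_module K D (C n)" for n unfolding defs by (rule bs_module[OF D inf Um Vm])
 have ln: "nt D (C n) (U (Suc (Suc n))) (l n)" for n unfolding defs by (rule bl_nt[OF D inf Um Vm])
 have rn: "nt D (C n) (V (Suc n)) (r n)" for n unfolding defs by (rule br_nt[OF D inf Um Vm])
 have bn: "nt D A (C n) (\<lambda>x v. b n x (f x v) (g x v))"
  if "nt D A (U (Suc (Suc n))) f" "nt D A (V (Suc n)) g" for n f g and A :: "('o, 'm, 'k, 'u) kmod"
  unfolding defs by (rule bp_nt[OF D inf Um Vm that])
 have bin: "b n x u v \<in> el (C n) x" and lb: "l n x (b n x u v) = u" and rb: "r n x (b n x u v) = v"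
  if "x \<in> Ob D" "u \<in> el (U (Suc (Suc n))) x" "v \<in> el (V (Suc n)) x" for n x u v
  unfolding defs by (rule bp_in[OF D inf Um Vm that] bl_bp[OF D inf Um Vm that] br_bp[OF D inf Um Vm that])+
 have Cext: "w = w'" if "x \<in> Ob D" "w \<in> el (C n) x" "w' \<in> el (C n) x"
  "l n x w = l n x w'" "r n x w = r n x w'" for n x w w'
  by (rule bs_ext[OF D inf Um Vm that[unfolded defs]])
 have Cj: "w \<in> jsp D J (C n) x \<longleftrightarrow> l n x w \<in> jsp D J (U (Suc (Suc n))) x \<and> r n x w \<in> jsp D J (V (Suc n)) x"
  if "x \<in> Ob D" "w \<in> el (C n) x" for n x w
  unfolding defs by (rule bs_jsp[OF D inf Um Vm J that[unfolded defs]])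
 have Cp: "projective_module K D (C n)" for n
  unfolding defs using U(2) V(2) by (intro bs_proj[OF D inf Um Vm]) (auto simp: projseq_def)
 \<comment> \<open>The component in \<open>U\<close> of the differential of the cone; the component
   in \<open>V\<close> is \<open>\<epsilon>\<close>.\<close>
 define t where "t n = (\<lambda>x w. \<delta> (Suc n) x (l n x w) \<oplus>[val (U (Suc n)) x] a (Suc n) x (r n x w))" for n
 have tn: "nt D (C n) (U (Suc n)) (t n)" for n
  unfolding t_def by (rule nt_plus[OF Um nt_compose[OF ln Un] nt_compose[OF rn an]])
 \<comment> \<open>At the bottom the cone is replaced by \<open>M\<close> and
   \<open>U (Suc 0)\<close>: the terms \<open>U 0\<close> and \<open>V 0\<close> disappear, since
   \<open>i\<close> and \<open>p\<close> present \<open>M\<close> as a cokernel. The term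
   \<open>C n\<close> has index \<open>n + 2\<close>.\<close>
 define W where "W n = (case n of 0 => M | Suc 0 => U (Suc 0) | Suc (Suc n) => C n)" for n
 define \<omega> where "\<omega> n = (case n of 0 => (\<lambda>x w. p x (\<delta> 0 x w)) | Suc 0 => t 0 |
  Suc (Suc n) => (\<lambda>x w. b n x (t (Suc n) x w) (\<epsilon> (Suc n) x (r (Suc n) x w))))" for n
 have W: "W 0 = M" "W (Suc 0) = U (Suc 0)" "\<And>n. W (Suc (Suc n)) = C n" by (simp_all add: W_def)
 have \<omega>: "\<omega> 0 = (\<lambda>x w. p x (\<delta> 0 x w))" "\<omega> (Suc 0) = t 0"
  "\<And>n. \<omega> (Suc (Suc n)) = (\<lambda>x w. b n x (t (Suc n) x w) (\<epsilon> (Suc n) x (r (Suc n) x w)))"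
  by (simp_all add: \<omega>_def)
 note en = nt_compose[OF rn Vn]
 have Wm: "k_module K D (W n)" for n by (auto simp: W_def M Um Cm split: nat.splits)
 have \<omega>n: "nt D (W (Suc n)) (W n) (\<omega> n)" for n
 proof (cases n rule: nat.exhaust[case_names 0 Suc])
  case 0 then show ?thesis using nt_compose[OF Un p] by (simp add: W \<omega>)
 next
  case (Suc m) then show ?thesis using tn[of 0] bn[OF tn en] by (cases m) (simp_all add: W \<omega>)
 qed
 have \<omega>C: "\<omega> (Suc (Suc n)) x w \<in> el (C n) x" if "x \<in> Ob D" "w \<in> el (C (Suc n)) x" for n x w
  using nt_in[OF \<omega>n, of x w "Suc (Suc n)"] that by (simp add: W)
 have Wp: "projseq D W"
  unfolding projseq_def
 proof
  show "projective_module K D (W (Suc n))" for n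
   using U(2) Cp by (cases n) (auto simp: W projseq_def)
 qed
 have lt: "l n x (\<omega> (Suc (Suc n)) x w) = t (Suc n) x w" and rt: "r n x (\<omega> (Suc (Suc n)) x w) = \<epsilon> (Suc n) x (r (Suc n) x w)"
  if "x \<in> Ob D" "w \<in> el (C (Suc n)) x" for n x w
  using lb[OF that(1) nt_in[OF tn that] nt_in[OF en that]] rb[OF that(1) nt_in[OF tn that] nt_in[OF en that]]
  by (simp_all add: \<omega>)
 have C0: "w = \<zero>[val (C n) x]" if "x \<in> Ob D" "w \<in> el (C n) x" "l n x w = \<zero>[val (U (Suc (Suc n))) x]" "r n x w = \<zero>[val (V (Suc n)) x]" for n x w
  using Cext[OF that(1,2) module_zero[OF val_mod[OF Cm that(1)]]] that(3,4) nt_zero_at[OF Cm Um ln that(1)] nt_zero_at[OF Cm Vm rn that(1)] by simp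
 have \<delta>t: "\<delta> n x (t n x w) = \<ominus>[val (U n) x] a n x (\<epsilon> n x (r n x w))" if x: "x \<in> Ob D" and w: "w \<in> el (C n) x" for n x w
 proof -
  note lw = nt_in[OF ln x w] and rw = nt_in[OF rn x w]
  interpret X: module K "val (U n) x" by (rule val_mod[OF Um x])
  show ?thesis
   unfolding t_def nt_add[OF Un x nt_in[OF Un x lw] nt_in[OF an x rw]] Ud[OF x lw] ac[OF x rw]
   using nt_in[OF an x nt_in[OF Vn x rw]] by simp
 qed
 \<comment> \<open>The map \<open>t 0\<close> is the whole differential on \<open>C 0\<close> and
   has no component in \<open>V\<close>; the injectivity of \<open>i\<close> recovers the vanishing
   of that component.\<close>
 have \<delta>t0: "\<epsilon> 0 x (r 0 x w) = \<zero>[val (V 0) x]" if x: "x \<in> Ob D" and w: "w \<in> el (C 0) x" and z: "\<delta> 0 x (t 0 x w) = \<zero>[val (U 0) x]" for x w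
 proof -
  interpret X: module K "val (U 0) x" by (rule val_mod[OF Um x])
  note e = nt_in[OF Vn x nt_in[OF rn x w]]
  have "i x (\<epsilon> 0 x (r 0 x w)) = \<ominus>[val (U 0) x] \<delta> 0 x (t 0 x w)" unfolding \<delta>t[OF x w] a0 using nt_in[OF i x e] by simp
  then show ?thesis using z inj[OF x e] by simp
 qed
 \<comment> \<open>Common step for exactness (\<open>N\<close> zero, see \<open>fill0\<close>) and
   for exactness modulo \<open>J\<close> (\<open>N\<close> the span in \<open>U\<close>): with
   \<open>v'\<close> as prescribed second component, a first component exists as soon as
   \<open>u - a v'\<close> lies in \<open>N\<close> plus the boundaries.\<close>
 have fill: "\<exists>w\<in>el (C n) x. r n x w = v' \<and> (\<exists>j\<in>N. u = j \<oplus>[val (U (Suc n)) x] t n x w)"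
  if x: "x \<in> Ob D" and u: "u \<in> el (U (Suc n)) x" and v': "v' \<in> el (V (Suc n)) x" and N: "N \<subseteq> el (U (Suc n)) x"
   and e: "\<And>s. s \<in> el (U (Suc n)) x ==> \<delta> n x s = \<delta> n x u \<oplus>[val (U n) x] a n x (\<epsilon> n x v') ==>
    \<exists>j\<in>N. \<exists>u'\<in>el (U (Suc (Suc n))) x. s = j \<oplus>[val (U (Suc n)) x] \<delta> (Suc n) x u'"
  for n x u v' N
 proof -
  let ?U = "val (U (Suc n)) x"
  interpret X: module K ?U by (rule val_mod[OF Um x])
  interpret X': module K "val (U n) x" by (rule val_mod[OF Um x])
  note av = nt_in[OF an x v']
  have "\<delta> n x (u \<ominus>[?U] a (Suc n) x v') = \<delta> n x u \<oplus>[val (U n) x] a n x (\<epsilon> n x v')"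
   using nt_minus_at[OF Um Um Un x u av] ac[OF x v'] nt_in[OF an x nt_in[OF Vn x v']] by (simp add: a_minus_def)
  then obtain j u' where j: "j \<in> N" and u': "u' \<in> el (U (Suc (Suc n))) x"
   and su: "u \<ominus>[?U] a (Suc n) x v' = j \<oplus>[?U] \<delta> (Suc n) x u'"
   using e[OF X.minus_closed[OF u av]] by auto
  have "u = (u \<ominus>[?U] a (Suc n) x v') \<oplus>[?U] a (Suc n) x v'" using minus_add_cancel[OF X.module_axioms u av] by simp
  also have "\<dots> = j \<oplus>[?U] t n x (b n x u' v')"
   unfolding su t_def lb[OF x u' v'] rb[OF x u' v'] using subsetD[OF N j] nt_in[OF Un x u'] av by (simp add: X.a_assoc)
  finally show ?thesis using bin[OF x u' v'] j rb[OF x u' v'] by blast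
 qed
 have fill0: "\<exists>w\<in>el (C n) x. r n x w = v' \<and> u = t n x w"
  if x: "x \<in> Ob D" and u: "u \<in> el (U (Suc n)) x" and v': "v' \<in> el (V (Suc n)) x"
   and e: "\<delta> n x u \<oplus>[val (U n) x] a n x (\<epsilon> n x v') = \<zero>[val (U n) x]" for n x u v'
 proof -
  interpret X: module K "val (U (Suc n)) x" by (rule val_mod[OF Um x])
  have "\<exists>w\<in>el (C n) x. r n x w = v' \<and> (\<exists>j\<in>{\<zero>[val (U (Suc n)) x]}. u = j \<oplus>[val (U (Suc n)) x] t n x w)"
  proof (rule fill[OF x u v'])
   fix s assume s: "s \<in> el (U (Suc n)) x" "\<delta> n x s = \<delta> n x u \<oplus>[val (U n) x] a n x (\<epsilon> n x v')"
   obtain u' where "u' \<in> el (U (Suc (Suc n))) x" "\<delta> (Suc n) x u' = s" using Ul[OF x s(1)] s(2) e by auto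
   then show "\<exists>j\<in>{\<zero>[val (U (Suc n)) x]}. \<exists>u'\<in>el (U (Suc (Suc n))) x. s = j \<oplus>[val (U (Suc n)) x] \<delta> (Suc n) x u'"
    using X.l_zero[OF s(1)] by (intro bexI[OF _ singletonI] bexI[of _ u']) simp_all
  qed simp
  then show ?thesis using X.l_zero[OF nt_in[OF tn x]] by auto
 qed
 have kern: "\<exists>v'\<in>el (V (Suc (Suc n))) x. \<epsilon> (Suc n) x v' = r n x w"
  if "x \<in> Ob D" "w \<in> el (C n) x" "\<epsilon> n x (r n x w) = \<zero>[val (V n) x]" for n x w
  using Vl[OF that(1) nt_in[OF rn that(1,2)] that(3)] by blast
 have ex: "exseq D W \<omega>"
 proof (rule exseqI[where X = W and \<delta> = \<omega>, OF Wm \<omega>n])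
  fix x v assume x: "x \<in> Ob D" and v: "v \<in> el (W 0) x"
  obtain u where u: "u \<in> el (U 0) x" "p x u = v" using psurj[OF x] v by (auto simp: W)
  obtain w where "w \<in> el (U (Suc 0)) x" "\<delta> 0 x w = u" using ex_surj[OF U(1) x u(1)] by blast
  then show "\<exists>w\<in>el (W (Suc 0)) x. \<omega> 0 x w = v" using u(2) by (auto simp: W \<omega>)
 next
  fix n x v assume x: "x \<in> Ob D" and v: "v \<in> el (W (Suc n)) x" and z: "\<omega> n x v = \<zero>[val (W n) x]"
  show "\<exists>w\<in>el (W (Suc (Suc n))) x. \<omega> (Suc n) x w = v"
  proof (cases n)
   case 0
   interpret X: module K "val (U 0) x" by (rule val_mod[OF Um x])
   have u: "v \<in> el (U (Suc 0)) x" and pu: "p x (\<delta> 0 x v) = \<zero>[val M x]" using v z 0 by (auto simp: W \<omega>)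
   note du = nt_in[OF Un x u]
   obtain f where f: "f \<in> el (V 0) x" "i x f = \<delta> 0 x v" using pker[OF x du pu] by blast
   \<comment> \<open>The preimage is that of \<open>f\<close> with the opposite sign, since
     \<open>fill0\<close> asks \<open>\<delta> u + a \<epsilon> v'\<close> to vanish.\<close>
   obtain v' where v': "v' \<in> el (V (Suc 0)) x" "\<epsilon> 0 x v' = \<ominus>[val (V 0) x] f"
    using ex_surj[OF V(1) x module_neg[OF val_mod[OF Vm x] f(1)]] by blast
   have "i x (\<epsilon> 0 x v') = \<ominus>[val (U 0) x] \<delta> 0 x v"
    unfolding v'(2) f(2)[symmetric] by (rule lin_neg[OF val_mod[OF Vm x] val_mod[OF Um x] nt_lin[OF i x] f(1)])
   then show ?thesis using fill0[OF x u v'(1)] X.r_neg[OF du] 0 by (auto simp: W \<omega> a0)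
  next
   case (Suc m)
   have w: "v \<in> el (C m) x" using v Suc by (simp add: W)
   have "t m x v = \<zero>[val (U (Suc m)) x] \<and> \<epsilon> m x (r m x v) = \<zero>[val (V m) x]"
   proof (cases m)
    case 0
    then show ?thesis using z Suc \<delta>t0[OF x, of v] w nt_zero_at[OF Um Um Un x, of 0] by (simp add: W \<omega>)
   next
    case (Suc q)
    have v: "v \<in> el (C (Suc q)) x" and "\<omega> (Suc (Suc q)) x v = \<zero>[val (C q) x]" using w z \<open>n = Suc m\<close> Suc by (simp_all add: W)
    then show ?thesis using lt[OF x v] rt[OF x v] nt_zero_at[OF Cm Um ln x] nt_zero_at[OF Cm Vm rn x] Suc by simp
   qed
   then have tz: "t m x v = \<zero>[val (U (Suc m)) x]" and rz: "\<epsilon> m x (r m x v) = \<zero>[val (V m) x]" by blast+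
   obtain v' where v': "v' \<in> el (V (Suc (Suc m))) x" "\<epsilon> (Suc m) x v' = r m x v" using kern[OF x w rz] by blast
   obtain w' where w': "w' \<in> el (C (Suc m)) x" "r (Suc m) x w' = v'" "l m x v = t (Suc m) x w'"
    using fill0[OF x nt_in[OF ln x w] v'(1)] tz unfolding v'(2) t_def by blast
   have "\<omega> (Suc (Suc m)) x w' = v"
    by (rule Cext[OF x \<omega>C[OF x w'(1)] w]) (simp_all add: lt[OF x w'(1)] rt[OF x w'(1)] w'(2,3) v'(2))
   then show ?thesis using w'(1) Suc by (auto simp: W)
  qed
 next
  fix n x w assume x: "x \<in> Ob D" and "w \<in> el (W (Suc (Suc n))) x"
  then have w: "w \<in> el (C n) x" by (simp add: W)
  show "\<omega> n x (\<omega> (Suc n) x w) = \<zero>[val (W n) x]"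
  proof (cases n)
   case 0
   have e: "\<epsilon> 0 x (r 0 x w) \<in> el (V 0) x" using nt_in[OF Vn x nt_in[OF rn x w]] 0 by simp
   have "\<delta> 0 x (t 0 x w) = i x (\<ominus>[val (V 0) x] \<epsilon> 0 x (r 0 x w))"
    using \<delta>t[OF x w] lin_neg[OF val_mod[OF Vm x] val_mod[OF Um x] nt_lin[OF i x] e] 0 by (simp add: a0)
   then show ?thesis using pi[OF x module_neg[OF val_mod[OF Vm x] e]] 0 by (simp add: W \<omega>)
  next
   case (Suc m)
   have wm: "w \<in> el (C (Suc m)) x" using w Suc by simp
   let ?y = "\<omega> (Suc (Suc m)) x w"
   note y = \<omega>C[OF x wm] and rw = nt_in[OF rn x wm]
   interpret X: module K "val (U (Suc m)) x" by (rule val_mod[OF Um x])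
   have ty: "t m x ?y = \<zero>[val (U (Suc m)) x]"
    unfolding t_def[of m] lt[OF x wm] rt[OF x wm] \<delta>t[OF x wm] by (rule X.l_neg[OF nt_in[OF an x nt_in[OF Vn x rw]]])
   have ry: "\<epsilon> m x (r m x ?y) = \<zero>[val (V m) x]" unfolding rt[OF x wm] by (rule Vd[OF x rw])
   show ?thesis
   proof (cases m)
    case 0 then show ?thesis using ty Suc by (simp add: W \<omega>)
   next
    case (Suc q)
    have yq: "?y \<in> el (C (Suc q)) x" using y Suc by simp
    have "\<omega> (Suc (Suc q)) x ?y = \<zero>[val (C q) x]"
     by (rule C0[OF x \<omega>C[OF x yq]]) (use lt[OF x yq] rt[OF x yq] ty ry Suc in simp_all)
    then show ?thesis using Suc \<open>n = Suc m\<close> by (simp add: W)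
   qed
  qed
 qed
 have "exm D J W \<omega> (Suc n)"
  unfolding exm_def
 proof (intro ballI impI)
  fix x z assume x: "x \<in> Ob D" and z: "z \<in> el (W (Suc (Suc n))) x" and dz: "\<omega> (Suc n) x z \<in> jsp D J (W (Suc n)) x"
  have w: "z \<in> el (C n) x" using z by (simp add: W)
  note jU = subf_in[OF Um jsp_subf(1)[OF D J Um] x] and jV = subf_in[OF Vm jsp_subf(1)[OF D J Vm] x]
  interpret X': module K "val (U (Suc n)) x" by (rule val_mod[OF Um x])
  interpret Y': module K "val (V (Suc n)) x" by (rule val_mod[OF Vm x])
  note lz = nt_in[OF ln x w] and rz = nt_in[OF rn x w]
  have "t n x z \<in> jsp D J (U (Suc n)) x \<and>
   (\<exists>jv\<in>jsp D J (V (Suc n)) x. \<exists>v'\<in>el (V (Suc (Suc n))) x. r n x z = jv \<oplus>[val (V (Suc n)) x] \<epsilon> (Suc n) x v')"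
  proof (cases n)
   case 0
   have tj: "t 0 x z \<in> jsp D J (U (Suc 0)) x" using dz 0 by (simp add: W \<omega>)
   have w0: "z \<in> el (C 0) x" using w 0 by simp
   \<comment> \<open>In the lowest degree the hypothesis that \<open>U 0\<close> is killed takes the
     place of exactness of \<open>V\<close> modulo \<open>J\<close>: \<open>\<delta> 0\<close> of
     \<open>t 0 x z\<close> lies in \<open>J (U 0)\<close>, which is zero, so the second component
     of \<open>z\<close> is itself a boundary.\<close>
   from \<delta>t0[OF x w0 killed_jsp[OF Um k x jsp_nt[OF D J Um Um Un x tj]]]
   obtain v' where v': "v' \<in> el (V (Suc (Suc 0))) x" "\<epsilon> (Suc 0) x v' = r 0 x z" using kern[OF x w0] by blast
   then have "r n x z = \<zero>[val (V (Suc n)) x] \<oplus>[val (V (Suc n)) x] \<epsilon> (Suc n) x v'" using Y'.l_zero[OF rz] 0 by simp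
   then show ?thesis using tj 0 v'(1) by (blast intro: jsp_zero)
  next
   case (Suc q)
   have wq: "z \<in> el (C (Suc q)) x" using w Suc by simp
   have "\<omega> (Suc (Suc q)) x z \<in> jsp D J (C q) x" using dz Suc by (simp add: W)
   then have lj: "t (Suc q) x z \<in> jsp D J (U (Suc (Suc q))) x" and rj: "\<epsilon> (Suc q) x (r (Suc q) x z) \<in> jsp D J (V (Suc q)) x"
    using Cj[OF x \<omega>C[OF x wq]] lt[OF x wq] rt[OF x wq] by simp_all
   then show ?thesis
    using exmD[OF eV[OF Suc] x, unfolded Suc, of "r (Suc q) x z"] nt_in[OF rn x wq] Suc by blast
  qed
  then obtain jv v' where tj: "t n x z \<in> jsp D J (U (Suc n)) x" and jv: "jv \<in> jsp D J (V (Suc n)) x"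
   and v': "v' \<in> el (V (Suc (Suc n))) x" and rv: "r n x z = jv \<oplus>[val (V (Suc n)) x] \<epsilon> (Suc n) x v'" by blast
  note jvc = jV[OF jv] and ev = nt_in[OF Vn x v']
  have "\<exists>w'\<in>el (C (Suc n)) x. r (Suc n) x w' = v' \<and> (\<exists>j\<in>jsp D J (U (Suc (Suc n))) x. l n x z = j \<oplus>[val (U (Suc (Suc n))) x] t (Suc n) x w')"
  proof (rule fill[OF x lz v'])
   show "jsp D J (U (Suc (Suc n))) x \<subseteq> el (U (Suc (Suc n))) x" using jU by blast
   fix s assume s: "s \<in> el (U (Suc (Suc n))) x"
    and ds: "\<delta> (Suc n) x s = \<delta> (Suc n) x (l n x z) \<oplus>[val (U (Suc n)) x] a (Suc n) x (\<epsilon> (Suc n) x v')"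
   let ?aj = "a (Suc n) x jv"
   have "t n x z = ?aj \<oplus>[val (U (Suc n)) x] \<delta> (Suc n) x s"
    unfolding t_def rv nt_add[OF an x jvc ev] ds
    using nt_in[OF Un x lz] nt_in[OF an x ev] nt_in[OF an x jvc] by (simp add: X'.a_ac)
   \<comment> \<open>Cancelling \<open>?aj\<close>, which lies in the span, leaves the boundary of
     \<open>s\<close> in the span, so exactness of \<open>U\<close> modulo \<open>J\<close> applies
     to \<open>s\<close>.\<close>
   then have "?aj \<oplus>[val (U (Suc n)) x] \<delta> (Suc n) x s \<in> jsp D J (U (Suc n)) x" using tj by simp
   then have "\<delta> (Suc n) x s \<in> jsp D J (U (Suc n)) x"
    by (rule sub_cancel[OF X'.module_axioms subf_sub[OF jsp_subf(1)[OF D J Um] x] jsp_nt[OF D J Vm Um an x jv] nt_in[OF Un x s]])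
   then show "\<exists>j\<in>jsp D J (U (Suc (Suc n))) x. \<exists>u'\<in>el (U (Suc (Suc (Suc n)))) x.
     s = j \<oplus>[val (U (Suc (Suc n))) x] \<delta> (Suc (Suc n)) x u'"
    by (rule exmD[OF eU x s])
  qed
  then obtain w' j where w': "w' \<in> el (C (Suc n)) x" and j: "j \<in> jsp D J (U (Suc (Suc n))) x"
   and tw: "l n x z = j \<oplus>[val (U (Suc (Suc n))) x] t (Suc n) x w'" and rw: "r (Suc n) x w' = v'" by blast
  let ?j = "b n x j jv" and ?d = "\<omega> (Suc (Suc n)) x w'"
  note jc = jU[OF j] and d = \<omega>C[OF x w']
  note jb = bin[OF x jc jvc]
  have jj: "?j \<in> jsp D J (C n) x" using Cj[OF x jb] lb[OF x jc jvc] rb[OF x jc jvc] j jv by simp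
  have "z = ?j \<oplus>[val (C n) x] ?d"
   by (rule Cext[OF x w module_add[OF val_mod[OF Cm x] jb d]])
    (simp_all add: nt_add[OF ln x jb d] nt_add[OF rn x jb d] lb[OF x jc jvc] rb[OF x jc jvc] lt[OF x w'] rt[OF x w'] tw rw rv)
  then show "\<exists>j\<in>jsp D J (W (Suc (Suc n))) x. \<exists>w\<in>el (W (Suc (Suc (Suc n)))) x. z = j \<oplus>[val (W (Suc (Suc n))) x] \<omega> (Suc (Suc n)) x w"
   using jj w' by (auto simp: W)
 qed
 then show ?thesis
  using gdnI[OF D J ex Wp, of M "\<lambda>x v. v" "\<lambda>x v. v" "Suc n"] nt_id[of D M] W(1) by simp
qed

text \<open>Dimension shifting: every killed module is a quotient of a sum of modules \<open>N y\<close>.\<close>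

lemma acyclic_all:
 fixes D :: "('o, 'k, 'm) kcat" and N :: "'o => ('o, 'm, 'k, 'u) kmod"
 assumes sD: "small_k_category TYPE('u) K D" and J: "two_sided_ideal K D J"
  and N: "\<And>y. y \<in> Ob D ==> k_module K D (N y)" "\<And>y. y \<in> Ob D ==> killed D J (N y)" "\<And>y n. y \<in> Ob D ==> gdn D J (N y) n"
  and e: "\<And>y. y \<in> Ob D ==> e y \<in> el (N y) y"
  and univ: "\<And>y (M :: ('o, 'm, 'k, 'u) kmod) v. y \<in> Ob D ==> k_module K D M ==> killed D J M ==> v \<in> el M y ==>
   \<exists>h. nt D (N y) M h \<and> h y (e y) = v"
  and M: "k_module K D M" "killed D J M"
 shows "gdn D J (M :: ('o, 'm, 'k, 'u) kmod) n"
 using M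
proof (induction n arbitrary: M)
 case 0
 then show ?case by (intro gdn_zero[OF small_cat[OF sD] J])
next
 case (Suc n M)
 note D = small_cat[OF sD] and inf = small_inf[OF sD]
 have "\<exists>X \<delta>. X 0 = N y \<and> exseq D X \<delta> \<and> (\<forall>n. isfree D (X (Suc n)))" if "y \<in> Ob D" for y
  by (rule free_resolution[OF sD N(1)[OF that]])
 then obtain X \<delta> where X: "\<And>y. y \<in> Ob D ==> X y 0 = N y" "\<And>y. y \<in> Ob D ==> exseq D (X y) (\<delta> y)"
  "\<And>y n. y \<in> Ob D ==> isfree D (X y (Suc n))" by metis
 have Xp: "projseq D (X y)" if "y \<in> Ob D" for y by (rule free_projseq[where X = "X y", OF sD X(3)[OF that]])
 let ?S = "SIGMA y:Ob D. el M y"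
 have S: "?S \<lesssim> (UNIV :: 'u set)" by (rule fc_index_small[OF sD])
 \<comment> \<open>The sum of the resolutions of \<open>N y\<close> over all pairs of an object
   \<open>y\<close> and an element of \<open>M\<close> at \<open>y\<close>. It resolves a killed
   module that maps onto \<open>M\<close>.\<close>
 let ?U = "\<lambda>n. dsum ?S (\<lambda>s. X (fst s) n)"
 have "\<exists>dU. exseq D ?U dU \<and> projseq D ?U \<and> (\<forall>n. exm D J ?U dU n)"
 proof (rule dsum_resolution[OF D J inf S])
  fix s n assume "s \<in> ?S"
  then have s: "fst s \<in> Ob D" by auto
  show "exseq D (X (fst s)) (\<delta> (fst s))" "projseq D (X (fst s))" by (rule X(2)[OF s] Xp[OF s])+
  show "exm D J (X (fst s)) (\<delta> (fst s)) n"
   by (rule gdnD[OF _ X(2)[OF s] Xp[OF s]]) (simp add: X(1)[OF s] N(3)[OF s])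
 qed
 then obtain dU where U: "exseq D ?U dU" "projseq D ?U" "\<And>n. exm D J ?U dU n" by blast
 let ?M0 = "\<lambda>s. X (fst s) 0"
 have M0: "k_module K D (?M0 s)" "killed D J (?M0 s)" if "s \<in> ?S" for s using that X(1) N(1,2) by auto
 note L = ex_mod[OF U(1), of 0]
 have kL: "killed D J (?U 0)" by (rule dsum_killed[OF D J inf S M0])
 have "\<exists>h. nt D (?M0 s) M h \<and> h (fst s) (e (fst s)) = snd s" if "s \<in> ?S" for s
  using that univ[OF _ Suc.prems, of "fst s" "snd s"] X(1) by auto
 then obtain h where h: "\<And>s. s \<in> ?S ==> nt D (?M0 s) M (h s)" "\<And>s. s \<in> ?S ==> h s (fst s) (e (fst s)) = snd s" by metis
 let ?p = "dout ?S ?M0 M h"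
 have p: "nt D (?U 0) M ?p" by (rule dout_nt[OF D M0(1) inf S Suc.prems(1) h(1)])
 have ps: "\<exists>u\<in>el (?U 0) x. ?p x u = v" if x: "x \<in> Ob D" and v: "v \<in> el M x" for x v
 proof -
  have s: "(x, v) \<in> ?S" using x v by simp
  have ex: "e x \<in> el (?M0 (x, v)) x" using e[OF x] X(1)[OF x] by simp
  show ?thesis
   using nt_in[OF dinj_nt[where M = ?M0, OF D M0(1) inf S s] x ex]
    dout_dinj[where M = ?M0 and h = h, OF D M0(1) inf S Suc.prems(1) h(1) x s ex] h(2)[OF s] by auto
 qed
 let ?Z = "\<lambda>x. {v \<in> el (?U 0) x. ?p x v = \<zero>[val M x]}"
 have Z: "subf D (?U 0) ?Z" by (rule subf_kernel[OF L Suc.prems(1) p])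
 \<comment> \<open>The kernel of the cover is killed again, so the induction hypothesis applies to
   it in degree \<open>n\<close>; the cone raises this to degree \<open>Suc n\<close> for
   \<open>M\<close>.\<close>
 let ?F = "subk (?U 0) ?Z"
 have F: "k_module K D ?F" by (rule subk_module[OF L Z D])
 have kF: "killed D J ?F" by (rule killed_subk[OF L Z kL])
 obtain V \<epsilon> where V: "V 0 = ?F" "exseq D V \<epsilon>" "\<And>n. isfree D (V (Suc n))" using free_resolution[OF sD F] by blast
 have Vp: "projseq D V" by (rule free_projseq[where X = V, OF sD V(3)])
 have eV: "exm D J V \<epsilon> n" using gdnD[of D J V, OF _ V(2) Vp] Suc.IH[OF F kF] V(1) by simp
 show ?case
  by (rule cone_resolution[OF D J inf U(1,2) V(2) Vp Suc.prems(1) _ p _ ps _ _ kL U(3) eV, where i = "\<lambda>x v. v"])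
   (auto simp: V(1) subk_incl[OF L Z])
qed

section \<open>Bimodules\<close>

subsection \<open>Quotient complexes\<close>

text \<open>Exactness of the quotient complex \<open>F/Z\<close> is checked on representatives in
  \<open>F\<close>; for \<open>Z n = jsp D J (F n)\<close> the hypothesis \<open>ex\<close> is
  \<open>exm\<close>.\<close>

lemma quot_exseq:
 fixes F :: "nat => ('o, 'm, 'k, 'u) kmod"
 assumes D: "k_category K D" and F: "exseq D F \<delta>" and Z: "\<And>n. subf D (F n) (Z n)"
  and \<delta>Z: "\<And>n x v. x \<in> Ob D ==> v \<in> Z (Suc n) x ==> \<delta> n x v \<in> Z n x"
  and ex: "\<And>n x z. x \<in> Ob D ==> z \<in> el (F (Suc n)) x ==> \<delta> n x z \<in> Z n x ==>
   \<exists>j\<in>Z (Suc n) x. \<exists>w\<in>el (F (Suc (Suc n))) x. z = j \<oplus>[val (F (Suc n)) x] \<delta> (Suc n) x w"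
 shows "exseq D (\<lambda>n. quotk (F n) (Z n)) (\<lambda>n x u. rp (F n) (Z n) x (\<delta> n x u))"
proof -
 note Fm = ex_mod[OF F] and Fn = ex_nt[OF F]
 note Qm = quotk_module(1)[OF D Fm Z] and Qp = quotk_proj[OF D Fm Z]
 note z = quotk_zero_iff[OF Fm Z] and el = quotk_elem[OF Fm Z]
 have n: "nt D (F (Suc n)) (quotk (F n) (Z n)) (\<lambda>x u. rp (F n) (Z n) x (\<delta> n x u))" for n
  by (rule nt_compose[OF Fn Qp])
 have n': "nt D (quotk (F (Suc n)) (Z (Suc n))) (quotk (F n) (Z n)) (\<lambda>x u. rp (F n) (Z n) x (\<delta> n x u))" for n
  by (rule quotk_out[OF Fm Z Qm n]) (simp add: z \<delta>Z nt_in[OF Fn] subf_in[OF Fm Z])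
 have \<delta>rp: "rp (F n) (Z n) x (\<delta> n x (rp (F (Suc n)) (Z (Suc n)) x v)) = rp (F n) (Z n) x (\<delta> n x v)"
  if "x \<in> Ob D" "v \<in> el (F (Suc n)) x" for n x v
  by (rule rp_lin_sub[OF Fm Z Fm Z that(1) nt_lin[OF Fn that(1)] \<delta>Z[OF that(1)] that(2)])
 show ?thesis
 proof (rule exseqI[where \<delta> = "\<lambda>n x u. rp (F n) (Z n) x (\<delta> n x u)" and X = "\<lambda>n. quotk (F n) (Z n)", OF Qm n'])
  fix x v assume x: "x \<in> Ob D" and v: "v \<in> el (quotk (F 0) (Z 0)) x"
  obtain w where w: "w \<in> el (F (Suc 0)) x" "\<delta> 0 x w = v" using ex_surj[OF F x el(1)[OF x v]] by blast
  show "\<exists>w\<in>el (quotk (F (Suc 0)) (Z (Suc 0))) x. rp (F 0) (Z 0) x (\<delta> 0 x w) = v"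
   using \<delta>rp[OF x w(1)] w el(2)[OF x v] by (intro bexI[OF _ quotk_in[OF w(1)]]) simp
 next
  fix n x v assume x: "x \<in> Ob D" and v: "v \<in> el (quotk (F (Suc n)) (Z (Suc n))) x"
   and 0: "rp (F n) (Z n) x (\<delta> n x v) = \<zero>[val (quotk (F n) (Z n)) x]"
  note vc = el(1)[OF x v]
  have "\<delta> n x v \<in> Z n x" using 0 z[OF x nt_in[OF Fn x vc]] by simp
  then obtain j w where j: "j \<in> Z (Suc n) x" and w: "w \<in> el (F (Suc (Suc n))) x"
   and eq: "v = j \<oplus>[val (F (Suc n)) x] \<delta> (Suc n) x w" using ex[OF x vc] by blast
  interpret M: module K "val (F (Suc n)) x" by (rule val_mod[OF Fm x])
  interpret Q: module K "val (quotk (F (Suc n)) (Z (Suc n))) x" by (rule val_mod[OF Qm x])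
  note jc = subf_in[OF Fm Z x j] and dw = nt_in[OF Fn x w]
  have "v = rp (F (Suc n)) (Z (Suc n)) x v" using el(2)[OF x v] by simp
  also have "\<dots> = rp (F (Suc n)) (Z (Suc n)) x j \<oplus>[val (quotk (F (Suc n)) (Z (Suc n))) x] rp (F (Suc n)) (Z (Suc n)) x (\<delta> (Suc n) x w)"
   by (subst eq) (rule nt_add[OF Qp x jc dw])
  also have "rp (F (Suc n)) (Z (Suc n)) x j = \<zero>[val (quotk (F (Suc n)) (Z (Suc n))) x]" using z[OF x jc] j by simp
  finally have "v = rp (F (Suc n)) (Z (Suc n)) x (\<delta> (Suc n) x w)" using nt_in[OF Qp x dw] by simp
  then show "\<exists>w\<in>el (quotk (F (Suc (Suc n))) (Z (Suc (Suc n)))) x. rp (F (Suc n)) (Z (Suc n)) x (\<delta> (Suc n) x w) = v"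
   using \<delta>rp[OF x w] by (intro bexI[OF _ quotk_in[OF w]]) simp
 next
  fix n x w assume x: "x \<in> Ob D" and w: "w \<in> el (quotk (F (Suc (Suc n))) (Z (Suc (Suc n)))) x"
  note wc = el(1)[OF x w]
  show "rp (F n) (Z n) x (\<delta> n x (rp (F (Suc n)) (Z (Suc n)) x (\<delta> (Suc n) x w))) = \<zero>[val (quotk (F n) (Z n)) x]"
   unfolding \<delta>rp[OF x nt_in[OF Fn x wc]] ex_dd[OF F x wc] by (simp add: quotk_def)
 qed
qed

text \<open>The identity \<open>J (F/Z) = (J F + Z)/Z\<close>, by right exactness in one direction
  and by naturality in the other.\<close>

lemma quot_jsp:
 assumes D: "k_category K D" and J: "two_sided_ideal K D J" and F: "k_module K D F" and Z: "subf D F Z"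
  and x: "x \<in> Ob D" and v: "v \<in> el F x"
 shows "rp F Z x v \<in> jsp D J (quotk F Z) x \<longleftrightarrow> v \<in> ssum (val F x) (jsp D J F x) (Z x)"
proof
 note Q = quotk_module(1)[OF D F Z] and p = quotk_proj[OF D F Z]
 note m = val_mod[OF F x]
 interpret M: module K "val F x" by (rule m)
 note jc = subf_in[OF F jsp_subf(1)[OF D J F] x] and zc = subf_in[OF F Z x]
 {
  assume "rp F Z x v \<in> jsp D J (quotk F Z) x"
  then obtain w where w: "w \<in> jsp D J F x" "rp F Z x w = rp F Z x v"
   using jsp_surj[OF D J F Q p quotk_surj x] by blast
  have "v \<ominus>[val F x] w \<in> Z x" using rp_eq_iff[OF F Z x v jc[OF w(1)]] w(2) by simp
  moreover have "v = w \<oplus>[val F x] (v \<ominus>[val F x] w)"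
   using minus_add_cancel[OF m v jc[OF w(1)]] M.a_comm[OF jc[OF w(1)] M.minus_closed[OF v jc[OF w(1)]]] by simp
  ultimately show "v \<in> ssum (val F x) (jsp D J F x) (Z x)" using w(1) unfolding ssum_def by blast
 next
  assume "v \<in> ssum (val F x) (jsp D J F x) (Z x)"
  then obtain j z where jz: "j \<in> jsp D J F x" "z \<in> Z x" "v = j \<oplus>[val F x] z" by (auto simp: ssum_def)
  have "v \<ominus>[val F x] j = z" unfolding jz(3) M.a_comm[OF jc[OF jz(1)] zc[OF jz(2)]]
   using jc[OF jz(1)] zc[OF jz(2)] by (simp add: a_minus_def M.a_assoc M.r_neg)
  then have "rp F Z x v = rp F Z x j" using rp_eq_iff[OF F Z x v jc[OF jz(1)]] jz(2) by simp
  then show "rp F Z x v \<in> jsp D J (quotk F Z) x" using jsp_nt[OF D J F Q p x jz(1)] by simp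
 }
qed

text \<open>Reducing \<open>F/Z\<close> modulo \<open>J\<close> amounts to reducing \<open>F\<close>
  modulo \<open>J F + Z\<close>. An iterated reduction thus becomes a single condition on the
  original sequence.\<close>

lemma quot_exm:
 fixes F :: "nat => ('o, 'm, 'k, 'u) kmod"
 assumes D: "k_category K D" and J: "two_sided_ideal K D J" and F: "\<And>n. k_module K D (F n)"
  and \<delta>: "\<And>n. nt D (F (Suc n)) (F n) (\<delta> n)" and Z: "\<And>n. subf D (F n) (Z n)"
  and \<delta>Z: "\<And>n x v. x \<in> Ob D ==> v \<in> Z (Suc n) x ==> \<delta> n x v \<in> Z n x"
 shows "exm D J (\<lambda>n. quotk (F n) (Z n)) (\<lambda>n x u. rp (F n) (Z n) x (\<delta> n x u)) n \<longleftrightarrow>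
  (\<forall>x\<in>Ob D. \<forall>z\<in>el (F (Suc n)) x. \<delta> n x z \<in> ssum (val (F n) x) (jsp D J (F n) x) (Z n x) -->
   (\<exists>j\<in>ssum (val (F (Suc n)) x) (jsp D J (F (Suc n)) x) (Z (Suc n) x).
    \<exists>w\<in>el (F (Suc (Suc n))) x. z = j \<oplus>[val (F (Suc n)) x] \<delta> (Suc n) x w))" (is "?L \<longleftrightarrow> ?R")
proof -
 let ?r = "\<lambda>n. rp (F n) (Z n)" and ?Q = "\<lambda>n. quotk (F n) (Z n)"
 note Q = quotk_module(1)[OF D F Z] and p = quotk_proj[OF D F Z]
 note el = quotk_elem[OF F Z]
 note qj = quot_jsp[OF D J F Z]
 have \<delta>rp: "?r n x (\<delta> n x (?r (Suc n) x v)) = ?r n x (\<delta> n x v)"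
  if "x \<in> Ob D" "v \<in> el (F (Suc n)) x" for n x v
  by (rule rp_lin_sub[OF F Z F Z that(1) nt_lin[OF \<delta> that(1)] \<delta>Z[OF that(1)] that(2)])
 have sm: "submodule (ssum (val (F n) x) (jsp D J (F n) x) (Z n x)) K (val (F n) x)" if "x \<in> Ob D" for n x
  by (rule submodule_ssum[OF val_mod[OF F that] subf_sub[OF jsp_subf(1)[OF D J F] that] subf_sub[OF Z that]])
 show ?thesis
 proof
  assume L: ?L
  show ?R
  proof (intro ballI impI)
   fix x z assume x: "x \<in> Ob D" and z: "z \<in> el (F (Suc n)) x"
    and dz: "\<delta> n x z \<in> ssum (val (F n) x) (jsp D J (F n) x) (Z n x)"
   interpret M: module K "val (F (Suc n)) x" by (rule val_mod[OF F x])
   have "?r n x (\<delta> n x (?r (Suc n) x z)) \<in> jsp D J (?Q n) x"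
    using qj[OF x nt_in[OF \<delta> x z]] dz \<delta>rp[OF x z] by simp
   then obtain j w where j: "j \<in> jsp D J (?Q (Suc n)) x" and w: "w \<in> el (?Q (Suc (Suc n))) x"
    and eq: "?r (Suc n) x z = j \<oplus>[val (?Q (Suc n)) x] ?r (Suc n) x (\<delta> (Suc n) x w)"
    using exmD[OF L x quotk_in[OF z]] by blast
   note wc = el(1)[OF x w]
   note dw = nt_in[OF \<delta> x wc]
   have d: "z \<ominus>[val (F (Suc n)) x] \<delta> (Suc n) x w \<in> el (F (Suc n)) x" using z dw by simp
   interpret Q: module K "val (?Q (Suc n)) x" by (rule val_mod[OF Q x])
   have jc: "j \<in> el (?Q (Suc n)) x" by (rule subf_in[OF Q jsp_subf(1)[OF D J Q] x j])
   have "?r (Suc n) x (z \<ominus>[val (F (Suc n)) x] \<delta> (Suc n) x w) = j"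
    unfolding nt_minus_at[OF F Q p x z dw] eq
    using jc quotk_in[OF dw] by (simp add: a_minus_def Q.a_assoc Q.r_neg)
   then have "z \<ominus>[val (F (Suc n)) x] \<delta> (Suc n) x w \<in> ssum (val (F (Suc n)) x) (jsp D J (F (Suc n)) x) (Z (Suc n) x)"
    using qj[OF x d] j by simp
   then show "\<exists>j\<in>ssum (val (F (Suc n)) x) (jsp D J (F (Suc n)) x) (Z (Suc n) x).
    \<exists>w\<in>el (F (Suc (Suc n))) x. z = j \<oplus>[val (F (Suc n)) x] \<delta> (Suc n) x w"
    using minus_add_cancel[OF M.module_axioms z dw, symmetric] wc by blast
  qed
 next
  assume R: ?R
  show ?L
   unfolding exm_def
  proof (intro ballI impI)
   fix x z assume x: "x \<in> Ob D" and z: "z \<in> el (?Q (Suc n)) x" and dz: "?r n x (\<delta> n x z) \<in> jsp D J (?Q n) x"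
   note zc = el(1)[OF x z]
   obtain j w where j: "j \<in> ssum (val (F (Suc n)) x) (jsp D J (F (Suc n)) x) (Z (Suc n) x)"
    and w: "w \<in> el (F (Suc (Suc n))) x" and eq: "z = j \<oplus>[val (F (Suc n)) x] \<delta> (Suc n) x w"
    using R x zc qj[OF x nt_in[OF \<delta> x zc]] dz by blast
   have jc: "j \<in> el (F (Suc n)) x" by (rule sub_carrier[OF val_mod[OF F x] sm[OF x] j])
   have "z = ?r (Suc n) x z" using el(2)[OF x z] by simp
   also have "\<dots> = ?r (Suc n) x j \<oplus>[val (?Q (Suc n)) x] ?r (Suc n) x (\<delta> (Suc n) x w)"
    by (subst eq) (rule nt_add[OF p x jc nt_in[OF \<delta> x w]])
   also have "?r (Suc n) x (\<delta> (Suc n) x w) = ?r (Suc n) x (\<delta> (Suc n) x (?r (Suc (Suc n)) x w))" using \<delta>rp[OF x w] by simp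
   finally show "\<exists>j\<in>jsp D J (?Q (Suc n)) x. \<exists>w\<in>el (?Q (Suc (Suc n))) x.
    z = j \<oplus>[val (?Q (Suc n)) x] ?r (Suc n) x (\<delta> (Suc n) x w)"
    using qj[OF x jc] j quotk_in[OF w] by blast
  qed
 qed
qed

end

text \<open>\<open>XA n b\<close> and \<open>XB n a\<close> are the sections of the
 \<open>n\<close>-th term at a fixed second and first argument.\<close>

locale bicomplex = kfield K for K :: "('k, 'r) ring_scheme" (structure) +
 fixes A :: "('a, 'k, 'm) kcat" and B :: "('b, 'k, 'n) kcat"
  and IA :: "'a => 'a => 'm set" and IB :: "'b => 'b => 'n set"
  and XA :: "nat => 'b => ('a, 'm, 'k, 'u) kmod" and XB :: "nat => 'a => ('b, 'n, 'k, 'u) kmod"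
  and \<delta> :: "nat => 'a => 'b => 'u => 'u"
 assumes cA: "k_category K A" and cB: "k_category K B"
  and iA: "two_sided_ideal K A IA" and iB: "two_sided_ideal K B IB"
  and val_eq: "\<And>n a b. val (XA n b) a = val (XB n a) b"
  and comm: "\<And>n a a' b b' f g v. a \<in> Ob A ==> a' \<in> Ob A ==> b \<in> Ob B ==> b' \<in> Ob B ==>
   f \<in> Mor A a a' ==> g \<in> Mor B b b' ==> v \<in> el (XA n b) a ==>
   act (XB n a') b b' g (act (XA n b) a a' f v) = act (XA n b') a a' f (act (XB n a) b b' g v)"
  and exA: "\<And>b. b \<in> Ob B ==> exseq A (\<lambda>n. XA n b) (\<lambda>n a. \<delta> n a b)"
  and exB: "\<And>a. a \<in> Ob A ==> exseq B (\<lambda>n. XB n a) (\<lambda>n. \<delta> n a)"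
begin

text \<open>A span formed in the second variable but read as a submodule in the first one, see
  \<open>ZB_subf\<close>.\<close>

definition ZB :: "nat => 'b => 'a => 'u set" where
 "ZB n b a = jsp B IB (XB n a) b"

definition YA :: "'b => nat => ('a, 'm, 'k, 'u) kmod" where
 "YA b n = quotk (XA n b) (ZB n b)"

definition dA :: "'b => nat => 'a => 'u => 'u" where
 "dA b n a u = rp (XA n b) (ZB n b) a (\<delta> n a b u)"

text \<open>Exactness after dividing by both spans at once. It treats the two variables alike, up to
  the order of the summands.\<close>

definition exsym :: "nat => 'b => bool" where
 "exsym n b \<longleftrightarrow> (\<forall>a\<in>Ob A. \<forall>z\<in>el (XA (Suc n) b) a.
   \<delta> n a b z \<in> ssum (val (XA n b) a) (jsp A IA (XA n b) a) (jsp B IB (XB n a) b) -->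
   (\<exists>j\<in>ssum (val (XA (Suc n) b) a) (jsp A IA (XA (Suc n) b) a) (jsp B IB (XB (Suc n) a) b).
    \<exists>w\<in>el (XA (Suc (Suc n)) b) a. z = j \<oplus>[val (XA (Suc n) b) a] \<delta> (Suc n) a b w))"

lemma modA: "b \<in> Ob B ==> k_module K A (XA n b)" by (rule ex_mod[OF exA])
lemma modB: "a \<in> Ob A ==> k_module K B (XB n a)" by (rule ex_mod[OF exB])

text \<open>Morphisms of \<open>A\<close> commute with the action of \<open>B\<close>, hence carry
  generators \<open>j u\<close> with \<open>j\<close> in \<open>IB\<close> to such
  generators.\<close>

lemma ZB_subf:
 assumes b: "b \<in> Ob B"
 shows "subf A (XA n b) (ZB n b)"
 unfolding subf_def ZB_def
proof (intro conjI ballI)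
 show "submodule (jsp B IB (XB n a) b) K (val (XA n b) a)" if "a \<in> Ob A" for a
  unfolding val_eq by (rule subf_sub[OF jsp_subf(1)[OF cB iB modB[OF that]] b])
 fix a a' f v assume o: "a \<in> Ob A" "a' \<in> Ob A" and f: "f \<in> Mor A a a'" and v: "v \<in> jsp B IB (XB n a) b"
 have s: "submodule (jsp B IB (XB n a') b) K (val (XA n b) a')"
  unfolding val_eq by (rule subf_sub[OF jsp_subf(1)[OF cB iB modB[OF o(2)]] b])
 have "v \<in> {v \<in> el (XA n b) a. act (XA n b) a a' f v \<in> jsp B IB (XB n a') b}"
 proof (rule jsp_least[OF modB[OF o(1)] b _ _ v])
  show "submodule {v \<in> el (XA n b) a. act (XA n b) a a' f v \<in> jsp B IB (XB n a') b} K (val (XB n a) b)"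
   unfolding val_eq[symmetric]
   by (rule submodule_preimage[OF val_mod[OF modA[OF b] o(1)] val_mod[OF modA[OF b] o(2)] act_lin[OF modA[OF b] o f] s])
  fix b' j u assume b': "b' \<in> Ob B" and j: "j \<in> IB b' b" and u: "u \<in> el (XB n a) b'"
  have jc: "j \<in> Mor B b' b" by (rule ideal_carrier[OF cB iB b' b j])
  have u': "u \<in> el (XA n b') a" using u by (simp add: val_eq)
  have "act (XA n b) a a' f (act (XB n a) b' b j u) = act (XB n a') b' b j (act (XA n b') a a' f u)"
   using comm[OF o b' b f jc u'] by simp
  moreover have "act (XA n b') a a' f u \<in> el (XB n a') b'"
   using act_in[OF modA[OF b'] o f u'] by (simp add: val_eq)
  ultimately show "act (XB n a) b' b j u \<in> {v \<in> el (XA n b) a. act (XA n b) a a' f v \<in> jsp B IB (XB n a') b}"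
   using jsp_act[OF cB iB modB[OF o(2)] b' b j] act_in[OF modB[OF o(1)] b' b jc u] by (simp add: val_eq)
 qed
 then show "act (XA n b) a a' f v \<in> jsp B IB (XB n a') b" by simp
qed

lemma \<delta>_ZB:
 assumes "b \<in> Ob B" "a \<in> Ob A" "v \<in> ZB (Suc n) b a"
 shows "\<delta> n a b v \<in> ZB n b a"
 using jsp_nt[OF cB iB modB[OF assms(2)] modB[OF assms(2)] ex_nt[OF exB[OF assms(2)]] assms(1)] assms(3)
 unfolding ZB_def by blast

lemma YA_exseq:
 assumes b: "b \<in> Ob B" and e: "\<And>a n. a \<in> Ob A ==> exm B IB (\<lambda>n. XB n a) (\<lambda>n. \<delta> n a) n"
 shows "exseq A (YA b) (dA b)"
proof -
 have "exseq A (\<lambda>n. quotk (XA n b) (ZB n b)) (\<lambda>n a u. rp (XA n b) (ZB n b) a (\<delta> n a b u))"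
 proof (rule quot_exseq[where \<delta> = "\<lambda>n a. \<delta> n a b", OF cA exA[OF b] ZB_subf[OF b]])
  show "\<delta> n a b v \<in> ZB n b a" if "a \<in> Ob A" "v \<in> ZB (Suc n) b a" for n a v by (rule \<delta>_ZB[OF b that])
  fix n a z assume a: "a \<in> Ob A" and z: "z \<in> el (XA (Suc n) b) a" and d: "\<delta> n a b z \<in> ZB n b a"
  then show "\<exists>j\<in>ZB (Suc n) b a. \<exists>w\<in>el (XA (Suc (Suc n)) b) a. z = j \<oplus>[val (XA (Suc n) b) a] \<delta> (Suc n) a b w"
   using exmD[OF e[OF a, of n] b] unfolding ZB_def val_eq by blast
 qed
 then show ?thesis unfolding YA_def dA_def .
qed

lemma YA_exm:
 assumes b: "b \<in> Ob B"
 shows "exm A IA (YA b) (dA b) n \<longleftrightarrow> exsym n b"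
 unfolding YA_def dA_def exsym_def
 using quot_exm[where F = "\<lambda>n. XA n b" and \<delta> = "\<lambda>n a. \<delta> n a b" and Z = "\<lambda>n. ZB n b" and n = n,
   OF cA iA modA[OF b] ex_nt[OF exA[OF b]] ZB_subf[OF b] \<delta>_ZB[OF b]]
 unfolding ZB_def .

lemma swap: "bicomplex K B A IB IA XB XA (\<lambda>n b a. \<delta> n a b)"
proof
 show "val (XB n a) b = val (XA n b) a" for n a b by (simp add: val_eq)
 fix n b b' a a' f g v
 assume "b \<in> Ob B" "b' \<in> Ob B" "a \<in> Ob A" "a' \<in> Ob A" "f \<in> Mor B b b'" "g \<in> Mor A a a'" "v \<in> el (XB n a) b"
 then show "act (XA n b') a a' g (act (XB n a) b b' f v) = act (XB n a') b b' f (act (XA n b) a a' g v)"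
  using comm[of a a' b b' g f v n] by (simp add: val_eq)
qed (rule cB cA iB iA exB exA; assumption?)+

text \<open>The order of the summands in \<open>ssum\<close> is immaterial, and the values are
  shared by \<open>XA\<close> and \<open>XB\<close>.\<close>

lemma exsym_swap:
 assumes e: "\<And>b. b \<in> Ob B ==> exsym n b" and a: "a \<in> Ob A"
 shows "bicomplex.exsym B A IB IA XB XA (\<lambda>n b a. \<delta> n a b) n a"
proof -
 interpret S: bicomplex K B A IB IA XB XA "\<lambda>n b a. \<delta> n a b" by (rule swap)
 have c: "ssum (val (XB n a) b) (jsp B IB (XB n a) b) (jsp A IA (XA n b) a) =
  ssum (val (XA n b) a) (jsp A IA (XA n b) a) (jsp B IB (XB n a) b)" if b: "b \<in> Ob B" for n b
  using subf_in[OF modB[OF a] jsp_subf(1)[OF cB iB modB[OF a]] b] subf_in[OF modA[OF b] jsp_subf(1)[OF cA iA modA[OF b]] a]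
  unfolding val_eq by (intro ssum_comm[OF val_mod[OF modB[OF a] b]]) auto
 show ?thesis
  unfolding S.exsym_def using e a by (simp add: c[folded val_eq] exsym_def val_eq[symmetric])
qed

end

subsection \<open>Projectivity relative to a submodule\<close>

context kfield
begin

text \<open>Projectivity of \<open>X/Z\<close>, expressed by maps on \<open>X\<close> that vanish on
  \<open>Z\<close>. For zero \<open>Z\<close> it yields projectivity of \<open>X\<close> itself
  (\<open>relproj_zero\<close>), and direct sums can be treated without forming quotients
  (\<open>relproj_dsum\<close>).\<close>

definition relproj :: "('o, 'k, 'm) kcat => ('o, 'm, 'k, 'u) kmod => ('o => 'u set) => bool" where
 "relproj D X Z \<longleftrightarrow> (\<forall>(M :: ('o, 'm, 'k, 'u) kmod) (N :: ('o, 'm, 'k, 'u) kmod) e h.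
   k_module K D M --> k_module K D N --> nt D M N e --> nt D X N h -->
   (\<forall>x\<in>Ob D. e x ` el M x = el N x) --> (\<forall>x\<in>Ob D. \<forall>v\<in>Z x. h x v = \<zero>[val N x]) -->
   (\<exists>h'. nt D X M h' \<and> (\<forall>x\<in>Ob D. \<forall>v\<in>el X x. e x (h' x v) = h x v) \<and>
    (\<forall>x\<in>Ob D. \<forall>v\<in>Z x. h' x v = \<zero>[val M x])))"

lemma relprojD:
 fixes X M N :: "('o, 'm, 'k, 'u) kmod"
 assumes "relproj D X Z" "k_module K D M" "k_module K D N" "nt D M N e" "nt D X N h"
  and "\<And>x. x \<in> Ob D ==> e x ` el M x = el N x" "\<And>x v. x \<in> Ob D ==> v \<in> Z x ==> h x v = \<zero>[val N x]"
 shows "\<exists>h'. nt D X M h' \<and> (\<forall>x\<in>Ob D. \<forall>v\<in>el X x. e x (h' x v) = h x v) \<and>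
    (\<forall>x\<in>Ob D. \<forall>v\<in>Z x. h' x v = \<zero>[val M x])"
 using assms unfolding relproj_def by simp

lemma relproj_quotk:
 fixes X :: "('o, 'm, 'k, 'u) kmod"
 assumes D: "k_category K D" and X: "k_module K D X" and Z: "subf D X Z" and r: "relproj D X Z"
 shows "projective_module K D (quotk X Z)"
proof (rule projI[OF quotk_module(1)[OF D X Z]])
 fix M N :: "('o, 'm, 'k, 'u) kmod" and e h
 assume M: "k_module K D M" and N: "k_module K D N" and e: "nt D M N e" and h: "nt D (quotk X Z) N h"
  and s: "\<And>x. x \<in> Ob D ==> e x ` el M x = el N x"
 note p = quotk_proj[OF D X Z]
 have "\<exists>h'. nt D X M h' \<and> (\<forall>x\<in>Ob D. \<forall>v\<in>el X x. e x (h' x v) = h x (rp X Z x v)) \<and>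
    (\<forall>x\<in>Ob D. \<forall>v\<in>Z x. h' x v = \<zero>[val M x])"
 proof (rule relprojD[OF r M N e nt_compose[OF p h] s])
  fix x v assume x: "x \<in> Ob D" and v: "v \<in> Z x"
  show "h x (rp X Z x v) = \<zero>[val N x]"
   using quotk_zero_iff[OF X Z x subf_in[OF X Z x v]] v nt_zero_at[OF quotk_module(1)[OF D X Z] N h x] by simp
 qed
 then obtain h' where h': "nt D X M h'" "\<And>x v. x \<in> Ob D ==> v \<in> el X x ==> e x (h' x v) = h x (rp X Z x v)"
  "\<And>x v. x \<in> Ob D ==> v \<in> Z x ==> h' x v = \<zero>[val M x]" by blast
 have "nt D (quotk X Z) M h'" by (rule quotk_out[OF X Z M h'(1,3)])
 moreover have "e x (h' x v) = h x v" if "x \<in> Ob D" "v \<in> el (quotk X Z) x" for x v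
  using h'(2)[OF that(1)] quotk_elem[OF X Z that] by simp
 ultimately show "\<exists>h'. nt D (quotk X Z) M h' \<and> (\<forall>x\<in>Ob D. \<forall>v\<in>el (quotk X Z) x. e x (h' x v) = h x v)" by blast
qed

lemma relproj_zero:
 fixes X :: "('o, 'm, 'k, 'u) kmod"
 assumes X: "k_module K D X" and r: "relproj D X Z" and Z: "\<And>x v. x \<in> Ob D ==> v \<in> Z x ==> v = \<zero>[val X x]"
 shows "projective_module K D X"
proof (rule projI[OF X])
 fix M N :: "('o, 'm, 'k, 'u) kmod" and e h
 assume M: "k_module K D M" and N: "k_module K D N" and e: "nt D M N e" and h: "nt D X N h"
  and s: "\<And>x. x \<in> Ob D ==> e x ` el M x = el N x"
 have "h x v = \<zero>[val N x]" if "x \<in> Ob D" "v \<in> Z x" for x v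
  using Z[OF that] nt_zero_at[OF X N h that(1)] by simp
 then show "\<exists>h'. nt D X M h' \<and> (\<forall>x\<in>Ob D. \<forall>v\<in>el X x. e x (h' x v) = h x v)"
  using relprojD[OF r M N e h s] by blast
qed

text \<open>Lifts are constructed on the summands. Membership in \<open>Z\<close> is decided by
  components, so the assembled lift vanishes on \<open>Z\<close> as well.\<close>

lemma relproj_dsum:
 fixes M :: "'s => ('o, 'm, 'k, 'u) kmod"
 assumes D: "k_category K D" and inf: "infinite (UNIV :: 'u set)" and S: "S \<lesssim> (UNIV :: 'u set)"
  and M: "\<And>s. s \<in> S ==> k_module K D (M s)" and W: "\<And>s. s \<in> S ==> subf D (M s) (W s)"
  and r: "\<And>s. s \<in> S ==> relproj D (M s) (W s)"
  and Z: "\<And>x u. x \<in> Ob D ==> u \<in> el (dsum S M) x ==> u \<in> Z x \<longleftrightarrow> (\<forall>s\<in>S. dcmp S M s x u \<in> W s x)"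
  and Zc: "\<And>x. x \<in> Ob D ==> Z x \<subseteq> el (dsum S M) x"
 shows "relproj D (dsum S M) Z"
 unfolding relproj_def
proof (intro allI impI)
 fix P N :: "('o, 'm, 'k, 'u) kmod" and e h
 assume P: "k_module K D P" and N: "k_module K D N" and e: "nt D P N e" and h: "nt D (dsum S M) N h"
  and s: "\<forall>x\<in>Ob D. e x ` el P x = el N x" and h0: "\<forall>x\<in>Ob D. \<forall>v\<in>Z x. h x v = \<zero>[val N x]"
 have dm: "k_module K D (dsum S M)" by (rule dsum_module[OF D M inf S])
 have dn: "nt D (M s) (dsum S M) (dinj S M s)" if "s \<in> S" for s by (rule dinj_nt[OF D M inf S that])
 have dc: "nt D (dsum S M) (M s) (dcmp S M s)" if "s \<in> S" for s by (rule dcmp_nt[OF D M inf S that])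
 have "\<exists>h'. nt D (M s) P h' \<and> (\<forall>x\<in>Ob D. \<forall>v\<in>el (M s) x. e x (h' x v) = h x (dinj S M s x v)) \<and>
    (\<forall>x\<in>Ob D. \<forall>v\<in>W s x. h' x v = \<zero>[val P x])" if t: "s \<in> S" for s
 proof (rule relprojD[OF r[OF t] P N e nt_compose[OF dn[OF t] h]])
  fix x v assume x: "x \<in> Ob D" and v: "v \<in> W s x"
  have vc: "v \<in> el (M s) x" by (rule subf_in[OF M[OF t] W[OF t] x v])
  have "dcmp S M t' x (dinj S M s x v) \<in> W t' x" if t': "t' \<in> S" for t'
   using dcmp_dinj[where M = M, OF D M inf S x t t' vc] v sub_zero[OF val_mod[OF M[OF t'] x] subf_sub[OF W[OF t'] x]] by auto
  then have "dinj S M s x v \<in> Z x" using Z[OF x nt_in[OF dn[OF t] x vc]] by simp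
  then show "h x (dinj S M s x v) = \<zero>[val N x]" using h0 x by blast
 qed (use s in blast)
 then obtain k where k: "\<And>s. s \<in> S ==> nt D (M s) P (k s)"
  "\<And>s x v. s \<in> S ==> x \<in> Ob D ==> v \<in> el (M s) x ==> e x (k s x v) = h x (dinj S M s x v)"
  "\<And>s x v. s \<in> S ==> x \<in> Ob D ==> v \<in> W s x ==> k s x v = \<zero>[val P x]" by metis
 let ?o = "dout S M P k"
 have o: "nt D (dsum S M) P ?o" by (rule dout_nt[OF D M inf S P k(1)])
 have oi: "?o x (dinj S M s x v) = k s x v" if "x \<in> Ob D" "s \<in> S" "v \<in> el (M s) x" for x s v
  by (rule dout_dinj[where M = M and h = k, OF D M inf S P k(1) that])
 show "\<exists>h'. nt D (dsum S M) P h' \<and> (\<forall>x\<in>Ob D. \<forall>v\<in>el (dsum S M) x. e x (h' x v) = h x v) \<and>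
    (\<forall>x\<in>Ob D. \<forall>v\<in>Z x. h' x v = \<zero>[val P x])"
 proof (intro exI[of _ ?o] conjI ballI o)
  fix x u assume x: "x \<in> Ob D" and u: "u \<in> el (dsum S M) x"
  show "e x (?o x u) = h x u"
   by (rule dsum_nt_eq[where M = M and g = "\<lambda>x u. e x (?o x u)", OF D M inf S N nt_compose[OF o e] h _ x u]) (simp_all add: oi x k(2))
 next
  fix x u assume x: "x \<in> Ob D" and uz: "u \<in> Z x"
  have u: "u \<in> el (dsum S M) x" using Zc[OF x] uz by blast
  have "u \<in> {v \<in> el (dsum S M) x. ?o x v = \<zero>[val P x]}"
  proof (rule dsum_mem[OF D M inf S x _ u])
   show "submodule {v \<in> el (dsum S M) x. ?o x v = \<zero>[val P x]} K (val (dsum S M) x)"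
    by (rule submodule_kernel[OF val_mod[OF dm x] val_mod[OF P x] nt_lin[OF o x]])
   fix s assume t: "s \<in> S"
   have "dcmp S M s x u \<in> W s x" using Z[OF x u] uz t by blast
   then show "dinj S M s x (dcmp S M s x u) \<in> {v \<in> el (dsum S M) x. ?o x v = \<zero>[val P x]}"
    using oi[OF x t nt_in[OF dc[OF t] x u]] k(3)[OF t x] nt_in[OF dn[OF t] x nt_in[OF dc[OF t] x u]] by simp
  qed auto
  then show "?o x u = \<zero>[val P x]" by simp
 qed
qed

subsection \<open>Sections of modules over a tensor product\<close>

text \<open>The section \<open>M(-, b)\<close>, that is, restriction of \<open>M\<close> along the
  functor from \<open>A\<close> to \<open>A \<otimes> B\<close> given by
  \<open>f \<mapsto> f \<otimes> 1\<close>; \<open>rB\<close> is the section in the other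
  variable.\<close>

definition rA :: "('a, 'k, 'm) kcat => ('b, 'k, 'n) kcat => ('a \<times> 'b, ('m \<times> 'n => 'k) set, 'k, 'u) kmod => 'b => ('a, 'm, 'k, 'u) kmod" where
 "rA A B M b = \<lparr>val = (\<lambda>a. val M (a, b)),
   act = (\<lambda>a a' f. act M (a, b) (a', b) (telt A B a a' b b f (Id B b)))\<rparr>"

definition rB :: "('a, 'k, 'm) kcat => ('b, 'k, 'n) kcat => ('a \<times> 'b, ('m \<times> 'n => 'k) set, 'k, 'u) kmod => 'a => ('b, 'n, 'k, 'u) kmod" where
 "rB A B M a = \<lparr>val = (\<lambda>b. val M (a, b)),
   act = (\<lambda>b b' g. act M (a, b) (a, b') (telt A B a a b b' (Id A a) g))\<rparr>"

lemma sec_simps [simp]: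
 "val (rA A B M b) a = val M (a, b)" "val (rB A B M a) b = val M (a, b)"
 "act (rA A B M b) a a' f = act M (a, b) (a', b) (telt A B a a' b b f (Id B b))"
 "act (rB A B M a) b b' g = act M (a, b) (a, b') (telt A B a a b b' (Id A a) g)"
 by (simp_all add: rA_def rB_def)

lemma tact_linear:
 assumes A: "k_category K A" and B: "k_category K B" and M: "k_module K (tensor_cat K A B) M"
  and o: "a \<in> Ob A" "a' \<in> Ob A" "b \<in> Ob B" "b' \<in> Ob B" and v: "v \<in> el M (a, b)"
 shows "linear_map K (thom A B a a' b b') (val M (a', b')) (\<lambda>t. act M (a, b) (a', b') t v)"
 using bilin_left[OF act_bilin[OF M, of "(a, b)" "(a', b')"] v] o by simp

lemma tact_bilin:
 assumes A: "k_category K A" and B: "k_category K B" and M: "k_module K (tensor_cat K A B) M"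
  and o: "a \<in> Ob A" "a' \<in> Ob A" "b \<in> Ob B" "b' \<in> Ob B" and v: "v \<in> el M (a, b)"
 shows "bilinear_map K (Hom A a a') (Hom B b b') (val M (a', b'))
  (\<lambda>f g. act M (a, b) (a', b') (telt A B a a' b b' f g) v)"
proof -
 note e = tensor_elt_bilinear[OF hom_mod[OF A o(1,2)] hom_mod[OF B o(3,4)]]
 note l = tact_linear[OF assms]
 show ?thesis
  unfolding bilinear_map_def using lin_comp[OF bilin_right[OF e] l] lin_comp[OF bilin_left[OF e] l] by blast
qed

lemma tact_comp:
 assumes A: "k_category K A" and B: "k_category K B" and M: "k_module K (tensor_cat K A B) M"
  and o: "a \<in> Ob A" "a' \<in> Ob A" "a'' \<in> Ob A" "b \<in> Ob B" "b' \<in> Ob B" "b'' \<in> Ob B"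
  and f: "f \<in> Mor A a a'" "f' \<in> Mor A a' a''" and g: "g \<in> Mor B b b'" "g' \<in> Mor B b' b''"
  and v: "v \<in> el M (a, b)"
 shows "act M (a', b') (a'', b'') (telt A B a' a'' b' b'' f' g')
   (act M (a, b) (a', b') (telt A B a a' b b' f g) v) =
  act M (a, b) (a'', b'') (telt A B a a'' b b'' (Comp A a a' a'' f' f) (Comp B b b' b'' g' g)) v"
 using act_comp[OF M, of "(a, b)" "(a', b')" "(a'', b'')", OF _ _ _ tensor_elt_in[OF A B o(1,2,4,5) f(1) g(1)]
   tensor_elt_in[OF A B o(2,3,5,6) f(2) g(2)] v] o tensor_comp_elt[OF A B o f g] by simp

lemma tact_in:
 assumes A: "k_category K A" and B: "k_category K B" and M: "k_module K (tensor_cat K A B) M"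
  and o: "a \<in> Ob A" "a' \<in> Ob A" "b \<in> Ob B" "b' \<in> Ob B"
  and "f \<in> Mor A a a'" "g \<in> Mor B b b'" "v \<in> el M (a, b)"
 shows "act M (a, b) (a', b') (telt A B a a' b b' f g) v \<in> el M (a', b')"
 using bilin_closed[OF tact_bilin[OF A B M o]] assms(8-10) by blast

lemma tnt:
 assumes A: "k_category K A" and B: "k_category K B" and n: "nt (tensor_cat K A B) M N \<eta>"
  and o: "a \<in> Ob A" "a' \<in> Ob A" "b \<in> Ob B" "b' \<in> Ob B"
  and "f \<in> Mor A a a'" "g \<in> Mor B b b'" "v \<in> el M (a, b)"
 shows "\<eta> (a', b') (act M (a, b) (a', b') (telt A B a a' b b' f g) v) =
  act N (a, b) (a', b') (telt A B a a' b b' f g) (\<eta> (a, b) v)"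
 using nt_nat[OF n, of "(a, b)" "(a', b')", OF _ _ tensor_elt_in[OF A B o assms(8,9)]] o assms(10) by simp

lemma rA_module:
 assumes A: "k_category K A" and B: "k_category K B" and M: "k_module K (tensor_cat K A B) M" and b: "b \<in> Ob B"
 shows "k_module K A (rA A B M b)"
proof -
 note i = id_in[OF B b]
 show ?thesis
  unfolding k_module_def
 proof (intro conjI ballI)
  show "module K (val (rA A B M b) a)" if "a \<in> Ob A" for a using val_mod[OF M, of "(a, b)"] that b by simp
  show "bilinear_map K (Hom A a a') (val (rA A B M b) a) (val (rA A B M b) a') (act (rA A B M b) a a')"
   if o: "a \<in> Ob A" "a' \<in> Ob A" for a a'
   unfolding bilinear_map_def
  proof (intro conjI ballI)
   show "linear_map K (val (rA A B M b) a) (val (rA A B M b) a') (act (rA A B M b) a a' f)" if "f \<in> Mor A a a'" for f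
    using act_lin[OF M, of "(a, b)" "(a', b)", OF _ _ tensor_elt_in[OF A B o b b that i]] o b by simp
   show "linear_map K (Hom A a a') (val (rA A B M b) a') (\<lambda>f. act (rA A B M b) a a' f v)" if "v \<in> el (rA A B M b) a" for v
    using bilin_left[OF tact_bilin[OF A B M o b b], of v, OF _ i] that by simp
  qed
  show "act (rA A B M b) a a (Id A a) v = v" if "a \<in> Ob A" "v \<in> el (rA A B M b) a" for a v
   using act_id[OF M, of "(a, b)" v] that b by simp
  show "act (rA A B M b) x z (Comp A x y z g f) v = act (rA A B M b) y z g (act (rA A B M b) x y f v)"
   if "x \<in> Ob A" "y \<in> Ob A" "z \<in> Ob A" "f \<in> Mor A x y" "g \<in> Mor A y z" "v \<in> el (rA A B M b) x" for x y z f g v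
   using tact_comp[OF A B M that(1-3) b b b that(4,5) i i, of v] that(6) comp_idl[OF B b b i] by simp
 qed
qed

lemma rB_module:
 assumes A: "k_category K A" and B: "k_category K B" and M: "k_module K (tensor_cat K A B) M" and a: "a \<in> Ob A"
 shows "k_module K B (rB A B M a)"
proof -
 note i = id_in[OF A a]
 show ?thesis
  unfolding k_module_def
 proof (intro conjI ballI)
  show "module K (val (rB A B M a) b)" if "b \<in> Ob B" for b using val_mod[OF M, of "(a, b)"] that a by simp
  show "bilinear_map K (Hom B b b') (val (rB A B M a) b) (val (rB A B M a) b') (act (rB A B M a) b b')"
   if o: "b \<in> Ob B" "b' \<in> Ob B" for b b'
   unfolding bilinear_map_def
  proof (intro conjI ballI)
   show "linear_map K (val (rB A B M a) b) (val (rB A B M a) b') (act (rB A B M a) b b' f)" if "f \<in> Mor B b b'" for f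
    using act_lin[OF M, of "(a, b)" "(a, b')", OF _ _ tensor_elt_in[OF A B a a o i that]] o a by simp
   show "linear_map K (Hom B b b') (val (rB A B M a) b') (\<lambda>f. act (rB A B M a) b b' f v)" if "v \<in> el (rB A B M a) b" for v
    using bilin_right[OF tact_bilin[OF A B M a a o], of v, OF _ i] that by simp
  qed
  show "act (rB A B M a) b b (Id B b) v = v" if "b \<in> Ob B" "v \<in> el (rB A B M a) b" for b v
   using act_id[OF M, of "(a, b)" v] that a by simp
  show "act (rB A B M a) x z (Comp B x y z g f) v = act (rB A B M a) y z g (act (rB A B M a) x y f v)"
   if "x \<in> Ob B" "y \<in> Ob B" "z \<in> Ob B" "f \<in> Mor B x y" "g \<in> Mor B y z" "v \<in> el (rB A B M a) x" for x y z f g v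
   using tact_comp[OF A B M a a a that(1-3) i i that(4,5), of v] that(6) comp_idl[OF A a a i] by simp
 qed
qed

text \<open>Exactness is an objectwise notion, so it passes to sections.\<close>

lemma sec_exseq:
 assumes A: "k_category K A" and B: "k_category K B" and X: "exseq (tensor_cat K A B) X \<delta>"
 shows rA_exseq: "b \<in> Ob B ==> exseq A (\<lambda>n. rA A B (X n) b) (\<lambda>n a. \<delta> n (a, b))"
  and rB_exseq: "a \<in> Ob A ==> exseq B (\<lambda>n. rB A B (X n) a) (\<lambda>n b. \<delta> n (a, b))"
proof -
 note Xm = ex_mod[OF X] and Xn = ex_nt[OF X]
 have l: "linear_map K (val (X (Suc n)) (a, b)) (val (X n) (a, b)) (\<delta> n (a, b))" if "a \<in> Ob A" "b \<in> Ob B" for n a b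
  using nt_lin[OF Xn, of "(a, b)" n] that by simp
 have e: "\<delta> 0 (a, b) ` el (X (Suc 0)) (a, b) = el (X 0) (a, b)"
  "\<delta> (Suc n) (a, b) ` el (X (Suc (Suc n))) (a, b) = {v \<in> el (X (Suc n)) (a, b). \<delta> n (a, b) v = \<zero>[val (X n) (a, b)]}"
  if "a \<in> Ob A" "b \<in> Ob B" for a b n
  using X that unfolding exseq_def by auto
 show "exseq A (\<lambda>n. rA A B (X n) b) (\<lambda>n a. \<delta> n (a, b))" if b: "b \<in> Ob B"
  unfolding exseq_def using rA_module[OF A B Xm b] e b
  by (auto intro!: ntI simp: l tnt[OF A B Xn _ _ b b _ id_in[OF B b]])
 show "exseq B (\<lambda>n. rB A B (X n) a) (\<lambda>n b. \<delta> n (a, b))" if a: "a \<in> Ob A"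
  unfolding exseq_def using rB_module[OF A B Xm a] e a
  by (auto intro!: ntI simp: l tnt[OF A B Xn a a _ _ id_in[OF A a]])
qed

text \<open>The two actions commute because \<open>f \<otimes> 1\<close> and
  \<open>1 \<otimes> g\<close>, composed in either order, give \<open>f \<otimes> g\<close>.\<close>

lemma sec_bicomplex:
 assumes A: "k_category K A" and B: "k_category K B" and IA: "two_sided_ideal K A IA" and IB: "two_sided_ideal K B IB"
  and X: "exseq (tensor_cat K A B) X \<delta>"
 shows "bicomplex K A B IA IB (\<lambda>n b. rA A B (X n) b) (\<lambda>n a. rB A B (X n) a) (\<lambda>n a b. \<delta> n (a, b))"
proof
 fix n a a' b b' f g v
 assume o: "a \<in> Ob A" "a' \<in> Ob A" "b \<in> Ob B" "b' \<in> Ob B" and f: "f \<in> Mor A a a'" and g: "g \<in> Mor B b b'"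
  and v: "v \<in> el (rA A B (X n) b) a"
 note c = tact_comp[OF A B ex_mod[OF X]]
 note ids = id_in[OF A o(1)] id_in[OF A o(2)] id_in[OF B o(3)] id_in[OF B o(4)]
 show "act (rB A B (X n) a') b b' g (act (rA A B (X n) b) a a' f v) = act (rA A B (X n) b') a a' f (act (rB A B (X n) a) b b' g v)"
  using c[OF o(1,2,2,3,3,4) f ids(2,3) g, of v n] c[OF o(1,1,2,3,4,4) ids(1) f g ids(4), of v n] v
   comp_idl[OF A o(1,2) f] comp_idr[OF A o(1,2) f] comp_idl[OF B o(3,4) g] comp_idr[OF B o(3,4) g] by simp
qed (use A B IA IB rA_exseq[OF A B X] rB_exseq[OF A B X] in auto)

lemma ru_inv:
 fixes D :: "('o, 'k, 'm) kcat"
 assumes sD: "small_k_category TYPE('u) K D" and x: "x \<in> Ob D"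
 shows "nt D (repu D x :: ('o, 'm, 'k, 'u) kmod) (hrep D x) (trd (hrep D x))"
  and "y \<in> Ob D ==> f \<in> Mor D x y ==> trd (hrep D x) y (ru D x y f :: 'u) = f"
proof -
 have small: "el (hrep D x) y \<lesssim> (UNIV :: 'u set)" if "y \<in> Ob D" for y using small_hom[OF sD x that] by simp
 note t = trk_props[OF small_cat[OF sD] hrep_module[OF small_cat[OF sD] x] small]
 show "nt D (repu D x :: ('o, 'm, 'k, 'u) kmod) (hrep D x) (trd (hrep D x))" unfolding repu_def by (rule t(3))
 show "trd (hrep D x) y (ru D x y f :: 'u) = f" if "y \<in> Ob D" "f \<in> Mor D x y"
  using t(4)[OF _ that(1), of f] that(2) unfolding ru_def by simp
qed

text \<open>With the zero ideal the spans vanish, and statements relative to an ideal become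
  absolute ones.\<close>

lemma zero_ideal:
 assumes C: "k_category K C"
 shows "two_sided_ideal K C (\<lambda>x y. {\<zero>[Hom C x y]})"
 unfolding two_sided_ideal_def
 using lin_zero[OF hom_mod[OF C] hom_mod[OF C] bilin_right[OF comp_bilin[OF C]]]
  lin_zero[OF hom_mod[OF C] hom_mod[OF C] bilin_left[OF comp_bilin[OF C]]]
 by (auto simp: submodule_zero[OF hom_mod[OF C]])

text \<open>This is \<open>ZB_subf\<close> for a single module, placed in a sequence by
  \<open>id_exseq\<close> and with the zero ideal in the idle variable.\<close>

lemma sec_subf:
 assumes A: "k_category K A" and B: "k_category K B" and M: "k_module K (tensor_cat K A B) M"
 shows "two_sided_ideal K B IB ==> b \<in> Ob B ==> subf A (rA A B M b) (\<lambda>a. jsp B IB (rB A B M a) b)"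
  and "two_sided_ideal K A IA ==> a \<in> Ob A ==> subf B (rB A B M a) (\<lambda>b. jsp A IA (rA A B M b) a)"
proof -
 let ?X = "\<lambda>n :: nat. if n \<le> 1 then M else subk M (\<lambda>x. {\<zero>[val M x]})"
 have X: "exseq (tensor_cat K A B) ?X (\<lambda>n x v. v)" by (rule id_exseq[OF tensor_category[OF A B] M])
 show "subf A (rA A B M b) (\<lambda>a. jsp B IB (rB A B M a) b)" if I: "two_sided_ideal K B IB" and b: "b \<in> Ob B"
 proof -
  interpret S: bicomplex K A B "\<lambda>x y. {\<zero>[Hom A x y]}" IB "\<lambda>n b. rA A B (?X n) b" "\<lambda>n a. rB A B (?X n) a" "\<lambda>n a b v. v"
   by (rule sec_bicomplex[OF A B zero_ideal[OF A] I X])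
  have "S.ZB 0 b = (\<lambda>a. jsp B IB (rB A B M a) b)" unfolding fun_eq_iff S.ZB_def by simp
  then show ?thesis using S.ZB_subf[OF b, of 0] by (simp only: if_True le0)
 qed
 show "subf B (rB A B M a) (\<lambda>b. jsp A IA (rA A B M b) a)" if I: "two_sided_ideal K A IA" and a: "a \<in> Ob A"
 proof -
  interpret S: bicomplex K A B IA "\<lambda>x y. {\<zero>[Hom B x y]}" "\<lambda>n b. rA A B (?X n) b" "\<lambda>n a. rB A B (?X n) a" "\<lambda>n a b v. v"
   by (rule sec_bicomplex[OF A B I zero_ideal[OF B] X])
  interpret S': bicomplex K B A "\<lambda>x y. {\<zero>[Hom B x y]}" IA "\<lambda>n a. rB A B (?X n) a" "\<lambda>n b. rA A B (?X n) b" "\<lambda>n b a v. v"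
   by (rule S.swap)
  have "S'.ZB 0 a = (\<lambda>b. jsp A IA (rA A B M b) a)" unfolding fun_eq_iff S'.ZB_def by simp
  then show ?thesis using S'.ZB_subf[OF a, of 0] by (simp only: if_True le0)
 qed
qed

text \<open>A section of a representable module is a direct sum of copies of a representable module,
 indexed by a basis of a morphism space; \<open>linear_lift\<close> replaces the choice of the basis.\<close>

lemma relproj_bilinear:
 fixes A :: "('a, 'k, 'm) kcat" and B :: "('b, 'k, 'n) kcat"
  and RA :: "'b => ('a, 'm, 'k, 'u) kmod" and RB :: "'a => ('b, 'n, 'k, 'u) kmod"
 assumes A: "k_category K A" and B: "k_category K B" and I: "two_sided_ideal K B I"
  and RA: "\<And>b. b \<in> Ob B ==> k_module K A (RA b)" and RB: "\<And>a. a \<in> Ob A ==> k_module K B (RB a)"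
  and val: "\<And>a b. val (RB a) b = val (RA b) a" and o: "a0 \<in> Ob A" "b0 \<in> Ob B" and b: "b \<in> Ob B"
  and w: "\<And>a b. a \<in> Ob A ==> b \<in> Ob B ==> bilinear_map K (Hom A a0 a) (Hom B b0 b) (val (RA b) a) (w a b)"
  and wA: "\<And>a a' b f p q. a \<in> Ob A ==> a' \<in> Ob A ==> b \<in> Ob B ==> f \<in> Mor A a a' ==> p \<in> Mor A a0 a ==> q \<in> Mor B b0 b ==>
   act (RA b) a a' f (w a b p q) = w a' b (Comp A a0 a a' f p) q"
  and wB: "\<And>a b b' g p q. a \<in> Ob A ==> b \<in> Ob B ==> b' \<in> Ob B ==> g \<in> Mor B b b' ==> p \<in> Mor A a0 a ==> q \<in> Mor B b0 b ==>
   act (RB a) b b' g (w a b p q) = w a b' p (Comp B b0 b b' g q)"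
  and ex: "\<And>a b (M :: ('k, 'u) module) \<beta>. a \<in> Ob A ==> b \<in> Ob B ==> module K M ==> bilinear_map K (Hom A a0 a) (Hom B b0 b) M \<beta> ==>
   \<exists>L. linear_map K (val (RA b) a) M L \<and> (\<forall>p\<in>Mor A a0 a. \<forall>q\<in>Mor B b0 b. L (w a b p q) = \<beta> p q)"
  and ext: "\<And>a b (M :: ('k, 'u) module) f g v. a \<in> Ob A ==> b \<in> Ob B ==> module K M ==> linear_map K (val (RA b) a) M f ==>
   linear_map K (val (RA b) a) M g ==> (\<And>p q. p \<in> Mor A a0 a ==> q \<in> Mor B b0 b ==> f (w a b p q) = g (w a b p q)) ==>
   v \<in> el (RA b) a ==> f v = g v"
 shows "relproj A (RA b) (\<lambda>a. jsp B I (RB a) b)"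
 unfolding relproj_def
proof (intro allI impI)
 note ids = id_in[OF A o(1)] id_in[OF B o(2)]
 fix M N :: "('a, 'm, 'k, 'u) kmod" and e h
 assume M: "k_module K A M" and N: "k_module K A N" and e: "nt A M N e" and h: "nt A (RA b) N h"
  and s: "\<forall>x\<in>Ob A. e x ` el M x = el N x"
  and h0: "\<forall>x\<in>Ob A. \<forall>v\<in>jsp B I (RB x) b. h x v = \<zero>[val N x]"
 \<comment> \<open>\<open>w a b p q\<close> stands for \<open>p \<otimes> q\<close> in
   \<open>A(a0, a) \<otimes> B(b0, b)\<close>, and \<open>?\<gamma> q\<close> for
   \<open>1 \<otimes> q\<close>. At fixed \<open>b\<close> the latter elements generate the section
   over \<open>A\<close>.\<close>
 let ?\<gamma> = "w a0 b (Id A a0)"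
 note \<gamma>l = bilin_right[OF w[OF o(1) b] ids(1)]
 have "h a0 (?\<gamma> j) = \<zero>[val N a0]" if j: "j \<in> I b0 b" for j
 proof -
  have "w a0 b0 (Id A a0) (Id B b0) \<in> el (RB a0) b0" unfolding val by (rule bilin_closed[OF w[OF o] ids])
  from jsp_act[OF B I RB[OF o(1)] o(2) b j this] have "?\<gamma> j \<in> jsp B I (RB a0) b"
   using wB[OF o b ideal_carrier[OF B I o(2) b j] ids] comp_idr[OF B o(2) b ideal_carrier[OF B I o(2) b j]] by simp
  then show ?thesis using h0 o(1) by blast
 qed
 \<comment> \<open>Instead of choosing values on a basis, the restriction of \<open>h\<close> to the
   elements \<open>1 \<otimes> q\<close> is lifted linearly along \<open>e\<close>. The lift
   vanishes where that restriction does, in particular on \<open>I b0 b\<close>.\<close>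
 moreover obtain \<beta> where \<beta>: "linear_map K (Hom B b0 b) (val M a0) \<beta>" "\<And>q. q \<in> Mor B b0 b ==> e a0 (\<beta> q) = h a0 (?\<gamma> q)"
  "\<And>q. q \<in> Mor B b0 b ==> h a0 (?\<gamma> q) = \<zero>[val N a0] ==> \<beta> q = \<zero>[val M a0]"
 proof -
  note l = lin_comp[OF \<gamma>l nt_lin[OF h o(1)]]
  have "h a0 (?\<gamma> q) \<in> e a0 ` el M a0" if "q \<in> Mor B b0 b" for q using s o(1) lin_closed[OF l that] by blast
  from linear_lift[OF hom_mod[OF B o(2) b] val_mod[OF M o(1)] val_mod[OF N o(1)] l nt_lin[OF e o(1)] this]
  show ?thesis using that by blast
 qed
 ultimately have \<beta>0: "\<beta> j = \<zero>[val M a0]" if "j \<in> I b0 b" for j using that ideal_carrier[OF B I o(2) b that] by blast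
 \<comment> \<open>Naturality forces the lift on pure tensors: \<open>p \<otimes> q\<close> must go
   to \<open>p\<close> applied to \<open>\<beta> q\<close>.\<close>
 have "bilinear_map K (Hom A a0 a) (Hom B b0 b) (val M a) (\<lambda>p q. act M a0 a p (\<beta> q))" if "a \<in> Ob A" for a
  by (rule bilin_comp[OF act_bilin[OF M o(1) that] lin_id \<beta>(1)])
 then have "\<forall>a\<in>Ob A. \<exists>L. linear_map K (val (RA b) a) (val M a) L \<and> (\<forall>p\<in>Mor A a0 a. \<forall>q\<in>Mor B b0 b. L (w a b p q) = act M a0 a p (\<beta> q))"
  using ex b val_mod[OF M] by blast
 from bchoice[OF this] obtain L where L: "\<And>a. a \<in> Ob A ==> linear_map K (val (RA b) a) (val M a) (L a)"
  and Lw: "\<And>a p q. a \<in> Ob A ==> p \<in> Mor A a0 a ==> q \<in> Mor B b0 b ==> L a (w a b p q) = act M a0 a p (\<beta> q)" by blast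
 have "nt A (RA b) M L"
 proof (rule ntI[OF L])
  fix a a' f v assume x: "a \<in> Ob A" "a' \<in> Ob A" and f: "f \<in> Mor A a a'" and v: "v \<in> el (RA b) a"
  show "L a' (act (RA b) a a' f v) = act M a a' f (L a v)"
  proof (rule ext[OF x(1) b val_mod[OF M x(2)] lin_comp[OF act_lin[OF RA[OF b] x f] L[OF x(2)]] lin_comp[OF L[OF x(1)] act_lin[OF M x f]] _ v])
   fix p q assume p: "p \<in> Mor A a0 a" and q: "q \<in> Mor B b0 b"
   show "L a' (act (RA b) a a' f (w a b p q)) = act M a a' f (L a (w a b p q))"
    using wA[OF x b f p q] Lw[OF x(1) p q] Lw[OF x(2) comp_in[OF A o(1) x p f] q] act_comp[OF M o(1) x p f lin_closed[OF \<beta>(1) q]] by simp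
  qed
 qed
 moreover have "e a (L a v) = h a v" if x: "a \<in> Ob A" and v: "v \<in> el (RA b) a" for a v
 proof (rule ext[OF x b val_mod[OF N x] lin_comp[OF L[OF x] nt_lin[OF e x]] nt_lin[OF h x] _ v])
  fix p q assume p: "p \<in> Mor A a0 a" and q: "q \<in> Mor B b0 b"
  show "e a (L a (w a b p q)) = h a (w a b p q)"
   using Lw[OF x p q] nt_nat[OF e o(1) x p lin_closed[OF \<beta>(1) q]] \<beta>(2)[OF q] nt_nat[OF h o(1) x p lin_closed[OF \<gamma>l q]]
    wA[OF o(1) x b p ids(1) q] comp_idr[OF A o(1) x p] by simp
 qed
 \<comment> \<open>A generator \<open>j (p \<otimes> q)\<close> of the span equals
   \<open>p \<otimes> j q\<close>, where \<open>j q\<close> lies in the ideal and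
   \<open>\<beta>\<close> vanishes on it.\<close>
 moreover have "L a v = \<zero>[val M a]" if x: "a \<in> Ob A" and v: "v \<in> jsp B I (RB a) b" for a v
 proof -
  note k = submodule_kernel[OF val_mod[OF RA[OF b] x] val_mod[OF M x] L[OF x]]
  have "v \<in> {v \<in> el (RA b) a. L a v = \<zero>[val M a]}"
  proof (rule jsp_least[OF RB[OF x] b k[folded val] _ v, unfolded val])
   fix b' j u assume y: "b' \<in> Ob B" and j: "j \<in> I b' b" and u: "u \<in> el (RA b') a"
   note jc = ideal_carrier[OF B I y b j]
   note al = act_lin[OF RB[OF x] y b jc, unfolded val]
   have "L a (act (RB a) b' b j u) = \<zero>[val M a]"
   proof (rule ext[OF x y val_mod[OF M x] lin_comp[OF al L[OF x]] lin_const_zero[OF val_mod[OF M x]] _ u])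
    fix p q assume p: "p \<in> Mor A a0 a" and q: "q \<in> Mor B b0 b'"
    show "L a (act (RB a) b' b j (w a b' p q)) = \<zero>[val M a]"
     using wB[OF x y b jc p q] Lw[OF x p comp_in[OF B o(2) y b q jc]] \<beta>0[OF ideal_right[OF I o(2) y b q j]]
      lin_zero[OF val_mod[OF M o(1)] val_mod[OF M x] act_lin[OF M o(1) x p]] by simp
   qed
   then show "act (RB a) b' b j u \<in> {v \<in> el (RA b) a. L a v = \<zero>[val M a]}" using lin_closed[OF al u] by simp
  qed
  then show ?thesis by simp
 qed
 ultimately show "\<exists>h'. nt A (RA b) M h' \<and> (\<forall>x\<in>Ob A. \<forall>v\<in>el (RA b) x. e x (h' x v) = h x v) \<and>
    (\<forall>x\<in>Ob A. \<forall>v\<in>jsp B I (RB x) b. h' x v = \<zero>[val M x])" by blast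
qed

text \<open>A representable over \<open>A \<otimes> B\<close> is
  \<open>A(a0, -) \<otimes> B(b0, -)\<close> up to the encoding \<open>ru\<close>, so the universal
  property of the tensor product provides \<open>ex\<close> and \<open>ext\<close> for
  \<open>relproj_bilinear\<close>. The second part exchanges the variables and flips bilinear
  maps.\<close>

lemma relproj_repu:
 fixes A :: "('a, 'k, 'm) kcat" and B :: "('b, 'k, 'n) kcat"
 assumes sA: "small_k_category TYPE('u) K A" and sB: "small_k_category TYPE('u) K B" and o: "a0 \<in> Ob A" "b0 \<in> Ob B"
 defines "R \<equiv> repu (tensor_cat K A B) (a0, b0) :: ('a \<times> 'b, ('m \<times> 'n => 'k) set, 'k, 'u) kmod"
 shows relproj_repu_A: "two_sided_ideal K B IB ==> b \<in> Ob B ==> relproj A (rA A B R b) (\<lambda>a. jsp B IB (rB A B R a) b)"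
  and relproj_repu_B: "two_sided_ideal K A IA ==> a \<in> Ob A ==> relproj B (rB A B R a) (\<lambda>b. jsp A IA (rA A B R b) a)"
proof -
 let ?T = "tensor_cat K A B"
 note A = small_cat[OF sA] and B = small_cat[OF sB] and sT = small_tensor[OF sA sB]
 have o0: "(a0, b0) \<in> Ob ?T" using o by simp
 have Rm: "k_module K ?T R" unfolding R_def by (rule repu_module[OF sT o0])
 note Am = hom_mod[OF A o(1)] and Bm = hom_mod[OF B o(2)]
 let ?V = "\<lambda>a b. thom A B a0 a b0 b" and ?t = "\<lambda>a b. telt A B a0 a b0 b"
 let ?u = "\<lambda>a b. ru ?T (a0, b0) (a, b) :: _ => 'u" and ?d = "\<lambda>a b. trd (hrep ?T (a0, b0)) (a, b)"
 let ?w = "\<lambda>a b p q. ?u a b (?t a b p q)"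
 have ul: "linear_map K (?V a b) (val R (a, b)) (?u a b)" if "a \<in> Ob A" "b \<in> Ob B" for a b
  using ru_lin[OF sT o0, of "(a, b)"] that unfolding R_def by simp
 have w: "bilinear_map K (Hom A a0 a) (Hom B b0 b) (val R (a, b)) (?w a b)" if x: "a \<in> Ob A" "b \<in> Ob B" for a b
 proof -
  note t = tensor_elt_bilinear[OF Am[OF x(1)] Bm[OF x(2)]]
  show ?thesis unfolding bilinear_map_def using lin_comp[OF bilin_right[OF t] ul[OF x]] lin_comp[OF bilin_left[OF t] ul[OF x]] by blast
 qed
 have wc: "act R (a, b) (a', b') (telt A B a a' b b' f g) (?w a b p q) = ?w a' b' (Comp A a0 a a' f p) (Comp B b0 b b' g q)"
  if "a \<in> Ob A" "a' \<in> Ob A" "b \<in> Ob B" "b' \<in> Ob B" "f \<in> Mor A a a'" "g \<in> Mor B b b'" "p \<in> Mor A a0 a" "q \<in> Mor B b0 b" for a a' b b' f g p q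
  using ru_act[OF sT o0, of "(a, b)" "(a', b')", OF _ _ tensor_elt_in[OF A B o(1) that(1) o(2) that(3,7,8)] tensor_elt_in[OF A B that(1-6)]]
   tensor_comp_elt[OF A B o(1) that(1,2) o(2) that(3,4,7,5,8,6)] that(1-4) unfolding R_def by simp
 have wA: "act (rA A B R b) a a' f (?w a b p q) = ?w a' b (Comp A a0 a a' f p) q"
  if "a \<in> Ob A" "a' \<in> Ob A" "b \<in> Ob B" "f \<in> Mor A a a'" "p \<in> Mor A a0 a" "q \<in> Mor B b0 b" for a a' b f p q
  using wc[OF that(1,2,3,3,4) id_in[OF B that(3)] that(5,6)] comp_idl[OF B o(2) that(3,6)] by simp
 have wB: "act (rB A B R a) b b' g (?w a b p q) = ?w a b' p (Comp B b0 b b' g q)"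
  if "a \<in> Ob A" "b \<in> Ob B" "b' \<in> Ob B" "g \<in> Mor B b b'" "p \<in> Mor A a0 a" "q \<in> Mor B b0 b" for a b b' g p q
  using wc[OF that(1,1,2,3) id_in[OF A that(1)] that(4,5,6)] comp_idl[OF A o(1) that(1,5)] by simp
 have ex: "\<exists>L. linear_map K (val R (a, b)) M L \<and> (\<forall>p\<in>Mor A a0 a. \<forall>q\<in>Mor B b0 b. L (?w a b p q) = \<beta> p q)"
  if x: "a \<in> Ob A" "b \<in> Ob B" and M: "module K M" and \<beta>: "bilinear_map K (Hom A a0 a) (Hom B b0 b) M \<beta>" for a b \<beta> and M :: "('k, 'u) module"
 proof -
  have d: "linear_map K (val R (a, b)) (?V a b) (?d a b)"
   using nt_lin[OF ru_inv(1)[OF sT o0], of "(a, b)"] x unfolding R_def by simp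
  have du: "?d a b (?u a b t) = t" if "t \<in> carrier (?V a b)" for t using ru_inv(2)[OF sT o0, of "(a, b)" t] x that by simp
  show ?thesis
   using lin_comp[OF d tensor_lift_linear[OF Am[OF x(1)] Bm[OF x(2)] M \<beta>]] tensor_lift_elt[OF Am[OF x(1)] Bm[OF x(2)] M \<beta>]
    du[OF bilin_closed[OF tensor_elt_bilinear[OF Am[OF x(1)] Bm[OF x(2)]]]]
   by (intro exI[of _ "\<lambda>v. tensor_lift K M \<beta> (?d a b v)"]) simp
 qed
 have ext: "f v = g v" if x: "a \<in> Ob A" "b \<in> Ob B" and M: "module K M" and l: "linear_map K (val R (a, b)) M f" "linear_map K (val R (a, b)) M g"
   and eq: "\<And>p q. p \<in> Mor A a0 a ==> q \<in> Mor B b0 b ==> f (?w a b p q) = g (?w a b p q)" and v: "v \<in> el R (a, b)"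
  for a b f g v and M :: "('k, 'u) module"
 proof -
  obtain t where t: "t \<in> carrier (?V a b)" "v = ?u a b t" using ru_surj[OF sT o0, of "(a, b)" v] x v unfolding R_def by auto
  show ?thesis unfolding t(2)
   by (rule tensor_ext[OF Am[OF x(1)] Bm[OF x(2)] M lin_comp[OF ul[OF x] l(1)] lin_comp[OF ul[OF x] l(2)] eq t(1)])
 qed
 show "relproj A (rA A B R b) (\<lambda>a. jsp B IB (rB A B R a) b)" if I: "two_sided_ideal K B IB" and b: "b \<in> Ob B"
  by (rule relproj_bilinear[where w = ?w and RA = "rA A B R" and RB = "rB A B R", OF A B I rA_module[OF A B Rm] rB_module[OF A B Rm] _ o b])
   (use w wA wB ex ext in \<open>simp_all del: sec_simps(3,4)\<close>)
 show "relproj B (rB A B R a) (\<lambda>b. jsp A IA (rA A B R b) a)" if I: "two_sided_ideal K A IA" and a: "a \<in> Ob A"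
 proof (rule relproj_bilinear[where w = "\<lambda>b a q p. ?w a b p q" and RA = "rB A B R" and RB = "rA A B R", OF B A I rB_module[OF A B Rm] rA_module[OF A B Rm] _ o(2,1) a])
  show "\<exists>L. linear_map K (val (rB A B R a) b) M L \<and> (\<forall>q\<in>Mor B b0 b. \<forall>p\<in>Mor A a0 a. L (?w a b p q) = \<beta> q p)"
   if x: "b \<in> Ob B" "a \<in> Ob A" and M: "module K M" and \<beta>: "bilinear_map K (Hom B b0 b) (Hom A a0 a) M \<beta>" for a b \<beta> and M :: "('k, 'u) module"
   using ex[OF x(2,1) M bilin_flip[OF \<beta>]] by auto
  show "f v = g v" if "b \<in> Ob B" "a \<in> Ob A" "module K M" "linear_map K (val (rB A B R a) b) M f" "linear_map K (val (rB A B R a) b) M g"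
    "\<And>q p. q \<in> Mor B b0 b ==> p \<in> Mor A a0 a ==> f (?w a b p q) = g (?w a b p q)" "v \<in> el (rB A B R a) b"
   for a b f g v and M :: "('k, 'u) module"
   using ext[OF that(2,1,3), of f g v] that(4-7) by simp
 qed (use bilin_flip[OF w] wA wB in \<open>simp_all del: sec_simps(3,4)\<close>)
qed

text \<open>The summands are covered by \<open>relproj_repu\<close>. Passage to the direct sum is
  \<open>relproj_dsum\<close>, membership in the span being decided by components according to
  \<open>dsum_jsp\<close>.\<close>

lemma sec_projective:
 fixes A :: "('a, 'k, 'm) kcat" and B :: "('b, 'k, 'n) kcat" and P :: "('a \<times> 'b, ('m \<times> 'n => 'k) set, 'k, 'u) kmod"
 assumes sA: "small_k_category TYPE('u) K A" and sB: "small_k_category TYPE('u) K B" and P: "isfree (tensor_cat K A B) P"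
 shows rA_relproj: "two_sided_ideal K B IB ==> b \<in> Ob B ==> relproj A (rA A B P b) (\<lambda>a. jsp B IB (rB A B P a) b)"
  and rB_relproj: "two_sided_ideal K A IA ==> a \<in> Ob A ==> relproj B (rB A B P a) (\<lambda>b. jsp A IA (rA A B P b) a)"
proof -
 let ?T = "tensor_cat K A B"
 note A = small_cat[OF sA] and B = small_cat[OF sB] and inf = small_inf[OF sA]
 note sT = small_tensor[OF sA sB]
 obtain S :: "(('a \<times> 'b) \<times> 'u) set" and xs where S: "S \<lesssim> (UNIV :: 'u set)" and xs: "xs ` S \<subseteq> Ob ?T"
  and Pe: "P = dsum S (\<lambda>s. repu ?T (xs s))"
  using P unfolding isfree_def by auto
 let ?R = "\<lambda>s. repu ?T (xs s) :: ('a \<times> 'b, ('m \<times> 'n => 'k) set, 'k, 'u) kmod"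
 have Rm: "k_module K ?T (?R s)" if "s \<in> S" for s using repu_module[OF sT] xs that by blast
 have Pm: "k_module K ?T P" unfolding Pe by (rule dsum_module[OF small_cat[OF sT] Rm inf S])
 \<comment> \<open>Sections commute with direct sums up to equality: the encoding at
   \<open>(a, b)\<close> depends on the values at \<open>(a, b)\<close> alone.\<close>
 have eA: "rA A B P b = dsum S (\<lambda>s. rA A B (?R s) b)" for b
  unfolding Pe by (simp add: rA_def dsum_def trk_def dsr_def cong: if_cong)
 have eB: "rB A B P a = dsum S (\<lambda>s. rB A B (?R s) a)" for a
  unfolding Pe by (simp add: rB_def dsum_def trk_def dsr_def cong: if_cong)
 have c: "dcmp S (\<lambda>s. rA A B (?R s) b) s a = dcmp S (\<lambda>s. rB A B (?R s) a) s b" for a b s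
  by (simp add: dcmp_def trd_def fun_eq_iff)
 show "relproj A (rA A B P b) (\<lambda>a. jsp B IB (rB A B P a) b)" if I: "two_sided_ideal K B IB" and b: "b \<in> Ob B"
 proof -
  have RA: "k_module K A (rA A B (?R s) b)" if "s \<in> S" for s by (rule rA_module[OF A B Rm[OF that] b])
  have RB: "k_module K B (rB A B (?R s) a)" if "a \<in> Ob A" "s \<in> S" for a s by (rule rB_module[OF A B Rm[OF that(2)] that(1)])
  show ?thesis
   unfolding eA
  proof (rule relproj_dsum[where M = "\<lambda>s. rA A B (?R s) b" and W = "\<lambda>s a. jsp B IB (rB A B (?R s) a) b", OF A inf S RA])
   fix s assume s: "s \<in> S"
   obtain a0 b0 where x: "xs s = (a0, b0)" "a0 \<in> Ob A" "b0 \<in> Ob B" using xs s by (cases "xs s") auto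
   show "relproj A (rA A B (?R s) b) (\<lambda>a. jsp B IB (rB A B (?R s) a) b)"
    unfolding x(1) by (rule relproj_repu_A[OF sA sB x(2,3) I b])
   show "subf A (rA A B (?R s) b) (\<lambda>a. jsp B IB (rB A B (?R s) a) b)"
    by (rule sec_subf(1)[OF A B Rm[OF s] I b])
  next
   fix a u assume a: "a \<in> Ob A" and u: "u \<in> el (dsum S (\<lambda>s. rA A B (?R s) b)) a"
   have "u \<in> el (dsum S (\<lambda>s. rB A B (?R s) a)) b" using u unfolding eA[symmetric] eB[symmetric] by simp
   from dsum_jsp[where M = "\<lambda>s. rB A B (?R s) a", OF B I inf S RB[OF a] b this]
   show "u \<in> jsp B IB (rB A B P a) b \<longleftrightarrow> (\<forall>s\<in>S. dcmp S (\<lambda>s. rA A B (?R s) b) s a u \<in> jsp B IB (rB A B (?R s) a) b)"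
    unfolding eB c by simp
  next
   fix a assume a: "a \<in> Ob A"
   show "jsp B IB (rB A B P a) b \<subseteq> el (dsum S (\<lambda>s. rA A B (?R s) b)) a"
    using subf_in[OF rB_module[OF A B Pm a] jsp_subf(1)[OF B I rB_module[OF A B Pm a]] b] unfolding eA[symmetric] by auto
  qed
 qed
 show "relproj B (rB A B P a) (\<lambda>b. jsp A IA (rA A B P b) a)" if I: "two_sided_ideal K A IA" and a: "a \<in> Ob A"
 proof -
  have RB: "k_module K B (rB A B (?R s) a)" if "s \<in> S" for s by (rule rB_module[OF A B Rm[OF that] a])
  have RA: "k_module K A (rA A B (?R s) b)" if "b \<in> Ob B" "s \<in> S" for b s by (rule rA_module[OF A B Rm[OF that(2)] that(1)])
  show ?thesis
   unfolding eB
  proof (rule relproj_dsum[where M = "\<lambda>s. rB A B (?R s) a" and W = "\<lambda>s b. jsp A IA (rA A B (?R s) b) a", OF B inf S RB])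
   fix s assume s: "s \<in> S"
   obtain a0 b0 where x: "xs s = (a0, b0)" "a0 \<in> Ob A" "b0 \<in> Ob B" using xs s by (cases "xs s") auto
   show "relproj B (rB A B (?R s) a) (\<lambda>b. jsp A IA (rA A B (?R s) b) a)"
    unfolding x(1) by (rule relproj_repu_B[OF sA sB x(2,3) I a])
   show "subf B (rB A B (?R s) a) (\<lambda>b. jsp A IA (rA A B (?R s) b) a)"
    by (rule sec_subf(2)[OF A B Rm[OF s] I a])
  next
   fix b u assume b: "b \<in> Ob B" and u: "u \<in> el (dsum S (\<lambda>s. rB A B (?R s) a)) b"
   have "u \<in> el (dsum S (\<lambda>s. rA A B (?R s) b)) a" using u unfolding eA[symmetric] eB[symmetric] by simp
   from dsum_jsp[where M = "\<lambda>s. rA A B (?R s) b", OF A I inf S RA[OF b] a this]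
   show "u \<in> jsp A IA (rA A B P b) a \<longleftrightarrow> (\<forall>s\<in>S. dcmp S (\<lambda>s. rB A B (?R s) a) s b u \<in> jsp A IA (rA A B (?R s) b) a)"
    unfolding eA c[symmetric] by simp
  next
   fix b assume b: "b \<in> Ob B"
   show "jsp A IA (rA A B P b) a \<subseteq> el (dsum S (\<lambda>s. rB A B (?R s) a)) b"
    using subf_in[OF rA_module[OF A B Pm b] jsp_subf(1)[OF A I rA_module[OF A B Pm b]] a] unfolding eB[symmetric] by auto
  qed
 qed
qed

lemma killed_zero_ideal:
 assumes D: "k_category K D" and F: "k_module K D F"
 shows "killed D (\<lambda>x y. {\<zero>[Hom D x y]}) F"
 unfolding killed_def
 using lin_zero[OF hom_mod[OF D] val_mod[OF F] bilin_left[OF act_bilin[OF F]]] by auto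

text \<open>The case of the zero ideal, in which the span to be divided out is zero.\<close>

lemma sec_free_projective:
 fixes A :: "('a, 'k, 'm) kcat" and B :: "('b, 'k, 'n) kcat" and P :: "('a \<times> 'b, ('m \<times> 'n => 'k) set, 'k, 'u) kmod"
 assumes sA: "small_k_category TYPE('u) K A" and sB: "small_k_category TYPE('u) K B" and P: "isfree (tensor_cat K A B) P"
 shows rA_proj: "b \<in> Ob B ==> projective_module K A (rA A B P b)"
  and rB_proj: "a \<in> Ob A ==> projective_module K B (rB A B P a)"
proof -
 note A = small_cat[OF sA] and B = small_cat[OF sB]
 note Pm = proj_module[OF free_proj[OF small_tensor[OF sA sB] P]]
 show "projective_module K A (rA A B P b)" if b: "b \<in> Ob B"
 proof (rule relproj_zero[OF rA_module[OF A B Pm b] rA_relproj[OF sA sB P zero_ideal[OF B] b]])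
  fix a v assume a: "a \<in> Ob A" and v: "v \<in> jsp B (\<lambda>x y. {\<zero>[Hom B x y]}) (rB A B P a) b"
  note m = rB_module[OF A B Pm a]
  show "v = \<zero>[val (rA A B P b) a]" using killed_jsp[OF m killed_zero_ideal[OF B m] b v] by simp
 qed
 show "projective_module K B (rB A B P a)" if a: "a \<in> Ob A"
 proof (rule relproj_zero[OF rB_module[OF A B Pm a] rB_relproj[OF sA sB P zero_ideal[OF A] a]])
  fix b v assume b: "b \<in> Ob B" and v: "v \<in> jsp A (\<lambda>x y. {\<zero>[Hom A x y]}) (rA A B P b) a"
  note m = rA_module[OF A B Pm b]
  show "v = \<zero>[val (rB A B P a) b]" using killed_jsp[OF m killed_zero_ideal[OF A m] a v] by simp
 qed
qed

section \<open>The kernel of the tensor product of two projections\<close>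

definition tker :: "('a, 'k, 'm) kcat => ('b, 'k, 'n) kcat => ('a => 'a => 'm set) => ('b => 'b => 'n set) =>
  'a \<times> 'b => 'a \<times> 'b => ('m \<times> 'n => 'k) set set" where
 "tker A B IA IB = functor_kernel (tensor_cat K A B) (tensor_cat K (quot_cat A IA) (quot_cat B IB))
   (tensor_fun K (quot_cat A IA) (quot_cat B IB) (quot_proj A IA) (quot_proj B IB))"

text \<open>\<open>tker_elt\<close> and \<open>tker_least\<close> together say that the kernel is
  \<open>IA \<otimes> B + A \<otimes> IB\<close>; the minimality rests on
  \<open>tensor_quotient_kernel\<close>.\<close>

lemma tker_props:
 assumes A: "k_category K A" and B: "k_category K B" and IA: "two_sided_ideal K A IA" and IB: "two_sided_ideal K B IB"
 shows tker_functor: "k_functor K (tensor_cat K A B) (tensor_cat K (quot_cat A IA) (quot_cat B IB))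
   (tensor_fun K (quot_cat A IA) (quot_cat B IB) (quot_proj A IA) (quot_proj B IB))"
  and tker_ideal: "two_sided_ideal K (tensor_cat K A B) (tker A B IA IB)"
  and tker_elt: "a \<in> Ob A ==> a' \<in> Ob A ==> b \<in> Ob B ==> b' \<in> Ob B ==> f \<in> Mor A a a' ==> g \<in> Mor B b b' ==>
   f \<in> IA a a' \<or> g \<in> IB b b' ==> telt A B a a' b b' f g \<in> tker A B IA IB (a, b) (a', b')"
  and tker_least: "a \<in> Ob A ==> a' \<in> Ob A ==> b \<in> Ob B ==> b' \<in> Ob B ==> submodule N K (thom A B a a' b b') ==>
   (\<And>f g. f \<in> Mor A a a' ==> g \<in> Mor B b b' ==> f \<in> IA a a' \<or> g \<in> IB b b' ==>
    telt A B a a' b b' f g \<in> N) ==> t \<in> tker A B IA IB (a, b) (a', b') ==> t \<in> N"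
proof -
 note QA = quot_category[OF A IA] and QB = quot_category[OF B IB]
 show F: "k_functor K (tensor_cat K A B) (tensor_cat K (quot_cat A IA) (quot_cat B IB))
   (tensor_fun K (quot_cat A IA) (quot_cat B IB) (quot_proj A IA) (quot_proj B IB))"
  by (rule tensor_functor[OF A B QA QB quot_proj_functor[OF A IA] quot_proj_functor[OF B IB]])
 show "two_sided_ideal K (tensor_cat K A B) (tker A B IA IB)"
  unfolding tker_def by (rule functor_kernel_ideal[OF tensor_category[OF A B] tensor_category[OF QA QB] F])
 assume o: "a \<in> Ob A" "a' \<in> Ob A" "b \<in> Ob B" "b' \<in> Ob B"
 let ?V = "Hom A a a'" and ?W = "Hom B b b'"
 let ?V' = "quot_module ?V (IA a a')" and ?W' = "quot_module ?W (IB b b')"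
 note V = hom_mod[OF A o(1,2)] and W = hom_mod[OF B o(3,4)]
 note V0 = ideal_sub[OF IA o(1,2)] and W0 = ideal_sub[OF IB o(3,4)]
 note V' = qm_module[OF V V0] and W' = qm_module[OF W W0]
 note e' = tensor_elt_bilinear[OF V' W']
 show "tensor_elt K ?V ?W f g \<in> tker A B IA IB (a, b) (a', b')"
  if f: "f \<in> carrier ?V" and g: "g \<in> carrier ?W" and I: "f \<in> IA a a' \<or> g \<in> IB b b'"
 proof -
  have "tensor_elt K ?V' ?W' (IA a a' +>[?V] f) (IB b b' +>[?W] g) = \<zero>[tensor_module K ?V' ?W']"
  proof (cases "f \<in> IA a a'")
   case True
   then show ?thesis
    using coset_zero_iff[OF V V0 f] lin_zero[OF V' tensor_module_module[OF V' W'] bilin_left[OF e' qm_carrierI[OF g]]]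
    by (simp add: qm_zero)
  next
   case False
   then show ?thesis
    using I coset_zero_iff[OF W W0 g] lin_zero[OF W' tensor_module_module[OF V' W'] bilin_right[OF e' qm_carrierI[OF f]]]
    by (simp add: qm_zero)
  qed
  then show ?thesis
   unfolding tker_def functor_kernel_def
   using tensor_map_elt[OF V W V' W' qm_proj_linear[OF V V0] qm_proj_linear[OF W W0] f g] tensor_elt_in[OF A B o f g] by simp
 qed
 show "t \<in> N" if N: "submodule N K (tensor_module K ?V ?W)"
  and e: "\<And>f g. f \<in> carrier ?V ==> g \<in> carrier ?W ==> f \<in> IA a a' \<or> g \<in> IB b b' ==> tensor_elt K ?V ?W f g \<in> N"
  and t: "t \<in> tker A B IA IB (a, b) (a', b')"
 proof (rule tensor_quotient_kernel[OF V W V0 W0 N])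
  show "tensor_elt K ?V ?W v w \<in> N" if "v \<in> IA a a'" "w \<in> carrier ?W" for v w
   using e that ideal_carrier[OF A IA o(1,2)] by blast
  show "tensor_elt K ?V ?W v w \<in> N" if "v \<in> carrier ?V" "w \<in> IB b b'" for v w
   using e that ideal_carrier[OF B IB o(3,4)] by blast
 qed (use t in \<open>simp_all add: tker_def functor_kernel_def\<close>)
qed

text \<open>The kernel is generated by tensors with one factor in an ideal, and
  \<open>f \<otimes> g\<close> acts as \<open>f \<otimes> 1\<close> and \<open>1 \<otimes> g\<close>
  in either order; hence its span is the sum of the spans in the two variables. This turns
  \<open>exm\<close> over the tensor category into \<open>exsym\<close>.\<close>

lemma tker_jsp:
 assumes A: "k_category K A" and B: "k_category K B" and IA: "two_sided_ideal K A IA" and IB: "two_sided_ideal K B IB"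
  and M: "k_module K (tensor_cat K A B) M" and o: "a \<in> Ob A" "b \<in> Ob B"
 shows "jsp (tensor_cat K A B) (tker A B IA IB) M (a, b) =
  ssum (val M (a, b)) (jsp A IA (rA A B M b) a) (jsp B IB (rB A B M a) b)" (is "?L = ?R")
proof -
 let ?T = "tensor_cat K A B" and ?J = "tker A B IA IB"
 note T = tensor_category[OF A B] and J = tker_ideal[OF A B IA IB]
 note Am = rA_module[OF A B M o(2)] and Bm = rB_module[OF A B M o(1)]
 have oT: "(a, b) \<in> Ob ?T" using o by simp
 note m = val_mod[OF M oT]
 have sA: "submodule (jsp A IA (rA A B M b) a) K (val M (a, b))"
  using subf_sub[OF jsp_subf(1)[OF A IA Am] o(1)] by simp
 have sB: "submodule (jsp B IB (rB A B M a) b) K (val M (a, b))"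
  using subf_sub[OF jsp_subf(1)[OF B IB Bm] o(2)] by simp
 note sR = submodule_ssum[OF m sA sB]
 note sL = subf_sub[OF jsp_subf(1)[OF T J M] oT]
 note ids = id_in[OF A] id_in[OF B]
 show ?thesis
 proof
  show "?L \<subseteq> ?R"
  proof (rule subsetI, rule jsp_least[OF M oT sR])
   fix p t v assume p: "p \<in> Ob ?T" and t: "t \<in> ?J p (a, b)" and v: "v \<in> el M p"
   obtain a' b' where pe: "p = (a', b')" and o': "a' \<in> Ob A" "b' \<in> Ob B" using p by auto
   note v = v[unfolded pe]
   note l = tact_linear[OF A B M o'(1) o(1) o'(2) o(2) v]
   note TM = tensor_module_module[OF hom_mod[OF A o'(1) o(1)] hom_mod[OF B o'(2) o(2)]]
   have "t \<in> {t \<in> carrier (thom A B a' a b' b). act M (a', b') (a, b) t v \<in> ?R}"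
   proof (rule tker_least[OF A B IA IB o'(1) o(1) o'(2) o(2) submodule_preimage[OF TM m l sR] _ t[unfolded pe]])
    fix f g assume f: "f \<in> Mor A a' a" and g: "g \<in> Mor B b' b" and I: "f \<in> IA a' a \<or> g \<in> IB b' b"
    have "act M (a', b') (a, b) (telt A B a' a b' b f g) v \<in> ?R"
    \<comment> \<open>The factor from the ideal is made to act last, so that the result is visibly a
      generator of a span.\<close>
    proof (cases "f \<in> IA a' a")
     case True
     note gv = tact_in[OF A B M o'(1) o'(1) o'(2) o(2) ids(1)[OF o'(1)] g v]
     have "act (rA A B M b) a' a f (act M (a', b') (a', b) (telt A B a' a' b' b (Id A a') g) v)
       \<in> jsp A IA (rA A B M b) a"
      using jsp_act[OF A IA Am o'(1) o(1) True] gv by simp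
     moreover have "act (rA A B M b) a' a f (act M (a', b') (a', b) (telt A B a' a' b' b (Id A a') g) v)
       = act M (a', b') (a, b) (telt A B a' a b' b f g) v"
      using tact_comp[OF A B M o'(1) o'(1) o(1) o'(2) o(2) o(2) ids(1)[OF o'(1)] f g ids(2)[OF o(2)] v]
       comp_idr[OF A o'(1) o(1) f] comp_idl[OF B o'(2) o(2) g] by simp
     ultimately show ?thesis by (auto intro: ssum_left[OF m sA sB])
    next
     case False
     then have gI: "g \<in> IB b' b" using I by simp
     note fv = tact_in[OF A B M o'(1) o(1) o'(2) o'(2) f ids(2)[OF o'(2)] v]
     have "act (rB A B M a) b' b g (act M (a', b') (a, b') (telt A B a' a b' b' f (Id B b')) v)
       \<in> jsp B IB (rB A B M a) b"
      using jsp_act[OF B IB Bm o'(2) o(2) gI] fv by simp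
     moreover have "act (rB A B M a) b' b g (act M (a', b') (a, b') (telt A B a' a b' b' f (Id B b')) v)
       = act M (a', b') (a, b) (telt A B a' a b' b f g) v"
      using tact_comp[OF A B M o'(1) o(1) o(1) o'(2) o'(2) o(2) f ids(1)[OF o(1)] ids(2)[OF o'(2)] g v]
       comp_idl[OF A o'(1) o(1) f] comp_idr[OF B o'(2) o(2) g] by simp
     ultimately show ?thesis by (auto intro: ssum_right[OF m sA sB])
    qed
    then show "telt A B a' a b' b f g
      \<in> {t \<in> carrier (thom A B a' a b' b). act M (a', b') (a, b) t v \<in> ?R}"
     using tensor_elt_in[OF A B o'(1) o(1) o'(2) o(2) f g] by simp
   qed
   then show "act M p (a, b) t v \<in> ?R" unfolding pe by simp
  qed
  have "jsp A IA (rA A B M b) a \<subseteq> ?L"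
  proof (rule subsetI, rule jsp_least[OF Am o(1)])
   show "submodule ?L K (val (rA A B M b) a)" using sL by simp
   fix a' j v assume a': "a' \<in> Ob A" and j: "j \<in> IA a' a" and v: "v \<in> el (rA A B M b) a'"
   have t: "telt A B a' a b b j (Id B b) \<in> ?J (a', b) (a, b)"
    by (rule tker_elt[OF A B IA IB a' o(1) o(2,2) ideal_carrier[OF A IA a' o(1) j] ids(2)[OF o(2)] disjI1[OF j]])
   show "act (rA A B M b) a' a j v \<in> ?L"
    using jsp_act[OF T J M _ oT t] a' o(2) v by simp
  qed
  moreover have "jsp B IB (rB A B M a) b \<subseteq> ?L"
  proof (rule subsetI, rule jsp_least[OF Bm o(2)])
   show "submodule ?L K (val (rB A B M a) b)" using sL by simp
   fix b' j v assume b': "b' \<in> Ob B" and j: "j \<in> IB b' b" and v: "v \<in> el (rB A B M a) b'"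
   have t: "telt A B a a b' b (Id A a) j \<in> ?J (a, b') (a, b)"
    by (rule tker_elt[OF A B IA IB o(1,1) b' o(2) ids(1)[OF o(1)] ideal_carrier[OF B IB b' o(2) j] disjI2[OF j]])
   show "act (rB A B M a) b' b j v \<in> ?L"
    using jsp_act[OF T J M _ oT t] b' o(1) v by simp
  qed
  ultimately show "?R \<subseteq> ?L" by (rule ssum_subset[OF m sL])
 qed
qed

lemma gdn_iff:
 fixes X :: "nat => ('o, 'm, 'k, 'u) kmod"
 assumes "k_category K D" "two_sided_ideal K D J" "exseq D X \<delta>" "projseq D X"
 shows "gdn D J (X 0) n \<longleftrightarrow> exm D J X \<delta> n"
 using gdnI[OF assms nt_id[of D "X 0"] nt_id[of D "X 0"]] gdnD[of D J X n \<delta>] assms(3,4) by blast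

end

section \<open>Reduction in one variable followed by the other\<close>

context bicomplex
begin

text \<open>If the sections over \<open>B\<close> are acyclic for \<open>IB\<close>, dividing by
  \<open>IB\<close> leaves an exact sequence, and by \<open>r\<close> its terms are projective over
  \<open>A\<close>. So it is a projective resolution, its exactness modulo \<open>IA\<close> is the
  vanishing of Tor, and by \<open>YA_exm\<close> the same exactness is \<open>exsym\<close>.\<close>

lemma balance:
 assumes b: "b \<in> Ob B" and g: "\<And>a n. a \<in> Ob A ==> gdn B IB (XB 0 a) n" and p: "\<And>a. a \<in> Ob A ==> projseq B (\<lambda>n. XB n a)"
  and r: "\<And>n. relproj A (XA (Suc n) b) (ZB (Suc n) b)"
 shows "gdn A IA (quotk (XA 0 b) (ZB 0 b)) n \<longleftrightarrow> exsym n b"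
proof -
 have e: "exm B IB (\<lambda>n. XB n a) (\<lambda>n. \<delta> n a) n" if a: "a \<in> Ob A" for a n
  using gdn_iff[OF cB iB exB[OF a] p[OF a], of n] g[OF a] by blast
 have "projseq A (YA b)"
  unfolding projseq_def YA_def using relproj_quotk[OF cA modA[OF b] ZB_subf[OF b] r] by blast
 from gdn_iff[OF cA iA YA_exseq[OF b e] this, of n] show ?thesis unfolding YA_exm[OF b] unfolding YA_def .
qed

end

context kfield
begin

text \<open>Both orders of reduction for one free resolution over the tensor category; projectivity
  of sections supplies what \<open>balance\<close> asks of the terms.\<close>

lemma sec_balance:
 fixes A :: "('a, 'k, 'm) kcat" and B :: "('b, 'k, 'n) kcat" and X :: "nat => ('a \<times> 'b, ('m \<times> 'n => 'k) set, 'k, 'u) kmod"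
 assumes sA: "small_k_category TYPE('u) K A" and sB: "small_k_category TYPE('u) K B"
  and IA: "two_sided_ideal K A IA" and IB: "two_sided_ideal K B IB"
  and X: "exseq (tensor_cat K A B) X \<delta>" and Xf: "\<And>n. isfree (tensor_cat K A B) (X (Suc n))"
 shows sec_balance_A: "(\<And>a n. a \<in> Ob A ==> gdn B IB (rB A B (X 0) a) n) ==> b \<in> Ob B ==>
   gdn A IA (quotk (rA A B (X 0) b) (\<lambda>a. jsp B IB (rB A B (X 0) a) b)) n \<longleftrightarrow>
    bicomplex.exsym A B IA IB (\<lambda>n b. rA A B (X n) b) (\<lambda>n a. rB A B (X n) a) (\<lambda>n a b. \<delta> n (a, b)) n b"
  and sec_balance_B: "(\<And>b n. b \<in> Ob B ==> gdn A IA (rA A B (X 0) b) n) ==> a \<in> Ob A ==>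
   gdn B IB (quotk (rB A B (X 0) a) (\<lambda>b. jsp A IA (rA A B (X 0) b) a)) n \<longleftrightarrow>
    bicomplex.exsym B A IB IA (\<lambda>n a. rB A B (X n) a) (\<lambda>n b. rA A B (X n) b) (\<lambda>n b a. \<delta> n (a, b)) n a"
proof -
 note A = small_cat[OF sA] and B = small_cat[OF sB]
 let ?XA = "\<lambda>n b. rA A B (X n) b" and ?XB = "\<lambda>n a. rB A B (X n) a" and ?\<delta> = "\<lambda>n a b. \<delta> n (a, b)"
 interpret S: bicomplex K A B IA IB ?XA ?XB ?\<delta> by (rule sec_bicomplex[OF A B IA IB X])
 interpret S': bicomplex K B A IB IA ?XB ?XA "\<lambda>n b a. \<delta> n (a, b)" by (rule S.swap)
 note Xm = ex_mod[OF X]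
 have ZA: "S.ZB n b = (\<lambda>a. jsp B IB (?XB n a) b)" and ZB: "S'.ZB n a = (\<lambda>b. jsp A IA (?XA n b) a)" for n a b
  unfolding S.ZB_def S'.ZB_def by simp_all
 have pA: "projseq A (\<lambda>n. ?XA n b)" if "b \<in> Ob B" for b unfolding projseq_def using rA_proj[OF sA sB Xf that] by blast
 have pB: "projseq B (\<lambda>n. ?XB n a)" if "a \<in> Ob A" for a unfolding projseq_def using rB_proj[OF sA sB Xf that] by blast
 show "gdn A IA (quotk (?XA 0 b) (\<lambda>a. jsp B IB (?XB 0 a) b)) n \<longleftrightarrow> S.exsym n b"
  if "\<And>a n. a \<in> Ob A ==> gdn B IB (rB A B (X 0) a) n" and b: "b \<in> Ob B"
  using S.balance[OF b that(1) pB, unfolded ZA] rA_relproj[OF sA sB Xf IB b] by blast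
 show "gdn B IB (quotk (?XB 0 a) (\<lambda>b. jsp A IA (?XA 0 b) a)) n \<longleftrightarrow> S'.exsym n a"
  if "\<And>b n. b \<in> Ob B ==> gdn A IA (rA A B (X 0) b) n" and a: "a \<in> Ob A"
  using S'.balance[OF a that(1) pA, unfolded ZB] rB_relproj[OF sA sB Xf IA a] by blast
qed

text \<open>A killed \<open>M\<close> has killed sections in both variables. The first reduction is
  exact by \<open>gB\<close>, the second by \<open>gA\<close>, and \<open>tker_jsp\<close>
  identifies the outcome with the reduction over the tensor category.\<close>

lemma tensor_gdn:
 fixes A :: "('a, 'k, 'm) kcat" and B :: "('b, 'k, 'n) kcat" and M :: "('a \<times> 'b, ('m \<times> 'n => 'k) set, 'k, 'u) kmod"
 assumes sA: "small_k_category TYPE('u) K A" and sB: "small_k_category TYPE('u) K B"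
  and IA: "two_sided_ideal K A IA" and IB: "two_sided_ideal K B IB"
  and gA: "\<And>(N :: ('a, 'm, 'k, 'u) kmod) n. k_module K A N ==> killed A IA N ==> gdn A IA N n"
  and gB: "\<And>(N :: ('b, 'n, 'k, 'u) kmod) n. k_module K B N ==> killed B IB N ==> gdn B IB N n"
  and M: "k_module K (tensor_cat K A B) M" and k: "killed (tensor_cat K A B) (tker A B IA IB) M"
 shows "gdn (tensor_cat K A B) (tker A B IA IB) M n"
proof -
 let ?T = "tensor_cat K A B" and ?J = "tker A B IA IB"
 note A = small_cat[OF sA] and B = small_cat[OF sB]
 note sT = small_tensor[OF sA sB]
 note T = small_cat[OF sT] and J = tker_ideal[OF A B IA IB]
 note ids = id_in[OF A] id_in[OF B]
 obtain X \<delta> where X0: "X 0 = M" and X: "exseq ?T X \<delta>" and Xf: "\<And>n. isfree ?T (X (Suc n))"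
  using free_resolution[OF sT M] by blast
 let ?XA = "\<lambda>n b. rA A B (X n) b" and ?XB = "\<lambda>n a. rB A B (X n) a" and ?\<delta> = "\<lambda>n a b. \<delta> n (a, b)"
 interpret S: bicomplex K A B IA IB ?XA ?XB ?\<delta> by (rule sec_bicomplex[OF A B IA IB X])
 have kA: "act (rA A B M b) a a' j v = \<zero>[val M (a', b)]"
  if "a \<in> Ob A" "a' \<in> Ob A" "b \<in> Ob B" "j \<in> IA a a'" "v \<in> el M (a, b)" for a a' b j v
  using killedD[OF k, of "(a, b)" "(a', b)", OF _ _ tker_elt[OF A B IA IB that(1,2,3,3) ideal_carrier[OF A IA that(1,2,4)] ids(2)[OF that(3)] disjI1[OF that(4)]]]
   that by simp
 have kB: "act (rB A B M a) b b' j v = \<zero>[val M (a, b')]"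
  if "a \<in> Ob A" "b \<in> Ob B" "b' \<in> Ob B" "j \<in> IB b b'" "v \<in> el M (a, b)" for a b b' j v
  using killedD[OF k, of "(a, b)" "(a, b')", OF _ _ tker_elt[OF A B IA IB that(1,1,2,3) ids(1)[OF that(1)] ideal_carrier[OF B IB that(2,3,4)] disjI2[OF that(4)]]]
   that by simp
 have g0: "gdn B IB (rB A B (X 0) a) n" if a: "a \<in> Ob A" for a n
  unfolding X0 using kB a by (intro gB rB_module[OF A B M a]) (simp add: killed_def)
 have es: "S.exsym n b" if b: "b \<in> Ob B" for n b
 proof -
  have Z: "subf A (rA A B M b) (\<lambda>a. jsp B IB (rB A B M a) b)" by (rule sec_subf(1)[OF A B M IB b])
  note m = rA_module[OF A B M b]
  \<comment> \<open>The span divided out is zero since \<open>M\<close> is killed; the quotient is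
    kept because \<open>sec_balance_A\<close> is phrased with it.\<close>
  have "killed A IA (quotk (rA A B M b) (\<lambda>a. jsp B IB (rB A B M a) b))"
  proof (rule killed_quotk[OF A IA m Z])
   show "act (rA A B M b) a a' j v \<in> jsp B IB (rB A B M a') b"
    if "a \<in> Ob A" "a' \<in> Ob A" "j \<in> IA a a'" "v \<in> el (rA A B M b) a" for a a' j v
    using kA[OF that(1,2) b that(3)] that(4) sub_zero[OF val_mod[OF m that(2)] subf_sub[OF Z that(2)]] by simp
  qed
  from gA[OF quotk_module(1)[OF A m Z] this] show ?thesis
   using sec_balance_A[OF sA sB IA IB X Xf g0 b] unfolding X0 by simp
 qed
 have "exm ?T ?J X \<delta> n"
  unfolding exm_def
 proof (intro ballI impI)
  fix p z assume p: "p \<in> Ob ?T" and z: "z \<in> el (X (Suc n)) p" and d: "\<delta> n p z \<in> jsp ?T ?J (X n) p"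
  obtain a b where pe: "p = (a, b)" and o: "a \<in> Ob A" "b \<in> Ob B" using p by auto
  note j = tker_jsp[OF A B IA IB ex_mod[OF X] o]
  show "\<exists>j\<in>jsp ?T ?J (X (Suc n)) p. \<exists>w\<in>el (X (Suc (Suc n))) p. z = j \<oplus>[val (X (Suc n)) p] \<delta> (Suc n) p w"
   using es[OF o(2), of n] o(1) z d unfolding S.exsym_def pe j by simp
 qed
 then show ?thesis
  using gdn_iff[where X = X and n = n, OF T J X free_projseq[where X = X, OF sT Xf]] X0 by simp
qed

section \<open>The bimodule \<open>C\<close> and the passage to right modules\<close>

definition bimod :: "('o, 'k, 'm) kcat => ('o \<times> 'o, ('m \<times> 'm => 'k) set, 'k, 'm) kmod" where
 "bimod C = \<lparr>val = (\<lambda>(x, y). Hom C x y),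
   act = (\<lambda>(x, y) (x', y') t v. tensor_lift K (Hom C x' y') (\<lambda>f g. Comp C x' y y' g (Comp C x' x y v f)) t)\<rparr>"

lemma bimod_val [simp]: "val (bimod C) (x, y) = Hom C x y"
 by (simp add: bimod_def)

text \<open>The first variable runs over the opposite category, so a morphism from
  \<open>(x, y)\<close> to \<open>(x', y')\<close> is made of \<open>f : x' \<rightarrow> x\<close>
  and \<open>g : y \<rightarrow> y'\<close>, and these act on \<open>v : x \<rightarrow> y\<close>
  by composition on both sides.\<close>

lemma bimod_act:
 assumes C: "k_category K C" and o: "x \<in> Ob C" "x' \<in> Ob C" "y \<in> Ob C" "y' \<in> Ob C" and v: "v \<in> Mor C x y"
 shows bimod_act_lin: "linear_map K (thom C C x' x y y') (Hom C x' y') (\<lambda>t. act (bimod C) (x, y) (x', y') t v)"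
  and bimod_act_elt: "f \<in> Mor C x' x ==> g \<in> Mor C y y' ==>
   act (bimod C) (x, y) (x', y') (telt C C x' x y y' f g) v = Comp C x' y y' g (Comp C x' x y v f)"
proof -
 note m = hom_mod[OF C]
 have b: "bilinear_map K (Hom C x' x) (Hom C y y') (Hom C x' y') (\<lambda>f g. Comp C x' y y' g (Comp C x' x y v f))"
  by (rule bilin_comp[OF bilin_flip[OF comp_bilin[OF C o(2,3,4)]] bilin_right[OF comp_bilin[OF C o(2,1,3)] v] lin_id])
 note l = tensor_lift_linear[OF m[OF o(2,1)] m[OF o(3,4)] m[OF o(2,4)] b] tensor_lift_elt[OF m[OF o(2,1)] m[OF o(3,4)] m[OF o(2,4)] b]
 have e: "act (bimod C) (x, y) (x', y') = (\<lambda>t v. tensor_lift K (Hom C x' y') (\<lambda>f g. Comp C x' y y' g (Comp C x' x y v f)) t)"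
  by (simp add: bimod_def)
 show "linear_map K (thom C C x' x y y') (Hom C x' y') (\<lambda>t. act (bimod C) (x, y) (x', y') t v)"
  unfolding e by (rule l(1))
 show "act (bimod C) (x, y) (x', y') (telt C C x' x y y' f g) v = Comp C x' y y' g (Comp C x' x y v f)"
  if "f \<in> Mor C x' x" "g \<in> Mor C y y'"
  unfolding e by (rule l(2)[OF that])
qed

text \<open>Linearity in \<open>v\<close> and compatibility with composition are checked on pure
  tensors, where the latter is associativity in \<open>C\<close>.\<close>

lemma bimod_module:
 assumes C: "k_category K C"
 shows "k_module K (tensor_cat K (op_cat C) C) (bimod C)"
proof -
 let ?T = "tensor_cat K (op_cat C) C" and ?M = "bimod C"
 note m = hom_mod[OF C] and ids = id_in[OF C] and ci = comp_in[OF C] and op = op_category[OF C]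
 note l = bimod_act_lin[OF C] and e = bimod_act_elt[OF C]
 have lv: "linear_map K (Hom C x y) (Hom C x' y') (act ?M (x, y) (x', y') t)"
  if o: "x \<in> Ob C" "x' \<in> Ob C" "y \<in> Ob C" "y' \<in> Ob C" and t: "t \<in> carrier (thom C C x' x y y')" for x x' y y' t
 proof (rule linI)
  note V = m[OF o(1,3)] and W = m[OF o(2,4)]
  note cb = bilin_simps[OF comp_bilin[OF C o(2,3,4)]] bilin_simps[OF comp_bilin[OF C o(2,1,3)]]
  show "act ?M (x, y) (x', y') t v \<in> Mor C x' y'" if "v \<in> Mor C x y" for v
   by (rule lin_closed[OF l[OF o that] t])
  fix u v assume u: "u \<in> Mor C x y" and v: "v \<in> Mor C x y"
  note uv = module_add[OF V u v]
  show "act ?M (x, y) (x', y') t (u \<oplus>[Hom C x y] v) =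
    act ?M (x, y) (x', y') t u \<oplus>[Hom C x' y'] act ?M (x, y) (x', y') t v"
  proof (rule tensor_ext[OF m[OF o(2,1)] m[OF o(3,4)] W l[OF o uv] lin_plus[OF W l[OF o u] l[OF o v]] _ t])
   fix f g assume f: "f \<in> Mor C x' x" and g: "g \<in> Mor C y y'"
   show "act ?M (x, y) (x', y') (telt C C x' x y y' f g) (u \<oplus>[Hom C x y] v) =
    act ?M (x, y) (x', y') (telt C C x' x y y' f g) u \<oplus>[Hom C x' y']
    act ?M (x, y) (x', y') (telt C C x' x y y' f g) v"
    using e[OF o u f g] e[OF o v f g] e[OF o uv f g] cb(5)[OF u v f] cb(2)[OF g ci[OF o(2,1,3) f u] ci[OF o(2,1,3) f v]] by simp
  qed
 next
  note V = m[OF o(1,3)] and W = m[OF o(2,4)]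
  note cb = bilin_simps[OF comp_bilin[OF C o(2,3,4)]] bilin_simps[OF comp_bilin[OF C o(2,1,3)]]
  fix a v assume a: "a \<in> carrier K" and v: "v \<in> Mor C x y"
  note av = module_smult[OF V a v]
  show "act ?M (x, y) (x', y') t (a \<odot>[Hom C x y] v) = a \<odot>[Hom C x' y'] act ?M (x, y) (x', y') t v"
  proof (rule tensor_ext[OF m[OF o(2,1)] m[OF o(3,4)] W l[OF o av] lin_scale[OF W l[OF o v] a] _ t])
   fix f g assume f: "f \<in> Mor C x' x" and g: "g \<in> Mor C y y'"
   show "act ?M (x, y) (x', y') (telt C C x' x y y' f g) (a \<odot>[Hom C x y] v) =
    a \<odot>[Hom C x' y'] act ?M (x, y) (x', y') (telt C C x' x y y' f g) v"
    using e[OF o v f g] e[OF o av f g] cb(7)[OF a v f] cb(4)[OF a g ci[OF o(2,1,3) f v]] by simp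
  qed
 qed
 have ac: "act ?M (x, y) (x'', y'') (Comp ?T (x, y) (x', y') (x'', y'') s t) v =
   act ?M (x', y') (x'', y'') s (act ?M (x, y) (x', y') t v)"
  if o: "x \<in> Ob C" "x' \<in> Ob C" "x'' \<in> Ob C" "y \<in> Ob C" "y' \<in> Ob C" "y'' \<in> Ob C"
   and t: "t \<in> carrier (thom C C x' x y y')"
   and s: "s \<in> carrier (thom C C x'' x' y' y'')"
   and v: "v \<in> Mor C x y" for x x' x'' y y' y'' s t v
 proof -
  note cT = tensor_comp_bilin[OF op C, of x x' x'' y y' y'', simplified, OF o]
  note W = m[OF o(3,6)] and lv' = l[OF o(1,3,4,6) v]
  note tv = lin_closed[OF l[OF o(1,2,4,5) v] t]
  show ?thesis
  proof (rule tensor_ext[OF m[OF o(3,2)] m[OF o(5,6)] W lin_comp[OF bilin_left[OF cT t] lv'] l[OF o(2,3,5,6) tv] _ s])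
   fix f' g' assume f': "f' \<in> Mor C x'' x'" and g': "g' \<in> Mor C y' y''"
   let ?s = "telt C C x'' x' y' y'' f' g'"
   have s': "?s \<in> carrier (thom C C x'' x' y' y'')"
    by (rule bilin_closed[OF tensor_elt_bilinear[OF m[OF o(3,2)] m[OF o(5,6)]] f' g'])
   show "act ?M (x, y) (x'', y'') (Comp ?T (x, y) (x', y') (x'', y'') ?s t) v = act ?M (x', y') (x'', y'') ?s (act ?M (x, y) (x', y') t v)"
   proof (rule tensor_ext[OF m[OF o(2,1)] m[OF o(4,5)] W lin_comp[OF bilin_right[OF cT s'] lv']
      lin_comp[OF l[OF o(1,2,4,5) v] lv[OF o(2,3,5,6) s']] _ t])
    fix f g assume f: "f \<in> Mor C x' x" and g: "g \<in> Mor C y y'"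
    note vf = ci[OF o(2,1,4) f v]
    note gvf = ci[OF o(2,4,5) vf g] and vff = ci[OF o(3,2,4) f' vf]
    show "act ?M (x, y) (x'', y'') (Comp ?T (x, y) (x', y') (x'', y'') ?s (telt C C x' x y y' f g)) v =
      act ?M (x', y') (x'', y'') ?s (act ?M (x, y) (x', y') (telt C C x' x y y' f g) v)"
     using tensor_comp_elt[OF op C, of x x' x'' y y' y'' f f' g g'] o f f' g g'
      e[OF o(1,2,4,5) v f g] e[OF o(2,3,5,6) gvf f' g'] e[OF o(1,3,4,6) v ci[OF o(3,2,1) f' f] ci[OF o(4,5,6) g g']]
      comp_assoc[OF C o(3,2,1,4) f' f v] comp_assoc[OF C o(3,2,4,5) f' vf g] comp_assoc[OF C o(3,4,5,6) vff g g'] by simp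
   qed
  qed
 qed
 show ?thesis
  unfolding k_module_def
 proof (intro conjI ballI)
  show "module K (val ?M p)" if "p \<in> Ob ?T" for p using that m by auto
  show "bilinear_map K (Hom ?T p q) (val ?M p) (val ?M q) (act ?M p q)" if "p \<in> Ob ?T" "q \<in> Ob ?T" for p q
   using that lv l unfolding bilinear_map_def by (cases p; cases q) simp
  show "act ?M p p (Id ?T p) v = v" if "p \<in> Ob ?T" "v \<in> el ?M p" for p v
   using that e[OF _ _ _ _ _ ids ids] comp_idl[OF C] comp_idr[OF C] by (cases p) simp
  show "act ?M p r (Comp ?T p q r s t) v = act ?M q r s (act ?M p q t v)"
   if "p \<in> Ob ?T" "q \<in> Ob ?T" "r \<in> Ob ?T" "t \<in> Mor ?T p q" "s \<in> Mor ?T q r" "v \<in> el ?M p" for p q r s t v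
   using that ac by (cases p; cases q; cases r) simp
 qed
qed

text \<open>The bimodule \<open>C\<close> has projective sections on both sides. Reducing a free resolution of it on one
 side and using the symmetry of the reduction transfers the vanishing of Tor from left to right modules.\<close>

lemma gdn_op:
 fixes C :: "('o, 'k, 'm) kcat" and M :: "('o, 'm, 'k, 'u) kmod"
 assumes sC: "small_k_category TYPE('u) K C" and J: "two_sided_ideal K C J"
  and g: "\<And>(N :: ('o, 'm, 'k, 'u) kmod) n. k_module K C N ==> killed C J N ==> gdn C J N n"
  and M: "k_module K (op_cat C) M" "killed (op_cat C) (op_ideal J) M"
 shows "gdn (op_cat C) (op_ideal J) M n"
proof -
 let ?O = "op_cat C" and ?oJ = "op_ideal J"
 let ?T = "tensor_cat K ?O C"
 note C = small_cat[OF sC] and sO = small_op[OF sC] and oJ = op_two_sided_ideal[OF J]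
 note O = small_cat[OF sO]
 note sT = small_tensor[OF sO sC]
 note T = small_cat[OF sT]
 note ids = id_in[OF C]
 \<comment> \<open>The bimodule \<open>C\<close> moved into the universe; \<open>?e\<close> and
   \<open>?d\<close> translate between morphisms and their codes.\<close>
 define U :: "('o \<times> 'o, ('m \<times> 'm => 'k) set, 'k, 'u) kmod" where "U = trk (bimod C)"
 let ?e = "\<lambda>x y. tre (bimod C) (x, y) :: 'm => 'u" and ?d = "\<lambda>x y. trd (bimod C) (x, y) :: 'u => 'm"
 have small: "el (bimod C) p \<lesssim> (UNIV :: 'u set)" if "p \<in> Ob ?T" for p
  using that small_hom[OF sC] by auto
 note t = trk_props[OF T bimod_module[OF C] small, folded U_def]
 have U: "k_module K ?T U" by (rule t(1))
 note UA = rA_module[OF O C U] and UB = rB_module[OF O C U]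
 have el: "linear_map K (Hom C x y) (val U (x, y)) (?e x y)" if "x \<in> Ob C" "y \<in> Ob C" for x y
  using nt_lin[OF t(2), of "(x, y)"] that by simp
 have dl: "linear_map K (val U (x, y)) (Hom C x y) (?d x y)" if "x \<in> Ob C" "y \<in> Ob C" for x y
  using nt_lin[OF t(3), of "(x, y)"] that by simp
 have de: "?d x y (?e x y f) = f" if "x \<in> Ob C" "y \<in> Ob C" "f \<in> Mor C x y" for x y f
  using t(4)[of "(x, y)"] that by simp
 have ed: "?e x y (?d x y u) = u" if "x \<in> Ob C" "y \<in> Ob C" "u \<in> el U (x, y)" for x y u
  using t(5)[of "(x, y)"] that by simp
 have aA: "act (rA ?O C U y) x x' f (?e x y v) = ?e x' y (Comp C x' x y v f)"
  if o: "x \<in> Ob C" "x' \<in> Ob C" "y \<in> Ob C" and f: "f \<in> Mor C x' x" and v: "v \<in> Mor C x y" for x x' y f v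
  using tnt[OF O C t(2), of x x' y y f "Id C y" v] o f v ids bimod_act_elt[OF C o(1,2,3,3) v f ids[OF o(3)]]
   comp_idl[OF C o(2,3) comp_in[OF C o(2,1,3) f v]] by simp
 have aB: "act (rB ?O C U x) y y' g (?e x y v) = ?e x y' (Comp C x y y' g v)"
  if o: "x \<in> Ob C" "y \<in> Ob C" "y' \<in> Ob C" and g: "g \<in> Mor C y y'" and v: "v \<in> Mor C x y" for x y y' g v
  using tnt[OF O C t(2), of x x y y' "Id C x" g v] o g v ids bimod_act_elt[OF C o(1,1,2,3) v ids[OF o(1)] g]
   comp_idr[OF C o(1,2) v] by simp
 \<comment> \<open>The section of \<open>C\<close> at a fixed \<open>y\<close> is
   \<open>C(-, y)\<close>, a representable of the opposite category and therefore projective;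
   likewise \<open>C(x, -)\<close> on the other side. This gives \<open>gA\<close> and
   \<open>gB\<close>.\<close>
 have eA: "nt ?O (hrep ?O y) (rA ?O C U y) (\<lambda>x. ?e x y)" if y: "y \<in> Ob C" for y
  using el aA y by (intro ntI) simp_all
 have eB: "nt C (hrep C x) (rB ?O C U x) (?e x)" if x: "x \<in> Ob C" for x
  using el aB x by (intro ntI) simp_all
 have dA: "nt ?O (rA ?O C U y) (hrep ?O y) (\<lambda>x. ?d x y)" if y: "y \<in> Ob C" for y
 proof (rule ntI)
  fix x x' f u assume o: "x \<in> Ob ?O" "x' \<in> Ob ?O" and f: "f \<in> Mor ?O x x'" and u: "u \<in> el (rA ?O C U y) x"
  have du: "?d x y u \<in> Mor C x y" using lin_closed[OF dl[of x y]] o y u by simp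
  show "?d x' y (act (rA ?O C U y) x x' f u) = act (hrep ?O y) x x' f (?d x y u)"
   using aA[of x x' y f "?d x y u"] ed[of x y u] de[of x' y "Comp C x' x y (?d x y u) f"] comp_in[OF C, of x' x y f "?d x y u"] o y f u du by simp
 qed (use dl y in simp)
 have dB: "nt C (rB ?O C U x) (hrep C x) (?d x)" if x: "x \<in> Ob C" for x
 proof (rule ntI)
  fix y y' f u assume o: "y \<in> Ob C" "y' \<in> Ob C" and f: "f \<in> Mor C y y'" and u: "u \<in> el (rB ?O C U x) y"
  have du: "?d x y u \<in> Mor C x y" using lin_closed[OF dl[of x y]] o x u by simp
  show "?d x y' (act (rB ?O C U x) y y' f u) = act (hrep C x) y y' f (?d x y u)"
   using aB[of x y y' f "?d x y u"] ed[of x y u] de[of x y' "Comp C x y y' f (?d x y u)"] comp_in[OF C, of x y y' "?d x y u" f] o x f u du by simp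
 qed (use dl x in simp)
 have gA: "gdn ?O ?oJ (rA ?O C U y) n" if y: "y \<in> Ob C" for y n
 proof -
  have y': "y \<in> Ob ?O" using y by simp
  have sm: "el (hrep ?O y) x \<lesssim> (UNIV :: 'u set)" if "x \<in> Ob ?O" for x using small_hom[OF sC] that y by simp
  note r = trk_props[OF O hrep_module[OF O y'] sm, folded repu_def]
  show ?thesis
  proof (rule gdn_iso[OF sO oJ repu_module[OF sO y'] nt_compose[OF r(3) eA[OF y]] nt_compose[OF dA[OF y] r(2)] _ gdn_proj[OF O oJ repu_proj[OF sO y']]])
   show "?e x y (trd (hrep ?O y) x (tre (hrep ?O y) x (?d x y v) :: 'u)) = v" if "x \<in> Ob ?O" "v \<in> el (rA ?O C U y) x" for x v
    using r(4)[OF _ that(1), of "?d x y v"] ed[of x y v] lin_closed[OF dl[of x y], of v] that y by simp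
  qed
 qed
 have gB: "gdn C J (rB ?O C U x) n" if x: "x \<in> Ob C" for x n
 proof -
  have sm: "el (hrep C x) y \<lesssim> (UNIV :: 'u set)" if "y \<in> Ob C" for y using small_hom[OF sC] that x by simp
  note r = trk_props[OF C hrep_module[OF C x] sm, folded repu_def]
  show ?thesis
  proof (rule gdn_iso[OF sC J repu_module[OF sC x] nt_compose[OF r(3) eB[OF x]] nt_compose[OF dB[OF x] r(2)] _ gdn_proj[OF C J repu_proj[OF sC x]]])
   show "?e x y (trd (hrep C x) y (tre (hrep C x) y (?d x y v) :: 'u)) = v" if "y \<in> Ob C" "v \<in> el (rB ?O C U x) y" for y v
    using r(4)[OF _ that(1), of "?d x y v"] ed[of x y v] lin_closed[OF dl[of x y], of v] that x by simp
  qed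
 qed
 \<comment> \<open>Both spans encode \<open>J(x, y)\<close>, so the reduced sections are
   \<open>(C/J)(-, y)\<close> and \<open>(C/J)(x, -)\<close>. The inclusions used below are
   \<open>jA\<close> and \<open>jB\<close>.\<close>
 let ?ZA = "\<lambda>y x. jsp C J (rB ?O C U x) y" and ?ZB = "\<lambda>x y. jsp ?O ?oJ (rA ?O C U y) x"
 have ZA: "subf ?O (rA ?O C U y) (?ZA y)" if "y \<in> Ob C" for y by (rule sec_subf(1)[OF O C U J that])
 have ZB: "subf C (rB ?O C U x) (?ZB x)" if "x \<in> Ob C" for x using sec_subf(2)[OF O C U oJ] that by simp
 have jA: "?e x y f \<in> ?ZA y x" if o: "x \<in> Ob C" "y \<in> Ob C" and f: "f \<in> J x y" for x y f
  using jsp_act[OF C J UB, of x, OF _ o f, of "?e x x (Id C x)"] aB[OF o(1,1,2) ideal_carrier[OF C J o f] ids[OF o(1)]]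
   lin_closed[OF el ids] comp_idr[OF C o ideal_carrier[OF C J o f]] o by simp
 have jB: "?e x y f \<in> ?ZB x y" if o: "x \<in> Ob C" "y \<in> Ob C" and f: "f \<in> J x y" for x y f
  using jsp_act[OF O oJ UA[OF o(2)], of y x f "?e y y (Id C y)"] aA[OF o(2,1,2) ideal_carrier[OF C J o f] ids[OF o(2)]]
   lin_closed[OF el ids] comp_idl[OF C o ideal_carrier[OF C J o f]] o f by (simp add: op_ideal_def)
 have kA: "killed ?O ?oJ (quotk (rA ?O C U y) (?ZA y))" if y: "y \<in> Ob C" for y
 proof (rule killed_quotk[OF O oJ UA[OF y] ZA[OF y]])
  fix x x' j v assume o: "x \<in> Ob ?O" "x' \<in> Ob ?O" and j: "j \<in> ?oJ x x'" and v: "v \<in> el (rA ?O C U y) x"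
  have o': "x \<in> Ob C" "x' \<in> Ob C" and j': "j \<in> J x' x" and v': "v \<in> el U (x, y)" using o j v by (simp_all add: op_ideal_def)
  note dv = lin_closed[OF dl[OF o'(1) y] v']
  show "act (rA ?O C U y) x x' j v \<in> ?ZA y x'"
   using aA[OF o' y ideal_carrier[OF C J o'(2,1) j'] dv] ed[OF o'(1) y v'] jA[OF o'(2) y ideal_left[OF J o'(2,1) y j' dv]] by simp
 qed
 have kB: "killed C J (quotk (rB ?O C U x) (?ZB x))" if x: "x \<in> Ob C" for x
 proof (rule killed_quotk[OF C J _ ZB[OF x]])
  show "k_module K C (rB ?O C U x)" using UB x by simp
  fix y y' j v assume o: "y \<in> Ob C" "y' \<in> Ob C" and j: "j \<in> J y y'" and v: "v \<in> el (rB ?O C U x) y"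
  have v': "v \<in> el U (x, y)" using v by simp
  note dv = lin_closed[OF dl[OF x o(1)] v']
  show "act (rB ?O C U x) y y' j v \<in> ?ZB x y'"
   using aB[OF x o ideal_carrier[OF C J o j] dv] ed[OF x o(1) v'] jB[OF x o(2) ideal_right[OF J x o dv j]] by simp
 qed
 obtain X \<delta> where X0: "X 0 = U" and X: "exseq ?T X \<delta>" and Xf: "\<And>n. isfree ?T (X (Suc n))"
  using free_resolution[OF sT U] by blast
 let ?XA = "\<lambda>n b. rA ?O C (X n) b" and ?XB = "\<lambda>n a. rB ?O C (X n) a" and ?\<delta> = "\<lambda>n a b. \<delta> n (a, b)"
 interpret S: bicomplex K ?O C ?oJ J ?XA ?XB ?\<delta> by (rule sec_bicomplex[OF O C oJ J X])
 interpret S': bicomplex K C ?O J ?oJ ?XB ?XA "\<lambda>n b a. \<delta> n (a, b)" by (rule S.swap)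
 \<comment> \<open>The left module \<open>(C/J)(x, -)\<close> is killed by \<open>J\<close>, so the
   hypothesis \<open>g\<close> applies to it; by balance this is the exactness of the doubly reduced
   resolution.\<close>
 have s': "S'.exsym n x" if x: "x \<in> Ob C" for x n
 proof -
  have "gdn C J (quotk (rB ?O C (X 0) x) (\<lambda>b. jsp ?O ?oJ (rA ?O C (X 0) b) x)) n"
   unfolding X0 using x by (intro g quotk_module(1)[OF C _ ZB] kB UB) simp_all
  then show ?thesis
   using sec_balance_B[OF sO sC oJ J X Xf _, of x n] gA x unfolding X0 by simp
 qed
 \<comment> \<open>The same exactness, read with the variables exchanged, is the vanishing for the
   right module \<open>(C/J)(-, y)\<close>.\<close>
 have gN: "gdn ?O ?oJ (quotk (rA ?O C U y) (?ZA y)) n" if y: "y \<in> Ob C" for y n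
 proof -
  have "S.exsym n y" using S'.exsym_swap[of n y] s' y by simp
  then show ?thesis
   using sec_balance_A[OF sO sC oJ J X Xf _ y, of n] gB unfolding X0 by simp
 qed
 show ?thesis
 proof (rule acyclic_all[where N = "\<lambda>y. quotk (rA ?O C U y) (?ZA y)" and e = "\<lambda>y. rp (rA ?O C U y) (?ZA y) y (?e y y (Id C y))", OF sO oJ _ _ _ _ _ M])
  fix y assume "y \<in> Ob ?O"
  then have y: "y \<in> Ob C" by simp
  show "k_module K ?O (quotk (rA ?O C U y) (?ZA y))" by (rule quotk_module(1)[OF O UA[OF y] ZA[OF y]])
  show "killed ?O ?oJ (quotk (rA ?O C U y) (?ZA y))" by (rule kA[OF y])
  show "gdn ?O ?oJ (quotk (rA ?O C U y) (?ZA y)) n" for n by (rule gN[OF y])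
  have ic: "?e y y (Id C y) \<in> el (rA ?O C U y) y" using lin_closed[OF el[OF y y] ids[OF y]] by simp
  show "rp (rA ?O C U y) (?ZA y) y (?e y y (Id C y)) \<in> el (quotk (rA ?O C U y) (?ZA y)) y" by (rule quotk_in[OF ic])
  fix N :: "('o, 'm, 'k, 'u) kmod" and v
  assume N: "k_module K ?O N" "killed ?O ?oJ N" and v: "v \<in> el N y"
  \<comment> \<open>Yoneda for killed modules: a morphism from \<open>x\<close> to \<open>y\<close>
    acts on \<open>v\<close>, and morphisms in \<open>J\<close> act as zero, so the map factors
    through \<open>(C/J)(-, y)\<close>. The class of the identity goes to \<open>v\<close>.\<close>
  let ?h = "\<lambda>x u. act N y x (?d x y u) v"
  have hl: "linear_map K (val U (x, y)) (val N x) (?h x)" if x: "x \<in> Ob C" for x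
   using lin_comp[OF dl[OF x y] bilin_left[OF act_bilin[OF N(1), of y x] v, simplified, OF y x]] .
  have hn: "nt ?O (rA ?O C U y) N ?h"
  proof (rule ntI)
   fix x x' f u assume o: "x \<in> Ob ?O" "x' \<in> Ob ?O" and f: "f \<in> Mor ?O x x'" and u: "u \<in> el (rA ?O C U y) x"
   have "?d x y u \<in> Mor ?O y x" using lin_closed[OF dl[of x y], of u] o y u by simp
   then show "?h x' (act (rA ?O C U y) x x' f u) = act N x x' f (?h x u)"
    using nt_nat[OF dA[OF y] o f u] act_comp[OF N(1) _ o _ f v, of "?d x y u"] y by simp
  qed (use hl in simp)
  have h0: "?h x u = \<zero>[val N x]" if x: "x \<in> Ob ?O" and u: "u \<in> ?ZA y x" for x u
  proof -
   have x': "x \<in> Ob C" using x by simp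
   have "u \<in> {u \<in> el U (x, y). ?h x u = \<zero>[val N x]}"
   proof (rule jsp_least[OF UB[OF x] y _ _ u])
    show "submodule {u \<in> el U (x, y). ?h x u = \<zero>[val N x]} K (val (rB ?O C U x) y)"
     using submodule_kernel[OF val_mod[OF UA[OF y] x] val_mod[OF N(1) x], of "?h x"] hl[OF x'] by simp
    fix y' j w assume y': "y' \<in> Ob C" and j: "j \<in> J y' y" and w: "w \<in> el (rB ?O C U x) y'"
    have w': "w \<in> el U (x, y')" using w by simp
    note dw = lin_closed[OF dl[OF x' y'] w'] and jc = ideal_carrier[OF C J y' y j]
    note jw = comp_in[OF C x' y' y dw jc]
    have "act (rB ?O C U x) y' y j w = ?e x y (Comp C x y' y j (?d x y' w))"
     using aB[OF x' y' y jc dw] ed[OF x' y' w'] by simp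
    moreover have "act N y x (Comp C x y' y j (?d x y' w)) v = \<zero>[val N x]"
     using killedD[OF N(2) _ x _ v] ideal_right[OF J x' y' y dw j] y by (simp add: op_ideal_def)
    ultimately show "act (rB ?O C U x) y' y j w \<in> {u \<in> el U (x, y). ?h x u = \<zero>[val N x]}"
     using de[OF x' y jw] lin_closed[OF el[OF x' y] jw] by simp
   qed
   then show ?thesis by simp
  qed
  have "?h y (rp (rA ?O C U y) (?ZA y) y (?e y y (Id C y))) = ?h y (?e y y (Id C y))"
   by (rule rp_lin[OF UA[OF y] ZA[OF y] \<open>y \<in> Ob ?O\<close> N(1) hn h0[OF \<open>y \<in> Ob ?O\<close>] ic])
  also have "\<dots> = v" using de[OF y y ids[OF y]] act_id[OF N(1) _ v] y by simp
  finally show "\<exists>h. nt ?O (quotk (rA ?O C U y) (?ZA y)) N h \<and> h y (rp (rA ?O C U y) (?ZA y) y (?e y y (Id C y))) = v"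
   using quotk_out[OF UA[OF y] ZA[OF y] N(1) hn h0] by blast
 qed
qed

subsection \<open>Modules over a quotient category\<close>

abbreviation pb :: "('o, 'k, 'm) kcat => ('o => 'o => 'm set) => ('o, 'm set, 'k, 'u) kmod => ('o, 'm, 'k, 'u) kmod" where
 "pb D J F \<equiv> mod_pullback (quot_proj D J) F"

text \<open>For a killed \<open>M\<close>, the module over \<open>D/J\<close> on the same values;
  which representative of a coset acts is then irrelevant by \<open>lin_coset\<close>.\<close>

definition desc :: "('o, 'm, 'k, 'u) kmod => ('o, 'm set, 'k, 'u) kmod" where
 "desc M = \<lparr>val = val M, act = (\<lambda>x y X v. act M x y (SOME f. f \<in> X) v)\<rparr>"

text \<open>\<open>M\<close> and \<open>F\<close> are one object seen over \<open>D\<close> and over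
  \<open>D/J\<close>. Both \<open>pb\<close> and \<open>desc\<close> produce such pairs, so results
  on maps and exactness are proved once for the relation.\<close>

definition descends :: "('o, 'k, 'm) kcat => ('o => 'o => 'm set) => ('o, 'm, 'k, 'u) kmod => ('o, 'm set, 'k, 'u) kmod => bool" where
 "descends D J M F \<longleftrightarrow> val F = val M \<and>
   (\<forall>x\<in>Ob D. \<forall>y\<in>Ob D. \<forall>f\<in>Mor D x y. \<forall>v\<in>el M x. act F x y (J x y +>[Hom D x y] f) v = act M x y f v)"

lemma pb_simps [simp]:
 "val (pb D J F) = val F" "act (pb D J F) x y f = act F x y (J x y +>[Hom D x y] f)"
 by (simp_all add: mod_pullback_def)

lemma desc_val [simp]: "val (desc M) = val M"
 by (simp add: desc_def)

lemma descends_pb: "descends D J (pb D J F) F"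
 by (simp add: descends_def)

lemma pb_module:
 assumes D: "k_category K D" and J: "two_sided_ideal K D J" and F: "k_module K (quot_cat D J) F"
 shows "k_module K D (pb D J F)" and pb_killed: "killed D J (pb D J F)"
proof -
 note q = qm_proj_linear[OF hom_mod[OF D] ideal_sub[OF J]]
 note b = act_bilin[OF F, simplified] and m = val_mod[OF F, simplified]
 have e: "act (pb D J F) x y = (\<lambda>f v. act F x y (J x y +>[Hom D x y] f) v)" for x y by (simp add: fun_eq_iff)
 show "k_module K D (pb D J F)"
  unfolding k_module_def
 proof (intro conjI ballI)
  show "bilinear_map K (Hom D x y) (val (pb D J F) x) (val (pb D J F) y) (act (pb D J F) x y)" if "x \<in> Ob D" "y \<in> Ob D" for x y
   unfolding e using bilin_comp[OF b[OF that] q[OF that that] lin_id] by simp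
  show "act (pb D J F) x x (Id D x) v = v" if "x \<in> Ob D" "v \<in> el (pb D J F) x" for x v
   using act_id[OF F, of x v] that by simp
  show "act (pb D J F) x z (Comp D x y z g f) v = act (pb D J F) y z g (act (pb D J F) x y f v)"
   if "x \<in> Ob D" "y \<in> Ob D" "z \<in> Ob D" "f \<in> Mor D x y" "g \<in> Mor D y z" "v \<in> el (pb D J F) x" for x y z f g v
   using act_comp[OF F, of x y z "J x y +>[Hom D x y] f" "J y z +>[Hom D y z] g" v] that quot_comp[OF D J that(1-5)]
   by (simp add: qm_carrierI)
 qed (simp add: m)
 show "killed D J (pb D J F)"
  unfolding killed_def
 proof (intro ballI)
  fix x y j v assume o: "x \<in> Ob D" "y \<in> Ob D" and j: "j \<in> J x y" and v: "v \<in> el (pb D J F) x"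
  note h = hom_mod[OF D o] ideal_sub[OF J o]
  have "act F x y (J x y) v = \<zero>[val F y]"
   using lin_zero[OF qm_module[OF h] m[OF o(2)] bilin_left[OF b[OF o], of v]] v by (simp add: qm_zero)
  then show "act (pb D J F) x y j v = \<zero>[val (pb D J F) y]"
   using coset_zero_iff[OF h ideal_carrier[OF D J o j]] j by simp
 qed
qed

lemma desc_module:
 assumes D: "k_category K D" and J: "two_sided_ideal K D J" and M: "k_module K D M" and k: "killed D J M"
 shows descends_desc: "descends D J M (desc M)" and "k_module K (quot_cat D J) (desc M)"
proof -
 note h = hom_mod[OF D] and s = ideal_sub[OF J]
 have a: "act (desc M) x y (J x y +>[Hom D x y] f) v = act M x y f v"
  if o: "x \<in> Ob D" "y \<in> Ob D" and f: "f \<in> Mor D x y" and v: "v \<in> el M x" for x y f v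
 proof -
  have "(SOME g. g \<in> J x y +>[Hom D x y] f) \<in> J x y +>[Hom D x y] f"
   by (rule someI[of _ f]) (rule coset_self[OF h[OF o] s[OF o] f])
  from lin_coset[OF h[OF o] s[OF o] val_mod[OF M o(2)] bilin_left[OF act_bilin[OF M o] v] killedD[OF k o _ v] f this]
  show ?thesis by (simp add: desc_def)
 qed
 then show d: "descends D J M (desc M)" by (simp add: descends_def)
 show "k_module K (quot_cat D J) (desc M)"
  unfolding k_module_def
 proof (intro conjI ballI)
  show "module K (val (desc M) x)" if "x \<in> Ob (quot_cat D J)" for x using val_mod[OF M] that by simp
  show "bilinear_map K (Hom (quot_cat D J) x y) (val (desc M) x) (val (desc M) y) (act (desc M) x y)"
   if "x \<in> Ob (quot_cat D J)" "y \<in> Ob (quot_cat D J)" for x y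
   unfolding bilinear_map_def
  proof (intro conjI ballI)
   have o: "x \<in> Ob D" "y \<in> Ob D" using that by simp_all
   note hs = h[OF o] s[OF o]
   note ac = a[OF o]
   show "linear_map K (val (desc M) x) (val (desc M) y) (act (desc M) x y X)" if Xc: "X \<in> Mor (quot_cat D J) x y" for X
   proof -
    obtain f where X: "X = J x y +>[Hom D x y] f" and f: "f \<in> Mor D x y" using Xc by (auto simp: qm_carrier)
    show ?thesis
     unfolding X desc_val using a[OF o f] by (intro lin_cong[OF val_mod[OF M o(1)] _ act_lin[OF M o f]]) simp
   qed
   fix v assume "v \<in> el (desc M) x"
   then have v: "v \<in> el M x" by simp
   note l = bilin_left[OF act_bilin[OF M o] v]
   show "linear_map K (Hom (quot_cat D J) x y) (val (desc M) y) (\<lambda>X. act (desc M) x y X v)"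
   proof (rule linI)
    fix X assume "X \<in> Mor (quot_cat D J) x y"
    then obtain f where X: "X = J x y +>[Hom D x y] f" and f: "f \<in> Mor D x y" by (auto simp: qm_carrier)
    show "act (desc M) x y X v \<in> el (desc M) y" using ac[OF f v] act_in[OF M o f v] by (simp add: X)
    show "act (desc M) x y (r \<odot>[Hom (quot_cat D J) x y] X) v = r \<odot>[val (desc M) y] act (desc M) x y X v" if r: "r \<in> carrier K" for r
     using ac[OF f v] ac[OF module_smult[OF hs(1) r f] v] lin_smult[OF l r f] qm_smult[OF hs r f] by (simp add: X)
    fix Y assume "Y \<in> Mor (quot_cat D J) x y"
    then obtain g where Y: "Y = J x y +>[Hom D x y] g" and g: "g \<in> Mor D x y" by (auto simp: qm_carrier)
    show "act (desc M) x y (X \<oplus>[Hom (quot_cat D J) x y] Y) v = act (desc M) x y X v \<oplus>[val (desc M) y] act (desc M) x y Y v"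
     using ac[OF f v] ac[OF g v] ac[OF module_add[OF hs(1) f g] v] lin_add[OF l f g] qm_add[OF hs f g] by (simp add: X Y)
   qed
  qed
  show "act (desc M) x x (Id (quot_cat D J) x) v = v" if "x \<in> Ob (quot_cat D J)" "v \<in> el (desc M) x" for x v
   using that a[OF _ _ id_in[OF D]] act_id[OF M] by simp
  show "act (desc M) x z (Comp (quot_cat D J) x y z X' X) v = act (desc M) y z X' (act (desc M) x y X v)"
   if "x \<in> Ob (quot_cat D J)" "y \<in> Ob (quot_cat D J)" "z \<in> Ob (quot_cat D J)" "X \<in> Mor (quot_cat D J) x y"
    "X' \<in> Mor (quot_cat D J) y z" "v \<in> el (desc M) x" for x y z X X' v
  proof -
   have o: "x \<in> Ob D" "y \<in> Ob D" "z \<in> Ob D" and v: "v \<in> el M x" using that by simp_all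
   note Xc = that(4) and Xc' = that(5)
   obtain f where X: "X = J x y +>[Hom D x y] f" and f: "f \<in> Mor D x y" using Xc by (auto simp: qm_carrier)
   obtain g where X': "X' = J y z +>[Hom D y z] g" and g: "g \<in> Mor D y z" using Xc' by (auto simp: qm_carrier)
   show ?thesis
    unfolding X X' quot_comp[OF D J o f g] a[OF o(1,3) comp_in[OF D o f g] v] a[OF o(1,2) f v]
     a[OF o(2,3) g act_in[OF M o(1,2) f v]] by (rule act_comp[OF M o f g v])
  qed
 qed
qed

text \<open>Every morphism of \<open>D/J\<close> is the coset of a morphism of \<open>D\<close>, so
  naturality over the two categories is the same condition; in other words, pullback is fully
  faithful.\<close>

lemma nt_descends:
 assumes F: "descends D J M F" and G: "descends D J N G"
 shows "nt (quot_cat D J) F G \<eta> \<longleftrightarrow> nt D M N \<eta>"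
proof -
 have v: "val F = val M" "val G = val N" using F G by (simp_all add: descends_def)
 have "(\<forall>X\<in>Mor (quot_cat D J) x y. \<forall>v\<in>el F x. \<eta> y (act F x y X v) = act G x y X (\<eta> x v)) \<longleftrightarrow>
   (\<forall>f\<in>Mor D x y. \<forall>v\<in>el M x. \<eta> y (act M x y f v) = act N x y f (\<eta> x v))" (is "?L \<longleftrightarrow> ?R")
  if o: "x \<in> Ob D" "y \<in> Ob D" and l: "linear_map K (val M x) (val N x) (\<eta> x)" for x y
 proof -
  have c: "Mor (quot_cat D J) x y = (\<lambda>f. J x y +>[Hom D x y] f) ` Mor D x y"
   by (auto simp: qm_carrier)
  show ?thesis
   unfolding c using F G lin_closed[OF l] o by (simp add: descends_def)
 qed
 then show ?thesis unfolding nt_def v by auto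
qed

lemma exseq_descends:
 assumes "\<And>n. descends D J (M n) (F n)" "\<And>n. k_module K D (M n)" "\<And>n. k_module K (quot_cat D J) (F n)"
 shows "exseq (quot_cat D J) F \<delta> \<longleftrightarrow> exseq D M \<delta>"
proof -
 have v: "val (F n) = val (M n)" for n using assms(1)[of n] by (simp add: descends_def)
 show ?thesis unfolding exseq_def using assms(2,3) nt_descends[OF assms(1) assms(1)] by (simp add: v)
qed

text \<open>Maps from \<open>P/JP\<close> to a module over \<open>D/J\<close> are maps from
  \<open>P\<close> to its pullback. A lift found for \<open>P\<close> kills \<open>J P\<close>
  because its target is killed.\<close>

lemma desc_projective:
 fixes P :: "('o, 'm, 'k, 'u) kmod"
 assumes D: "k_category K D" and J: "two_sided_ideal K D J" and P: "projective_module K D P"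
 shows "projective_module K (quot_cat D J) (desc (quotk P (jsp D J P)))"
proof -
 note Pm = proj_module[OF P]
 note Z = jsp_subf(1)[OF D J Pm]
 let ?Q = "quotk P (jsp D J P)"
 note Qm = quotk_module(1)[OF D Pm Z] and p = quotk_proj[OF D Pm Z]
 have k: "killed D J ?Q" by (rule killed_quotk[OF D J Pm Z jsp_act[OF D J Pm]])
 note d = desc_module(1)[OF D J Qm k]
 show ?thesis
 proof (rule projI[OF desc_module(2)[OF D J Qm k]])
  fix M N :: "('o, 'm set, 'k, 'u) kmod" and e h
  assume M: "k_module K (quot_cat D J) M" and N: "k_module K (quot_cat D J) N" and e: "nt (quot_cat D J) M N e"
   and h: "nt (quot_cat D J) (desc ?Q) N h" and s: "\<And>x. x \<in> Ob (quot_cat D J) ==> e x ` el M x = el N x"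
  note M' = pb_module[OF D J M] and N' = pb_module[OF D J N]
  have e': "nt D (pb D J M) (pb D J N) e" using e nt_descends[OF descends_pb descends_pb] by blast
  have h': "nt D ?Q (pb D J N) h" using h nt_descends[OF d descends_pb] by blast
  have "\<exists>g. nt D P (pb D J M) g \<and> (\<forall>x\<in>Ob D. \<forall>v\<in>el P x. e x (g x v) = h x (rp P (jsp D J P) x v))"
   by (rule proj_lift_surj[OF P M'(1) N'(1) e' nt_compose[OF p h']]) (use s in simp)
  then obtain g where g: "nt D P (pb D J M) g"
   and eg: "\<And>x v. x \<in> Ob D ==> v \<in> el P x ==> e x (g x v) = h x (rp P (jsp D J P) x v)" by blast
  have "g x v = \<zero>[val (pb D J M) x]" if "x \<in> Ob D" "v \<in> jsp D J P x" for x v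
   by (rule killed_jsp[OF M' that(1) jsp_nt[OF D J Pm M'(1) g that]])
  then have g': "nt D ?Q (pb D J M) g" by (rule quotk_out[OF Pm Z M'(1) g])
  have "nt (quot_cat D J) (desc ?Q) M g" using g' nt_descends[OF d descends_pb] by blast
  moreover have "e x (g x v) = h x v" if "x \<in> Ob D" "v \<in> el ?Q x" for x v
   using eg[OF that(1) quotk_elem(1)[OF Pm Z that]] quotk_elem(2)[OF Pm Z that] by simp
  ultimately show "\<exists>h'. nt (quot_cat D J) (desc ?Q) M h' \<and> (\<forall>x\<in>Ob (quot_cat D J). \<forall>v\<in>el (desc ?Q) x. e x (h' x v) = h x v)"
   by auto
 qed
qed

subsection \<open>The complexes computing Ext\<close>

text \<open>The sequence \<open>X\<close> contains the resolved module as \<open>X 0\<close>, so degree \<open>i\<close> of the resolution is \<open>X (Suc i)\<close>;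
 the maps out of \<open>X 0\<close> do not contribute to the coboundaries in degree \<open>0\<close>.\<close>

definition cocycle where
 "cocycle D X \<delta> i G \<eta> \<longleftrightarrow> nt D (X (Suc i)) G \<eta> \<and>
   (\<forall>x\<in>Ob D. \<forall>v\<in>el (X (Suc (Suc i))) x. \<eta> x (\<delta> (Suc i) x v) = \<zero>[val G x])"

definition coboundary where
 "coboundary D X \<delta> i G \<eta> \<longleftrightarrow> (\<exists>\<theta>. nt D (X i) G \<theta> \<and> (i = 0 --> (\<forall>x\<in>Ob D. \<forall>v\<in>el (X 0) x. \<theta> x v = \<zero>[val G x])) \<and>
   (\<forall>x\<in>Ob D. \<forall>v\<in>el (X (Suc i)) x. \<eta> x v = \<theta> x (\<delta> i x v)))"

lemma restr_cong: "(\<And>x v. x \<in> Ob D ==> v \<in> el F x ==> \<eta> x v = \<theta> x v) ==> restr D F \<eta> = restr D F \<theta>"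
 by (auto simp: restr_def fun_eq_iff)

lemma restr_eq_iff: "restr D F \<eta> = restr D F \<theta> \<longleftrightarrow> (\<forall>x\<in>Ob D. \<forall>v\<in>el F x. \<eta> x v = \<theta> x v)"
 by (metis restr_apply restr_cong)

lemma nt_comp_restr: "nt_comp D F \<eta> \<theta> = restr D F (\<lambda>x v. \<eta> x (\<theta> x v))"
 by (simp add: nt_comp_def restr_def)

lemma nat_hom_zero: "\<zero>[nat_hom K D F G] = restr D F (\<lambda>x v. \<zero>[val G x])"
 by (simp add: nat_hom_def restr_def)

lemma nat_hom_iff: "k_module K D F ==> \<eta> \<in> carrier (nat_hom K D F G) \<longleftrightarrow> nt D F G \<eta> \<and> restr D F \<eta> = \<eta>"
 using nt_nat_hom[of D F G \<eta>] nat_hom_nt[of \<eta> D F G] nat_homD[of \<eta> D F G] by metis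

text \<open>\<open>case_nat\<close> puts the resolved module and the augmentation at index 0, in the
  numbering of \<open>exseq\<close>.\<close>

lemma resolution_exseq:
 assumes F: "k_module K D F" and R: "projective_resolution K D F R"
 shows "exseq D (case_nat F (rmod R)) (case_nat (raug R) (rdiff R))" and resolution_projseq: "projseq D (case_nat F (rmod R))"
proof -
 show "projseq D (case_nat F (rmod R))" using R unfolding projective_resolution_def projseq_def by simp
 have "k_module K D (rmod R n)" for n using R proj_module unfolding projective_resolution_def by blast
 then show "exseq D (case_nat F (rmod R)) (case_nat (raug R) (rdiff R))"
  using R F unfolding exseq_def projective_resolution_def nt_surj_def nt_exact_def
  by (auto simp: nat_hom_nt split: nat.split)
qed

text \<open>Free resolutions exist inside the universe, so the choice in \<open>proj_res\<close> is
  meaningful; the differentials are made extensional to lie in \<open>nat_hom\<close>.\<close>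

lemma proj_res_resolution:
 fixes F :: "('o, 'm, 'k, 'u) kmod"
 assumes sD: "small_k_category TYPE('u) K D" and F: "k_module K D F"
 shows "projective_resolution K D F (proj_res K D F)"
proof -
 obtain X \<delta> where X0: "X 0 = F" and X: "exseq D X \<delta>" and Xf: "\<And>n. isfree D (X (Suc n))"
  using free_resolution[OF sD F] by blast
 let ?R = "\<lparr>rmod = \<lambda>n. X (Suc n), rdiff = \<lambda>n. restr D (X (Suc (Suc n))) (\<delta> (Suc n)), raug = restr D (X (Suc 0)) (\<delta> 0)\<rparr>"
 note Xm = ex_mod[OF X] and Xn = ex_nt[OF X]
 have im: "restr D F \<eta> x ` el F x = \<eta> x ` el F x" if "x \<in> Ob D" for F :: "('o, 'm, 'k, 'u) kmod" and \<eta> :: "'o => 'u => 'u" and x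
  using that by (auto simp: image_iff)
 have "projective_resolution K D F ?R"
  unfolding projective_resolution_def nt_surj_def nt_exact_def
  using free_proj[OF sD Xf] nt_nat_hom[OF Xm Xn] X unfolding exseq_def X0[symmetric]
  by (auto simp: im cong: conj_cong)
 then show ?thesis unfolding proj_res_def by (rule someI)
qed

lemma cocycles_iff:
 assumes F: "k_module K D F" and R: "projective_resolution K D F R"
 shows "\<eta> \<in> cocycles K D R G i \<longleftrightarrow> \<eta> \<in> carrier (nat_hom K D (rmod R i) G) \<and> cocycle D (case_nat F (rmod R)) (case_nat (raug R) (rdiff R)) i G \<eta>"
 unfolding cocycles_def cocycle_def nt_comp_restr nat_hom_zero restr_eq_iff using nat_hom_nt by auto

lemma coboundaries_iff:
 assumes F: "k_module K D F" and R: "projective_resolution K D F R" and G: "k_module K D G"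
 shows "\<eta> \<in> coboundaries K D R G i \<longleftrightarrow> \<eta> \<in> carrier (nat_hom K D (rmod R i) G) \<and> coboundary D (case_nat F (rmod R)) (case_nat (raug R) (rdiff R)) i G \<eta>"
proof -
 let ?X = "case_nat F (rmod R)" and ?\<delta> = "case_nat (raug R) (rdiff R)"
 note X = resolution_exseq(1)[OF F R]
 have m: "k_module K D (rmod R n)" for n using ex_mod[OF X, of "Suc n"] by simp
 note hi = nat_hom_iff[OF m]
 show ?thesis
 proof (cases i)
  case 0
  \<comment> \<open>In degree 0 the map \<open>\<theta>\<close> on the resolved module has to
    vanish, in accordance with \<open>coboundaries\<close> being zero there.\<close>
  have "coboundary D ?X ?\<delta> 0 G \<eta> \<longleftrightarrow> (\<forall>x\<in>Ob D. \<forall>v\<in>el (rmod R 0) x. \<eta> x v = \<zero>[val G x])"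
  proof
   assume "coboundary D ?X ?\<delta> 0 G \<eta>"
   then show "\<forall>x\<in>Ob D. \<forall>v\<in>el (rmod R 0) x. \<eta> x v = \<zero>[val G x]"
    using nt_in[OF ex_nt[OF X, of 0]] unfolding coboundary_def by auto
  next
   assume "\<forall>x\<in>Ob D. \<forall>v\<in>el (rmod R 0) x. \<eta> x v = \<zero>[val G x]"
   then show "coboundary D ?X ?\<delta> 0 G \<eta>" unfolding coboundary_def
    using nt_zero[OF G, of F] by (intro exI[of _ "\<lambda>x v. \<zero>[val G x]"]) simp
  qed
  then show ?thesis
   using 0 nt_nat_hom[OF m nt_zero[OF G]] unfolding coboundaries_def nat_hom_zero
   by (auto simp: hi restr_eq_iff[symmetric])
 next
  case (Suc j)
  show ?thesis
  proof
   assume "\<eta> \<in> coboundaries K D R G i"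
   then obtain \<theta> where t: "\<theta> \<in> carrier (nat_hom K D (rmod R j) G)" "\<eta> = nt_comp D (rmod R (Suc j)) \<theta> (rdiff R j)"
    using Suc unfolding coboundaries_def by auto
   note n = nt_compose[OF ex_nt[OF X, of "Suc j"] nat_hom_nt[OF t(1), folded nat.case(2)[of F "rmod R"]]]
   then show "\<eta> \<in> carrier (nat_hom K D (rmod R i) G) \<and> coboundary D ?X ?\<delta> i G \<eta>"
    using t Suc nt_nat_hom[OF m, of "Suc j" G] nat_hom_nt[OF t(1)] unfolding coboundary_def nt_comp_restr by auto
  next
   assume a: "\<eta> \<in> carrier (nat_hom K D (rmod R i) G) \<and> coboundary D ?X ?\<delta> i G \<eta>"
   then obtain \<theta> where t: "nt D (rmod R j) G \<theta>" "\<forall>x\<in>Ob D. \<forall>v\<in>el (rmod R (Suc j)) x. \<eta> x v = \<theta> x (rdiff R j x v)"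
    using Suc unfolding coboundary_def by auto
   have "\<eta> = restr D (rmod R (Suc j)) (\<lambda>x v. restr D (rmod R j) \<theta> x (rdiff R j x v))"
   proof -
    have "\<eta> = restr D (rmod R (Suc j)) \<eta>" using a Suc by (simp add: hi)
    also have "\<dots> = restr D (rmod R (Suc j)) (\<lambda>x v. restr D (rmod R j) \<theta> x (rdiff R j x v))"
     using t(2) nt_in[OF ex_nt[OF X, of "Suc j"]] by (intro restr_cong) simp
    finally show ?thesis .
   qed
   then show "\<eta> \<in> coboundaries K D R G i"
    using Suc nt_nat_hom[OF m t(1)] unfolding coboundaries_def nt_comp_restr by auto
  qed
 qed
qed

end

text \<open>\<open>\<phi>\<close> compares a projective resolution over \<open>D\<close> with one over \<open>D/J\<close>. Its effect on cohomology is
 controlled by the reduction of \<open>X\<close> modulo \<open>J\<close>, which is homotopy equivalent to \<open>Y\<close> when it is exact.\<close>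

locale reduction = kfield K for K :: "('k, 'r) ring_scheme" (structure) +
 fixes D :: "('o, 'k, 'm) kcat" and J :: "'o => 'o => 'm set"
  and X :: "nat => ('o, 'm, 'k, 'u) kmod" and \<delta> :: "nat => 'o => 'u => 'u"
  and Y :: "nat => ('o, 'm set, 'k, 'u) kmod" and \<epsilon> :: "nat => 'o => 'u => 'u" and \<phi> :: "nat => 'o => 'u => 'u"
 assumes cD: "k_category K D" and iJ: "two_sided_ideal K D J"
  and X: "exseq D X \<delta>" "projseq D X" and Y: "exseq (quot_cat D J) Y \<epsilon>" "projseq (quot_cat D J) Y"
  and X0: "X 0 = pb D J (Y 0)" and \<phi>_nt: "\<And>n. nt D (X n) (pb D J (Y n)) (\<phi> n)"
  and \<phi>_comm: "\<And>n x v. x \<in> Ob D ==> v \<in> el (X (Suc n)) x ==> \<epsilon> n x (\<phi> (Suc n) x v) = \<phi> n x (\<delta> n x v)"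
  and \<phi>_0: "\<And>x v. \<phi> 0 x v = v"
begin

lemmas modX = ex_mod[OF X(1)] and ntX = ex_nt[OF X(1)] and modY = ex_mod[OF Y(1)]
lemmas modpb = pb_module[OF cD iJ]

lemma nt_pb: "nt D (pb D J F) (pb D J G) \<eta> \<longleftrightarrow> nt (quot_cat D J) F G \<eta>"
 using nt_descends[OF descends_pb descends_pb] by blast

lemma \<phi>_in: "x \<in> Ob D ==> v \<in> el (X n) x ==> \<phi> n x v \<in> el (Y n) x"
 using nt_in[OF \<phi>_nt[of n], of x v] by simp

lemma jsp_pb:
 assumes G: "k_module K (quot_cat D J) G" and M: "k_module K D M" and n: "nt D M (pb D J G) \<eta>" and x: "x \<in> Ob D" and v: "v \<in> jsp D J M x"
 shows "\<eta> x v = \<zero>[val G x]"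
 using killed_jsp[OF modpb[OF G] x jsp_nt[OF cD iJ M modpb(1)[OF G] n x v]] by simp

lemma cocycle_pullback:
 assumes c: "cocycle (quot_cat D J) Y \<epsilon> i G \<eta>"
 shows "cocycle D X \<delta> i (pb D J G) (\<lambda>x v. \<eta> x (\<phi> (Suc i) x v))"
 unfolding cocycle_def
proof (intro conjI ballI)
 show "nt D (X (Suc i)) (pb D J G) (\<lambda>x v. \<eta> x (\<phi> (Suc i) x v))"
  using nt_compose[OF \<phi>_nt] nt_pb c unfolding cocycle_def by blast
 fix x v assume x: "x \<in> Ob D" and v: "v \<in> el (X (Suc (Suc i))) x"
 show "\<eta> x (\<phi> (Suc i) x (\<delta> (Suc i) x v)) = \<zero>[val (pb D J G) x]"
  using c \<phi>_comm[OF x v, symmetric] \<phi>_in[OF x v] x unfolding cocycle_def by simp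
qed

lemma coboundary_pullback:
 assumes c: "coboundary (quot_cat D J) Y \<epsilon> i G \<eta>"
 shows "coboundary D X \<delta> i (pb D J G) (\<lambda>x v. \<eta> x (\<phi> (Suc i) x v))"
proof -
 obtain \<theta> where t: "nt (quot_cat D J) (Y i) G \<theta>" "i = 0 ==> (\<forall>x\<in>Ob D. \<forall>v\<in>el (Y 0) x. \<theta> x v = \<zero>[val G x])"
  "\<forall>x\<in>Ob D. \<forall>v\<in>el (Y (Suc i)) x. \<eta> x v = \<theta> x (\<epsilon> i x v)"
  using c unfolding coboundary_def by auto
 have "nt D (X i) (pb D J G) (\<lambda>x v. \<theta> x (\<phi> i x v))" using nt_compose[OF \<phi>_nt] nt_pb t(1) by blast
 then show ?thesis
  unfolding coboundary_def using t(2,3) \<phi>_in \<phi>_comm \<phi>_0 X0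
  by (intro exI[of _ "\<lambda>x v. \<theta> x (\<phi> i x v)"]) auto
qed

text \<open>\<open>E\<close>, \<open>r\<close> and \<open>d\<close> are the terms of
  \<open>X/JX\<close>, the projections onto them and the induced differential.\<close>

definition E :: "nat => ('o, 'm, 'k, 'u) kmod" where
 "E n = quotk (X n) (jsp D J (X n))"

definition r :: "nat => 'o => 'u => 'u" where
 "r n = rp (X n) (jsp D J (X n))"

definition d :: "nat => 'o => 'u => 'u" where
 "d n x u = r n x (\<delta> n x u)"

lemma jspX: "subf D (X n) (jsp D J (X n))"
 by (rule jsp_subf(1)[OF cD iJ modX])

lemma modE: "k_module K D (E n)" and r_nt: "nt D (X n) (E n) (r n)" and killedE: "killed D J (E n)"
 unfolding E_def r_def
 by (rule quotk_module[OF cD modX jspX])+ (rule killed_quotk[OF cD iJ modX jspX jsp_act[OF cD iJ modX]])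

lemma E_in: "x \<in> Ob D ==> u \<in> el (E n) x ==> u \<in> el (X n) x" "x \<in> Ob D ==> u \<in> el (E n) x ==> r n x u = u"
 unfolding E_def r_def by (rule quotk_elem[OF modX jspX], assumption+)+

text \<open>A map from \<open>X n\<close> to a module over \<open>D/J\<close> factors through
  \<open>X/JX\<close> with the same underlying function, so \<open>X\<close> and \<open>X/JX\<close>
  have the same Hom complexes into such modules.\<close>

lemma nt_E:
 assumes G: "k_module K (quot_cat D J) G" and n: "nt D (X n) (pb D J G) \<eta>"
 shows "nt (quot_cat D J) (desc (E n)) G \<eta>" and "x \<in> Ob D ==> v \<in> el (X n) x ==> \<eta> x (r n x v) = \<eta> x v"
proof -
 have z: "\<eta> x v = \<zero>[val (pb D J G) x]" if "x \<in> Ob D" "v \<in> jsp D J (X n) x" for x v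
  using jsp_pb[OF G modX n that] by simp
 show "\<eta> x (r n x v) = \<eta> x v" if "x \<in> Ob D" "v \<in> el (X n) x"
  unfolding r_def by (rule rp_lin[OF modX jspX that(1) modpb(1)[OF G] n z[OF that(1)] that(2)])
 have "nt D (E n) (pb D J G) \<eta>" unfolding E_def by (rule quotk_out[OF modX jspX modpb(1)[OF G] n z])
 then show "nt (quot_cat D J) (desc (E n)) G \<eta>"
  using nt_descends[OF desc_module(1)[OF cD iJ modE killedE] descends_pb] by blast
qed

text \<open>When \<open>X/JX\<close> is exact, it is a projective resolution over \<open>D/J\<close>
  of the module resolved by \<open>Y\<close>, so \<open>\<phi>\<close> becomes a homotopy
  equivalence from \<open>E\<close> to \<open>Y\<close> with inverse \<open>g\<close>. The homotopy
  for \<open>\<phi>\<close> after \<open>g\<close> gives injectivity, the one for \<open>g\<close>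
  after \<open>\<phi>\<close> surjectivity.\<close>

lemma cohomology_iso:
 assumes e: "\<And>n. exm D J X \<delta> n" and G: "k_module K (quot_cat D J) G"
 shows pullback_inj: "cocycle (quot_cat D J) Y \<epsilon> i G \<eta> ==> coboundary D X \<delta> i (pb D J G) (\<lambda>x v. \<eta> x (\<phi> (Suc i) x v)) ==>
   coboundary (quot_cat D J) Y \<epsilon> i G \<eta>"
  and pullback_surj: "cocycle D X \<delta> i (pb D J G) \<theta> ==> \<exists>\<eta> b. cocycle (quot_cat D J) Y \<epsilon> i G \<eta> \<and>
   nt D (X (Suc i)) (pb D J G) b \<and> coboundary D X \<delta> i (pb D J G) b \<and>
   (\<forall>x\<in>Ob D. \<forall>v\<in>el (X (Suc i)) x. \<theta> x v = b x v \<oplus>[val G x] \<eta> x (\<phi> (Suc i) x v))"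
proof -
 let ?Q = "quot_cat D J" and ?E = "\<lambda>n. desc (E n)"
 note Q = quot_category[OF cD iJ]
 note dE = desc_module[OF cD iJ modE killedE]
 note m = val_mod[OF G, simplified]
 have "exseq D E d"
  unfolding E_def[abs_def] d_def[abs_def] r_def
 proof (rule quot_exseq[OF cD X(1) jspX])
  show "\<delta> n x v \<in> jsp D J (X n) x" if "x \<in> Ob D" "v \<in> jsp D J (X (Suc n)) x" for n x v
   by (rule jsp_nt[OF cD iJ modX modX ntX that])
 qed (rule exmD[OF e])
 then have Ed: "exseq ?Q ?E d" using exseq_descends[where M = E and F = ?E, OF dE(1) modE dE(2)] by blast
 have Ep: "projseq ?Q ?E"
  using desc_projective[OF cD iJ] X(2) unfolding projseq_def E_def by blast
 have \<phi>E: "nt ?Q (?E n) (Y n) (\<phi> n)" for n by (rule nt_E(1)[OF modY \<phi>_nt])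
 have \<phi>r: "\<phi> n x (r n x v) = \<phi> n x v" if "x \<in> Ob D" "v \<in> el (X n) x" for n x v
  by (rule nt_E(2)[OF modY \<phi>_nt that])
 have \<phi>d: "\<epsilon> n x (\<phi> (Suc n) x u) = \<phi> n x (d n x u)" if x: "x \<in> Ob D" and u: "u \<in> el (E (Suc n)) x" for n x u
  using \<phi>_comm[OF x E_in(1)[OF x u]] \<phi>r[OF x nt_in[OF ntX x E_in(1)[OF x u]]] by (simp add: d_def)
 \<comment> \<open>The inverse starts with the projection \<open>r 0\<close>, since
   \<open>X 0\<close> is the pullback of \<open>Y 0\<close>; as this module is killed, nothing is
   divided out in degree 0.\<close>
 have "nt D (pb D J (Y 0)) (E 0) (r 0)" using r_nt[of 0] X0 by simp
 then have "nt ?Q (Y 0) (?E 0) (r 0)" using nt_descends[OF descends_pb dE(1)] by blast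
 from comparison[OF Q Y Ed this]
 obtain g where g0: "g 0 = r 0" and gg: "\<forall>n. nt ?Q (Y n) (?E n) (g n)"
  and ggd: "\<forall>n. \<forall>x\<in>Ob ?Q. \<forall>v\<in>el (Y (Suc n)) x. d n x (g (Suc n) x v) = g n x (\<epsilon> n x v)"
  by (elim exE conjE)
 have g: "nt ?Q (Y n) (?E n) (g n)" for n using gg by (rule spec)
 have gd: "d n x (g (Suc n) x v) = g n x (\<epsilon> n x v)" if "x \<in> Ob D" "v \<in> el (Y (Suc n)) x" for n x v
  using ggd that by simp
 have gin: "g n x v \<in> el (E n) x" "g n x v \<in> el (X n) x" if "x \<in> Ob D" "v \<in> el (Y n) x" for n x v
  using nt_in[OF g, of x v n] E_in(1)[of x "g n x v" n] that by simp_all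
 note Ydd = ex_dd[OF Y(1), simplified] and \<epsilon>in = nt_in[OF ex_nt[OF Y(1)], simplified]
 show "coboundary ?Q Y \<epsilon> i G \<eta>"
  if c: "cocycle ?Q Y \<epsilon> i G \<eta>" and b: "coboundary D X \<delta> i (pb D J G) (\<lambda>x v. \<eta> x (\<phi> (Suc i) x v))"
 proof -
  have "\<exists>h. (\<forall>n. nt ?Q (Y n) (Y (Suc n)) (h n)) \<and> (\<forall>x\<in>Ob ?Q. \<forall>v\<in>el (Y 0) x. h 0 x v = \<zero>[val (Y (Suc 0)) x]) \<and>
   (\<forall>n. \<forall>x\<in>Ob ?Q. \<forall>v\<in>el (Y (Suc n)) x. v = \<phi> (Suc n) x (g (Suc n) x v) \<oplus>[val (Y (Suc n)) x]
    (\<epsilon> (Suc n) x (h (Suc n) x v) \<oplus>[val (Y (Suc n)) x] h n x (\<epsilon> n x v)))"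
  proof (rule homotopy[where f = "\<lambda>n x v. v" and g = "\<lambda>n x v. \<phi> n x (g n x v)", OF Q Y Y(1)])
   show "nt ?Q (Y n) (Y n) (\<lambda>x v. v)" for n by (rule nt_id)
   show "nt ?Q (Y n) (Y n) (\<lambda>x v. \<phi> n x (g n x v))" for n by (rule nt_compose[OF g \<phi>E])
   show "\<epsilon> n x (\<phi> (Suc n) x (g (Suc n) x v)) = \<phi> n x (g n x (\<epsilon> n x v))" if "x \<in> Ob ?Q" "v \<in> el (Y (Suc n)) x" for n x v
    using \<phi>d[of x "g (Suc n) x v" n] gin(1)[of x v "Suc n"] gd[of x v n] that by simp
   show "v = \<phi> 0 x (g 0 x v)" if "x \<in> Ob ?Q" "v \<in> el (Y 0) x" for x v
    using \<phi>r[of x v 0] that by (simp add: g0 \<phi>_0 X0)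
  qed simp
  then obtain h where hn: "\<forall>n. nt ?Q (Y n) (Y (Suc n)) (h n)"
   and hz: "\<forall>x\<in>Ob ?Q. \<forall>v\<in>el (Y 0) x. h 0 x v = \<zero>[val (Y (Suc 0)) x]"
   and hc: "\<forall>n. \<forall>x\<in>Ob ?Q. \<forall>v\<in>el (Y (Suc n)) x. v = \<phi> (Suc n) x (g (Suc n) x v) \<oplus>[val (Y (Suc n)) x]
    (\<epsilon> (Suc n) x (h (Suc n) x v) \<oplus>[val (Y (Suc n)) x] h n x (\<epsilon> n x v))"
   by (elim exE conjE)
  have h: "nt ?Q (Y n) (Y (Suc n)) (h n)" for n using hn by (rule spec)
  have h0: "h 0 x v = \<zero>[val (Y (Suc 0)) x]" if "x \<in> Ob D" "v \<in> el (Y 0) x" for x v using hz that by simp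
  have hh: "v = \<phi> (Suc n) x (g (Suc n) x v) \<oplus>[val (Y (Suc n)) x]
    (\<epsilon> (Suc n) x (h (Suc n) x v) \<oplus>[val (Y (Suc n)) x] h n x (\<epsilon> n x v))" if "x \<in> Ob D" "v \<in> el (Y (Suc n)) x" for n x v
   by (rule hc[rule_format]) (use that in simp_all)
  obtain \<theta> where t: "nt D (X i) (pb D J G) \<theta>" "i = 0 ==> (\<forall>x\<in>Ob D. \<forall>v\<in>el (X 0) x. \<theta> x v = \<zero>[val G x])"
   "\<And>x v. x \<in> Ob D ==> v \<in> el (X (Suc i)) x ==> \<eta> x (\<phi> (Suc i) x v) = \<theta> x (\<delta> i x v)"
   using b unfolding coboundary_def by auto
  have \<eta>: "nt ?Q (Y (Suc i)) G \<eta>" and c0: "\<And>x v. x \<in> Ob D ==> v \<in> el (Y (Suc (Suc i))) x ==> \<eta> x (\<epsilon> (Suc i) x v) = \<zero>[val G x]"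
   using c unfolding cocycle_def by auto
  \<comment> \<open>Obtained by applying \<open>\<eta>\<close> to the homotopy formula: the cocycle
    kills the term \<open>\<epsilon> h\<close>, and the two remaining terms are
    \<open>?\<theta>\<close> after \<open>\<epsilon> i\<close>.\<close>
  let ?\<theta> = "\<lambda>x v. \<theta> x (g i x v) \<oplus>[val G x] \<eta> x (h i x v)"
  have n: "nt ?Q (Y i) G ?\<theta>" by (rule nt_plus[OF G nt_compose[OF g nt_E(1)[OF G t(1)]] nt_compose[OF h \<eta>]])
  have eq: "\<eta> x v = ?\<theta> x (\<epsilon> i x v)" if x: "x \<in> Ob D" and v: "v \<in> el (Y (Suc i)) x" for x v
  proof -
   interpret V: module K "val G x" by (rule m[OF x])
   have x': "x \<in> Ob ?Q" using x by simp
   interpret W: module K "val (Y (Suc i)) x" by (rule val_mod[OF modY x'])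
   note ev = \<epsilon>in[OF x v] and hv = nt_in[OF h x' v]
   note gv = gin[OF x v]
   have 1: "\<phi> (Suc i) x (g (Suc i) x v) \<in> el (Y (Suc i)) x" by (rule \<phi>_in[OF x gv(2)])
   have 2: "\<epsilon> (Suc i) x (h (Suc i) x v) \<in> el (Y (Suc i)) x" by (rule \<epsilon>in[OF x hv])
   have 3: "h i x (\<epsilon> i x v) \<in> el (Y (Suc i)) x" by (rule nt_in[OF h x' ev])
   have "\<eta> x v = \<eta> x (\<phi> (Suc i) x (g (Suc i) x v)) \<oplus>[val G x] (\<eta> x (\<epsilon> (Suc i) x (h (Suc i) x v)) \<oplus>[val G x] \<eta> x (h i x (\<epsilon> i x v)))"
    by (subst hh[OF x v]) (simp only: nt_add[OF \<eta> x' 1 W.add.m_closed[OF 2 3]] nt_add[OF \<eta> x' 2 3])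
   also have "\<eta> x (\<epsilon> (Suc i) x (h (Suc i) x v)) = \<zero>[val G x]" by (rule c0[OF x hv])
   also have "\<eta> x (\<phi> (Suc i) x (g (Suc i) x v)) = \<theta> x (g i x (\<epsilon> i x v))"
    using t(3)[OF x gv(2)] nt_E(2)[OF G t(1) x nt_in[OF ntX x gv(2)]] gd[OF x v] by (simp add: d_def)
   finally show ?thesis using V.l_zero[OF nt_in[OF \<eta> x' 3]] by simp
  qed
  \<comment> \<open>Degree 0: the homotopy starts with zero, so \<open>?\<theta>\<close> inherits
    the vanishing of \<open>\<theta>\<close>.\<close>
  have "?\<theta> x v = \<zero>[val G x]" if i: "i = 0" and x: "x \<in> Ob D" and v: "v \<in> el (Y 0) x" for x v
  proof -
   interpret V: module K "val G x" by (rule m[OF x])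
   show ?thesis
    using t(2)[OF i] gin(2)[OF x v] h0[OF x v] nt_zero_at[OF modY G \<eta>, of x] i x by simp
  qed
  then show ?thesis unfolding coboundary_def using n eq by (intro exI[of _ ?\<theta>]) simp
 qed
 show "\<exists>\<eta> b. cocycle ?Q Y \<epsilon> i G \<eta> \<and> nt D (X (Suc i)) (pb D J G) b \<and> coboundary D X \<delta> i (pb D J G) b \<and>
   (\<forall>x\<in>Ob D. \<forall>v\<in>el (X (Suc i)) x. \<theta> x v = b x v \<oplus>[val G x] \<eta> x (\<phi> (Suc i) x v))"
  if c: "cocycle D X \<delta> i (pb D J G) \<theta>"
 proof -
  have \<theta>: "nt D (X (Suc i)) (pb D J G) \<theta>" and c0: "\<And>x v. x \<in> Ob D ==> v \<in> el (X (Suc (Suc i))) x ==> \<theta> x (\<delta> (Suc i) x v) = \<zero>[val G x]"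
   using c unfolding cocycle_def by auto
  note \<theta>E = nt_E[OF G \<theta>]
  have \<theta>d: "\<theta> x (d (Suc i) x v) = \<zero>[val G x]" if x: "x \<in> Ob D" and v: "v \<in> el (E (Suc (Suc i))) x" for x v
   using \<theta>E(2)[OF x nt_in[OF ntX x E_in(1)[OF x v]]] c0[OF x E_in(1)[OF x v]] by (simp add: d_def)
  have "\<exists>k. (\<forall>n. nt ?Q (?E n) (?E (Suc n)) (k n)) \<and> (\<forall>x\<in>Ob ?Q. \<forall>v\<in>el (?E 0) x. k 0 x v = \<zero>[val (?E (Suc 0)) x]) \<and>
   (\<forall>n. \<forall>x\<in>Ob ?Q. \<forall>v\<in>el (?E (Suc n)) x. v = g (Suc n) x (\<phi> (Suc n) x v) \<oplus>[val (?E (Suc n)) x]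
    (d (Suc n) x (k (Suc n) x v) \<oplus>[val (?E (Suc n)) x] k n x (d n x v)))"
  proof (rule homotopy[where f = "\<lambda>n x v. v" and g = "\<lambda>n x v. g n x (\<phi> n x v)", OF Q Ed Ep Ed])
   show "nt ?Q (?E n) (?E n) (\<lambda>x v. v)" for n by (rule nt_id)
   show "nt ?Q (?E n) (?E n) (\<lambda>x v. g n x (\<phi> n x v))" for n by (rule nt_compose[OF \<phi>E g])
   show "d n x (g (Suc n) x (\<phi> (Suc n) x v)) = g n x (\<phi> n x (d n x v))" if "x \<in> Ob ?Q" "v \<in> el (?E (Suc n)) x" for n x v
    using \<phi>d[of x v n] gd[of x "\<phi> (Suc n) x v" n] \<phi>_in[of x v "Suc n"] E_in(1)[of x v "Suc n"] that by simp
   show "v = g 0 x (\<phi> 0 x v)" if "x \<in> Ob ?Q" "v \<in> el (?E 0) x" for x v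
    using E_in(2)[of x v 0] that by (simp add: g0 \<phi>_0)
  qed simp
  then obtain k where kn: "\<forall>n. nt ?Q (?E n) (?E (Suc n)) (k n)"
   and kz: "\<forall>x\<in>Ob ?Q. \<forall>v\<in>el (?E 0) x. k 0 x v = \<zero>[val (?E (Suc 0)) x]"
   and kc: "\<forall>n. \<forall>x\<in>Ob ?Q. \<forall>v\<in>el (?E (Suc n)) x. v = g (Suc n) x (\<phi> (Suc n) x v) \<oplus>[val (?E (Suc n)) x]
    (d (Suc n) x (k (Suc n) x v) \<oplus>[val (?E (Suc n)) x] k n x (d n x v))"
   by (elim exE conjE)
  have k: "nt ?Q (?E n) (?E (Suc n)) (k n)" for n using kn by (rule spec)
  have k0: "k 0 x v = \<zero>[val (E (Suc 0)) x]" if "x \<in> Ob D" "v \<in> el (E 0) x" for x v using kz that by simp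
  have kk: "v = g (Suc n) x (\<phi> (Suc n) x v) \<oplus>[val (E (Suc n)) x]
    (d (Suc n) x (k (Suc n) x v) \<oplus>[val (E (Suc n)) x] k n x (d n x v))" if "x \<in> Ob D" "v \<in> el (E (Suc n)) x" for n x v
   by (rule kc[rule_format, unfolded desc_val]) (use that in simp_all)
  \<comment> \<open>By the homotopy \<open>k\<close>, the cocycle \<open>\<theta>\<close> is the
    pullback of \<open>\<theta>\<close> after \<open>g\<close>, plus the coboundary of
    \<open>?t\<close>.\<close>
  let ?\<eta> = "\<lambda>x v. \<theta> x (g (Suc i) x v)" and ?t = "\<lambda>x v. \<theta> x (k i x (r i x v))"
  let ?b = "\<lambda>x v. ?t x (\<delta> i x v)"
  have \<eta>: "cocycle ?Q Y \<epsilon> i G ?\<eta>"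
   unfolding cocycle_def
  proof (intro conjI ballI)
   show "nt ?Q (Y (Suc i)) G ?\<eta>" by (rule nt_compose[OF g \<theta>E(1)])
   show "?\<eta> x (\<epsilon> (Suc i) x v) = \<zero>[val G x]" if "x \<in> Ob ?Q" "v \<in> el (Y (Suc (Suc i))) x" for x v
    using gd[of x v "Suc i"] \<theta>d[of x "g (Suc (Suc i)) x v"] gin(1)[of x v "Suc (Suc i)"] that by simp
  qed
  have kD: "nt D (E n) (E (Suc n)) (k n)" for n using k nt_descends[OF dE(1) dE(1)] by blast
  have \<theta>D: "nt D (E (Suc i)) (pb D J G) \<theta>" using \<theta>E(1) nt_descends[OF dE(1) descends_pb] by blast
  have t: "nt D (X i) (pb D J G) ?t" by (rule nt_compose[OF nt_compose[OF r_nt kD] \<theta>D])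
  have b: "nt D (X (Suc i)) (pb D J G) ?b" by (rule nt_compose[OF ntX t])
  have "?t x v = \<zero>[val G x]" if i: "i = 0" and x: "x \<in> Ob D" and v: "v \<in> el (X 0) x" for x v
   using k0[OF x nt_in[OF r_nt x v]] nt_zero_at[OF modE modpb(1)[OF G] \<theta>D x] i by simp
  then have bc: "coboundary D X \<delta> i (pb D J G) ?b"
   unfolding coboundary_def using t by (intro exI[of _ ?t]) simp
  have "\<theta> x v = ?b x v \<oplus>[val G x] ?\<eta> x (\<phi> (Suc i) x v)" if x: "x \<in> Ob D" and v: "v \<in> el (X (Suc i)) x" for x v
  proof -
   interpret V: module K "val G x" by (rule m[OF x])
   interpret W: module K "val (E (Suc i)) x" by (rule val_mod[OF modE x])
   let ?u = "r (Suc i) x v"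
   note u = nt_in[OF r_nt x v]
   note \<phi>u = \<phi>r[OF x v]
   have du: "d i x ?u = r i x (\<delta> i x v)"
    unfolding d_def r_def
    by (rule rp_lin_sub[OF modX jspX modX jspX x nt_lin[OF ntX x] jsp_nt[OF cD iJ modX modX ntX x] v])
   note kv = nt_in[OF kD x u]
   have 1: "g (Suc i) x (\<phi> (Suc i) x v) \<in> el (E (Suc i)) x" by (rule gin(1)[OF x \<phi>_in[OF x v]])
   have 2: "d (Suc i) x (k (Suc i) x ?u) \<in> el (E (Suc i)) x"
    using nt_in[OF r_nt x nt_in[OF ntX x E_in(1)[OF x kv]]] by (simp add: d_def)
   have 3: "k i x (r i x (\<delta> i x v)) \<in> el (E (Suc i)) x" by (rule nt_in[OF kD x nt_in[OF r_nt x nt_in[OF ntX x v]]])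
   have ku: "?u = g (Suc i) x (\<phi> (Suc i) x v) \<oplus>[val (E (Suc i)) x]
    (d (Suc i) x (k (Suc i) x ?u) \<oplus>[val (E (Suc i)) x] k i x (r i x (\<delta> i x v)))"
    using kk[OF x u] unfolding \<phi>u du .
   note \<theta>in = nt_in[OF \<theta>D x, simplified]
   have "\<theta> x v = \<theta> x ?u" using \<theta>E(2)[OF x v] by simp
   also have "\<dots> = ?\<eta> x (\<phi> (Suc i) x v) \<oplus>[val G x] (\<theta> x (d (Suc i) x (k (Suc i) x ?u)) \<oplus>[val G x] ?b x v)"
    using nt_add[OF \<theta>D x 1 W.add.m_closed[OF 2 3]] nt_add[OF \<theta>D x 2 3] ku by simp
   also have "\<dots> = ?\<eta> x (\<phi> (Suc i) x v) \<oplus>[val G x] ?b x v" using \<theta>d[OF x kv] \<theta>in[OF 3] by simp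
   also have "\<dots> = ?b x v \<oplus>[val G x] ?\<eta> x (\<phi> (Suc i) x v)" using \<theta>in[OF 3] \<theta>in[OF 1] by (simp add: V.a_comm)
   finally show ?thesis .
  qed
  then show ?thesis using \<eta> b bc by blast
 qed
qed

text \<open>Conversely, exactness of the reduction is detected by the projection of \<open>X (Suc n)\<close> onto its
 largest \<open>J\<close>-killed quotient on which it is a cocycle.\<close>

lemma exm_of_surj:
 assumes s: "\<And>(G :: ('o, 'm set, 'k, 'u) kmod) \<theta>. k_module K (quot_cat D J) G ==> cocycle D X \<delta> n (pb D J G) \<theta> ==>
   \<exists>\<eta> b. cocycle (quot_cat D J) Y \<epsilon> n G \<eta> \<and> coboundary D X \<delta> n (pb D J G) b \<and>
    (\<forall>x\<in>Ob D. \<forall>v\<in>el (X (Suc n)) x. \<theta> x v = b x v \<oplus>[val G x] \<eta> x (\<phi> (Suc n) x v))"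
 shows "exm D J X \<delta> n"
proof -
 let ?I = "\<lambda>x. \<delta> (Suc n) x ` el (X (Suc (Suc n))) x"
 \<comment> \<open>Membership of \<open>z\<close> in \<open>?Z x\<close> is the conclusion of
   \<open>exm\<close>, and the projection \<open>?p\<close> is the cocycle that detects it.\<close>
 let ?Z = "\<lambda>x. ssum (val (X (Suc n)) x) (jsp D J (X (Suc n)) x) (?I x)"
 let ?M = "quotk (X (Suc n)) ?Z" and ?p = "rp (X (Suc n)) ?Z"
 note I = subf_image[OF modX modX ntX subf_carrier[OF modX], of "Suc n"]
 note Z = subf_ssum[OF modX jspX I]
 note M = quotk_module[OF cD modX Z]
 have jZ: "v \<in> ?Z x" if "x \<in> Ob D" "v \<in> jsp D J (X (Suc n)) x" for x v
  by (rule ssum_left[OF val_mod[OF modX that(1)] subf_sub[OF jspX that(1)] subf_sub[OF I that(1)] that(2)])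
 have iZ: "v \<in> ?Z x" if "x \<in> Ob D" "v \<in> ?I x" for x v
  by (rule ssum_right[OF val_mod[OF modX that(1)] subf_sub[OF jspX that(1)] subf_sub[OF I that(1)] that(2)])
 have k: "killed D J ?M" by (rule killed_quotk[OF cD iJ modX Z jZ[OF _ jsp_act[OF cD iJ modX]]])
 note dM = desc_module[OF cD iJ M(1) k]
 note zi = quotk_zero_iff[OF modX Z]
 have "nt D (X (Suc n)) (pb D J (desc ?M)) ?p"
 proof -
  have "descends D J ?M (desc ?M)" by (rule dM(1))
  then have "nt (quot_cat D J) (desc ?M) (desc ?M) (\<lambda>x v. v) \<longleftrightarrow> nt D ?M (pb D J (desc ?M)) (\<lambda>x v. v)"
   by (rule nt_descends[OF _ descends_pb])
  then have "nt D ?M (pb D J (desc ?M)) (\<lambda>x v. v)" using nt_id by blast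
  from nt_compose[OF M(2) this] show ?thesis .
 qed
 then have "cocycle D X \<delta> n (pb D J (desc ?M)) ?p"
  unfolding cocycle_def using zi[OF _ nt_in[OF ntX]] iZ by simp
 then obtain \<eta> b where \<eta>: "cocycle (quot_cat D J) Y \<epsilon> n (desc ?M) \<eta>" and b: "coboundary D X \<delta> n (pb D J (desc ?M)) b"
  and eq: "\<And>x v. x \<in> Ob D ==> v \<in> el (X (Suc n)) x ==> ?p x v = b x v \<oplus>[val ?M x] \<eta> x (\<phi> (Suc n) x v)"
  using s[OF dM(2), unfolded desc_val] by blast
 obtain \<theta> where \<theta>: "nt D (X n) (pb D J (desc ?M)) \<theta>" and b\<theta>: "\<And>x v. x \<in> Ob D ==> v \<in> el (X (Suc n)) x ==> b x v = \<theta> x (\<delta> n x v)"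
  using b unfolding coboundary_def by blast
 show ?thesis
  unfolding exm_def
 proof (intro ballI impI)
  fix x z assume x: "x \<in> Ob D" and z: "z \<in> el (X (Suc n)) x" and dz: "\<delta> n x z \<in> jsp D J (X n) x"
  have x': "x \<in> Ob (quot_cat D J)" using x by simp
  interpret V: module K "val ?M x" by (rule val_mod[OF M(1) x])
  \<comment> \<open>Both parts of the decomposition of \<open>?p\<close> vanish at \<open>z\<close>:
    the coboundary because it factors through the boundary of \<open>z\<close>, which lies in the
    span and dies in a killed module; the pulled-back cocycle because \<open>\<phi>\<close> sends
    \<open>z\<close> to a cycle, hence a boundary, of the exact sequence \<open>Y\<close>.\<close>
  have "\<epsilon> n x (\<phi> (Suc n) x z) = \<zero>[val (Y n) x]"
   using \<phi>_comm[OF x z] jsp_pb[OF modY modX \<phi>_nt x dz] by simp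
  then obtain w where "w \<in> el (Y (Suc (Suc n))) x" "\<epsilon> (Suc n) x w = \<phi> (Suc n) x z"
   using ex_lift[OF Y(1) x' \<phi>_in[OF x z]] by blast
  then have "\<eta> x (\<phi> (Suc n) x z) = \<zero>[val ?M x]" using \<eta> x' unfolding cocycle_def by force
  moreover have "b x z = \<zero>[val ?M x]" using b\<theta>[OF x z] jsp_pb[OF dM(2) modX \<theta> x dz] by simp
  ultimately have "?p x z = \<zero>[val ?M x]" using eq[OF x z] by simp
  then have "z \<in> ?Z x" using zi[OF x z] by simp
  then show "\<exists>j\<in>jsp D J (X (Suc n)) x. \<exists>w\<in>el (X (Suc (Suc n))) x. z = j \<oplus>[val (X (Suc n)) x] \<delta> (Suc n) x w"
   unfolding ssum_def by auto
 qed
qed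

end

section \<open>Ext as a quotient of modules, and the canonical map on it\<close>

context kfield
begin

lemma nat_hom_add: "\<eta> \<oplus>[nat_hom K D F G] \<theta> = restr D F (\<lambda>x v. \<eta> x v \<oplus>[val G x] \<theta> x v)"
 and nat_hom_smult: "a \<odot>[nat_hom K D F G] \<eta> = restr D F (\<lambda>x v. a \<odot>[val G x] \<eta> x v)"
 by (simp_all add: nat_hom_def restr_def)

lemma nat_hom_module:
 assumes F: "k_module K D F" and G: "k_module K D G"
 shows "module K (nat_hom K D F G)"
proof (rule module_of_eval[where S = "SIGMA x:Ob D. el F x" and V = "\<lambda>(x, v). val G x" and ev = "\<lambda>(x, v) \<eta>. \<eta> x v"])
 let ?N = "nat_hom K D F G"
 note ops = nat_hom_add nat_hom_smult nat_hom_zero and n = nat_hom_nt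
 show "\<zero>[?N] \<in> carrier ?N" unfolding ops by (rule nt_nat_hom[OF F nt_zero[OF G]])
 show "\<eta> \<oplus>[?N] \<theta> \<in> carrier ?N" if "\<eta> \<in> carrier ?N" "\<theta> \<in> carrier ?N" for \<eta> \<theta>
  unfolding ops by (rule nt_nat_hom[OF F nt_plus[OF G n[OF that(1)] n[OF that(2)]]])
 show "a \<odot>[?N] \<eta> \<in> carrier ?N" if "a \<in> carrier K" "\<eta> \<in> carrier ?N" for a \<eta>
  unfolding ops by (rule nt_nat_hom[OF F nt_scale[OF G n[OF that(2)] that(1)]])
 fix s assume "s \<in> (SIGMA x:Ob D. el F x)"
 then obtain x v where s: "s = (x, v)" "x \<in> Ob D" "v \<in> el F x" by blast
 show "module K (case s of (x, v) => val G x)" using val_mod[OF G] s by simp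
 show "linear_map K ?N (case s of (x, v) => val G x) (case s of (x, v) => \<lambda>\<eta>. \<eta> x v)"
  using s nt_in[OF n] by (auto simp: linear_map_def ops)
 show "(case s of (x, v) => \<lambda>\<eta>. \<eta> x v) \<zero>[?N] = \<zero>[case s of (x, v) => val G x]" using s by (simp add: ops)
next
 fix \<eta> \<theta> assume "\<eta> \<in> carrier (nat_hom K D F G)" "\<theta> \<in> carrier (nat_hom K D F G)"
  and "\<And>s. s \<in> (SIGMA x:Ob D. el F x) ==> (case s of (x, v) => \<lambda>\<eta>. \<eta> x v) \<eta> = (case s of (x, v) => \<lambda>\<eta>. \<eta> x v) \<theta>"
 then show "\<eta> = \<theta>" by (intro nat_hom_eqI) fastforce+
qed

lemma precomp_linear:
 assumes F: "k_module K D F" and F': "k_module K D F'" and G: "k_module K D G" and d: "nt D F F' d"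
 shows "linear_map K (nat_hom K D F' G) (nat_hom K D F G) (\<lambda>\<eta>. nt_comp D F \<eta> d)"
proof (rule linI)
 show "nt_comp D F \<eta> d \<in> carrier (nat_hom K D F G)" if "\<eta> \<in> carrier (nat_hom K D F' G)" for \<eta>
  unfolding nt_comp_restr by (rule nt_nat_hom[OF F nt_compose[OF d nat_hom_nt[OF that]]])
qed (auto simp: nt_comp_restr nat_hom_add nat_hom_smult nt_in[OF d] intro!: restr_cong)

lemma coboundary_cocycle:
 assumes X: "exseq D X \<delta>" and G: "k_module K D G" and n: "nt D (X (Suc i)) G \<eta>" and b: "coboundary D X \<delta> i G \<eta>"
 shows "cocycle D X \<delta> i G \<eta>"
proof -
 obtain \<theta> where t: "nt D (X i) G \<theta>" "\<And>x v. x \<in> Ob D ==> v \<in> el (X (Suc i)) x ==> \<eta> x v = \<theta> x (\<delta> i x v)"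
  using b unfolding coboundary_def by blast
 show ?thesis
  unfolding cocycle_def
  using n t(2)[OF _ nt_in[OF ex_nt[OF X]]] ex_dd[OF X] nt_zero_at[OF ex_mod[OF X] G t(1)] by simp
qed

lemma ext_submodules:
 assumes F: "k_module K D F" and R: "projective_resolution K D F R" and G: "k_module K D G"
 shows cocycles_module: "module K ((nat_hom K D (rmod R i) G)\<lparr>carrier := cocycles K D R G i\<rparr>)"
  and coboundaries_submodule: "submodule (coboundaries K D R G i) K ((nat_hom K D (rmod R i) G)\<lparr>carrier := cocycles K D R G i\<rparr>)"
proof -
 note X = resolution_exseq(1)[OF F R]
 have m: "k_module K D (rmod R n)" for n using ex_mod[OF X, of "Suc n"] by simp
 have d: "nt D (rmod R (Suc n)) (rmod R n) (rdiff R n)" for n using ex_nt[OF X, of "Suc n"] by simp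
 let ?N = "\<lambda>n. nat_hom K D (rmod R n) G" and ?Z = "cocycles K D R G i" and ?B = "coboundaries K D R G i"
 note N = nat_hom_module[OF m G]
 have Z: "submodule ?Z K (?N i)"
  unfolding cocycles_def by (rule submodule_kernel[OF N N precomp_linear[OF m m G d]])
 have B: "submodule ?B K (?N i)"
 proof (cases i)
  case 0
  show ?thesis using submodule_zero[OF N] unfolding coboundaries_def 0 by simp
 next
  case (Suc j)
  show ?thesis
   using submodule_image[OF N N precomp_linear[OF m m G d] submodule_carrier[OF N]] unfolding coboundaries_def Suc by simp
 qed
 have BZ: "?B \<subseteq> ?Z"
 proof
  fix \<eta> assume "\<eta> \<in> ?B"
  then have "\<eta> \<in> carrier (?N i)" "coboundary D (case_nat F (rmod R)) (case_nat (raug R) (rdiff R)) i G \<eta>"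
   by (simp_all add: coboundaries_iff[OF F R G])
  then show "\<eta> \<in> ?Z"
   using coboundary_cocycle[OF X G, of i \<eta>] nat_hom_nt[of \<eta> D "rmod R i" G] by (simp add: cocycles_iff[OF F R])
 qed
 show V: "module K ((?N i)\<lparr>carrier := ?Z\<rparr>)" by (rule submodule_module[OF N Z])
 show "submodule ?B K ((?N i)\<lparr>carrier := ?Z\<rparr>)"
  by (rule submodI[OF V]) (use BZ submoduleD[OF N B] in auto)
qed

lemma coset_carrier_update: "B +>[N\<lparr>carrier := Z\<rparr>] w = B +>[N] w"
 by (rule Set.set_eqI) (simp add: coset_mem)

text \<open>The induced map on quotients in the union form of \<open>ext_map\<close>; all cosets in
  the union are equal because \<open>\<Phi>\<close> maps \<open>A\<close> into
  \<open>B\<close>.\<close>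

lemma quot_iso:
 assumes V: "module K V" and W: "module K W" and \<Phi>: "linear_map K V W \<Phi>" and A: "submodule A K V" and B: "submodule B K W"
  and AB: "\<And>v. v \<in> A ==> \<Phi> v \<in> B" and inj: "\<And>v. v \<in> carrier V ==> \<Phi> v \<in> B ==> v \<in> A"
  and surj: "\<And>w. w \<in> carrier W ==> \<exists>v\<in>carrier V. w \<in> B +>[W] \<Phi> v"
 shows "linear_iso K (quot_module V A) (quot_module W B) (\<lambda>X. \<Union>v\<in>X. B +>[W] \<Phi> v)"
proof -
 let ?f = "\<lambda>X. \<Union>v\<in>X. B +>[W] \<Phi> v"
 note c = lin_closed[OF \<Phi>]
 have eqB: "B +>[W] \<Phi> u = B +>[W] \<Phi> v \<longleftrightarrow> \<Phi> (u \<ominus>[V] v) \<in> B" if "u \<in> carrier V" "v \<in> carrier V" for u v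
  using coset_eq_iff[OF W B c[OF that(1)] c[OF that(2)]] lin_minus[OF V W \<Phi> that] by simp
 have f: "?f (A +>[V] v) = B +>[W] \<Phi> v" if v: "v \<in> carrier V" for v
 proof -
  have "B +>[W] \<Phi> u = B +>[W] \<Phi> v" if "u \<in> A +>[V] v" for u
   using that eqB[OF _ v] AB unfolding coset_mem_iff[OF V A v] by blast
  then show ?thesis using coset_self[OF V A v] by blast
 qed
 have ex: "\<exists>v\<in>carrier M. X = N +>[M] v" if "X \<in> carrier (quot_module M N)" for M :: "('k, 'z) module" and N X
  using that by (auto simp: qm_carrier)
 have lin: "linear_map K (quot_module V A) (quot_module W B) ?f"
 proof (rule linI)
  fix X assume "X \<in> carrier (quot_module V A)"
  then obtain u where u: "u \<in> carrier V" "X = A +>[V] u" using ex by blast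
  show "?f X \<in> carrier (quot_module W B)" unfolding u(2) f[OF u(1)] by (rule qm_carrierI[OF c[OF u(1)]])
  show "?f (a \<odot>[quot_module V A] X) = a \<odot>[quot_module W B] ?f X" if a: "a \<in> carrier K" for a
   unfolding u(2) qm_smult[OF V A a u(1)] f[OF u(1)] f[OF module_smult[OF V a u(1)]] qm_smult[OF W B a c[OF u(1)]]
   by (simp add: lin_smult[OF \<Phi> a u(1)])
  fix Y assume "Y \<in> carrier (quot_module V A)"
  then obtain v where v: "v \<in> carrier V" "Y = A +>[V] v" using ex by blast
  show "?f (X \<oplus>[quot_module V A] Y) = ?f X \<oplus>[quot_module W B] ?f Y"
   unfolding u(2) v(2) qm_add[OF V A u(1) v(1)] f[OF u(1)] f[OF v(1)] f[OF module_add[OF V u(1) v(1)]] qm_add[OF W B c[OF u(1)] c[OF v(1)]]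
   by (simp add: lin_add[OF \<Phi> u(1) v(1)])
 qed
 have "bij_betw ?f (carrier (quot_module V A)) (carrier (quot_module W B))"
  unfolding bij_betw_def
 proof
  show "inj_on ?f (carrier (quot_module V A))"
  proof (rule inj_onI)
   fix X Y assume "X \<in> carrier (quot_module V A)" "Y \<in> carrier (quot_module V A)" and eq: "?f X = ?f Y"
   then obtain u v where u: "u \<in> carrier V" "X = A +>[V] u" and v: "v \<in> carrier V" "Y = A +>[V] v"
    using ex by metis
   have "\<Phi> (u \<ominus>[V] v) \<in> B" using eq eqB[OF u(1) v(1)] unfolding u(2) v(2) f[OF u(1)] f[OF v(1)] by simp
   then show "X = Y" unfolding u(2) v(2) coset_eq_iff[OF V A u(1) v(1)] by (rule inj[OF module_minus[OF V u(1) v(1)]])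
  qed
  show "?f ` carrier (quot_module V A) = carrier (quot_module W B)"
  proof
   show "?f ` carrier (quot_module V A) \<subseteq> carrier (quot_module W B)" using lin_closed[OF lin] by blast
   show "carrier (quot_module W B) \<subseteq> ?f ` carrier (quot_module V A)"
   proof
    fix Y assume "Y \<in> carrier (quot_module W B)"
    then obtain w where w: "w \<in> carrier W" "Y = B +>[W] w" using ex by blast
    obtain v where v: "v \<in> carrier V" "w \<in> B +>[W] \<Phi> v" using surj[OF w(1)] by blast
    have "Y = B +>[W] \<Phi> v"
     using v(2) unfolding w(2) coset_mem_iff[OF W B c[OF v(1)]] coset_eq_iff[OF W B w(1) c[OF v(1)]] by simp
    then show "Y \<in> ?f ` carrier (quot_module V A)"
     using f[OF v(1)] qm_carrierI[OF v(1), of A] by (intro image_eqI[of _ _ "A +>[V] v"]) simp_all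
   qed
  qed
 qed
 then show ?thesis using lin unfolding linear_iso_def by blast
qed

end

text \<open>Fixes the very resolutions and comparison map that \<open>Ext\<close> and
  \<open>ext_map\<close> choose, in order to interpret \<open>reduction\<close> for them. Both
  directions of \<open>strongly_idempotent_iff\<close> then speak about the canonical map
  itself.\<close>

locale ext_comparison = kfield K for K :: "('k, 'r) ring_scheme" (structure) +
 fixes D :: "('o, 'k, 'm) kcat" and J :: "'o => 'o => 'm set" and F :: "('o, 'm set, 'k, 'u) kmod"
 assumes sD: "small_k_category TYPE('u) K D" and idJ: "two_sided_ideal K D J" and modF: "k_module K (quot_cat D J) F"
begin

definition R :: "('o, 'm, 'k, 'u) resolution" where
 "R = proj_res K D (pb D J F)"

definition P :: "('o, 'm set, 'k, 'u) resolution" where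
 "P = proj_res K (quot_cat D J) F"

definition f :: "nat => 'o => 'u => 'u" where
 "f = (SOME f. comparison_map K D (quot_proj D J) R P f)"

lemma modpbF: "k_module K D (pb D J F)"
 by (rule pb_module(1)[OF small_cat[OF sD] idJ modF])

lemma resR: "projective_resolution K D (pb D J F) R"
 unfolding R_def by (rule proj_res_resolution[OF sD modpbF])

lemma resP: "projective_resolution K (quot_cat D J) F P"
 unfolding P_def by (rule proj_res_resolution[OF small_quot[OF sD idJ] modF])

lemmas exR = resolution_exseq(1)[OF modpbF resR] and exP = resolution_exseq(1)[OF modF resP]

lemma modR: "k_module K D (rmod R n)" and modP: "k_module K (quot_cat D J) (rmod P n)"
 using ex_mod[OF exR, of "Suc n"] ex_mod[OF exP, of "Suc n"] by simp_all

lemma pbP: "exseq D (\<lambda>n. pb D J (case_nat F (rmod P) n)) (case_nat (raug P) (rdiff P))"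
 using exseq_descends[where M = "\<lambda>n. pb D J (case_nat F (rmod P) n)" and F = "case_nat F (rmod P)",
   OF descends_pb pb_module(1)[OF small_cat[OF sD] idJ ex_mod[OF exP]] ex_mod[OF exP]] exP by blast

lemma comparison_restr:
 "nt_comp D (rmod R n) (nt_pullback D (quot_proj D J) \<eta>) \<theta> = restr D (rmod R n) (\<lambda>x v. \<eta> x (\<theta> x v))"
 unfolding nt_comp_restr by (rule restr_cong) (simp add: nt_pullback_def)

text \<open>The pullback of \<open>P\<close> stays exact over \<open>D\<close>, so the comparison
  theorem applies and the choice in \<open>f\<close> is meaningful. The identity at index 0 is
  dropped, because \<open>comparison_map\<close> starts with the augmentation.\<close>

lemma comparison_f: "comparison_map K D (quot_proj D J) R P f"
proof -
 have "nt D (case_nat (pb D J F) (rmod R) 0) (pb D J (case_nat F (rmod P) 0)) (\<lambda>x v. v)" using nt_id[of D "pb D J F"] by simp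
 from comparison[OF small_cat[OF sD] exR resolution_projseq[OF modpbF resR] pbP this]
 obtain g where g0: "g 0 = (\<lambda>x v. v)" and g: "\<And>n. nt D (case_nat (pb D J F) (rmod R) n) (pb D J (case_nat F (rmod P) n)) (g n)"
  and gd: "\<forall>n. \<forall>x\<in>Ob D. \<forall>v\<in>el (case_nat (pb D J F) (rmod R) (Suc n)) x.
   case_nat (raug P) (rdiff P) n x (g (Suc n) x v) = g n x (case_nat (raug R) (rdiff R) n x v)" by auto
 have gS: "nt D (rmod R n) (pb D J (rmod P n)) (g (Suc n))" for n using g[of "Suc n"] by simp
 have "comparison_map K D (quot_proj D J) R P (\<lambda>n. restr D (rmod R n) (g (Suc n)))"
  unfolding comparison_map_def
 proof (intro conjI allI)
  show "restr D (rmod R n) (g (Suc n)) \<in> carrier (nat_hom K D (rmod R n) (pb D J (rmod P n)))" for n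
   by (rule nt_nat_hom[OF modR gS])
  have "raug R \<in> carrier (nat_hom K D (rmod R 0) (pb D J F))" using resR unfolding projective_resolution_def by blast
  then have "restr D (rmod R 0) (raug R) = raug R" by (rule nat_homD)
  moreover have "restr D (rmod R 0) (\<lambda>x v. raug P x (restr D (rmod R 0) (g (Suc 0)) x v)) = restr D (rmod R 0) (raug R)"
   using gd[rule_format, of _ _ 0] by (intro restr_cong) (simp add: g0)
  ultimately show "nt_comp D (rmod R 0) (nt_pullback D (quot_proj D J) (raug P)) (restr D (rmod R 0) (g (Suc 0))) = raug R"
   unfolding comparison_restr by simp
  show "nt_comp D (rmod R (Suc n)) (nt_pullback D (quot_proj D J) (rdiff P n)) (restr D (rmod R (Suc n)) (g (Suc (Suc n)))) =
    nt_comp D (rmod R (Suc n)) (restr D (rmod R n) (g (Suc n))) (rdiff R n)" for n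
   unfolding comparison_restr unfolding nt_comp_restr
   using gd[rule_format, of _ _ "Suc n"] nt_in[OF ex_nt[OF exR, of "Suc n"]] by (intro restr_cong) simp
 qed
 then show ?thesis unfolding f_def by (rule someI[where P = "comparison_map K D (quot_proj D J) R P"])
qed

text \<open>The chain map of \<open>reduction\<close> begins with the identity of the resolved
  module, so \<open>f\<close> appears shifted by one.\<close>

sublocale reduction K D J "case_nat (pb D J F) (rmod R)" "case_nat (raug R) (rdiff R)" "case_nat F (rmod P)" "case_nat (raug P) (rdiff P)"
 "case_nat (\<lambda>x v. v) f"
proof
 show "k_category K D" by (rule small_cat[OF sD])
 show "projseq D (case_nat (pb D J F) (rmod R))" by (rule resolution_projseq[OF modpbF resR])
 show "projseq (quot_cat D J) (case_nat F (rmod P))" by (rule resolution_projseq[OF modF resP])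
 note c = comparison_f[unfolded comparison_map_def comparison_restr]
 show "nt D (case_nat (pb D J F) (rmod R) n) (pb D J (case_nat F (rmod P) n)) (case_nat (\<lambda>x v. v) f n)" for n
 proof (cases n)
  case 0 then show ?thesis using nt_id[of D "pb D J F"] by simp
 next
  case (Suc m)
  have "f m \<in> carrier (nat_hom K D (rmod R m) (pb D J (rmod P m)))" using c by blast
  from nat_hom_nt[OF this] show ?thesis using Suc by simp
 qed
 fix n x v assume x: "x \<in> Ob D" and v: "v \<in> el (case_nat (pb D J F) (rmod R) (Suc n)) x"
 show "case_nat (raug P) (rdiff P) n x (case_nat (\<lambda>x v. v) f (Suc n) x v) =
   case_nat (\<lambda>x v. v) f n x (case_nat (raug R) (rdiff R) n x v)"
 proof (cases n)
  case 0
  have "restr D (rmod R 0) (\<lambda>x v. raug P x (f 0 x v)) x v = raug R x v" using c by simp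
  then show ?thesis using 0 x v by simp
 next
  case (Suc m)
  have "restr D (rmod R (Suc m)) (\<lambda>x v. rdiff P m x (f (Suc m) x v)) x v = nt_comp D (rmod R (Suc m)) (f m) (rdiff R m) x v" using c by simp
  then show ?thesis using Suc x v by (simp add: nt_comp_restr)
 qed
qed (use idJ exR exP in simp_all)

abbreviation \<Phi> :: "nat => ('o => 'u => 'u) => 'o => 'u => 'u" where
 "\<Phi> i \<eta> \<equiv> restr D (rmod R i) (\<lambda>x v. \<eta> x (f i x v))"

abbreviation (input) VP where "VP i G \<equiv> (nat_hom K (quot_cat D J) (rmod P i) G)\<lparr>carrier := cocycles K (quot_cat D J) P G i\<rparr>"
abbreviation (input) BP where "BP i G \<equiv> coboundaries K (quot_cat D J) P G i"
abbreviation (input) VR where "VR i G \<equiv> (nat_hom K D (rmod R i) (pb D J G))\<lparr>carrier := cocycles K D R (pb D J G) i\<rparr>"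
abbreviation (input) BR where "BR i G \<equiv> coboundaries K D R (pb D J G) i"

lemma ext_eq:
 "Ext K (quot_cat D J) i F G = quot_module (VP i G) (BP i G)"
 "Ext K D i (pb D J F) (pb D J G) = quot_module (VR i G) (BR i G)"
 by (simp_all add: Ext_def Let_def R_def P_def)

lemma ext_map_eq: "ext_map K D (quot_cat D J) (quot_proj D J) i F G = (\<lambda>X. \<Union>\<eta>\<in>X. BR i G +>[VR i G] \<Phi> i \<eta>)"
proof -
 show ?thesis
  unfolding ext_map_def Let_def R_def[symmetric] P_def[symmetric] f_def[symmetric] comparison_restr coset_carrier_update ..
qed

lemmas iffs = cocycles_iff[OF modF resP] cocycles_iff[OF modpbF resR]

lemma cocycle_cong:
 assumes "\<And>x v. x \<in> Ob D ==> v \<in> el (rmod R i) x ==> \<eta> x v = \<theta> x v"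
  and "cocycle D (case_nat (pb D J F) (rmod R)) (case_nat (raug R) (rdiff R)) i G \<eta>"
 shows "cocycle D (case_nat (pb D J F) (rmod R)) (case_nat (raug R) (rdiff R)) i G \<theta>"
 using assms nt_cong[OF modR, of i \<eta> \<theta> G] nt_in[OF ex_nt[OF exR, of "Suc i"]] unfolding cocycle_def by simp

lemma coboundary_cong:
 assumes "\<And>x v. x \<in> Ob D ==> v \<in> el (rmod R i) x ==> \<eta> x v = \<theta> x v"
  and "coboundary D (case_nat (pb D J F) (rmod R)) (case_nat (raug R) (rdiff R)) i G \<eta>"
 shows "coboundary D (case_nat (pb D J F) (rmod R)) (case_nat (raug R) (rdiff R)) i G \<theta>"
 using assms unfolding coboundary_def by simp

text \<open>\<open>quot_iso\<close> with the two halves of \<open>cohomology_iso\<close>, whose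
  exactness assumption is \<open>g\<close> for the chosen resolution.\<close>

lemma ext_map_iso:
 assumes g: "\<And>n. gdn D J (pb D J F) n" and G: "k_module K (quot_cat D J) G"
 shows "linear_iso K (Ext K (quot_cat D J) i F G) (Ext K D i (pb D J F) (pb D J G)) (ext_map K D (quot_cat D J) (quot_proj D J) i F G)"
proof -
 note G' = modpb(1)[OF G]
 note biffs = coboundaries_iff[OF modF resP G] coboundaries_iff[OF modpbF resR G']
 have e: "exm D J (case_nat (pb D J F) (rmod R)) (case_nat (raug R) (rdiff R)) n" for n
  using gdn_iff[OF cD iJ X, of n] g by simp
 have fin: "f i x v \<in> el (rmod P i) x" if "x \<in> Ob D" "v \<in> el (rmod R i) x" for x v
  using \<phi>_in[of x v "Suc i"] that by simp
 have hom: "\<Phi> i \<eta> \<in> carrier (nat_hom K D (rmod R i) (pb D J G))" if "nt (quot_cat D J) (rmod P i) G \<eta>" for \<eta>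
 proof -
  have a: "nt D (rmod R i) (pb D J (rmod P i)) (f i)" using \<phi>_nt[of "Suc i"] by simp
  have b: "nt D (pb D J (rmod P i)) (pb D J G) \<eta>" using that nt_pb by blast
  show ?thesis by (rule nt_nat_hom[OF modR nt_compose[OF a b]])
 qed
 show ?thesis
  unfolding ext_eq ext_map_eq
 proof (rule quot_iso[OF cocycles_module[OF modF resP G] cocycles_module[OF modpbF resR G'] _
    coboundaries_submodule[OF modF resP G] coboundaries_submodule[OF modpbF resR G']])
  show "linear_map K (VP i G) (VR i G) (\<Phi> i)"
  proof (rule linI)
   fix \<eta> assume "\<eta> \<in> carrier (VP i G)"
   then have h: "\<eta> \<in> carrier (nat_hom K (quot_cat D J) (rmod P i) G)" and c: "cocycle (quot_cat D J) (case_nat F (rmod P)) (case_nat (raug P) (rdiff P)) i G \<eta>"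
    by (simp_all add: iffs)
   show "\<Phi> i \<eta> \<in> carrier (VR i G)"
    using hom[OF nat_hom_nt[OF h]] cocycle_cong[OF _ cocycle_pullback[OF c], of "\<Phi> i \<eta>"] by (simp add: iffs)
  next
   fix \<eta> \<theta>
   show "\<Phi> i (\<eta> \<oplus>[VP i G] \<theta>) = \<Phi> i \<eta> \<oplus>[VR i G] \<Phi> i \<theta>"
    by (auto simp: nat_hom_add fin intro!: restr_cong)
  next
   fix a \<eta>
   show "\<Phi> i (a \<odot>[VP i G] \<eta>) = a \<odot>[VR i G] \<Phi> i \<eta>"
    by (auto simp: nat_hom_smult fin intro!: restr_cong)
  qed
  show "\<Phi> i \<eta> \<in> BR i G" if "\<eta> \<in> BP i G" for \<eta>
  proof -
   have h: "\<eta> \<in> carrier (nat_hom K (quot_cat D J) (rmod P i) G)" and c: "coboundary (quot_cat D J) (case_nat F (rmod P)) (case_nat (raug P) (rdiff P)) i G \<eta>"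
    using that by (simp_all add: biffs)
   show ?thesis
    using hom[OF nat_hom_nt[OF h]] coboundary_cong[OF _ coboundary_pullback[OF c], of "\<Phi> i \<eta>"] by (simp add: biffs)
  qed
  show "\<eta> \<in> BP i G" if v: "\<eta> \<in> carrier (VP i G)" and b: "\<Phi> i \<eta> \<in> BR i G" for \<eta>
  proof -
   have h: "\<eta> \<in> carrier (nat_hom K (quot_cat D J) (rmod P i) G)" and c: "cocycle (quot_cat D J) (case_nat F (rmod P)) (case_nat (raug P) (rdiff P)) i G \<eta>"
    using v by (simp_all add: iffs)
   have "coboundary D (case_nat (pb D J F) (rmod R)) (case_nat (raug R) (rdiff R)) i (pb D J G) (\<Phi> i \<eta>)"
    using b by (simp add: biffs)
   from pullback_inj[OF e G c coboundary_cong[OF _ this]] show ?thesis using h by (simp add: biffs)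
  qed
  show "\<exists>\<eta>\<in>carrier (VP i G). \<theta> \<in> BR i G +>[VR i G] \<Phi> i \<eta>" if t: "\<theta> \<in> carrier (VR i G)" for \<theta>
  proof -
   have h: "\<theta> \<in> carrier (nat_hom K D (rmod R i) (pb D J G))" and c: "cocycle D (case_nat (pb D J F) (rmod R)) (case_nat (raug R) (rdiff R)) i (pb D J G) \<theta>"
    using t by (simp_all add: iffs)
   obtain \<eta> b where \<eta>: "cocycle (quot_cat D J) (case_nat F (rmod P)) (case_nat (raug P) (rdiff P)) i G \<eta>"
    and b: "nt D (rmod R i) (pb D J G) b" "coboundary D (case_nat (pb D J F) (rmod R)) (case_nat (raug R) (rdiff R)) i (pb D J G) b"
    and eq: "\<And>x v. x \<in> Ob D ==> v \<in> el (rmod R i) x ==> \<theta> x v = b x v \<oplus>[val G x] \<eta> x (f i x v)"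
    using pullback_surj[OF e G c] by auto
   let ?\<eta> = "restr (quot_cat D J) (rmod P i) \<eta>" and ?b = "restr D (rmod R i) b"
   have \<eta>n: "nt (quot_cat D J) (rmod P i) G \<eta>" using \<eta> unfolding cocycle_def by simp
   have rin: "rdiff P i x v \<in> el (rmod P i) x" if "x \<in> Ob D" "v \<in> el (rmod P (Suc i)) x" for x v
    using nt_in[OF ex_nt[OF exP, of "Suc i"], of x v] that by simp
   have "cocycle (quot_cat D J) (case_nat F (rmod P)) (case_nat (raug P) (rdiff P)) i G ?\<eta>"
    using \<eta> nt_cong[OF modP _ \<eta>n, of ?\<eta>] rin unfolding cocycle_def by simp
   then have 1: "?\<eta> \<in> carrier (VP i G)" using nt_nat_hom[OF modP \<eta>n] by (simp add: iffs)
   have 2: "?b \<in> BR i G" using nt_nat_hom[OF modR b(1)] coboundary_cong[OF _ b(2), of ?b] by (simp add: biffs)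
   have "\<theta> = restr D (rmod R i) \<theta>" using nat_homD[OF h] by simp
   also have "\<dots> = ?b \<oplus>[VR i G] \<Phi> i ?\<eta>"
    by (auto simp: nat_hom_add fin eq intro!: restr_cong)
   finally show ?thesis using 1 2 unfolding coset_mem by blast
  qed
 qed
qed

text \<open>Surjectivity in degree \<open>n\<close> writes each cocycle as a pulled-back cocycle
  plus a coboundary, which is the assumption of \<open>exm_of_surj\<close>.\<close>

lemma gdn_of_ext_map_iso:
 assumes iso: "\<And>G i. k_module K (quot_cat D J) G ==>
  linear_iso K (Ext K (quot_cat D J) i F G) (Ext K D i (pb D J F) (pb D J G)) (ext_map K D (quot_cat D J) (quot_proj D J) i F G)"
 shows "gdn D J (pb D J F) n"
proof -
 have "exm D J (case_nat (pb D J F) (rmod R)) (case_nat (raug R) (rdiff R)) n"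
 proof (rule exm_of_surj)
  fix G :: "('o, 'm set, 'k, 'u) kmod" and \<theta> assume G: "k_module K (quot_cat D J) G"
   and c: "cocycle D (case_nat (pb D J F) (rmod R)) (case_nat (raug R) (rdiff R)) n (pb D J G) \<theta>"
  note G' = modpb(1)[OF G]
  note biffs = coboundaries_iff[OF modF resP G] coboundaries_iff[OF modpbF resR G']
  note V = cocycles_module[OF modF resP G] coboundaries_submodule[OF modF resP G]
  note W = cocycles_module[OF modpbF resR G'] coboundaries_submodule[OF modpbF resR G']
  let ?w = "restr D (rmod R n) \<theta>"
  have tn: "nt D (rmod R n) (pb D J G) \<theta>" using c unfolding cocycle_def by simp
  have w: "?w \<in> carrier (VR n G)"
   using nt_nat_hom[OF modR tn] cocycle_cong[OF _ c, of ?w] by (simp add: iffs)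
  have "BR n G +>[VR n G] ?w \<in> (\<lambda>X. \<Union>\<eta>\<in>X. BR n G +>[VR n G] \<Phi> n \<eta>) ` carrier (quot_module (VP n G) (BP n G))"
   using iso[OF G, of n] qm_carrierI[OF w] unfolding ext_eq ext_map_eq linear_iso_def bij_betw_def by blast
  then obtain Y where Y: "Y \<in> carrier (quot_module (VP n G) (BP n G))"
   and eq: "BR n G +>[VR n G] ?w = (\<Union>\<eta>\<in>Y. BR n G +>[VR n G] \<Phi> n \<eta>)" by blast
  obtain \<eta> where \<eta>Y: "\<eta> \<in> Y" and "?w \<in> BR n G +>[VR n G] \<Phi> n \<eta>"
   using coset_self[OF W w] unfolding eq by blast
  then obtain b where b: "b \<in> BR n G" and wb: "?w = b \<oplus>[VR n G] \<Phi> n \<eta>" unfolding coset_mem by blast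
  obtain \<eta>' where "\<eta>' \<in> carrier (VP n G)" "Y = BP n G +>[VP n G] \<eta>'" using Y unfolding qm_carrier by blast
  then have "\<eta> \<in> carrier (VP n G)" using \<eta>Y coset_mem_iff[OF V] by blast
  then have "cocycle (quot_cat D J) (case_nat F (rmod P)) (case_nat (raug P) (rdiff P)) n G \<eta>" by (simp add: iffs)
  moreover have "coboundary D (case_nat (pb D J F) (rmod R)) (case_nat (raug R) (rdiff R)) n (pb D J G) b"
   using b by (simp add: biffs)
  moreover have "\<theta> x v = b x v \<oplus>[val G x] \<eta> x (f n x v)" if "x \<in> Ob D" "v \<in> el (rmod R n) x" for x v
   using fun_cong[OF fun_cong[OF wb, of x], of v] that by (simp add: nat_hom_add)
  ultimately show "\<exists>\<eta> b. cocycle (quot_cat D J) (case_nat F (rmod P)) (case_nat (raug P) (rdiff P)) n G \<eta> \<and>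
    coboundary D (case_nat (pb D J F) (rmod R)) (case_nat (raug R) (rdiff R)) n (pb D J G) b \<and>
    (\<forall>x\<in>Ob D. \<forall>v\<in>el (case_nat (pb D J F) (rmod R) (Suc n)) x.
     \<theta> x v = b x v \<oplus>[val G x] \<eta> x (case_nat (\<lambda>x v. v) f (Suc n) x v))"
   by (intro exI[of _ \<eta>] exI[of _ b]) simp
 qed
 then show ?thesis using gdn_iff[OF cD iJ X, of n] by simp
qed

end

section \<open>Strong idempotency as vanishing of Tor, and the conclusion\<close>

context kfield
begin

text \<open>Eliminates Ext and the quotient category. Killed modules and modules over
  \<open>D/J\<close> correspond through \<open>desc\<close> and \<open>pb\<close>, and the vanishing
  passes from the pullback of \<open>desc M\<close> to \<open>M\<close> along identity maps.\<close>

lemma strongly_idempotent_iff: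
 fixes D :: "('o, 'k, 'm) kcat"
 assumes sD: "small_k_category TYPE('u) K D" and J: "two_sided_ideal K D J"
 shows "strongly_idempotent TYPE('u) K D J \<longleftrightarrow>
  (\<forall>(M :: ('o, 'm, 'k, 'u) kmod) n. k_module K D M --> killed D J M --> gdn D J M n)"
proof
 note D = small_cat[OF sD]
 assume s: "strongly_idempotent TYPE('u) K D J"
 show "\<forall>(M :: ('o, 'm, 'k, 'u) kmod) n. k_module K D M --> killed D J M --> gdn D J M n"
 proof (intro allI impI)
  fix M :: "('o, 'm, 'k, 'u) kmod" and n assume M: "k_module K D M" and k: "killed D J M"
  note d = desc_module[OF D J M k]
  interpret E: ext_comparison K D J "desc M" by unfold_locales (rule sD J d(2))+
  have "gdn D J (pb D J (desc M)) n"
   by (rule E.gdn_of_ext_map_iso) (use s d(2) in \<open>simp add: strongly_idempotent_def\<close>)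
  moreover have "nt D (pb D J (desc M)) M (\<lambda>x v. v)" "nt D M (pb D J (desc M)) (\<lambda>x v. v)"
   using nt_descends[OF descends_pb d(1), where \<eta> = "\<lambda>x v. v"] nt_descends[OF d(1) descends_pb, where \<eta> = "\<lambda>x v. v"] nt_id[of "quot_cat D J" "desc M"] by blast+
  ultimately show "gdn D J M n" using gdn_iso[OF sD J pb_module(1)[OF D J d(2)]] by blast
 qed
next
 note D = small_cat[OF sD]
 assume g: "\<forall>(M :: ('o, 'm, 'k, 'u) kmod) n. k_module K D M --> killed D J M --> gdn D J M n"
 show "strongly_idempotent TYPE('u) K D J"
  unfolding strongly_idempotent_def
 proof (intro conjI allI impI J)
  fix F F' :: "('o, 'm set, 'k, 'u) kmod" and i
  assume "k_module K (quot_cat D J) F \<and> k_module K (quot_cat D J) F'"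
  then have F: "k_module K (quot_cat D J) F" and F': "k_module K (quot_cat D J) F'" by blast+
  interpret E: ext_comparison K D J F by unfold_locales (rule sD J F)+
  show "linear_iso K (Ext K (quot_cat D J) i F F') (Ext K D i (pb D J F) (pb D J F')) (ext_map K D (quot_cat D J) (quot_proj D J) i F F')"
   by (rule E.ext_map_iso[OF _ F']) (use g pb_module[OF D J F] in blast)
 qed
qed

lemma jsp_cong:
 assumes "\<And>x y. x \<in> Ob D ==> y \<in> Ob D ==> J x y = J' x y" and y: "y \<in> Ob D"
 shows "jsp D J F y = jsp D J' F y"
proof -
 have "v \<in> jsp D J' F y" if "\<And>x y. x \<in> Ob D ==> y \<in> Ob D ==> J x y = J' x y" "v \<in> jsp D J F y" for J J' v
  using that(2) by (induction rule: jsp.induct) (use that(1) y in \<open>auto intro: jsp.intros\<close>)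
 then show ?thesis using assms(1) by blast
qed

text \<open>Only spans at objects enter \<open>exm\<close>, so ideals that agree between objects
  give the same condition.\<close>

lemma gdn_cong:
 fixes M :: "('o, 'm, 'k, 'u) kmod"
 assumes "\<And>x y. x \<in> Ob D ==> y \<in> Ob D ==> J x y = J' x y"
 shows "gdn D J M n \<longleftrightarrow> gdn D J' M n"
proof -
 have "jsp D J F y = jsp D J' F y" if "y \<in> Ob D" for F :: "('o, 'm, 'k, 'u) kmod" and y
  by (rule jsp_cong[OF assms that])
 then have "exm D J X \<delta> n \<longleftrightarrow> exm D J' X \<delta> n" for X :: "nat => ('o, 'm, 'k, 'u) kmod" and \<delta>
  unfolding exm_def by simp
 then show ?thesis unfolding gdn_def by simp
qed

end

theorem proposition3p10:
  fixes K :: "('k, 'r) ring_scheme"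
    and C :: "('o, 'k, 'm) kcat"
    and I :: "'o \<Rightarrow> 'o \<Rightarrow> 'm set"
  assumes "field K"
    and "small_k_category TYPE('u) K C"
    and "two_sided_ideal K C I"
    and "homological_epimorphism TYPE('u) K C (quot_cat C I) (quot_proj C I)"
  shows "homological_epimorphism TYPE('u) K
           (tensor_cat K (op_cat C) C)
           (tensor_cat K (op_cat (quot_cat C I)) (quot_cat C I))
           (tensor_fun K (op_cat (quot_cat C I)) (quot_cat C I)
             (quot_proj (op_cat C) (op_ideal I))
             (quot_proj C I))"
proof -
 interpret kfield K using assms(1) by (simp add: kfield_def)
 let ?O = "op_cat C" and ?oI = "op_ideal I" and ?J = "functor_kernel C (quot_cat C I) (quot_proj C I)"
 note sC = assms(2) and I = assms(3)
 note C = small_cat[OF sC] and sO = small_op[OF sC] and oI = op_two_sided_ideal[OF I]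
 note O = small_cat[OF sO] and sT = small_tensor[OF sO sC]
 note J = functor_kernel_ideal[OF C quot_category[OF C I] quot_proj_functor[OF C I]]
 note JI = kernel_quot_proj[OF C I]
 \<comment> \<open>The hypothesis as a vanishing statement for covariant modules, with the kernel of
   the projection replaced by \<open>I\<close>.\<close>
 have g: "gdn C I M n" if M: "k_module K C M" and k: "killed C I M" for M :: "('o, 'm, 'k, 'u) kmod" and n
 proof -
  have "killed C ?J M" using k by (simp add: killed_def JI)
  then have "gdn C ?J M n"
   using assms(4) strongly_idempotent_iff[OF sC J] M unfolding homological_epimorphism_def by blast
  then show ?thesis using gdn_cong[of C ?J I M n] JI by simp
 qed
 \<comment> \<open>The factor \<open>op_cat C\<close> is served by \<open>gdn_op\<close>, the factor
   \<open>C\<close> by \<open>g\<close> itself.\<close>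
 note gT = tensor_gdn[OF sO sC oI I gdn_op[OF sC I g] g]
 let ?\<pi> = "tensor_fun K (op_cat (quot_cat C I)) (quot_cat C I) (quot_proj ?O ?oI) (quot_proj C I)"
 note QO = quot_category[OF O oI] and QC = quot_category[OF C I]
 \<comment> \<open>\<open>quot_cat_op\<close> identifies the two descriptions of the codomain by an
   equality, so that \<open>tker\<close> becomes literally the kernel in the goal.\<close>
 note \<pi> = tker_functor[OF O C oI I, unfolded quot_cat_op] and full = tensor_full[OF O C QO QC quot_proj_functor[OF O oI] quot_proj_functor[OF C I] quot_proj_full quot_proj_full, unfolded quot_cat_op]
 have "strongly_idempotent TYPE('u) K (tensor_cat K ?O C) (tker ?O C ?oI I)"
  using strongly_idempotent_iff[OF sT tker_ideal[OF O C oI I]] gT by blast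
 then have "strongly_idempotent TYPE('u) K (tensor_cat K ?O C)
   (functor_kernel (tensor_cat K ?O C) (tensor_cat K (op_cat (quot_cat C I)) (quot_cat C I)) ?\<pi>)"
  unfolding tker_def quot_cat_op .
 then show ?thesis
  using \<pi> full unfolding homological_epimorphism_def identity_on_objects_def by auto
qed

end
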